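(* Let $\alpha\ge0$, $v>0$ and let $E\in\mathcal{A}^x(v)$ with $\mathcal{P}_\alpha^x(E)<+\infty$. There exists $\tilde E\in\mathcal{A}^x(v)\cap\mathcal{S}_x\cap\mathcal{S}_y^*$, bounded and $x$-transformed-convex, such that $\mathcal{P}_\alpha^x(\tilde E)\le\mathcal{P}_\alpha^x(E)$. Moreover, in the case $\alpha>0$, if $E\in\mathcal{S}_x$, then $E$ is equivalent to an $x$-transformed-convex set if and only if $\mathcal{P}_\alpha^x(\tilde E)=\mathcal{P}_\alpha^x(E)$. In addition, there exist $r\in\,]0,+\infty[$ and $f\in C([0,r])\cap\mathrm{Lip}_{loc}(]0,r[)$ such that $$\tilde E=\{(x,y)\in\mathbb{R}^2 : |y|\le f(|x|),\ |x|\le r\}.$$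
   Context: For $\alpha\ge0$ and an $\mathcal{L}^2$-measurable set $E\subset\mathbb{R}^2$, the Grushin $\alpha$-perimeter is $$P_\alpha(E)=\sup\left\{\int_E(\partial_x\phi_1+|x|^\alpha\partial_y\phi_2)\,dx\,dy : \phi_1,\phi_2\in C^1_c(\mathbb{R}^2),\ \sup_{\mathbb{R}^2}\sqrt{\phi_1^2+\phi_2^2}\le1\right\}.$$ Set $E^{+x}=E\cap\{x>0\}$, $E^{-x}=E\cap\{x<0\}$. For $v>0$, $\mathcal{A}^x(v)$ is the class of $\mathcal{L}^2$-measurable $E\subset\mathbb{R}^2$ with $\mathcal{L}^2(E^{+x})=\mathcal{L}^2(E^{-x})=v$, and $\mathcal{P}_\alpha^x(E)=\frac12(P_\alpha(E^{+x})+P_\alpha(E^{-x})+P_\alpha(E))$. Sets are considered up to $\mathcal{L}^2$-negligible sets ("equivalent" means equal up to a negligible set). $\mathcal{S}_x$ is the class of $\mathcal{L}^2$-measurable $x$-symmetric sets ($(x,y)\in E$ implies $(-x,y)\in E$). $\mathcal{S}_y^*$ is the class of $\mathcal{L}^2$-measurable $y$-Schwarz symmetric sets, i.e. $y$-symmetric ($(x,y)\in E$ implies $(x,-y)\in E$) and $y$-convex (for each $t$ the section $\{y:(t,y)\in E\}$ is a, possibly empty, open interval). A set $E\in\mathcal{S}_x$ is $x$-transformed-convex if $\Psi(E^{+x})$ is convex, where $\Psi(x,y)=\left(\operatorname{sgn}(x)\frac{|x|^{\alpha+1}}{\alpha+1},\,y\right)$. *)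

theory Defs
  imports "HOL-Analysis.Analysis"
begin

definition C1_compact_support :: "(real \<times> real \<Rightarrow> real) \<Rightarrow> bool" where
  "C1_compact_support \<phi> \<longleftrightarrow>
     (\<exists>D. (\<forall>z. (\<phi> has_derivative blinfun_apply (D z)) (at z)) \<and> continuous_on UNIV D) \<and>
     compact (closure {z. \<phi> z \<noteq> 0})"

definition partial_x :: "(real \<times> real \<Rightarrow> real) \<Rightarrow> real \<times> real \<Rightarrow> real" where
  "partial_x \<phi> = (\<lambda>(x, y). deriv (\<lambda>s. \<phi> (s, y)) x)"

definition partial_y :: "(real \<times> real \<Rightarrow> real) \<Rightarrow> real \<times> real \<Rightarrow> real" where
  "partial_y \<phi> = (\<lambda>(x, y). deriv (\<lambda>s. \<phi> (x, s)) y)"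

text \<open>The case distinction implements the convention that the zeroth power of 0 is 1,
  which fails for powr.\<close>
definition grushin_weight :: "real \<Rightarrow> real \<Rightarrow> real" where
  "grushin_weight \<alpha> x = (if \<alpha> = 0 then 1 else \<bar>x\<bar> powr \<alpha>)"

definition grushin_div ::
  "real \<Rightarrow> (real \<times> real \<Rightarrow> real) \<Rightarrow> (real \<times> real \<Rightarrow> real) \<Rightarrow> real \<times> real \<Rightarrow> real" where
  "grushin_div \<alpha> \<phi>1 \<phi>2 = (\<lambda>z. partial_x \<phi>1 z + grushin_weight \<alpha> (fst z) * partial_y \<phi>2 z)"

definition grushin_perimeter :: "real \<Rightarrow> (real \<times> real) set \<Rightarrow> ereal" where
  "grushin_perimeter \<alpha> E =
     Sup {ereal (LINT z:E|lebesgue. grushin_div \<alpha> \<phi>1 \<phi>2 z) | \<phi>1 \<phi>2.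
            C1_compact_support \<phi>1 \<and> C1_compact_support \<phi>2 \<and>
            (\<forall>z. sqrt ((\<phi>1 z)\<^sup>2 + (\<phi>2 z)\<^sup>2) \<le> 1)}"

definition right_part :: "(real \<times> real) set \<Rightarrow> (real \<times> real) set" where
  "right_part E = E \<inter> {(x, y). x > 0}"

definition left_part :: "(real \<times> real) set \<Rightarrow> (real \<times> real) set" where
  "left_part E = E \<inter> {(x, y). x < 0}"

definition admissible_x :: "real \<Rightarrow> (real \<times> real) set set" where
  "admissible_x v = {E \<in> sets lebesgue.
     emeasure lebesgue (right_part E) = ennreal v \<and> emeasure lebesgue (left_part E) = ennreal v}"

definition partition_perimeter_x :: "real \<Rightarrow> (real \<times> real) set \<Rightarrow> ereal" where
  "partition_perimeter_x \<alpha> E =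
     (grushin_perimeter \<alpha> (right_part E) + grushin_perimeter \<alpha> (left_part E)
       + grushin_perimeter \<alpha> E) / 2"

definition equivalent_sets :: "(real \<times> real) set \<Rightarrow> (real \<times> real) set \<Rightarrow> bool" where
  "equivalent_sets E F \<longleftrightarrow> (E - F) \<union> (F - E) \<in> null_sets lebesgue"

definition x_symmetric_sets :: "(real \<times> real) set set" where
  "x_symmetric_sets = {E \<in> sets lebesgue. \<forall>x y. (x, y) \<in> E \<longrightarrow> (- x, y) \<in> E}"

definition y_schwarz_sets :: "(real \<times> real) set set" where
  "y_schwarz_sets = {E \<in> sets lebesgue.
     (\<forall>x y. (x, y) \<in> E \<longrightarrow> (x, - y) \<in> E) \<and>
     (\<forall>t. open {y. (t, y) \<in> E} \<and> is_interval {y. (t, y) \<in> E})}"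

definition grushin_transform :: "real \<Rightarrow> real \<times> real \<Rightarrow> real \<times> real" where
  "grushin_transform \<alpha> = (\<lambda>(x, y). (sgn x * (\<bar>x\<bar> powr (\<alpha> + 1) / (\<alpha> + 1)), y))"

definition x_transformed_convex :: "real \<Rightarrow> (real \<times> real) set \<Rightarrow> bool" where
  "x_transformed_convex \<alpha> E \<longleftrightarrow>
     E \<in> x_symmetric_sets \<and> convex (grushin_transform \<alpha> ` right_part E)"

definition locally_lipschitz_on :: "real set \<Rightarrow> (real \<Rightarrow> real) \<Rightarrow> bool" where
  "locally_lipschitz_on S f \<longleftrightarrow> (\<forall>K. compact K \<and> K \<subseteq> S \<longrightarrow> (\<exists>L. L-lipschitz_on K f))"

text \<open>Sections here are closed intervals, while those of sets in
  \<^const>\<open>y_schwarz_sets\<close> are open; hence a nonempty set of that class can agree with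
  such a region only in the sense of \<^const>\<open>equivalent_sets\<close>.\<close>
definition profile_region :: "real \<Rightarrow> (real \<Rightarrow> real) \<Rightarrow> (real \<times> real) set" where
  "profile_region r f = {(x, y). \<bar>y\<bar> \<le> f \<bar>x\<bar> \<and> \<bar>x\<bar> \<le> r}"

end

theory Submission
 imports Defs
begin

text \<open>The partition perimeter of \<open>E\<close> dominates the sum of the perimeters of its two halves in which
 segments on the axis \<open>x = 0\<close> count with weight 1/2: use fields whose first component is doubled off
 the axis, except in a thin strip. Each summand is bounded below by calibration: if \<open>S\<close> is the
 set of abscissae of nonempty sections and \<open>t x\<close> the measure of \<open>S \<inter> {0..x}\<close>, then the field with first component
 \<open>u = \<mu> * t x - 1/2\<close> and second component \<open>sqrt (1 - u\<^sup>2) * sin W\<close>, where the angle \<open>W\<close>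
 increases from \<open>- \<pi>/2\<close> to \<open>\<pi>/2\<close> along each section, gives \<open>cap_value \<alpha> v r\<close> with
 \<open>r\<close> the measure of \<open>S\<close>. Minimising over \<open>r\<close> determines the profile \<open>f\<close>, and the divergence
 theorem shows that the region below \<open>f\<close> attains the bound. If \<open>\<alpha> > 0\<close> and equality holds,
 sections are intervals, and varying the calibrating field makes their length \<open>2 * f x\<close> and
 their centre constant, so the set is convex after the transformation. If \<open>E\<close> is itself
 equivalent to a convex set but not minimal, the perimeter of \<open>E\<close> is matched by a dilation
 \<open>(x, y) \<mapsto> (k * x, y / k)\<close> of the minimiser, by the intermediate value theorem.\<close>

text \<open>The Grushin divergence differentiates the first component of a field only in x and the
  second only in y. Along a vertical section the second component can thus be prescribed with no
  regularity from one section to the next; this replaces rearrangement and compactness arguments.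
  The end values of \<open>u\<close> fix the constants: -1/2 is the weight of the axis, 1 is where
  the profile closes with a vertical tangent, so \<open>u\<close> climbs by 3/2 and has slope 3/(2r)
  in \<open>t\<close>. Such a field is neither C1 nor compactly supported, and sqrt (1 - u^2) is
  singular at u = 1; hence the class of fields is enlarged by limits and the unit ball by a factor
  sqrt (1 + \<delta>). Measuring abscissae by \<open>t x\<close> instead of x closes the gaps in
  \<open>S\<close> and loses only the difference of the weights at x and \<open>t x\<close>, which
  has a sign as the weight is monotone. In the equality case, turning the field by an angle of order
  \<epsilon> lengthens it only to order \<epsilon>^2, so all first-order effects vanish. The
  competitor is chosen after \<open>E\<close>, which leaves room to match a perimeter above the
  minimum.\<close>

abbreviation (input) wt :: "real \<Rightarrow> real \<Rightarrow> real" where "wt \<equiv> grushin_weight"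

type_synonym plane = "real \<times> real"

lemmas set_int_def = set_lebesgue_integral_def

lemma DERIV_imp_continuous_on: "(\<And>x. (f has_real_derivative f' x) (at x)) \<Longrightarrow> continuous_on T f"
 by (blast intro: DERIV_isCont continuous_at_imp_continuous_on)

lemma LBINT_Ioo_Icc:
 fixes f :: "real \<Rightarrow> real"
 shows "a \<le> b \<Longrightarrow> (LBINT x:{a<..<b}. f x) = (LBINT x:{a..b}. f x)"
 using interval_integral_Icc[of a b f] interval_integral_Ioo[of a b f] by simp

text \<open>An overshoot of the interval from -1 to 1 by \<delta>/8 leaves 1 + \<delta> - x^2 at
  least \<delta>/2. This margin keeps sqrt (1 + \<delta> - u^2) differentiable while smooth
  functions only approximate the calibration.\<close>

lemma square_near_one:
 fixes x \<delta> :: real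
 assumes "0 < \<delta>" "\<delta> \<le> 1" "\<bar>x\<bar> \<le> 1 + \<delta> / 8"
 shows "x\<^sup>2 \<le> 1 + \<delta> / 2"
proof -
 have "\<bar>x\<bar>\<^sup>2 \<le> (1 + \<delta> / 8)\<^sup>2" using assms by (intro power_mono) auto
 moreover have "(1 + \<delta> / 8)\<^sup>2 = 1 + \<delta> / 4 + \<delta> * \<delta> / 64" by (simp add: power2_eq_square field_simps)
 moreover have "\<delta> * \<delta> \<le> \<delta>" using assms mult_left_mono[of \<delta> 1 \<delta>] by simp
 ultimately show ?thesis using assms unfolding power2_abs by linarith
qed

text \<open>Sections are tested by measure and not by emptiness, so the set changes only by a null
  set when \<open>A\<close> does.\<close>

abbreviation (input) x_support :: "plane set \<Rightarrow> real set" where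
 "x_support A \<equiv> {x. emeasure lborel {y. (x, y) \<in> A} \<noteq> 0}"

section \<open>C1 functions on the plane and their partial derivatives\<close>

text \<open>A C1 function is carried together with its two partial derivatives as real functions.
  This replaces the operator-valued derivative of \<open>C1_compact_support\<close>, so that
  divergences can be computed by algebraic rules.\<close>

definition grad :: "(plane \<Rightarrow> real) \<Rightarrow> (plane \<Rightarrow> real) \<Rightarrow> (plane \<Rightarrow> real) \<Rightarrow> bool" where
 "grad \<phi> p q \<longleftrightarrow> (\<forall>z. (\<phi> has_derivative (\<lambda>w. fst w * p z + snd w * q z)) (at z)) \<and>
   continuous_on UNIV p \<and> continuous_on UNIV q"

lemma gradI:
 assumes "\<And>z. (\<phi> has_derivative (\<lambda>w. fst w * p z + snd w * q z)) (at z)"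
  "continuous_on UNIV p" "continuous_on UNIV q"
 shows "grad \<phi> p q"
 using assms by (auto simp: grad_def)

lemma gradD:
 assumes "grad \<phi> p q"
 shows "(\<phi> has_derivative (\<lambda>w. fst w * p z + snd w * q z)) (at z)"
  "continuous_on UNIV p" "continuous_on UNIV q" "continuous_on UNIV \<phi>"
proof -
 show a: "(\<phi> has_derivative (\<lambda>w. fst w * p z + snd w * q z)) (at z)" for z
  using assms unfolding grad_def by blast
 show "continuous_on UNIV p" "continuous_on UNIV q"
  using assms by (auto simp: grad_def)
 show "continuous_on UNIV \<phi>"
  using a by (meson continuous_at_imp_continuous_on has_derivative_continuous)
qed

lemma grad_borel:
 assumes "grad \<phi> p q"
 shows "\<phi> \<in> borel_measurable borel" "p \<in> borel_measurable borel" "q \<in> borel_measurable borel"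
 using gradD[OF assms] by (auto intro: borel_measurable_continuous_onI)

lemma grad_DERIV_x:
 assumes "grad \<phi> p q"
 shows "((\<lambda>s. \<phi> (s, y)) has_real_derivative p (x, y)) (at x)"
proof -
 have "((\<lambda>s. (s, y)) has_derivative (\<lambda>h. (h, 0))) (at x)"
  by (intro derivative_intros)
 from has_derivative_compose[OF this gradD(1)[OF assms]]
 show ?thesis by (simp add: has_field_derivative_def mult_commute_abs)
qed

lemma grad_DERIV_y:
 assumes "grad \<phi> p q"
 shows "((\<lambda>s. \<phi> (x, s)) has_real_derivative q (x, y)) (at y)"
proof -
 have "((\<lambda>s. (x, s)) has_derivative (\<lambda>h. (0, h))) (at y)"
  by (intro derivative_intros)
 from has_derivative_compose[OF this gradD(1)[OF assms]]
 show ?thesis by (simp add: has_field_derivative_def mult_commute_abs)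
qed

lemma grad_partial:
 assumes "grad \<phi> p q"
 shows "partial_x \<phi> = p" "partial_y \<phi> = q"
 using DERIV_imp_deriv[OF grad_DERIV_x[OF assms]] DERIV_imp_deriv[OF grad_DERIV_y[OF assms]]
 by (auto simp: partial_x_def partial_y_def fun_eq_iff)

lemma grad_const [intro]: "grad (\<lambda>z. c) (\<lambda>z. 0) (\<lambda>z. 0)"
 by (rule gradI) (auto intro!: derivative_eq_intros)

lemma grad_fst [intro]:
 assumes "\<And>x. (h has_real_derivative h' x) (at x)" "continuous_on UNIV h'"
 shows "grad (\<lambda>z. h (fst z)) (\<lambda>z. h' (fst z)) (\<lambda>z. 0)"
proof (rule gradI)
 fix z :: plane
 have "(fst has_derivative fst) (at z)" by (rule has_derivative_fst) (rule has_derivative_ident)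
 from has_derivative_compose[OF this assms(1)[unfolded has_field_derivative_def]]
 show "((\<lambda>z. h (fst z)) has_derivative (\<lambda>w. fst w * h' (fst z) + snd w * 0)) (at z)"
  by (simp add: mult.commute)
qed (auto intro!: continuous_intros continuous_on_compose2[OF assms(2)])

lemma grad_snd [intro]:
 assumes "\<And>x. (h has_real_derivative h' x) (at x)" "continuous_on UNIV h'"
 shows "grad (\<lambda>z. h (snd z)) (\<lambda>z. 0) (\<lambda>z. h' (snd z))"
proof (rule gradI)
 fix z :: plane
 have "(snd has_derivative snd) (at z)" by (rule has_derivative_snd) (rule has_derivative_ident)
 from has_derivative_compose[OF this assms(1)[unfolded has_field_derivative_def]]
 show "((\<lambda>z. h (snd z)) has_derivative (\<lambda>w. fst w * 0 + snd w * h' (snd z))) (at z)"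
  by (simp add: mult.commute)
qed (auto intro!: continuous_intros continuous_on_compose2[OF assms(2)])

lemma grad_add:
 assumes "grad f p q" "grad g p' q'"
 shows "grad (\<lambda>z. f z + g z) (\<lambda>z. p z + p' z) (\<lambda>z. q z + q' z)"
 by (rule gradI)
   (auto intro!: derivative_eq_intros gradD(1)[OF assms(1)] gradD(1)[OF assms(2)] continuous_intros
    gradD(2-)[OF assms(1)] gradD(2-)[OF assms(2)] simp: algebra_simps)

lemma grad_mult:
 assumes "grad f p q" "grad g p' q'"
 shows "grad (\<lambda>z. f z * g z) (\<lambda>z. p z * g z + f z * p' z) (\<lambda>z. q z * g z + f z * q' z)"
 by (rule gradI)
   (auto intro!: derivative_eq_intros gradD(1)[OF assms(1)] gradD(1)[OF assms(2)] continuous_intros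
    gradD(2-)[OF assms(1)] gradD(2-)[OF assms(2)] simp: algebra_simps)

lemma grad_cmult:
 assumes "grad g p' q'"
 shows "grad (\<lambda>z. c * g z) (\<lambda>z. c * p' z) (\<lambda>z. c * q' z)"
 using grad_mult[OF grad_const assms, of c] by simp

lemma grad_diff:
 assumes "grad f p q" "grad g p' q'"
 shows "grad (\<lambda>z. f z - g z) (\<lambda>z. p z - p' z) (\<lambda>z. q z - q' z)"
 using grad_add[OF assms(1) grad_cmult[OF assms(2), of "-1"]] by simp

lemma grad_compose:
 assumes "grad f p q" "\<And>x. (h has_real_derivative h' x) (at x)" "continuous_on UNIV h'"
 shows "grad (\<lambda>z. h (f z)) (\<lambda>z. h' (f z) * p z) (\<lambda>z. h' (f z) * q z)"
proof (rule gradI)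
 fix z :: plane
 from has_derivative_compose[OF gradD(1)[OF assms(1)] assms(2)[unfolded has_field_derivative_def]]
 show "((\<lambda>z. h (f z)) has_derivative (\<lambda>w. fst w * (h' (f z) * p z) + snd w * (h' (f z) * q z))) (at z)"
  by (simp add: algebra_simps)
qed (auto intro!: continuous_intros continuous_on_compose2[OF assms(3)] gradD(2-)[OF assms(1)])

lemma grad_scale:
 assumes "grad f p q"
 shows "grad (\<lambda>z. f (c * fst z, d * snd z)) (\<lambda>z. c * p (c * fst z, d * snd z)) (\<lambda>z. d * q (c * fst z, d * snd z))"
proof (rule gradI)
 fix z :: plane
 have "((\<lambda>z. (c * fst z, d * snd z)) has_derivative (\<lambda>w. (c * fst w, d * snd w))) (at z)"
  by (auto intro!: derivative_eq_intros)
 from has_derivative_compose[OF this gradD(1)[OF assms(1)]]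
 show "((\<lambda>z. f (c * fst z, d * snd z)) has_derivative
   (\<lambda>w. fst w * (c * p (c * fst z, d * snd z)) + snd w * (d * q (c * fst z, d * snd z)))) (at z)"
  by (simp add: algebra_simps)
qed (auto intro!: continuous_intros continuous_on_compose2[OF gradD(2)[OF assms(1)]] continuous_on_compose2[OF gradD(3)[OF assms(1)]])

lemma grad_cong:
 assumes "grad f p q" "\<And>z. f z = f' z" "\<And>z. p z = p' z" "\<And>z. q z = q' z"
 shows "grad f' p' q'"
proof -
 have "f = f'" "p = p'" "q = q'" using assms(2-) by auto
 then show ?thesis using assms(1) by simp
qed

text \<open>Polynomials are the C1 functions that the Stone-Weierstrass theorem delivers in
  \<open>C1_approximation\<close>.\<close>

lemma grad_polynomial:
 assumes "real_polynomial_function (f :: plane \<Rightarrow> real)"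
 shows "\<exists>p q. grad f p q"
 using assms
proof induction
 case (linear f)
 have "f w = fst w * f (1,0) + snd w * f (0,1)" for w
 proof -
  have "w = fst w *\<^sub>R (1,0) + snd w *\<^sub>R (0,1)" by (cases w) simp
  then have "f w = f (fst w *\<^sub>R (1,0) + snd w *\<^sub>R (0,1))" by simp
  also have "\<dots> = fst w * f (1,0) + snd w * f (0,1)"
   by (simp only: linear_add[OF bounded_linear.linear[OF linear]] linear_scale[OF bounded_linear.linear[OF linear]] real_scaleR_def)
  finally show ?thesis .
 qed
 then have *: "f = (\<lambda>w. fst w * f (1,0) + snd w * f (0,1))" by (rule ext)
 have "(f has_derivative f) (at z)" for z
  using bounded_linear_imp_has_derivative[OF linear] .
 then have "(f has_derivative (\<lambda>w. fst w * f (1,0) + snd w * f (0,1))) (at z)" for z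
  using * by metis
 then have "grad f (\<lambda>z. f (1,0)) (\<lambda>z. f (0,1))"
  by (intro gradI) auto
 then show ?case by blast
next
 case (const c)
 then show ?case using grad_const by blast
next
 case (add f g)
 then show ?case using grad_add by blast
next
 case (mult f g)
 then show ?case using grad_mult by blast
qed

text \<open>The partial derivatives are the values of the derivative at the two unit vectors;
  conversely the operator is rebuilt from the two projections with continuous coefficients.
  Compactness of the closed support is boundedness of the support.\<close>

lemma C1_compact_support_iff:
 "C1_compact_support \<phi> \<longleftrightarrow> (\<exists>p q. grad \<phi> p q) \<and> (\<exists>K. \<forall>z. norm z > K \<longrightarrow> \<phi> z = 0)"
proof -
 have 1: "compact (closure {z. \<phi> z \<noteq> 0}) \<longleftrightarrow> (\<exists>K. \<forall>z. norm z > K \<longrightarrow> \<phi> z = 0)"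
  unfolding compact_closure bounded_iff by (metis (mono_tags, lifting) mem_Collect_eq not_le)
 have 2: "(\<exists>p q. grad \<phi> p q)"
  if D: "\<And>z. (\<phi> has_derivative blinfun_apply (D z)) (at z)" "continuous_on UNIV D" for D
 proof -
  have "blinfun_apply (D z) w = fst w * D z (1,0) + snd w * D z (0,1)" for z w
  proof -
   have "w = fst w *\<^sub>R (1,0) + snd w *\<^sub>R (0,1)" by (cases w) simp
   then have "D z w = D z (fst w *\<^sub>R (1,0) + snd w *\<^sub>R (0,1))" by simp
   also have "\<dots> = fst w * D z (1,0) + snd w * D z (0,1)"
    by (simp only: blinfun.add_right blinfun.scaleR_right real_scaleR_def)
   finally show ?thesis .
  qed
  then have "(\<phi> has_derivative (\<lambda>w. fst w * D z (1,0) + snd w * D z (0,1))) (at z)" for z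
   using D(1)[of z] by (metis (no_types, lifting) ext)
  moreover have "continuous_on UNIV (\<lambda>z. D z (1,0))" "continuous_on UNIV (\<lambda>z. D z (0,1))"
   using D(2) by (auto intro!: continuous_intros)
  ultimately have "grad \<phi> (\<lambda>z. D z (1,0)) (\<lambda>z. D z (0,1))" by (rule gradI)
  then show ?thesis by blast
 qed
 have 3: "\<exists>D. (\<forall>z. (\<phi> has_derivative blinfun_apply (D z)) (at z)) \<and> continuous_on UNIV D"
  if C: "grad \<phi> p q" for p q
 proof -
  define F where "F = Blinfun (fst :: plane \<Rightarrow> real)"
  define S where "S = Blinfun (snd :: plane \<Rightarrow> real)"
  have FS: "blinfun_apply F = fst" "blinfun_apply S = snd"
   by (simp_all add: F_def S_def bounded_linear_Blinfun_apply bounded_linear_fst bounded_linear_snd)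
  define D where "D z = p z *\<^sub>R F + q z *\<^sub>R S" for z
  have "blinfun_apply (D z) = (\<lambda>w. fst w * p z + snd w * q z)" for z
   by (auto simp: D_def blinfun.add_left blinfun.scaleR_left FS mult.commute)
  moreover have "continuous_on UNIV D"
   unfolding D_def using gradD[OF C] by (auto intro!: continuous_intros)
  ultimately show ?thesis using gradD(1)[OF C] by (intro exI[of _ D]) auto
 qed
 show ?thesis unfolding C1_compact_support_def 1 using 2 3 by blast
qed

lemma grad_zero_outside:
 assumes "grad \<phi> p q" "\<And>z. z \<in> U \<Longrightarrow> \<phi> z = 0" "open U" "z \<in> U"
 shows "p z = 0" "q z = 0"
proof -
 have "(\<phi> has_derivative (\<lambda>w. 0)) (at z)"
  by (rule has_derivative_transform_within_open[of "\<lambda>z. 0", OF _ assms(3,4)]) (auto simp: assms)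
 from has_derivative_unique[OF this gradD(1)[OF assms(1)]]
 have "0 = fst w * p z + snd w * q z" for w by meson
 from this[of "(1,0)"] this[of "(0,1)"] show "p z = 0" "q z = 0" by auto
qed

lemma grad_compact_bounds:
 assumes "grad \<phi> p q" "\<And>z. norm z > K \<Longrightarrow> \<phi> z = 0"
 shows "\<And>z. norm z > K \<Longrightarrow> p z = 0" "\<And>z. norm z > K \<Longrightarrow> q z = 0"
  "\<exists>B. \<forall>z. \<bar>p z\<bar> \<le> B \<and> \<bar>q z\<bar> \<le> B"
proof -
 have op: "open {z::real\<times>real. norm z > K}" by (intro open_Collect_less continuous_intros)
 show 1: "\<And>z. norm z > K \<Longrightarrow> p z = 0" "\<And>z. norm z > K \<Longrightarrow> q z = 0"
  using grad_zero_outside[OF assms(1) _ op] assms(2) by auto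
 have *: "\<exists>B. \<forall>z. \<bar>f z\<bar> \<le> B" if "continuous_on UNIV f" "\<And>z. norm z > K \<Longrightarrow> f z = 0" for f :: "plane \<Rightarrow> real"
 proof -
  have "compact (f ` cball 0 K)"
   using that(1) by (intro compact_continuous_image) (auto intro: continuous_on_subset)
  then have "bounded (f ` cball 0 K)" by (rule compact_imp_bounded)
  then obtain B where B: "\<forall>x\<in>f ` cball 0 K. norm x \<le> B" by (auto simp: bounded_iff)
  then have "\<bar>f z\<bar> \<le> max B 0" for z
   using that(2)[of z] by (cases "norm z > K") (auto simp: le_max_iff_disj)
  then show ?thesis by blast
 qed
 obtain B1 where "\<forall>z. \<bar>p z\<bar> \<le> B1" using *[OF gradD(2)[OF assms(1)] 1(1)] by auto
 moreover obtain B2 where "\<forall>z. \<bar>q z\<bar> \<le> B2" using *[OF gradD(3)[OF assms(1)] 1(2)] by auto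
 ultimately show "\<exists>B. \<forall>z. \<bar>p z\<bar> \<le> B \<and> \<bar>q z\<bar> \<le> B"
  by (intro exI[of _ "max B1 B2"]) (auto simp: le_max_iff_disj)
qed

section \<open>The weight and area-preserving scalings\<close>

lemma wt_nonneg [simp]: "0 \<le> wt \<alpha> x"
 by (simp add: grushin_weight_def)

lemma wt_pos: "x \<noteq> 0 \<Longrightarrow> 0 < wt \<alpha> x"
 by (simp add: grushin_weight_def)

lemma wt_mono:
 assumes "0 \<le> \<alpha>" "\<bar>x\<bar> \<le> \<bar>y\<bar>" shows "wt \<alpha> x \<le> wt \<alpha> y"
 using assms by (auto simp: grushin_weight_def intro: powr_mono2)

lemma wt_strict_mono:
 assumes "0 < \<alpha>" "\<bar>x\<bar> < \<bar>y\<bar>" shows "wt \<alpha> x < wt \<alpha> y"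
 using assms by (auto simp: grushin_weight_def intro: powr_less_mono2)

lemma wt_continuous:
 assumes "0 \<le> \<alpha>" shows "continuous_on A (wt \<alpha>)"
proof (cases "\<alpha> = 0")
 case False
 then have "continuous_on A (\<lambda>x. \<bar>x\<bar> powr \<alpha>)" using assms by (intro continuous_on_powr') (auto intro!: continuous_intros)
 then show ?thesis using False by (simp add: grushin_weight_def[abs_def])
qed (simp add: grushin_weight_def[abs_def])

lemma wt_borel [measurable]:
 assumes "0 \<le> \<alpha>" shows "wt \<alpha> \<in> borel_measurable borel"
 by (rule borel_measurable_continuous_onI[OF wt_continuous[OF assms]])

text \<open>Homogeneity of the weight: both the cap integral and the perimeter of dilated sets scale
  through it.\<close>

lemma wt_mult:
 "wt \<alpha> (x * y) = wt \<alpha> x * wt \<alpha> y"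
 by (simp add: grushin_weight_def powr_mult abs_mult)

lemma integrable_continuous_compact:
 fixes h :: "plane \<Rightarrow> real"
 assumes "continuous_on UNIV h" "\<And>z. norm z > K \<Longrightarrow> h z = 0"
 shows "integrable lborel h"
proof -
 have "integrable lborel (\<lambda>z. indicator (cball 0 K) z *\<^sub>R h z)"
  by (rule borel_integrable_compact) (auto intro: continuous_on_subset[OF assms(1)])
 moreover have "(\<lambda>z. indicator (cball 0 K) z *\<^sub>R h z) = h"
  using assms(2) by (fastforce simp: indicator_def)
 ultimately show ?thesis by simp
qed

lemma set_integrable_subset_borel:
 fixes h :: "plane \<Rightarrow> real"
 assumes "integrable lborel h" "A \<in> sets borel"
 shows "set_integrable lborel A h"
 using integrable_mult_indicator[of A lborel h] assms unfolding set_integrable_def by simp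

lemma borel_fst_snd [measurable]:
 "fst \<in> borel_measurable (borel :: plane measure)"
 "snd \<in> borel_measurable (borel :: plane measure)"
 by (auto intro!: borel_measurable_continuous_onI continuous_intros)

lemma borel_scale_prod [measurable]:
 "(\<lambda>z. (c * fst z, d * snd z)) \<in> borel_measurable (borel :: plane measure)"
 by (auto intro!: borel_measurable_continuous_onI continuous_intros)

text \<open>One statement serves the reflection in the axis (\<open>c = -1\<close>,
  \<open>d = 1\<close>) and the dilations with factors \<open>k\<close> and
  \<open>1 / k\<close>.\<close>

lemma lborel_scale_prod:
 fixes c d :: real
 assumes "\<bar>c * d\<bar> = 1"
 shows "distr lborel borel (\<lambda>z. (c * fst z, d * snd z)) = (lborel :: plane measure)"
proof -
 define k :: "plane \<Rightarrow> real" where "k j = (if j = (1,0) then c else d)" for j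
 have nz: "c \<noteq> 0" "d \<noteq> 0" using assms by auto
 have T: "(0 + (\<Sum>j\<in>Basis. (k j * (x \<bullet> j)) *\<^sub>R j)) = (c * fst x, d * snd x)" for x
  by (cases x) (auto simp: Basis_prod_def k_def sum.union_disjoint sum.insert)
 have P: "(\<Prod>j\<in>(Basis::(real\<times>real) set). \<bar>k j\<bar>) = 1"
  using assms by (auto simp: Basis_prod_def k_def abs_mult mult.commute)
 have "lborel = density (distr lborel borel (\<lambda>x. 0 + (\<Sum>j\<in>Basis. (k j * (x \<bullet> j)) *\<^sub>R j)))
    (\<lambda>_. ennreal (\<Prod>j\<in>(Basis::(real\<times>real) set). \<bar>k j\<bar>))"
  by (rule lborel_affine_euclidean) (use nz in \<open>auto simp: k_def\<close>)
 then show ?thesis unfolding T P by (simp add: density_1)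
qed

lemma integral_scale_prod:
 fixes c d :: real and f :: "plane \<Rightarrow> real"
 assumes "\<bar>c * d\<bar> = 1" and [measurable]: "f \<in> borel_measurable borel"
 shows "(LBINT z. f (c * fst z, d * snd z)) = (LBINT z. f z)"
  (is "?l = ?r")
proof -
 have "?r = (\<integral>z. f z \<partial>(distr lborel borel (\<lambda>z. (c * fst z, d * snd z))))"
  using lborel_scale_prod[OF assms(1)] by simp
 also have "\<dots> = ?l"
  by (rule integral_distr) auto
 finally show ?thesis by simp
qed

lemma emeasure_scale_prod:
 fixes c d :: real
 assumes "\<bar>c * d\<bar> = 1" and [measurable]: "A \<in> sets borel"
 shows "emeasure lborel {z. (c * fst z, d * snd z) \<in> A} = emeasure lborel A"
proof -
 have "emeasure lborel A = emeasure (distr lborel borel (\<lambda>z. (c * fst z, d * snd z))) A"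
  using lborel_scale_prod[OF assms(1)] by simp
 also have "\<dots> = emeasure lborel ((\<lambda>z. (c * fst z, d * snd z)) -` A \<inter> space lborel)"
  by (rule emeasure_distr) auto
 finally show ?thesis by (simp add: vimage_def)
qed

section \<open>Borel representatives and access to the perimeter\<close>

text \<open>Sections and Fubini's theorem call for Borel sets. A Lebesgue set is exchanged for an
  equivalent Borel one, which changes no integral of a Borel function.\<close>

lemma set_integral_lebesgue_eq_lborel:
 fixes f :: "plane \<Rightarrow> real"
 assumes E: "E \<in> sets lebesgue" and A[measurable]: "A \<in> sets borel" and "equivalent_sets E A"
  and f[measurable]: "f \<in> borel_measurable borel"
 shows "(LINT z:E|lebesgue. f z) = (LBINT z:A. f z)"
proof -
 have fl: "f \<in> borel_measurable lebesgue" using f by (simp add: measurable_completion)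
 have Al: "A \<in> sets lebesgue" using A by (simp add: sets_completionI_sets)
 have "AE z in lebesgue. z \<notin> (E - A) \<union> (A - E)"
  using assms(3) by (intro AE_not_in) (simp add: equivalent_sets_def)
 then have "AE z in lebesgue. indicator E z *\<^sub>R f z = indicator A z *\<^sub>R f z"
  by eventually_elim (auto simp: indicator_def)
 then have "(LINT z:E|lebesgue. f z) = (LINT z:A|lebesgue. f z)"
  unfolding set_int_def
  using E Al fl by (intro integral_cong_AE borel_measurable_scaleR borel_measurable_indicator) auto
 also have "\<dots> = (LBINT z:A. f z)"
  unfolding set_int_def by (rule integral_completion) auto
 finally show ?thesis .
qed

lemma equivalent_borel:
 assumes "E \<in> sets lebesgue"
 obtains A :: "plane set" where "A \<in> sets borel" "A \<subseteq> E" "equivalent_sets E A"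
proof -
 from assms obtain S N N' where S: "E = S \<union> N" "N \<subseteq> N'" "N' \<in> null_sets lborel" "S \<in> sets lborel"
  by (auto simp: sets_completion)
 have "(E - S) \<union> (S - E) \<subseteq> N'" using S by auto
 moreover have "N' \<in> null_sets lebesgue" using S(3) by (rule null_sets_completionI)
 ultimately have "(E - S) \<union> (S - E) \<in> null_sets lebesgue"
  by (metis completion.complete2 null_sets_completion_subset)
 then show ?thesis using S by (intro that[of S]) (auto simp: equivalent_sets_def)
qed

text \<open>The Grushin divergence expressed by the two derivatives that enter it: \<open>p\<close>
  is the x-derivative of the first component, \<open>q\<close> the y-derivative of the
  second.\<close>

definition gdiv :: "real \<Rightarrow> (plane \<Rightarrow> real) \<Rightarrow> (plane \<Rightarrow> real) \<Rightarrow> plane \<Rightarrow> real" where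
 "gdiv \<alpha> p q z = p z + wt \<alpha> (fst z) * q z"

lemma gdiv_borel [measurable]:
 assumes "0 \<le> \<alpha>" "p \<in> borel_measurable borel" "q \<in> borel_measurable borel"
 shows "gdiv \<alpha> p q \<in> borel_measurable borel"
proof -
 note [measurable] = assms(2,3) wt_borel[OF assms(1)]
 show ?thesis unfolding gdiv_def[abs_def] by measurable
qed

lemma gdiv_continuous:
 assumes "0 \<le> \<alpha>" "continuous_on UNIV p" "continuous_on UNIV q"
 shows "continuous_on UNIV (gdiv \<alpha> p q)"
 unfolding gdiv_def[abs_def]
 by (intro continuous_intros assms continuous_on_compose2[OF wt_continuous[OF assms(1)]]) auto

text \<open>With \<open>perimeter_le\<close> this is the interface to the supremum: it speaks of a
  Borel representative, of gradients, and of a square bound in place of the square root.\<close>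

lemma perimeter_ge:
 assumes "0 \<le> \<alpha>" "E \<in> sets lebesgue" "A \<in> sets borel" "equivalent_sets E A"
  and "grad \<phi>1 p1 q1" "grad \<phi>2 p2 q2" "\<And>z. norm z > K \<Longrightarrow> \<phi>1 z = 0 \<and> \<phi>2 z = 0"
  and "\<And>z. (\<phi>1 z)\<^sup>2 + (\<phi>2 z)\<^sup>2 \<le> 1"
 shows "ereal (LBINT z:A. gdiv \<alpha> p1 q2 z) \<le> grushin_perimeter \<alpha> E"
proof -
 have c: "C1_compact_support \<phi>1" "C1_compact_support \<phi>2"
  using assms(5-7) unfolding C1_compact_support_iff by blast+
 have b: "gdiv \<alpha> p1 q2 \<in> borel_measurable borel"
  using assms(1) grad_borel[OF assms(5)] grad_borel[OF assms(6)] by measurable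
 have d: "grushin_div \<alpha> \<phi>1 \<phi>2 = gdiv \<alpha> p1 q2"
  by (simp add: grushin_div_def gdiv_def fun_eq_iff grad_partial[OF assms(5)] grad_partial[OF assms(6)])
 have "(LBINT z:A. gdiv \<alpha> p1 q2 z) = (LINT z:E|lebesgue. grushin_div \<alpha> \<phi>1 \<phi>2 z)"
  unfolding d using set_integral_lebesgue_eq_lborel[OF assms(2-4) b] by simp
 moreover have "\<forall>z. sqrt ((\<phi>1 z)\<^sup>2 + (\<phi>2 z)\<^sup>2) \<le> 1"
  using assms(8) by simp
 ultimately show ?thesis unfolding grushin_perimeter_def
  using c by (intro Sup_upper) auto
qed

lemma perimeter_le:
 assumes "0 \<le> \<alpha>" "E \<in> sets lebesgue" "A \<in> sets borel" "equivalent_sets E A"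
  and "\<And>\<phi>1 \<phi>2 p1 q1 p2 q2 K. grad \<phi>1 p1 q1 \<Longrightarrow> grad \<phi>2 p2 q2 \<Longrightarrow>
   (\<And>z. norm z > K \<Longrightarrow> \<phi>1 z = 0 \<and> \<phi>2 z = 0) \<Longrightarrow>
   (\<And>z. (\<phi>1 z)\<^sup>2 + (\<phi>2 z)\<^sup>2 \<le> 1) \<Longrightarrow> (LBINT z:A. gdiv \<alpha> p1 q2 z) \<le> C"
 shows "grushin_perimeter \<alpha> E \<le> ereal C"
 unfolding grushin_perimeter_def
proof (rule Sup_least, clarify)
 fix \<phi>1 \<phi>2 assume c: "C1_compact_support \<phi>1" "C1_compact_support \<phi>2" "\<forall>z. sqrt ((\<phi>1 z)\<^sup>2 + (\<phi>2 z)\<^sup>2) \<le> 1"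
 obtain p1 q1 K1 where 1: "grad \<phi>1 p1 q1" "\<And>z. norm z > K1 \<Longrightarrow> \<phi>1 z = 0"
  using c(1) unfolding C1_compact_support_iff by auto
 obtain p2 q2 K2 where 2: "grad \<phi>2 p2 q2" "\<And>z. norm z > K2 \<Longrightarrow> \<phi>2 z = 0"
  using c(2) unfolding C1_compact_support_iff by auto
 have b: "gdiv \<alpha> p1 q2 \<in> borel_measurable borel"
  using assms(1) grad_borel[OF 1(1)] grad_borel[OF 2(1)] by measurable
 have d: "grushin_div \<alpha> \<phi>1 \<phi>2 = gdiv \<alpha> p1 q2"
  by (simp add: grushin_div_def gdiv_def fun_eq_iff grad_partial[OF 1(1)] grad_partial[OF 2(1)])
 have "(LBINT z:A. gdiv \<alpha> p1 q2 z) \<le> C"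
  by (rule assms(5)[OF 1(1) 2(1), of "max K1 K2"]) (use 1 2 c(3) in auto)
 then show "ereal (LINT z:E|lebesgue. grushin_div \<alpha> \<phi>1 \<phi>2 z) \<le> ereal C"
  unfolding d using set_integral_lebesgue_eq_lborel[OF assms(2-4) b] by simp
qed

text \<open>The zero field competes. Nonnegativity is what lets a finite partition perimeter split
  into three finite summands.\<close>

lemma perimeter_nonneg: "0 \<le> grushin_perimeter \<alpha> E"
proof -
 have c: "C1_compact_support (\<lambda>z. 0)"
  unfolding C1_compact_support_iff using grad_const by auto
 have "ereal 0 \<le> grushin_perimeter \<alpha> E"
  unfolding grushin_perimeter_def
  by (rule Sup_upper, rule CollectI, rule exI[of _ "\<lambda>z. 0"], rule exI[of _ "\<lambda>z. 0"])
    (use c in \<open>auto simp: grushin_div_def partial_x_def partial_y_def set_int_def case_prod_beta\<close>)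
 then show ?thesis by (simp add: zero_ereal_def)
qed

section \<open>Cut-off functions\<close>

text \<open>The simplest C1 function that vanishes on a half-line; every cut-off below is a
  composition or a product of such functions.\<close>

definition pos_sq :: "real \<Rightarrow> real" where
 "pos_sq x = (max 0 x)\<^sup>2"

lemma pos_sq_DERIV: "(pos_sq has_real_derivative 2 * max 0 x) (at x)"
proof -
 consider "x > 0" | "x < 0" | "x = 0" by linarith
 then show ?thesis
 proof cases
  case 1
  have "((\<lambda>x. x\<^sup>2) has_real_derivative 2 * max 0 x) (at x)"
   using 1 by (auto intro!: derivative_eq_intros)
  then show ?thesis
   by (rule has_field_derivative_transform_within_open[of _ _ _ "{0<..}"]) (use 1 in \<open>auto simp: pos_sq_def\<close>)
 next
  case 2
  have "((\<lambda>x. 0) has_real_derivative 2 * max 0 x) (at x)"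
   using 2 by (auto intro!: derivative_eq_intros)
  then show ?thesis
   by (rule has_field_derivative_transform_within_open[of _ _ _ "{..<0}"]) (use 2 in \<open>auto simp: pos_sq_def\<close>)
 next
  case 3
  have "((\<lambda>h. pos_sq h / h) \<longlongrightarrow> 0) (at 0)"
  proof (rule Lim_null_comparison)
   show "\<forall>\<^sub>F h in at 0. norm (pos_sq h / h) \<le> \<bar>h\<bar>"
    by (auto simp: eventually_at_filter pos_sq_def power2_eq_square max_def)
   show "((\<lambda>h::real. \<bar>h\<bar>) \<longlongrightarrow> 0) (at 0)" by (rule tendsto_rabs_zero) (rule tendsto_ident_at)
  qed
  then show ?thesis using 3 by (simp add: DERIV_def pos_sq_def)
 qed
qed

lemma pos_sq_simps: "0 \<le> pos_sq x" "x \<le> 0 \<Longrightarrow> pos_sq x = 0" "x \<ge> 0 \<Longrightarrow> pos_sq x = x\<^sup>2"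
 by (auto simp: pos_sq_def max_def)

text \<open>The cut-off \<open>ramp\<close> rises from 0 at 0 to 1 at 1; \<open>bump x = 1 - ramp x\<close> for \<open>x \<ge> 0\<close>.\<close>

definition ramp :: "real \<Rightarrow> real" where "ramp x = 1 - pos_sq (1 - pos_sq x)"
definition ramp' :: "real \<Rightarrow> real" where "ramp' x = 4 * max 0 (1 - pos_sq x) * max 0 x"
definition bump :: "real \<Rightarrow> real" where "bump x = pos_sq (1 - x\<^sup>2)"
definition bump' :: "real \<Rightarrow> real" where "bump' x = - 4 * max 0 (1 - x\<^sup>2) * x"

lemma ramp_DERIV: "(ramp has_real_derivative ramp' x) (at x)"
 unfolding ramp_def[abs_def] ramp'_def
 by (auto intro!: derivative_eq_intros DERIV_chain'[OF _ pos_sq_DERIV] pos_sq_DERIV simp: algebra_simps)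

lemma bump_DERIV: "(bump has_real_derivative bump' x) (at x)"
proof -
 have "((\<lambda>x. 1 - x\<^sup>2) has_real_derivative - (2 * x)) (at x)"
  by (auto intro!: derivative_eq_intros)
 from DERIV_chain2[OF pos_sq_DERIV this] show ?thesis
  unfolding bump_def[abs_def] bump'_def by (simp add: algebra_simps)
qed

lemma pos_sq_continuous: "continuous_on A pos_sq"
 by (meson pos_sq_DERIV DERIV_continuous continuous_at_imp_continuous_on)

lemma ramp'_continuous: "continuous_on A ramp'"
 unfolding ramp'_def[abs_def] by (intro continuous_intros pos_sq_continuous)

lemma bump'_continuous: "continuous_on A bump'"
 unfolding bump'_def[abs_def] by (intro continuous_intros)

lemma pos_sq_le_1: "x \<le> 1 \<Longrightarrow> pos_sq x \<le> 1"
 by (auto simp: pos_sq_def power_le_one)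

lemma ramp_simps: "0 \<le> ramp x" "ramp x \<le> 1" "x \<le> 0 \<Longrightarrow> ramp x = 0" "1 \<le> x \<Longrightarrow> ramp x = 1"
 "1 \<le> x \<Longrightarrow> ramp' x = 0" "x \<le> 0 \<Longrightarrow> ramp' x = 0"
proof -
 show "0 \<le> ramp x" "ramp x \<le> 1"
  using pos_sq_le_1[of "1 - pos_sq x"] pos_sq_simps(1)[of x] pos_sq_simps(1)[of "1 - pos_sq x"] by (auto simp: ramp_def)
 show "x \<le> 0 \<Longrightarrow> ramp x = 0" by (simp add: ramp_def pos_sq_simps)
 show "x \<le> 0 \<Longrightarrow> ramp' x = 0" by (simp add: ramp'_def pos_sq_simps)
 assume "1 \<le> x"
 then have "1 \<le> x\<^sup>2" by simp
 then show "ramp x = 1" "ramp' x = 0"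
  using \<open>1 \<le> x\<close> by (auto simp: ramp_def ramp'_def pos_sq_simps)
qed

lemma ramp'_bound: "0 \<le> ramp' x" "ramp' x \<le> 4"
proof -
 show "0 \<le> ramp' x" by (simp add: ramp'_def)
 show "ramp' x \<le> 4"
 proof (cases "x \<le> 0 \<or> 1 \<le> x")
  case False
  then have "max 0 (1 - pos_sq x) * max 0 x \<le> 1 * 1"
   by (intro mult_mono) (auto simp: pos_sq_def)
  then show ?thesis by (simp add: ramp'_def)
 qed (auto simp: ramp_simps)
qed

lemma bump_simps: "0 \<le> bump x" "bump x \<le> 1" "1 \<le> \<bar>x\<bar> \<Longrightarrow> bump x = 0" "1 \<le> \<bar>x\<bar> \<Longrightarrow> bump' x = 0"
 "0 \<le> x \<Longrightarrow> bump x = 1 - ramp x" "0 \<le> x \<Longrightarrow> bump' x = - ramp' x" "bump 0 = 1" "\<bar>bump' x\<bar> \<le> 4"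
proof -
 show "0 \<le> bump x" "bump x \<le> 1" using pos_sq_le_1[of "1 - x\<^sup>2"] by (auto simp: bump_def pos_sq_simps)
 show "0 \<le> x \<Longrightarrow> bump x = 1 - ramp x" by (simp add: bump_def ramp_def pos_sq_simps)
 show *: "0 \<le> x \<Longrightarrow> bump' x = - ramp' x" for x by (simp add: bump'_def ramp'_def pos_sq_simps)
 show "bump 0 = 1" by (simp add: bump_def pos_sq_def)
 have "\<bar>bump' x\<bar> = ramp' \<bar>x\<bar>"
 proof (cases "x \<ge> 0")
  case True then show ?thesis using * ramp'_bound[of x] by simp
 next
  case False
  then have "bump' x = - bump' (- x)" by (simp add: bump'_def)
  then show ?thesis using *[of "-x"] False ramp'_bound[of "-x"] by simp
 qed
 then show "\<bar>bump' x\<bar> \<le> 4" using ramp'_bound by simp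
 assume "1 \<le> \<bar>x\<bar>"
 then have "1 \<le> x\<^sup>2" by (metis one_le_power power2_abs)
 then show "bump x = 0" "bump' x = 0" by (auto simp: bump_def bump'_def pos_sq_simps)
qed

section \<open>Splitting the partition perimeter into two half-weighted ones\<close>

text \<open>By duality, segments on the axis get weight 1/2 when the first component of the field is
  kept below 1/2 there. The notion is a bound and not a supremum, so no question of finiteness
  arises.\<close>

definition half_le :: "real \<Rightarrow> plane set \<Rightarrow> real \<Rightarrow> bool" where
 "half_le \<alpha> A C \<longleftrightarrow> (\<forall>\<phi>1 p1 q1 \<phi>2 p2 q2 K. grad \<phi>1 p1 q1 \<longrightarrow> grad \<phi>2 p2 q2 \<longrightarrow>
   (\<forall>z. norm z > K \<longrightarrow> \<phi>1 z = 0 \<and> \<phi>2 z = 0) \<longrightarrow> (\<forall>z. (\<phi>1 z)\<^sup>2 + (\<phi>2 z)\<^sup>2 \<le> 1) \<longrightarrow>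
   (\<forall>y. \<bar>\<phi>1 (0, y)\<bar> \<le> 1 / 2) \<longrightarrow> (LBINT z:A. gdiv \<alpha> p1 q2 z) \<le> C)"

lemma grad_ramp: "grad (\<lambda>z. ramp (fst z / \<delta>)) (\<lambda>z. ramp' (fst z / \<delta>) / \<delta>) (\<lambda>z. 0)"
 using grad_scale[OF grad_fst[OF ramp_DERIV ramp'_continuous], of "1 / \<delta>" 1] by simp

lemma grad_bump: "grad (\<lambda>z. bump (fst z / \<delta>)) (\<lambda>z. bump' (fst z / \<delta>) / \<delta>) (\<lambda>z. 0)"
 using grad_scale[OF grad_fst[OF bump_DERIV bump'_continuous], of "1 / \<delta>" 1] by simp

lemma grad_slice0:
 assumes "grad \<phi> p q"
 shows "grad (\<lambda>z. \<phi> (0, snd z)) (\<lambda>z. 0) (\<lambda>z. q (0, snd z))"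
 using grad_scale[OF assms, of 0 1] by simp

lemma norm_reflect: "norm (- fst z, snd z) = norm (z :: plane)"
 by (cases z) (simp add: norm_Pair)

text \<open>The vector is k (a, b) + d (c, 0), a combination of two vectors of the unit disc with
  total weight at most 1. It serves to interpolate between a field and its doubled trace on the
  axis.\<close>

lemma square_convex_bound:
 fixes k a b c d :: real
 assumes "0 \<le> k" "k \<le> 1" "a\<^sup>2 + b\<^sup>2 \<le> 1" "\<bar>c\<bar> \<le> 1" "0 \<le> d" "d \<le> 1 - k"
 shows "(k * a + d * c)\<^sup>2 + (k * b)\<^sup>2 \<le> 1"
proof -
 have ab: "sqrt (a\<^sup>2 + b\<^sup>2) \<le> 1" using assms by simp
 have "norm (k * a + d * c, k * b) = norm (k *\<^sub>R (a, b) + d *\<^sub>R (c, 0))" by simp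
 also have "\<dots> \<le> norm (k *\<^sub>R (a, b)) + norm (d *\<^sub>R (c, 0::real))" by (rule norm_triangle_ineq)
 also have "\<dots> = k * sqrt (a\<^sup>2 + b\<^sup>2) + d * \<bar>c\<bar>" using assms by (simp only: norm_scaleR) (simp add: norm_Pair)
 also have "\<dots> \<le> k * 1 + d * 1" using assms ab by (intro add_mono mult_left_mono) auto
 also have "\<dots> \<le> 1" using assms by simp
 finally show ?thesis by (simp add: norm_Pair)
qed

text \<open>The average of two divergences: that of a field with doubled trace
  \<open>2 * \<phi> (0, y)\<close> on the axis, tested on one half, and that of a field with zero
  trace, tested on the whole set. The singular factor \<open>ramp' / \<delta>\<close> then meets
  only \<open>\<phi> z - \<phi> (0, snd z)\<close>, which is of order \<delta> in the strip.\<close>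

definition half_int :: "real \<Rightarrow> real \<Rightarrow> plane set \<Rightarrow> (plane \<Rightarrow> real) \<Rightarrow> (plane \<Rightarrow> real) \<Rightarrow> (plane \<Rightarrow> real) \<Rightarrow> real" where
 "half_int \<alpha> \<delta> A \<phi> p q = (LBINT z:A. ramp' (fst z / \<delta>) / \<delta> * (\<phi> z - \<phi> (0, snd z)) + ramp (fst z / \<delta>) * gdiv \<alpha> p q z)"

text \<open>The new field is the given one away from the axis and the horizontal field
  \<open>2 * \<phi>1 (0, y)\<close> on it. The bound 1/2 on the axis is exactly what makes this
  doubled trace admissible.\<close>

lemma half_field_right:
 assumes \<phi>: "grad \<phi>1 p1 q1" "grad \<phi>2 p2 q2" "\<And>z. norm z > K \<Longrightarrow> \<phi>1 z = 0 \<and> \<phi>2 z = 0"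
  and b: "\<And>z. (\<phi>1 z)\<^sup>2 + (\<phi>2 z)\<^sup>2 \<le> 1" "\<And>y. \<bar>\<phi>1 (0, y)\<bar> \<le> 1 / 2" and "0 < \<delta>"
 obtains X1 px qx X2 py qy where
  "grad X1 px qx" "grad X2 py qy" "\<And>z. norm z > \<bar>K\<bar> + \<delta> \<Longrightarrow> X1 z = 0 \<and> X2 z = 0"
  "\<And>z. (X1 z)\<^sup>2 + (X2 z)\<^sup>2 \<le> 1"
  "\<And>z. fst z > 0 \<Longrightarrow> gdiv \<alpha> px qy z =
    ramp' (fst z / \<delta>) / \<delta> * (\<phi>1 z - 2 * \<phi>1 (0, snd z)) + ramp (fst z / \<delta>) * gdiv \<alpha> p1 q2 z"
proof -
 note X1 = grad_add[OF grad_mult[OF grad_ramp[of \<delta>] \<phi>(1)]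
   grad_mult[OF grad_bump[of \<delta>] grad_cmult[OF grad_slice0[OF \<phi>(1)], of 2]]]
 note X2 = grad_mult[OF grad_ramp[of \<delta>] \<phi>(2)]
 show ?thesis
 proof (rule that[OF X1 X2])
  fix z :: plane assume "norm z > \<bar>K\<bar> + \<delta>"
  moreover have "norm z \<le> \<bar>fst z\<bar> + \<bar>snd z\<bar>" by (metis norm_Pair_le prod.collapse real_norm_def)
  ultimately have "norm z > K" "1 \<le> \<bar>fst z / \<delta>\<bar> \<or> norm (0::real, snd z) > K"
   using \<open>0 < \<delta>\<close> by (auto simp: norm_Pair divide_simps)
  then show "ramp (fst z / \<delta>) * \<phi>1 z + bump (fst z / \<delta>) * (2 * \<phi>1 (0, snd z)) = 0 \<and> ramp (fst z / \<delta>) * \<phi>2 z = 0"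
   using \<phi>(3) bump_simps(3)[of "fst z / \<delta>"] by auto
 next
  fix z :: plane
  have "bump (fst z / \<delta>) \<le> 1 - ramp (fst z / \<delta>)"
   using bump_simps(2)[of "fst z / \<delta>"] bump_simps(5)[of "fst z / \<delta>"] ramp_simps(3)[of "fst z / \<delta>"]
   by (cases "fst z / \<delta> \<ge> 0") auto
  then show "(ramp (fst z / \<delta>) * \<phi>1 z + bump (fst z / \<delta>) * (2 * \<phi>1 (0, snd z)))\<^sup>2 + (ramp (fst z / \<delta>) * \<phi>2 z)\<^sup>2 \<le> 1"
   using b(1)[of z] b(2)[of "snd z"] ramp_simps(1,2)[of "fst z / \<delta>"] bump_simps(1)[of "fst z / \<delta>"]
   by (intro square_convex_bound) auto
 next
  fix z :: plane assume "fst z > 0"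
  then have "bump' (fst z / \<delta>) = - ramp' (fst z / \<delta>)" using \<open>0 < \<delta>\<close> by (intro bump_simps) auto
  then show "gdiv \<alpha> (\<lambda>z. ramp' (fst z / \<delta>) / \<delta> * \<phi>1 z + ramp (fst z / \<delta>) * p1 z +
       (bump' (fst z / \<delta>) / \<delta> * (2 * \<phi>1 (0, snd z)) + bump (fst z / \<delta>) * (2 * 0)))
   (\<lambda>z. 0 * \<phi>2 z + ramp (fst z / \<delta>) * q2 z) z =
     ramp' (fst z / \<delta>) / \<delta> * (\<phi>1 z - 2 * \<phi>1 (0, snd z)) + ramp (fst z / \<delta>) * gdiv \<alpha> p1 q2 z"
   by (simp add: gdiv_def algebra_simps)
 qed
qed

lemma set_integral_reflect:
 fixes f :: "plane \<Rightarrow> real"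
 assumes [measurable]: "B \<in> sets borel" "f \<in> borel_measurable borel"
 shows "(LBINT z:{z. (- fst z, snd z) \<in> B}. f (- fst z, snd z)) = (LBINT z:B. f z)"
proof -
 have "(LBINT z. indicator B (-1 * fst z, 1 * snd z) *\<^sub>R f (-1 * fst z, 1 * snd z)) = (LBINT z. indicator B z *\<^sub>R f z)"
  by (rule integral_scale_prod) auto
 then show ?thesis unfolding set_int_def by (simp add: indicator_def)
qed

lemma gdiv_integrable:
 assumes "0 \<le> \<alpha>" and "grad \<phi>1 p1 q1" "grad \<phi>2 p2 q2" "\<And>z. norm z > K \<Longrightarrow> \<phi>1 z = 0 \<and> \<phi>2 z = 0"
 shows "integrable lborel (gdiv \<alpha> p1 q2)"
proof (rule integrable_continuous_compact)
 show "continuous_on UNIV (gdiv \<alpha> p1 q2)"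
  using assms gradD by (intro gdiv_continuous) blast+
 show "gdiv \<alpha> p1 q2 z = 0" if "norm z > K" for z
  using grad_compact_bounds(1)[OF assms(2), of K z] grad_compact_bounds(2)[OF assms(3), of K z] assms(4) that
  by (simp add: gdiv_def)
qed

text \<open>Three competitors are tested: one with doubled trace on the right half, a mirrored one
  on the left half, and one on \<open>E\<close> that vanishes on the axis and equals the cut-off
  given fields on either side. The left half is written in mirrored form, so that both summands live
  in the right half-plane.\<close>

lemma half_sum_le:
 assumes "0 \<le> \<alpha>" and E: "E \<in> sets lebesgue" and A[measurable]: "A \<in> sets borel" and eq: "equivalent_sets E A"
  and pR: "grushin_perimeter \<alpha> (right_part E) = ereal pR" and pL: "grushin_perimeter \<alpha> (left_part E) = ereal pL"
  and pE: "grushin_perimeter \<alpha> E = ereal pE"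
  and \<phi>: "grad \<phi>1 p1 q1" "grad \<phi>2 p2 q2" "\<And>z. norm z > K \<Longrightarrow> \<phi>1 z = 0 \<and> \<phi>2 z = 0"
   "\<And>z. (\<phi>1 z)\<^sup>2 + (\<phi>2 z)\<^sup>2 \<le> 1" "\<And>y. \<bar>\<phi>1 (0, y)\<bar> \<le> 1 / 2"
  and \<psi>: "grad \<psi>1 r1 s1" "grad \<psi>2 r2 s2" "\<And>z. norm z > L \<Longrightarrow> \<psi>1 z = 0 \<and> \<psi>2 z = 0"
   "\<And>z. (\<psi>1 z)\<^sup>2 + (\<psi>2 z)\<^sup>2 \<le> 1" "\<And>y. \<bar>\<psi>1 (0, y)\<bar> \<le> 1 / 2" and "0 < \<delta>"
 shows "half_int \<alpha> \<delta> (A \<inter> {z. fst z > 0}) \<phi>1 p1 q2 + half_int \<alpha> \<delta> ({z. (- fst z, snd z) \<in> A} \<inter> {z. fst z > 0}) \<psi>1 r1 s2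
   \<le> (pR + pL + pE) / 2"
proof -
 define AR where "AR = A \<inter> {z. fst z > 0}"
 define AL where "AL = A \<inter> {z. fst z < 0}"
 define AM where "AM = {z. (- fst z, snd z) \<in> A} \<inter> {z. fst z > 0}"
 have bR[measurable]: "AR \<in> sets borel" unfolding AR_def by measurable
 have bL[measurable]: "AL \<in> sets borel" unfolding AL_def by measurable
 have AM': "AM = {z. (- fst z, snd z) \<in> AL}" by (auto simp: AM_def AL_def)
 have "(\<lambda>z. (-1 * fst z, 1 * snd z)) -` AL \<inter> space borel \<in> sets borel"
  by (rule measurable_sets[OF borel_scale_prod bL])
 then have bM[measurable]: "AM \<in> sets borel" unfolding AM' by (simp add: vimage_def)
 have sub: "right_part E \<in> sets lebesgue" "left_part E \<in> sets lebesgue"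
 proof -
  have "{z::real\<times>real. fst z > 0} \<in> sets borel" "{z::real\<times>real. fst z < 0} \<in> sets borel" by measurable
  then have "{z::real\<times>real. fst z > 0} \<in> sets lebesgue" "{z::real\<times>real. fst z < 0} \<in> sets lebesgue"
   by (auto simp: sets_completionI_sets)
  moreover have "right_part E = E \<inter> {z. fst z > 0}" "left_part E = E \<inter> {z. fst z < 0}"
   by (auto simp: right_part_def left_part_def)
  ultimately show "right_part E \<in> sets lebesgue" "left_part E \<in> sets lebesgue" using E by auto
 qed
 have null: "(E - A) \<union> (A - E) \<in> null_sets lebesgue" using eq by (simp add: equivalent_sets_def)
 have eqR: "equivalent_sets (right_part E) AR" and eqL: "equivalent_sets (left_part E) AL"
  unfolding equivalent_sets_def
  by (rule completion.complete2[OF _ null], force simp: right_part_def left_part_def AR_def AL_def)+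
 obtain X1 px qx X2 py qy where X: "grad X1 px qx" "grad X2 py qy"
  "\<And>z. norm z > \<bar>K\<bar> + \<delta> \<Longrightarrow> X1 z = 0 \<and> X2 z = 0" "\<And>z. (X1 z)\<^sup>2 + (X2 z)\<^sup>2 \<le> 1"
  "\<And>z. fst z > 0 \<Longrightarrow> gdiv \<alpha> px qy z =
    ramp' (fst z / \<delta>) / \<delta> * (\<phi>1 z - 2 * \<phi>1 (0, snd z)) + ramp (fst z / \<delta>) * gdiv \<alpha> p1 q2 z"
  using half_field_right[OF \<phi> \<open>0 < \<delta>\<close>] by blast
 obtain Y1 ax bx Y2 ay b_y where Y: "grad Y1 ax bx" "grad Y2 ay b_y"
  "\<And>z. norm z > \<bar>L\<bar> + \<delta> \<Longrightarrow> Y1 z = 0 \<and> Y2 z = 0" "\<And>z. (Y1 z)\<^sup>2 + (Y2 z)\<^sup>2 \<le> 1"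
  "\<And>z. fst z > 0 \<Longrightarrow> gdiv \<alpha> ax b_y z =
    ramp' (fst z / \<delta>) / \<delta> * (\<psi>1 z - 2 * \<psi>1 (0, snd z)) + ramp (fst z / \<delta>) * gdiv \<alpha> r1 s2 z"
  using half_field_right[OF \<psi> \<open>0 < \<delta>\<close>] by blast
 \<comment> \<open>Under the reflection the first component changes sign and the second does not;
   the weight being even, the divergence is then simply composed with the reflection.\<close>
 have refl1: "grad (\<lambda>z. - F (- fst z, snd z)) (\<lambda>z. P (- fst z, snd z)) (\<lambda>z. - Q (- fst z, snd z))"
  if "grad F P Q" for F P Q
  using grad_cmult[OF grad_scale[OF that, of "-1" 1], of "-1"] by simp
 have refl2: "grad (\<lambda>z. F (- fst z, snd z)) (\<lambda>z. - P (- fst z, snd z)) (\<lambda>z. Q (- fst z, snd z))"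
  if "grad F P Q" for F P Q
  using grad_scale[OF that, of "-1" 1] by simp
 have wrefl: "wt \<alpha> (- x) = wt \<alpha> x" for x by (simp add: grushin_weight_def)
 define GX where "GX = gdiv \<alpha> px qy"
 define GY where "GY = gdiv \<alpha> ax b_y"
 have iX: "integrable lborel GX" unfolding GX_def by (rule gdiv_integrable[OF \<open>0 \<le> \<alpha>\<close> X(1-3)])
 have iY: "integrable lborel GY" unfolding GY_def by (rule gdiv_integrable[OF \<open>0 \<le> \<alpha>\<close> Y(1-3)])
 have I1: "(LBINT z:AR. GX z) \<le> pR"
  using perimeter_ge[OF \<open>0 \<le> \<alpha>\<close> sub(1) bR eqR X(1-4)] pR by (simp add: GX_def)
 have "ereal (LBINT z:AL. gdiv \<alpha> (\<lambda>z. ax (- fst z, snd z)) (\<lambda>z. b_y (- fst z, snd z)) z)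
   \<le> grushin_perimeter \<alpha> (left_part E)"
  by (rule perimeter_ge[OF \<open>0 \<le> \<alpha>\<close> sub(2) bL eqL refl1[OF Y(1)] refl2[OF Y(2)], of "\<bar>L\<bar> + \<delta>"])
    (use Y(3,4) norm_reflect in \<open>auto\<close>)
 moreover have "gdiv \<alpha> (\<lambda>z. ax (- fst z, snd z)) (\<lambda>z. b_y (- fst z, snd z)) = (\<lambda>z. GY (- fst z, snd z))"
  by (auto simp: gdiv_def GY_def wrefl)
 moreover have AL': "AL = {z. (- fst z, snd z) \<in> AM}" by (auto simp: AM')
 moreover have "(LBINT z:{z. (- fst z, snd z) \<in> AM}. GY (- fst z, snd z)) = (LBINT z:AM. GY z)"
  using iY by (intro set_integral_reflect) auto
 ultimately have I2: "(LBINT z:AM. GY z) \<le> pL" using pL by simp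
 \<comment> \<open>The cut-off makes the field for \<open>E\<close> vanish on the axis, so the
   fields on the two sides can be chosen independently of each other.\<close>
 note R1 = grad_mult[OF grad_ramp[of \<delta>] \<phi>(1)]
 note R2 = grad_mult[OF grad_ramp[of \<delta>] \<phi>(2)]
 note L1 = grad_mult[OF grad_ramp[of \<delta>] \<psi>(1)]
 note L2 = grad_mult[OF grad_ramp[of \<delta>] \<psi>(2)]
 note Z1 = grad_add[OF R1 refl1[OF L1]]
 note Z2 = grad_add[OF R2 refl2[OF L2]]
 define HR where "HR z = ramp' (fst z / \<delta>) / \<delta> * \<phi>1 z + ramp (fst z / \<delta>) * gdiv \<alpha> p1 q2 z" for z
 define HL where "HL z = ramp' (fst z / \<delta>) / \<delta> * \<psi>1 z + ramp (fst z / \<delta>) * gdiv \<alpha> r1 s2 z" for z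
 have HRg: "HR = gdiv \<alpha> (\<lambda>z. ramp' (fst z / \<delta>) / \<delta> * \<phi>1 z + ramp (fst z / \<delta>) * p1 z) (\<lambda>z. 0 * \<phi>2 z + ramp (fst z / \<delta>) * q2 z)"
  and HLg: "HL = gdiv \<alpha> (\<lambda>z. ramp' (fst z / \<delta>) / \<delta> * \<psi>1 z + ramp (fst z / \<delta>) * r1 z) (\<lambda>z. 0 * \<psi>2 z + ramp (fst z / \<delta>) * s2 z)"
  by (auto simp: HR_def HL_def gdiv_def algebra_simps)
 have iR: "integrable lborel HR" unfolding HRg
  by (rule gdiv_integrable[OF \<open>0 \<le> \<alpha>\<close> R1 R2, of K]) (use \<phi>(3) in auto)
 have iL: "integrable lborel HL" unfolding HLg
  by (rule gdiv_integrable[OF \<open>0 \<le> \<alpha>\<close> L1 L2, of L]) (use \<psi>(3) in auto)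
 define ZP where "ZP z = ramp' (fst z / \<delta>) / \<delta> * \<phi>1 z + ramp (fst z / \<delta>) * p1 z
   + (ramp' (fst (- fst z, snd z) / \<delta>) / \<delta> * \<psi>1 (- fst z, snd z) + ramp (fst (- fst z, snd z) / \<delta>) * r1 (- fst z, snd z))" for z
 define ZQ where "ZQ z = 0 * \<phi>2 z + ramp (fst z / \<delta>) * q2 z + (0 * \<psi>2 (- fst z, snd z) + ramp (fst (- fst z, snd z) / \<delta>) * s2 (- fst z, snd z))" for z
 have I3: "(LBINT z:A. gdiv \<alpha> ZP ZQ z) \<le> pE"
 proof -
  have "ereal (LBINT z:A. gdiv \<alpha> ZP ZQ z) \<le> grushin_perimeter \<alpha> E"
   unfolding ZP_def[abs_def] ZQ_def[abs_def]
  proof (rule perimeter_ge[OF \<open>0 \<le> \<alpha>\<close> E A eq Z1 Z2, of "max K L"])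
   fix z :: plane assume z: "norm z > max K L"
   then have "norm (- fst z, snd z) > L" unfolding norm_reflect by simp
   then show "ramp (fst z / \<delta>) * \<phi>1 z + - (ramp (fst (- fst z, snd z) / \<delta>) * \<psi>1 (- fst z, snd z)) = 0 \<and>
     ramp (fst z / \<delta>) * \<phi>2 z + ramp (fst (- fst z, snd z) / \<delta>) * \<psi>2 (- fst z, snd z) = 0"
    using \<phi>(3)[of z] \<psi>(3)[of "(- fst z, snd z)"] z by simp
  next
   fix z :: plane
   have sq: "(ramp x * a)\<^sup>2 + (ramp x * b)\<^sup>2 \<le> 1" if "a\<^sup>2 + b\<^sup>2 \<le> 1" for a b x
    using square_convex_bound[of "ramp x" a b 0 0] that ramp_simps(1,2)[of x] by simp
   show "(ramp (fst z / \<delta>) * \<phi>1 z + - (ramp (fst (- fst z, snd z) / \<delta>) * \<psi>1 (- fst z, snd z)))\<^sup>2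
    + (ramp (fst z / \<delta>) * \<phi>2 z + ramp (fst (- fst z, snd z) / \<delta>) * \<psi>2 (- fst z, snd z))\<^sup>2 \<le> 1"
   proof (cases "fst z \<ge> 0")
    case True
    then have "ramp (fst (- fst z, snd z) / \<delta>) = 0" using \<open>0 < \<delta>\<close> by (intro ramp_simps) auto
    then show ?thesis using sq[OF \<phi>(4)[of z]] by simp
   next
    case False
    then have "ramp (fst z / \<delta>) = 0" using \<open>0 < \<delta>\<close> by (intro ramp_simps) (auto simp: divide_simps)
    then show ?thesis using sq[OF \<psi>(4)[of "(- fst z, snd z)"]] by simp
   qed
  qed
  then show ?thesis using pE by simp
 qed
 have Zeq: "indicator A z *\<^sub>R gdiv \<alpha> ZP ZQ z = indicator AR z *\<^sub>R HR z + indicator AL z *\<^sub>R HL (- fst z, snd z)" for z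
 proof -
  consider "fst z > 0" | "fst z < 0" | "fst z = 0" by linarith
  then show ?thesis
  proof cases
   case 1
   then have "ramp (- fst z / \<delta>) = 0" "ramp' (- fst z / \<delta>) = 0" using \<open>0 < \<delta>\<close> by (auto intro!: ramp_simps)
   then show ?thesis using 1 by (auto simp: gdiv_def ZP_def ZQ_def AR_def AL_def HR_def indicator_def algebra_simps)
  next
   case 2
   then have "ramp (fst z / \<delta>) = 0" "ramp' (fst z / \<delta>) = 0"
    using \<open>0 < \<delta>\<close> by (auto intro!: ramp_simps simp: divide_simps)
   then show ?thesis using 2 by (auto simp: gdiv_def ZP_def ZQ_def AR_def AL_def HL_def indicator_def algebra_simps wrefl)
  next
   case 3
   then show ?thesis by (auto simp: gdiv_def ZP_def ZQ_def AR_def AL_def indicator_def ramp_simps)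
  qed
 qed
 have iL': "integrable lborel (\<lambda>z. HL (- fst z, snd z))"
 proof -
  have "gdiv \<alpha> (\<lambda>z. (\<lambda>z. ramp' (fst z / \<delta>) / \<delta> * \<psi>1 z + ramp (fst z / \<delta>) * r1 z) (- fst z, snd z))
    (\<lambda>z. (\<lambda>z. 0 * \<psi>2 z + ramp (fst z / \<delta>) * s2 z) (- fst z, snd z)) = (\<lambda>z. HL (- fst z, snd z))"
   unfolding HLg by (auto simp: gdiv_def wrefl)
  moreover have "integrable lborel (gdiv \<alpha> (\<lambda>z. (\<lambda>z. ramp' (fst z / \<delta>) / \<delta> * \<psi>1 z + ramp (fst z / \<delta>) * r1 z) (- fst z, snd z))
    (\<lambda>z. (\<lambda>z. 0 * \<psi>2 z + ramp (fst z / \<delta>) * s2 z) (- fst z, snd z)))"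
  proof (rule gdiv_integrable[OF \<open>0 \<le> \<alpha>\<close> refl1[OF L1] refl2[OF L2], of L])
   fix z :: plane assume "norm z > L"
   then have "norm (- fst z, snd z) > L" unfolding norm_reflect by simp
   then show "- (ramp (fst (- fst z, snd z) / \<delta>) * \<psi>1 (- fst z, snd z)) = 0 \<and>
     ramp (fst (- fst z, snd z) / \<delta>) * \<psi>2 (- fst z, snd z) = 0" using \<psi>(3) by simp
  qed
  ultimately show ?thesis by simp
 qed
 have "(LBINT z:A. gdiv \<alpha> ZP ZQ z) = (LBINT z:AR. HR z) + (LBINT z:AL. HL (- fst z, snd z))"
  unfolding set_int_def Zeq
  using integrable_mult_indicator[OF _ iR, of AR] integrable_mult_indicator[OF _ iL', of AL]
  by (intro Bochner_Integration.integral_add) auto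
 also have "(LBINT z:AL. HL (- fst z, snd z)) = (LBINT z:AM. HL z)"
  unfolding AL' using iL by (intro set_integral_reflect) auto
 finally have I3': "(LBINT z:AR. HR z) + (LBINT z:AM. HL z) \<le> pE" using I3 by simp
 have eqX: "2 * half_int \<alpha> \<delta> AR \<phi>1 p1 q2 = (LBINT z:AR. GX z) + (LBINT z:AR. HR z)"
 proof -
  have "(LBINT z:AR. GX z) + (LBINT z:AR. HR z) = (LBINT z:AR. GX z + HR z)"
   by (rule set_integral_add(2)[symmetric]) (auto intro: set_integrable_subset_borel iX iR)
  also have "\<dots> = (LBINT z:AR. 2 * (ramp' (fst z / \<delta>) / \<delta> * (\<phi>1 z - \<phi>1 (0, snd z)) + ramp (fst z / \<delta>) * gdiv \<alpha> p1 q2 z))"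
   by (rule set_lebesgue_integral_cong) (auto simp: AR_def GX_def HR_def X(5) algebra_simps)
  finally show ?thesis unfolding half_int_def by (simp only: set_integral_mult_right)
 qed
 have eqY: "2 * half_int \<alpha> \<delta> AM \<psi>1 r1 s2 = (LBINT z:AM. GY z) + (LBINT z:AM. HL z)"
 proof -
  have "(LBINT z:AM. GY z) + (LBINT z:AM. HL z) = (LBINT z:AM. GY z + HL z)"
   by (rule set_integral_add(2)[symmetric]) (auto intro: set_integrable_subset_borel iY iL)
  also have "\<dots> = (LBINT z:AM. 2 * (ramp' (fst z / \<delta>) / \<delta> * (\<psi>1 z - \<psi>1 (0, snd z)) + ramp (fst z / \<delta>) * gdiv \<alpha> r1 s2 z))"
   by (rule set_lebesgue_integral_cong) (auto simp: AM_def GY_def HL_def Y(5) algebra_simps)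
  finally show ?thesis unfolding half_int_def by (simp only: set_integral_mult_right)
 qed
 show ?thesis using I1 I2 I3' eqX eqY unfolding AR_def[symmetric] AM_def[symmetric] by argo
qed

text \<open>At a point of the open half-plane \<open>ramp\<close> equals 1 as soon as the strip is
  thin enough. The singular term is dominated because \<phi>1 is Lipschitz in x and the factor
  1/\<delta> acts only where x is below \<delta>; finite area makes the constant bound
  integrable.\<close>

lemma half_int_limit:
 assumes "0 \<le> \<alpha>" and A[measurable]: "A \<in> sets borel" and fin: "emeasure lborel A < \<infinity>" and pos: "A \<subseteq> {z. fst z > 0}"
  and \<phi>: "grad \<phi>1 p1 q1" "grad \<phi>2 p2 q2" "\<And>z. norm z > K \<Longrightarrow> \<phi>1 z = 0 \<and> \<phi>2 z = 0"
 shows "(\<lambda>n. half_int \<alpha> (1 / real (Suc n)) A \<phi>1 p1 q2) \<longlonglongrightarrow> (LBINT z:A. gdiv \<alpha> p1 q2 z)"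
proof -
 have fb: "\<exists>B. \<forall>z. \<bar>p1 z\<bar> \<le> B \<and> \<bar>q1 z\<bar> \<le> B" by (rule grad_compact_bounds(3)[OF \<phi>(1)]) (use \<phi>(3) in auto)
 then obtain B where B: "\<And>z. \<bar>p1 z\<bar> \<le> B" by auto
 have B0: "0 \<le> B" using B[of "0"] by linarith
 have lip: "\<bar>\<phi>1 (x, y) - \<phi>1 (0, y)\<bar> \<le> B * x" if "0 < x" for x y
 proof -
  have "norm (\<phi>1 (x, y) - \<phi>1 (0, y)) \<le> B * norm (x - 0)"
   by (rule field_differentiable_bound[of UNIV "\<lambda>s. \<phi>1 (s, y)" "\<lambda>s. p1 (s, y)"])
     (auto simp: B intro: grad_DERIV_x[OF \<phi>(1)])
  then show ?thesis using that by simp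
 qed
 have iG: "integrable lborel (gdiv \<alpha> p1 q2)" by (rule gdiv_integrable[OF \<open>0 \<le> \<alpha>\<close> \<phi>])
 have [measurable]: "ramp \<in> borel_measurable borel" "ramp' \<in> borel_measurable borel" "gdiv \<alpha> p1 q2 \<in> borel_measurable borel"
  "\<phi>1 \<in> borel_measurable borel"
  using iG grad_borel[OF \<phi>(1)]
  by (auto intro!: borel_measurable_continuous_onI ramp'_continuous continuous_at_imp_continuous_on DERIV_isCont[OF ramp_DERIV])
 have [measurable]: "(\<lambda>z :: plane. \<phi>1 (0, snd z)) \<in> borel_measurable borel"
  by (rule grad_borel(1)[OF grad_slice0[OF \<phi>(1)]])
 define T where "T n z = ramp' (fst z / (1 / real (Suc n))) / (1 / real (Suc n)) * (\<phi>1 z - \<phi>1 (0, snd z))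
   + ramp (fst z / (1 / real (Suc n))) * gdiv \<alpha> p1 q2 z" for n z
 have "(\<lambda>n. \<integral>z. indicator A z *\<^sub>R T n z \<partial>lborel) \<longlonglongrightarrow> (LBINT z. indicator A z *\<^sub>R gdiv \<alpha> p1 q2 z)"
 proof (rule integral_dominated_convergence[where w = "\<lambda>z. indicator A z * (4 * B) + \<bar>gdiv \<alpha> p1 q2 z\<bar>"])
  show "integrable lborel (\<lambda>z. indicator A z * (4 * B) + \<bar>gdiv \<alpha> p1 q2 z\<bar>)"
   using iG fin by (intro Bochner_Integration.integrable_add integrable_abs integrable_mult_left integrable_real_indicator) auto
  show "(\<lambda>z. indicator A z *\<^sub>R T n z) \<in> borel_measurable lborel" for n
   unfolding T_def by measurable
  show "AE z in lborel. (\<lambda>n. indicator A z *\<^sub>R T n z) \<longlonglongrightarrow> indicator A z *\<^sub>R gdiv \<alpha> p1 q2 z"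
  proof (rule AE_I2)
   fix z :: plane
   show "(\<lambda>n. indicator A z *\<^sub>R T n z) \<longlonglongrightarrow> indicator A z *\<^sub>R gdiv \<alpha> p1 q2 z"
   proof (cases "z \<in> A")
    case True
    then have "fst z > 0" using pos by auto
    then obtain n0 where n0: "1 / real (Suc n0) < fst z" using nat_approx_posE by blast
    have "\<forall>\<^sub>F n in sequentially. T n z = gdiv \<alpha> p1 q2 z"
     unfolding eventually_sequentially
    proof (intro exI[of _ n0] allI impI)
     fix n assume "n0 \<le> n"
     then have "1 / real (Suc n) \<le> 1 / real (Suc n0)" by (simp add: divide_simps)
     then have "1 / real (Suc n) \<le> fst z" using n0 by linarith
     then have "1 \<le> fst z / (1 / real (Suc n))" by (simp add: divide_simps del: of_nat_Suc)
     then show "T n z = gdiv \<alpha> p1 q2 z" unfolding T_def by (simp only: ramp_simps)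
    qed
    then show ?thesis by (intro tendsto_scaleR tendsto_const) (rule tendsto_eventually)
   qed auto
  qed
  show "AE z in lborel. norm (indicator A z *\<^sub>R T n z) \<le> indicator A z * (4 * B) + \<bar>gdiv \<alpha> p1 q2 z\<bar>" for n
  proof (rule AE_I2)
   fix z :: plane
   define d where "d = 1 / real (Suc n)"
   have d: "0 < d" by (simp add: d_def)
   show "norm (indicator A z *\<^sub>R T n z) \<le> indicator A z * (4 * B) + \<bar>gdiv \<alpha> p1 q2 z\<bar>"
   proof (cases "z \<in> A")
    case True
    then have x: "fst z > 0" using pos by auto
    have 1: "\<bar>ramp' (fst z / d) / d * (\<phi>1 z - \<phi>1 (0, snd z))\<bar> \<le> 4 * B"
    proof (cases "fst z / d \<ge> 1")
     case True then show ?thesis using B0 by (simp add: ramp_simps)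
    next
     case False
     then have xd: "fst z / d \<le> 1" by simp
     have "\<bar>ramp' (fst z / d) / d * (\<phi>1 z - \<phi>1 (0, snd z))\<bar> \<le> (4 / d) * (B * fst z)"
      unfolding abs_mult
      using lip[OF x, of "snd z"] ramp'_bound[of "fst z / d"] d
      by (intro mult_mono) (auto simp: divide_right_mono)
     also have "\<dots> = 4 * B * (fst z / d)" by simp
     also have "\<dots> \<le> 4 * B * 1" using xd B0 by (intro mult_left_mono) auto
     finally show ?thesis by simp
    qed
    have 2: "\<bar>ramp (fst z / d) * gdiv \<alpha> p1 q2 z\<bar> \<le> 1 * \<bar>gdiv \<alpha> p1 q2 z\<bar>"
     unfolding abs_mult using ramp_simps(1,2)[of "fst z / d"] by (intro mult_right_mono) auto
    have "\<bar>ramp' (fst z / d) / d * (\<phi>1 z - \<phi>1 (0, snd z)) + ramp (fst z / d) * gdiv \<alpha> p1 q2 z\<bar> \<le> 4 * B + \<bar>gdiv \<alpha> p1 q2 z\<bar>"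
     using 1 2 by linarith
    then show ?thesis using True unfolding T_def d_def[symmetric] by simp
   qed simp
  qed
 qed (use iG in auto)
 then show ?thesis unfolding half_int_def set_int_def T_def .
qed

text \<open>The two test fields are chosen independently, so a bound for every sum of two test
  values is a bound for the sum of the two suprema. Each supremum is finite because the other field
  may be zero.\<close>

lemma partition_perimeter_halves:
 assumes "0 \<le> \<alpha>" and E: "E \<in> sets lebesgue" and A[measurable]: "A \<in> sets borel" and eq: "equivalent_sets E A"
  and fin: "emeasure lborel A < \<infinity>" and P: "partition_perimeter_x \<alpha> E < \<infinity>"
 obtains CR CL where "half_le \<alpha> (A \<inter> {z. fst z > 0}) CR"
  "half_le \<alpha> ({z. (- fst z, snd z) \<in> A} \<inter> {z. fst z > 0}) CL" "ereal (CR + CL) \<le> partition_perimeter_x \<alpha> E"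
proof -
 define AR where "AR = A \<inter> {z. fst z > 0}"
 define AM where "AM = {z. (- fst z, snd z) \<in> A} \<inter> {z. fst z > 0}"
 have "(\<lambda>z. (-1 * fst z, 1 * snd z)) -` A \<inter> space borel \<in> sets borel"
  by (rule measurable_sets[OF borel_scale_prod A])
 then have bM'[measurable]: "{z. (- fst z, snd z) \<in> A} \<in> sets borel" by (simp add: vimage_def)
 have [measurable]: "AR \<in> sets borel" "AM \<in> sets borel" unfolding AR_def AM_def by measurable
 have finR: "emeasure lborel AR < \<infinity>"
  by (rule le_less_trans[OF emeasure_mono fin]) (auto simp: AR_def)
 have "emeasure lborel {z. (-1 * fst z, 1 * snd z) \<in> A} = emeasure lborel A"
  by (rule emeasure_scale_prod) auto
 then have finM: "emeasure lborel AM < \<infinity>"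
  using fin by (intro le_less_trans[OF emeasure_mono[of AM "{z. (- fst z, snd z) \<in> A}"]]) (auto simp: AM_def)
 have "grushin_perimeter \<alpha> (right_part E) \<noteq> \<infinity> \<and> grushin_perimeter \<alpha> (left_part E) \<noteq> \<infinity> \<and> grushin_perimeter \<alpha> E \<noteq> \<infinity>"
  using P perimeter_nonneg[of \<alpha> "right_part E"] perimeter_nonneg[of \<alpha> "left_part E"] perimeter_nonneg[of \<alpha> E]
  unfolding partition_perimeter_x_def
  by (cases "grushin_perimeter \<alpha> (right_part E)"; cases "grushin_perimeter \<alpha> (left_part E)"; cases "grushin_perimeter \<alpha> E") auto
 then obtain pR pL pE where p: "grushin_perimeter \<alpha> (right_part E) = ereal pR" "grushin_perimeter \<alpha> (left_part E) = ereal pL"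
  "grushin_perimeter \<alpha> E = ereal pE"
  using perimeter_nonneg[of \<alpha> "right_part E"] perimeter_nonneg[of \<alpha> "left_part E"] perimeter_nonneg[of \<alpha> E]
  by (metis ereal_infty_less_eq2(1) ereal_less_eq(2) ereal_cases MInfty_neq_PInfty(1) not_MInfty_nonneg)
 have Px: "partition_perimeter_x \<alpha> E = ereal ((pR + pL + pE) / 2)"
  unfolding partition_perimeter_x_def p by simp
 define test where "test \<phi>1 p1 q1 \<phi>2 p2 q2 \<longleftrightarrow> grad \<phi>1 p1 q1 \<and> grad \<phi>2 p2 q2 \<and>
   (\<exists>K. \<forall>z. norm z > K \<longrightarrow> \<phi>1 z = 0 \<and> \<phi>2 z = 0) \<and> (\<forall>z. (\<phi>1 z)\<^sup>2 + (\<phi>2 z)\<^sup>2 \<le> 1) \<and>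
   (\<forall>y. \<bar>\<phi>1 (0, y)\<bar> \<le> 1 / 2)" for \<phi>1 p1 q1 \<phi>2 p2 q2 :: "plane \<Rightarrow> real"
 define I where "I B = {LBINT z:B. gdiv \<alpha> p1 q2 z | \<phi>1 p1 q1 \<phi>2 p2 q2. test \<phi>1 p1 q1 \<phi>2 p2 q2}" for B
 have le: "i + j \<le> (pR + pL + pE) / 2" if ij: "i \<in> I AR" "j \<in> I AM" for i j
 proof -
  obtain \<phi>1 p1 q1 \<phi>2 p2 q2 where t: "i = (LBINT z:AR. gdiv \<alpha> p1 q2 z)" "test \<phi>1 p1 q1 \<phi>2 p2 q2"
   using ij(1) unfolding I_def by auto
  obtain \<psi>1 r1 s1 \<psi>2 r2 s2 where u: "j = (LBINT z:AM. gdiv \<alpha> r1 s2 z)" "test \<psi>1 r1 s1 \<psi>2 r2 s2"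
   using ij(2) unfolding I_def by auto
  obtain K where \<phi>: "grad \<phi>1 p1 q1" "grad \<phi>2 p2 q2" "\<And>z. norm z > K \<Longrightarrow> \<phi>1 z = 0 \<and> \<phi>2 z = 0"
   "\<And>z. (\<phi>1 z)\<^sup>2 + (\<phi>2 z)\<^sup>2 \<le> 1" "\<And>y. \<bar>\<phi>1 (0, y)\<bar> \<le> 1 / 2"
   using t(2) unfolding test_def by blast
  obtain L where \<psi>: "grad \<psi>1 r1 s1" "grad \<psi>2 r2 s2" "\<And>z. norm z > L \<Longrightarrow> \<psi>1 z = 0 \<and> \<psi>2 z = 0"
   "\<And>z. (\<psi>1 z)\<^sup>2 + (\<psi>2 z)\<^sup>2 \<le> 1" "\<And>y. \<bar>\<psi>1 (0, y)\<bar> \<le> 1 / 2"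
   using u(2) unfolding test_def by blast
  have "(\<lambda>n. half_int \<alpha> (1 / real (Suc n)) AR \<phi>1 p1 q2 + half_int \<alpha> (1 / real (Suc n)) AM \<psi>1 r1 s2) \<longlonglongrightarrow> i + j"
   unfolding t u
   by (intro tendsto_add half_int_limit[OF \<open>0 \<le> \<alpha>\<close> _ finR _ \<phi>(1-3)] half_int_limit[OF \<open>0 \<le> \<alpha>\<close> _ finM _ \<psi>(1-3)])
     (auto simp: AR_def AM_def)
  moreover have "half_int \<alpha> (1 / real (Suc n)) AR \<phi>1 p1 q2 + half_int \<alpha> (1 / real (Suc n)) AM \<psi>1 r1 s2 \<le> (pR + pL + pE) / 2" for n
   unfolding AR_def AM_def by (rule half_sum_le[OF \<open>0 \<le> \<alpha>\<close> E A eq p \<phi> \<psi>]) auto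
  ultimately show ?thesis by (intro LIMSEQ_le_const2) auto
 qed
 have z: "0 \<in> I B" for B
 proof -
  have "test (\<lambda>z. 0) (\<lambda>z. 0) (\<lambda>z. 0) (\<lambda>z. 0) (\<lambda>z. 0) (\<lambda>z. 0)"
   unfolding test_def using grad_const by auto
  moreover have "0 = (LBINT z:B. gdiv \<alpha> (\<lambda>z. 0) (\<lambda>z. 0) z)" by (simp add: gdiv_def set_int_def)
  ultimately show ?thesis unfolding I_def by blast
 qed
 have bd: "bdd_above (I AR)" "bdd_above (I AM)"
  using le[OF _ z] le[OF z] by (auto intro!: bdd_aboveI[of _ "(pR + pL + pE) / 2"])
 have half: "half_le \<alpha> B (Sup (I B))" if "bdd_above (I B)" for B
  unfolding half_le_def
  by (intro allI impI cSup_upper[OF _ that]) (unfold I_def test_def, blast)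
 have "Sup (I AR) + Sup (I AM) \<le> (pR + pL + pE) / 2"
 proof -
  have "Sup (I AM) \<le> (pR + pL + pE) / 2 - i" if "i \<in> I AR" for i
   using le[OF that] z by (intro cSup_least) (auto simp: field_simps)
  then have "Sup (I AR) \<le> (pR + pL + pE) / 2 - Sup (I AM)"
   using z by (intro cSup_least) (auto simp: field_simps)
  then show ?thesis by linarith
 qed
 then show ?thesis
  using half[OF bd(1)] half[OF bd(2)] unfolding AR_def AM_def by (intro that) (auto simp: Px[unfolded AR_def AM_def])
qed

section \<open>Enlarging the class of test fields by limits\<close>

lemma bounded_convergence:
 fixes f :: "'a::euclidean_space \<Rightarrow> real"
 assumes A[measurable]: "A \<in> sets borel" and fin: "emeasure lborel A < \<infinity>"
  and [measurable]: "\<And>n. F n \<in> borel_measurable borel" "f \<in> borel_measurable borel"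
  and bd: "\<And>n z. z \<in> A \<Longrightarrow> \<bar>F n z\<bar> \<le> D"
  and lim: "AE z in lborel. z \<in> A \<longrightarrow> (\<lambda>n. F n z) \<longlonglongrightarrow> f z"
 shows "(\<lambda>n. LBINT z:A. F n z) \<longlonglongrightarrow> (LBINT z:A. f z)"
 unfolding set_int_def
proof (rule integral_dominated_convergence[where w = "\<lambda>z. indicator A z * D"])
 show "integrable lborel (\<lambda>z. indicator A z * D)"
  using fin by (intro integrable_mult_left integrable_real_indicator) auto
 show "AE z in lborel. (\<lambda>n. indicator A z *\<^sub>R F n z) \<longlonglongrightarrow> indicator A z *\<^sub>R f z"
  using lim by eventually_elim (auto simp: indicator_def)
 show "AE z in lborel. norm (indicator A z *\<^sub>R F n z) \<le> indicator A z * D" for n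
  using bd by (auto simp: indicator_def)
qed auto

text \<open>A cut-off at scale m has derivatives of size at most 4/m, which disappear in the limit
  since \<open>A\<close> has finite area. Division by \<open>B\<close> restores the unit bound. The
  second component has to vanish for large x because the weight grows there.\<close>

lemma half_le_noncompact:
 assumes "half_le \<alpha> A C" "0 \<le> \<alpha>" and A[measurable]: "A \<in> sets borel" and fin: "emeasure lborel A < \<infinity>"
  and \<phi>: "grad \<phi>1 p1 q1" "grad \<phi>2 p2 q2" and "0 < B"
  and b: "\<And>z. (\<phi>1 z)\<^sup>2 + (\<phi>2 z)\<^sup>2 \<le> B\<^sup>2" "\<And>y. \<bar>\<phi>1 (0, y)\<bar> \<le> B / 2"
  and M: "\<And>z. \<bar>fst z\<bar> > M \<Longrightarrow> \<phi>2 z = 0" and K: "\<And>z. \<bar>p1 z\<bar> \<le> K" "\<And>z. \<bar>q2 z\<bar> \<le> K"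
 shows "(LBINT z:A. gdiv \<alpha> p1 q2 z) \<le> B * C"
proof -
 define m where "m n = real (Suc n)" for n
 have m: "0 < m n" "1 \<le> m n" for n by (auto simp: m_def)
 have bs: "grad (\<lambda>z. bump (snd z / d)) (\<lambda>z. 0) (\<lambda>z. bump' (snd z / d) / d)" for d
  using grad_scale[OF grad_snd[OF bump_DERIV bump'_continuous], of 1 "1 / d"] by simp
 note chi = grad_mult[OF grad_bump bs]
 define ch where "ch n z = bump (fst z / m n) * bump (snd z / m n)" for n and z :: plane
 have ch: "0 \<le> ch n z" "ch n z \<le> 1" for n z
  unfolding ch_def using bump_simps(1,2) by (auto intro!: mult_le_one)
 define cx where "cx n z = bump' (fst z / m n) / m n * bump (snd z / m n)" for n and z :: plane
 define cy where "cy n z = bump (fst z / m n) * (bump' (snd z / m n) / m n)" for n and z :: plane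
 have c: "grad (ch n) (cx n) (cy n)" for n
  by (rule grad_cong[OF chi[of "m n" "m n"]]) (auto simp: ch_def cx_def cy_def)
 have cb: "\<bar>cx n z\<bar> \<le> 4 / m n" "\<bar>cy n z\<bar> \<le> 4 / m n" for n z
 proof -
  have "\<bar>cx n z\<bar> \<le> 4 / m n * 1" "\<bar>cy n z\<bar> \<le> 1 * (4 / m n)"
   unfolding cx_def cy_def abs_mult abs_divide
   by (intro mult_mono divide_mono; use bump_simps m[of n] in \<open>auto simp: abs_le_iff\<close>)+
  then show "\<bar>cx n z\<bar> \<le> 4 / m n" "\<bar>cy n z\<bar> \<le> 4 / m n" by auto
 qed
 have q0: "q2 z = 0" if "\<bar>fst z\<bar> > M" for z
  by (rule grad_zero_outside(2)[OF \<phi>(2), of "{z. \<bar>fst z\<bar> > M}"])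
    (use that M in \<open>auto intro!: open_Collect_less continuous_intros\<close>)
 define G where "G n z = (1 / B) * (ch n z * gdiv \<alpha> p1 q2 z + cx n z * \<phi>1 z + wt \<alpha> (fst z) * (cy n z * \<phi>2 z))" for n z
 have le: "(LBINT z:A. G n z) \<le> C" for n
 proof -
  note f1 = grad_cmult[OF grad_mult[OF c[of n] \<phi>(1)], of "1 / B"]
  note f2 = grad_cmult[OF grad_mult[OF c[of n] \<phi>(2)], of "1 / B"]
  have van: "\<forall>z. norm z > 2 * m n \<longrightarrow> 1 / B * (ch n z * \<phi>1 z) = 0 \<and> 1 / B * (ch n z * \<phi>2 z) = 0"
  proof (intro allI impI)
   fix z :: plane assume "norm z > 2 * m n"
   moreover have "norm z \<le> \<bar>fst z\<bar> + \<bar>snd z\<bar>" by (metis norm_Pair_le prod.collapse real_norm_def)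
   ultimately have "1 \<le> \<bar>fst z / m n\<bar> \<or> 1 \<le> \<bar>snd z / m n\<bar>" using m[of n] by (auto simp: divide_simps)
   then have "ch n z = 0" unfolding ch_def using bump_simps(3) by auto
   then show "1 / B * (ch n z * \<phi>1 z) = 0 \<and> 1 / B * (ch n z * \<phi>2 z) = 0" by simp
  qed
  have nm: "\<forall>z. (1 / B * (ch n z * \<phi>1 z))\<^sup>2 + (1 / B * (ch n z * \<phi>2 z))\<^sup>2 \<le> 1"
  proof
   fix z
   have "(1 / B * (ch n z * \<phi>1 z))\<^sup>2 + (1 / B * (ch n z * \<phi>2 z))\<^sup>2 = (ch n z)\<^sup>2 * (((\<phi>1 z)\<^sup>2 + (\<phi>2 z)\<^sup>2) / B\<^sup>2)"
    using \<open>0 < B\<close> by (simp add: power_mult_distrib power_divide field_simps)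
   also have "\<dots> \<le> 1 * 1"
    using b(1)[of z] \<open>0 < B\<close> ch[of n z] by (intro mult_mono) (auto simp: power_le_one)
   finally show "(1 / B * (ch n z * \<phi>1 z))\<^sup>2 + (1 / B * (ch n z * \<phi>2 z))\<^sup>2 \<le> 1" by simp
  qed
  have h: "\<forall>y. \<bar>1 / B * (ch n (0, y) * \<phi>1 (0, y))\<bar> \<le> 1 / 2"
  proof
   fix y
   have "\<bar>1 / B * (ch n (0, y) * \<phi>1 (0, y))\<bar> = ch n (0, y) * (\<bar>\<phi>1 (0, y)\<bar> / B)"
    using \<open>0 < B\<close> ch[of n "(0,y)"] by (simp add: abs_mult)
   also have "\<dots> \<le> 1 * (1 / 2)"
    using b(2)[of y] \<open>0 < B\<close> ch[of n "(0,y)"] by (intro mult_mono) (auto simp: divide_simps)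
   finally show "\<bar>1 / B * (ch n (0, y) * \<phi>1 (0, y))\<bar> \<le> 1 / 2" by simp
  qed
  have "(LBINT z:A. gdiv \<alpha> (\<lambda>z. 1 / B * (cx n z * \<phi>1 z + ch n z * p1 z)) (\<lambda>z. 1 / B * (cy n z * \<phi>2 z + ch n z * q2 z)) z) \<le> C"
   using assms(1)[unfolded half_le_def, rule_format, OF f1 f2, of "2 * m n"] van nm h by blast
  moreover have "gdiv \<alpha> (\<lambda>z. 1 / B * (cx n z * \<phi>1 z + ch n z * p1 z)) (\<lambda>z. 1 / B * (cy n z * \<phi>2 z + ch n z * q2 z)) = G n"
   by (auto simp: gdiv_def G_def algebra_simps)
  ultimately show ?thesis by simp
 qed
 note [measurable] = grad_borel[OF \<phi>(1)] grad_borel[OF \<phi>(2)] wt_borel[OF \<open>0 \<le> \<alpha>\<close>] grad_borel[OF c]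
 have gm[measurable]: "gdiv \<alpha> p1 q2 \<in> borel_measurable borel" using \<open>0 \<le> \<alpha>\<close> by (intro gdiv_borel) measurable
 have Gm: "G n \<in> borel_measurable borel" for n unfolding G_def[abs_def] by measurable
 define Wm where "Wm = wt \<alpha> M"
 have K0: "0 \<le> K" using K(1)[of 0] by linarith
 have \<phi>b: "\<bar>\<phi>1 z\<bar> \<le> B" "\<bar>\<phi>2 z\<bar> \<le> B" for z
 proof -
  have "(\<phi>1 z)\<^sup>2 \<le> B\<^sup>2" "(\<phi>2 z)\<^sup>2 \<le> B\<^sup>2" using b(1)[of z] zero_le_power2[of "\<phi>1 z"] zero_le_power2[of "\<phi>2 z"] by linarith+
  then show "\<bar>\<phi>1 z\<bar> \<le> B" "\<bar>\<phi>2 z\<bar> \<le> B"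
   using \<open>0 < B\<close> abs_le_square_iff[of "\<phi>1 z" B] abs_le_square_iff[of "\<phi>2 z" B] by auto
 qed
 have wq: "\<bar>wt \<alpha> (fst z) * h z\<bar> \<le> Wm * D" if "\<bar>fst z\<bar> > M \<Longrightarrow> h z = 0" "\<bar>h z\<bar> \<le> D" for h :: "real\<times>real\<Rightarrow>real" and D z
 proof (cases "\<bar>fst z\<bar> > M")
  case True
  then show ?thesis using that unfolding Wm_def by auto
 next
  case False
  then have "wt \<alpha> (fst z) \<le> Wm" unfolding Wm_def by (intro wt_mono[OF \<open>0 \<le> \<alpha>\<close>]) auto
  moreover have "0 \<le> Wm" by (simp add: Wm_def)
  ultimately show ?thesis unfolding abs_mult using that by (intro mult_mono) auto
 qed
 have bound: "\<bar>G n z\<bar> \<le> 1 / B * (K + Wm * K + 4 * B + Wm * (4 * B))" for n z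
 proof -
  have "4 / m n \<le> 4" using m[of n] by (simp add: divide_simps)
  then have cb': "\<bar>cx n z\<bar> \<le> 4" "\<bar>cy n z\<bar> \<le> 4" using cb[of n z] by linarith+
  have "\<bar>gdiv \<alpha> p1 q2 z\<bar> \<le> K + Wm * K" unfolding gdiv_def using K(1)[of z] wq[of z q2 K] K(2)[of z] q0[of z] by linarith
  moreover have "\<bar>ch n z * gdiv \<alpha> p1 q2 z\<bar> \<le> 1 * \<bar>gdiv \<alpha> p1 q2 z\<bar>" unfolding abs_mult using ch[of n z] by (intro mult_right_mono) auto
  moreover have "\<bar>cx n z * \<phi>1 z\<bar> \<le> 4 * B" unfolding abs_mult using cb' \<phi>b[of z] by (intro mult_mono) auto
  moreover have "\<bar>wt \<alpha> (fst z) * (cy n z * \<phi>2 z)\<bar> \<le> Wm * (4 * B)"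
   by (rule wq[of z "\<lambda>z. cy n z * \<phi>2 z"]) (use M in simp, unfold abs_mult, use cb' \<phi>b[of z] in \<open>intro mult_mono; auto\<close>)
  ultimately have "\<bar>ch n z * gdiv \<alpha> p1 q2 z + cx n z * \<phi>1 z + wt \<alpha> (fst z) * (cy n z * \<phi>2 z)\<bar> \<le> K + Wm * K + 4 * B + Wm * (4 * B)"
   by linarith
  then show ?thesis unfolding G_def using \<open>0 < B\<close> by (simp add: abs_mult divide_right_mono)
 qed
 have minf: "(\<lambda>n. x / m n) \<longlonglongrightarrow> 0" for x :: real
  unfolding m_def by (rule LIMSEQ_Suc[OF lim_const_over_n])
 have "isCont bump 0" using bump_DERIV DERIV_isCont by blast
 then have b1: "(\<lambda>n. bump (x / m n)) \<longlonglongrightarrow> 1" for x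
  using isCont_tendsto_compose[OF _ minf, of bump x] bump_simps(7) by simp
 have lim: "(\<lambda>n. G n z) \<longlonglongrightarrow> 1 / B * (1 * gdiv \<alpha> p1 q2 z + 0 * \<phi>1 z + wt \<alpha> (fst z) * (0 * \<phi>2 z))" for z
 proof -
  have "(\<lambda>n. ch n z) \<longlonglongrightarrow> 1 * 1" unfolding ch_def by (intro tendsto_mult b1)
  moreover have "(\<lambda>n. cx n z) \<longlonglongrightarrow> 0" "(\<lambda>n. cy n z) \<longlonglongrightarrow> 0"
   by (rule Lim_null_comparison[OF _ minf[of 4]], use cb in auto)+
  ultimately show ?thesis unfolding G_def by (intro tendsto_intros) auto
 qed
 have "(\<lambda>n. LBINT z:A. G n z) \<longlonglongrightarrow> (LBINT z:A. 1 / B * gdiv \<alpha> p1 q2 z)"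
 proof (rule bounded_convergence[OF A fin Gm])
  show "(\<lambda>z. 1 / B * gdiv \<alpha> p1 q2 z) \<in> borel_measurable borel" by measurable
 qed (use bound lim in auto)
 then have "(LBINT z:A. 1 / B * gdiv \<alpha> p1 q2 z) \<le> C" using le by (intro LIMSEQ_le_const2) auto
 then have "1 / B * (LBINT z:A. gdiv \<alpha> p1 q2 z) \<le> C" by (simp only: set_integral_mult_right)
 then show ?thesis using \<open>0 < B\<close> by (simp add: field_simps)
qed

text \<open>A measurable function is almost everywhere a limit of continuous ones; these are
  truncated at height \<open>G\<close>, replaced by polynomials on a square and multiplied by a
  plateau function. The polynomial error is at most 1, whence the bound
  \<open>G + 1\<close>.\<close>

lemma C1_approximation:
 fixes g :: "plane \<Rightarrow> real"
 assumes g: "g \<in> borel_measurable borel" "\<And>z. \<bar>g z\<bar> \<le> G" "\<And>z. \<bar>fst z\<bar> \<ge> N \<or> \<bar>snd z\<bar> \<ge> N \<Longrightarrow> g z = 0" and "0 \<le> N"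
 obtains h p q where "\<And>n::nat. grad (h n) (p n) (q n)" "\<And>n z. \<bar>h n z\<bar> \<le> G + 1"
  "\<And>n z. \<bar>fst z\<bar> \<ge> N + 1 \<or> \<bar>snd z\<bar> \<ge> N + 1 \<Longrightarrow> h n z = 0" "AE z in lborel. (\<lambda>n. h n z) \<longlonglongrightarrow> g z"
proof -
 have G0: "0 \<le> G" using g(2)[of 0] by linarith
 have "g \<in> borel_measurable lebesgue" using g(1) by (simp add: measurable_completion)
 then have "g measurable_on UNIV" by (intro lebesgue_measurable_imp_measurable_on) auto
 then obtain S h0 where S: "negligible S" "\<And>n. continuous_on UNIV (h0 n)" "\<And>z. z \<notin> S \<Longrightarrow> (\<lambda>n. h0 n z) \<longlonglongrightarrow> g z"
  unfolding measurable_on_def by auto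
 define h1 where "h1 n z = max (-G) (min G (h0 n z))" for n z
 have h1: "continuous_on UNIV (h1 n)" "\<bar>h1 n z\<bar> \<le> G" for n z
  unfolding h1_def using S(2) G0 by (auto intro!: continuous_intros)
 have h1lim: "(\<lambda>n. h1 n z) \<longlonglongrightarrow> g z" if "z \<notin> S" for z
 proof -
  have "(\<lambda>n. h1 n z) \<longlonglongrightarrow> max (-G) (min G (g z))" unfolding h1_def by (intro tendsto_intros S(3)[OF that])
  then show ?thesis using g(2)[of z] by (simp add: abs_le_iff max_def min_def split: if_splits)
 qed
 \<comment> \<open>The square is one unit larger than the support of \<open>g\<close>: the plateau
   \<open>pl\<close> has this unit to fall from 1 to 0, and outside the square the values of the
   polynomials are not controlled.\<close>
 define Q where "Q = cbox (- (N + 1), - (N + 1)) (N + 1, N + 1)"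
 have "\<exists>r. real_polynomial_function r \<and> (\<forall>z\<in>Q. \<bar>h1 n z - r z\<bar> < 1 / real (Suc n))" for n
 proof -
  have "compact Q" "continuous_on Q (h1 n)" "0 < 1 / real (Suc n)"
   unfolding Q_def by (auto simp del: cbox_Pair_eq intro!: continuous_on_subset[OF h1(1) subset_UNIV])
  then show ?thesis
  proof (rule Stone_Weierstrass_real_polynomial_function)
   fix r assume "real_polynomial_function r" "\<And>z. z \<in> Q \<Longrightarrow> \<bar>h1 n z - r z\<bar> < 1 / real (Suc n)"
   then show ?thesis by (intro exI[of _ r] conjI ballI)
  qed
 qed
 then obtain r where r: "\<And>n. real_polynomial_function (r n)" "\<And>n z. z \<in> Q \<Longrightarrow> \<bar>h1 n z - r n z\<bar> < 1 / real (Suc n)" by metis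
 have "\<exists>p q. grad (r n) p q" for n using grad_polynomial[OF r(1)] .
 then obtain rp rq where rg: "\<And>n. grad (r n) (rp n) (rq n)" by metis
 define pl where "pl x = ramp (x + (N + 1)) * ramp ((N + 1) - x)" for x
 define pl' where "pl' x = ramp' (x + (N + 1)) * ramp ((N + 1) - x) - ramp (x + (N + 1)) * ramp' ((N + 1) - x)" for x
 have pld: "(pl has_real_derivative pl' x) (at x)" for x
  unfolding pl_def[abs_def] pl'_def by (auto intro!: derivative_eq_intros DERIV_chain2[OF ramp_DERIV])
 have rc: "continuous_on S ramp" for S by (rule DERIV_imp_continuous_on[OF ramp_DERIV])
 have plc: "continuous_on UNIV pl'"
  unfolding pl'_def[abs_def]
  by (intro continuous_intros continuous_on_compose2[OF ramp'_continuous] continuous_on_compose2[OF rc]) auto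
 have plb: "0 \<le> pl x" "pl x \<le> 1" "\<bar>x\<bar> \<ge> N + 1 \<Longrightarrow> pl x = 0" "\<bar>x\<bar> \<le> N \<Longrightarrow> pl x = 1" for x
 proof -
  show "0 \<le> pl x" "pl x \<le> 1" unfolding pl_def using ramp_simps(1,2) by (auto intro!: mult_le_one)
  show "\<bar>x\<bar> \<ge> N + 1 \<Longrightarrow> pl x = 0"
  proof -
   assume "\<bar>x\<bar> \<ge> N + 1"
   then have "x + (N + 1) \<le> 0 \<or> (N + 1) - x \<le> 0" by linarith
   then show ?thesis unfolding pl_def using ramp_simps(3) by auto
  qed
  show "\<bar>x\<bar> \<le> N \<Longrightarrow> pl x = 1" unfolding pl_def
   using ramp_simps(4)[of "x + (N + 1)"] ramp_simps(4)[of "(N + 1) - x"] by (auto simp: abs_le_iff)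
 qed
 note grad = grad_mult[OF grad_mult[OF grad_fst[OF pld plc] grad_snd[OF pld plc]] rg]
 have inQ: "z \<in> Q \<or> pl (fst z) * pl (snd z) = 0" for z
 proof (cases "\<bar>fst z\<bar> \<ge> N + 1 \<or> \<bar>snd z\<bar> \<ge> N + 1")
  case True then show ?thesis using plb(3) by auto
 next
  case False
  then have "\<bar>fst z\<bar> < N + 1" "\<bar>snd z\<bar> < N + 1" by auto
  then show ?thesis unfolding Q_def by (cases z) (auto simp: cbox_Pair_eq)
 qed
 have pp: "0 \<le> pl x * pl y" "pl x * pl y \<le> 1" for x y using plb(1,2) by (auto intro!: mult_le_one)
 show ?thesis
 proof (rule that[OF grad])
  fix n and z :: plane
  show "\<bar>pl (fst z) * pl (snd z) * r n z\<bar> \<le> G + 1"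
   using inQ[of z]
  proof
   assume "z \<in> Q"
   from r(2)[OF this, of n] h1(2)[of n z] have "\<bar>r n z\<bar> \<le> G + 1 / real (Suc n)" by linarith
   moreover have "1 / real (Suc n) \<le> 1" by simp
   ultimately have "\<bar>r n z\<bar> \<le> G + 1" by linarith
   moreover have "\<bar>pl (fst z) * pl (snd z) * r n z\<bar> \<le> 1 * \<bar>r n z\<bar>" unfolding abs_mult[of "_ * _"]
    using pp[of "fst z" "snd z"] by (intro mult_right_mono) auto
   ultimately show ?thesis by linarith
  qed (use G0 in auto)
 next
  fix n and z :: plane
  assume "\<bar>fst z\<bar> \<ge> N + 1 \<or> \<bar>snd z\<bar> \<ge> N + 1"
  then show "pl (fst z) * pl (snd z) * r n z = 0" using plb(3) by auto
 next
  have "AE z in lebesgue. z \<notin> S" using S(1) by (intro AE_not_in) (simp add: negligible_iff_null_sets)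
  then have "AE z in lborel. z \<notin> S" by (simp add: AE_completion_iff)
  then show "AE z in lborel. (\<lambda>n. pl (fst z) * pl (snd z) * r n z) \<longlonglongrightarrow> g z"
  proof eventually_elim
   fix z assume zS: "z \<notin> S"
   show "(\<lambda>n. pl (fst z) * pl (snd z) * r n z) \<longlonglongrightarrow> g z"
    using inQ[of z]
   proof
    assume zQ: "z \<in> Q"
    have "(\<lambda>n. r n z - h1 n z) \<longlonglongrightarrow> 0"
     by (rule Lim_null_comparison[OF _ LIMSEQ_Suc[OF lim_1_over_n]])
       (use r(2)[OF zQ] in \<open>auto simp: abs_minus_commute intro!: always_eventually less_imp_le\<close>)
    from tendsto_add[OF this h1lim[OF zS]] have rl: "(\<lambda>n. r n z) \<longlonglongrightarrow> g z" by simp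
    show ?thesis
    proof (cases "\<bar>fst z\<bar> \<ge> N \<or> \<bar>snd z\<bar> \<ge> N")
     case True
     then have "g z = 0" using g(3) by blast
     then show ?thesis using tendsto_mult[OF tendsto_const rl, of "pl (fst z) * pl (snd z)"] by simp
    next
     case False
     then show ?thesis using rl plb(4) by simp
    qed
   next
    assume 0: "pl (fst z) * pl (snd z) = 0"
    then have "\<not> \<bar>fst z\<bar> \<le> N \<or> \<not> \<bar>snd z\<bar> \<le> N" using plb(4)[of "fst z"] plb(4)[of "snd z"] by force
    then have "\<bar>fst z\<bar> \<ge> N \<or> \<bar>snd z\<bar> \<ge> N" by linarith
    then have "g z = 0" using g(3) by blast
    then show ?thesis unfolding 0 by simp
   qed
  qed
 qed
qed

text \<open>The primitive in y is written as an integral over the fixed interval from 0 to 1 by an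
  affine substitution, so that differentiation under the integral applies in both variables at once.
  The last conclusion identifies the x-derivative of \<open>W\<close> through any primitive of
  \<open>p\<close>.\<close>

lemma C1_antiderivative:
 assumes g: "grad g p q" and L: "\<And>z. \<bar>snd z\<bar> \<ge> L \<Longrightarrow> g z = 0"
 obtains W r where "grad W r g" "\<And>x y. W (x, y) = (LBINT s. indicator {-L..y} s * g (x, s))"
  "\<And>x y F. (\<And>s. (F has_real_derivative p (x, s)) (at s)) \<Longrightarrow> r (x, y) = F y - F (- L)"
proof -
 define l where "l z t = (fst z, - L + (snd z + L) * t)" for z :: plane and t :: real
 define f where "f z t = (snd z + L) * g (l z t)" for z t
 define P where "P z t = (snd z + L) * p (l z t)" for z t
 define Q where "Q z t = g (l z t) + (snd z + L) * (t * q (l z t))" for z t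
 define F where "F = Blinfun (fst :: plane \<Rightarrow> real)"
 define S where "S = Blinfun (snd :: plane \<Rightarrow> real)"
 have FS: "blinfun_apply F = fst" "blinfun_apply S = snd"
  by (simp_all add: F_def S_def bounded_linear_Blinfun_apply bounded_linear_fst bounded_linear_snd)
 define D where "D z t = P z t *\<^sub>R F + Q z t *\<^sub>R S" for z t
 note gc = gradD[OF g]
 have lc: "continuous_on A (\<lambda>w. l (fst w) (snd w))" for A
  unfolding l_def by (intro continuous_intros)
 have Pc: "continuous_on (UNIV \<times> cbox 0 1) (\<lambda>(z, t). P z t)"
  unfolding P_def case_prod_beta by (intro continuous_intros continuous_on_compose2[OF gc(2) lc]) auto
 have Qc: "continuous_on (UNIV \<times> cbox 0 1) (\<lambda>(z, t). Q z t)"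
  unfolding Q_def case_prod_beta
  by (intro continuous_intros continuous_on_compose2[OF gc(3) lc] continuous_on_compose2[OF gc(4) lc]) auto
 have Dc: "continuous_on (UNIV \<times> cbox 0 1) (\<lambda>(z, t). D z t)"
  unfolding D_def case_prod_beta using Pc Qc by (intro continuous_intros) (auto simp: case_prod_beta)
 have fd: "((\<lambda>z. f z t) has_derivative blinfun_apply (D z t)) (at z within UNIV)" for z t
 proof -
  have "((\<lambda>z. l z t) has_derivative (\<lambda>w. (fst w, snd w * t))) (at z)"
   unfolding l_def by (auto intro!: derivative_eq_intros)
  from has_derivative_compose[OF this gc(1)]
  have "((\<lambda>z. g (l z t)) has_derivative (\<lambda>w. fst w * p (l z t) + snd w * t * q (l z t))) (at z)" by simp
  then have "((\<lambda>z. f z t) has_derivative (\<lambda>w. snd w * g (l z t) + (snd z + L) * (fst w * p (l z t) + snd w * t * q (l z t)))) (at z)"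
   unfolding f_def by (auto intro!: derivative_eq_intros)
  moreover have "blinfun_apply (D z t) = (\<lambda>w. snd w * g (l z t) + (snd z + L) * (fst w * p (l z t) + snd w * t * q (l z t)))"
   by (auto simp: D_def blinfun.add_left blinfun.scaleR_left FS P_def Q_def algebra_simps)
  ultimately show ?thesis by simp
 qed
 have sl: "continuous_on (cbox 0 1) (\<lambda>t. h z t)" if "continuous_on (UNIV \<times> cbox 0 1) (\<lambda>(z, t). h z t)"
  for h :: "plane \<Rightarrow> real \<Rightarrow> 'c::real_normed_vector" and z
 proof -
  have "continuous_on (cbox 0 1) (\<lambda>t::real. (z, t))" by (intro continuous_intros)
  from continuous_on_compose2[OF that this] show ?thesis by (auto simp del: box_real)
 qed
 have fc: "continuous_on (cbox 0 1) (f z)" for z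
 proof -
  have "continuous_on (UNIV \<times> cbox 0 1) (\<lambda>(z, t). f z t)"
   unfolding f_def case_prod_beta by (intro continuous_intros continuous_on_compose2[OF gc(4) lc]) auto
  then show ?thesis by (rule sl)
 qed
 define \<Omega> where "\<Omega> z = integral (cbox 0 1) (f z)" for z
 have \<Omega>d: "(\<Omega> has_derivative (\<lambda>w. fst w * integral (cbox 0 1) (P z) + snd w * g z)) (at z)" for z
 proof -
  have "((\<lambda>z. integral (cbox 0 1) (f z)) has_derivative integral (cbox 0 1) (D z)) (at z within UNIV)"
   by (rule leibniz_rule[OF fd integrable_continuous[OF fc] Dc]) auto
  moreover have "blinfun_apply (integral (cbox 0 1) (D z)) = (\<lambda>w. fst w * integral (cbox 0 1) (P z) + snd w * g z)"
  proof
   fix w :: plane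
   have Pi: "P z integrable_on cbox 0 1" and Qi: "Q z integrable_on cbox 0 1"
    using sl[OF Pc] sl[OF Qc] integrable_continuous by blast+
   have "blinfun_apply (integral (cbox 0 1) (D z)) w = integral (cbox 0 1) (\<lambda>t. D z t w)"
    by (rule blinfun_apply_integral) (use sl[OF Dc] integrable_continuous in blast)
   also have "\<dots> = integral (cbox 0 1) (\<lambda>t. fst w * P z t + snd w * Q z t)"
    by (simp add: D_def blinfun.add_left blinfun.scaleR_left FS mult.commute)
   also have "\<dots> = fst w * integral (cbox 0 1) (P z) + snd w * integral (cbox 0 1) (Q z)"
    using integral_add[OF integrable_cmul[OF Pi, of "fst w"] integrable_cmul[OF Qi, of "snd w"]] by simp
   \<comment> \<open>\<open>Q z\<close> is the derivative in t of \<open>t * g (l z t)\<close>, so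
     the y-derivative of the substituted integral collapses to \<open>g\<close>.\<close>
   also have "integral (cbox 0 1) (Q z) = g z"
   proof -
    have "((\<lambda>t. t * g (l z t)) has_vector_derivative Q z t) (at t within {0..1})" for t
    proof -
     have "((\<lambda>t. g (fst z, - L + (snd z + L) * t)) has_real_derivative q (l z t) * (snd z + L)) (at t)"
      unfolding l_def by (rule DERIV_chain2[OF grad_DERIV_y[OF g]]) (auto intro!: derivative_eq_intros)
     then have "((\<lambda>t. t * g (l z t)) has_real_derivative Q z t) (at t)"
      unfolding Q_def l_def by (auto intro!: derivative_eq_intros simp: algebra_simps)
     then show ?thesis by (simp add: has_real_derivative_iff_has_vector_derivative has_vector_derivative_at_within)
    qed
    then have "(Q z has_integral 1 * g (l z 1) - 0 * g (l z 0)) {0..1}"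
     by (intro fundamental_theorem_of_calculus) auto
    then show ?thesis by (simp add: l_def integral_unique)
   qed
   finally show "blinfun_apply (integral (cbox 0 1) (D z)) w = fst w * integral (cbox 0 1) (P z) + snd w * g z" .
  qed
  ultimately show ?thesis unfolding \<Omega>_def[abs_def] by simp
 qed
 have \<Omega>g: "grad \<Omega> (\<lambda>z. integral (cbox 0 1) (P z)) g"
  by (rule gradI[OF \<Omega>d integral_continuous_on_param[OF Pc] gc(4)])
 show ?thesis
 proof (rule that[OF \<Omega>g])
  fix x y F assume F: "\<And>s. (F has_real_derivative p (x, s)) (at s)"
  have "(P (x, y) has_integral F (- L + (y + L) * 1) - F (- L + (y + L) * 0)) {0..1}"
  proof (rule fundamental_theorem_of_calculus)
   fix t
   have "((\<lambda>t. F (- L + (y + L) * t)) has_real_derivative p (x, - L + (y + L) * t) * (y + L)) (at t)"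
    by (rule DERIV_chain2[OF F]) (auto intro!: derivative_eq_intros)
   then show "((\<lambda>t. F (- L + (y + L) * t)) has_vector_derivative P (x, y) t) (at t within {0..1})"
    by (simp add: P_def l_def has_real_derivative_iff_has_vector_derivative has_vector_derivative_at_within mult.commute)
  qed simp
  then show "integral (cbox 0 1) (P (x, y)) = F y - F (- L)" by (simp add: integral_unique)
 next
  fix x y
  have "f (x, - L) = (\<lambda>t. 0)" by (auto simp: f_def)
  then have 0: "\<Omega> (x, - L) = 0" by (simp add: \<Omega>_def)
  have gs: "isCont (\<lambda>s. g (x, s)) s" for s
   by (rule DERIV_isCont[OF grad_DERIV_y[OF g]])
  show "\<Omega> (x, y) = (LBINT s. indicator {-L..y} s * g (x, s))"
  proof (cases "- L \<le> y")
   case True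
   have "(LBINT s. g (x, s) * indicator {-L..y} s) = \<Omega> (x, y) - \<Omega> (x, - L)"
    by (rule integral_FTC_Icc_real[OF True grad_DERIV_y[OF \<Omega>g] gs])
   then show ?thesis using 0 by (simp add: mult.commute)
  next
   case False
   have "(LBINT s. g (x, s) * indicator {y..-L} s) = \<Omega> (x, - L) - \<Omega> (x, y)"
    by (rule integral_FTC_Icc_real[OF _ grad_DERIV_y[OF \<Omega>g] gs]) (use False in auto)
   moreover have "(\<lambda>s. g (x, s) * indicator {y..-L} s) = (\<lambda>s. 0)"
    using L[of "(x, s)" for s] by (fastforce simp: indicator_def)
   ultimately show ?thesis using 0 False by simp
  qed
 qed
qed

lemma AE_fst:
 assumes "AE x in lborel. R (x :: real)"
 shows "AE z in lborel. R (fst (z :: plane))"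
proof -
 obtain N where N: "N \<in> null_sets lborel" "{x \<in> space lborel. \<not> R x} \<subseteq> N"
  using assms by (auto simp: eventually_ae_filter)
 have "emeasure (lborel \<Otimes>\<^sub>M lborel) (N \<times> (UNIV :: real set)) = emeasure lborel N * emeasure lborel (UNIV :: real set)"
  by (rule lborel.emeasure_pair_measure_Times) (use N in auto)
 then have "N \<times> (UNIV :: real set) \<in> null_sets (lborel \<Otimes>\<^sub>M lborel)"
  using N by (intro null_setsI) auto
 then have "N \<times> (UNIV :: real set) \<in> null_sets lborel" by (simp add: lborel_prod)
 then show ?thesis by (rule AE_I') (use N in auto)
qed

lemma borel_antiderivative:
 fixes g :: "plane \<Rightarrow> real"
 assumes [measurable]: "g \<in> borel_measurable borel"
 shows "(\<lambda>z. \<integral>s. indicator {c..snd z} s * g (fst z, s) \<partial>lborel) \<in> borel_measurable borel"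
proof -
 have "(\<lambda>(z :: plane, s). (if c \<le> s \<and> s \<le> snd z then g (fst z, s) else 0)) \<in> borel_measurable (borel \<Otimes>\<^sub>M lborel)"
  by measurable
 then have "(\<lambda>z :: plane. \<integral>s. (if c \<le> s \<and> s \<le> snd z then g (fst z, s) else 0) \<partial>lborel) \<in> borel_measurable borel"
  by (rule lborel.borel_measurable_lebesgue_integral)
 moreover have "(if c \<le> s \<and> s \<le> snd z then g (fst z, s) else 0) = indicator {c..snd z} s * g (fst z, s)" for z :: plane and s
  by (simp add: indicator_def)
 ultimately show ?thesis by simp
qed

text \<open>Only the y-derivative of the angle enters the divergence, so \<open>W\<close> may be the
  primitive of a bounded Borel function that is rough in x. It is approximated by primitives of C1
  functions; these live in a square one unit larger than the support of \<open>g\<close>, which is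
  why integration starts at \<open>- (N + 1)\<close>.\<close>

lemma half_le_angle:
 assumes h: "half_le \<alpha> A C" "0 \<le> \<alpha>" and A[measurable]: "A \<in> sets borel" and fin: "emeasure lborel A < \<infinity>"
  and \<phi>: "grad \<phi> p1 q1" "grad a pa qa" and "0 < B"
  and b: "\<And>z. (\<phi> z)\<^sup>2 + (a z)\<^sup>2 \<le> B\<^sup>2" "\<And>y. \<bar>\<phi> (0, y)\<bar> \<le> B / 2"
  and M: "\<And>z. \<bar>fst z\<bar> > M \<Longrightarrow> a z = 0" and K: "\<And>z. \<bar>p1 z\<bar> \<le> K" "\<And>z. \<bar>qa z\<bar> \<le> K"
  and g: "g \<in> borel_measurable borel" "\<And>z. \<bar>g z\<bar> \<le> G" "\<And>z. \<bar>fst z\<bar> \<ge> N \<or> \<bar>snd z\<bar> \<ge> N \<Longrightarrow> g z = 0" and "0 \<le> N"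
  and W: "\<And>z. W z = - (pi / 2) + (LBINT s. indicator {- (N + 1)..snd z} s * g (fst z, s))"
 shows "(LBINT z:A. gdiv \<alpha> p1 (\<lambda>z. qa z * sin (W z) + a z * (cos (W z) * g z)) z) \<le> B * C"
proof -
 obtain h p q where h: "\<And>n::nat. grad (h n) (p n) (q n)" "\<And>n z. \<bar>h n z\<bar> \<le> G + 1"
  "\<And>n z. \<bar>fst z\<bar> \<ge> N + 1 \<or> \<bar>snd z\<bar> \<ge> N + 1 \<Longrightarrow> h n z = 0" "AE z in lborel. (\<lambda>n. h n z) \<longlonglongrightarrow> g z"
  using C1_approximation[OF g \<open>0 \<le> N\<close>] by blast
 have "\<exists>V r. grad V r (h n) \<and> (\<forall>x y. V (x, y) = (LBINT s. indicator {- (N + 1)..y} s * h n (x, s)))" for n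
 proof -
  have "\<bar>snd z\<bar> \<ge> N + 1 \<Longrightarrow> h n z = 0" for z using h(3) by blast
  then show ?thesis
  proof (rule C1_antiderivative[OF h(1)])
   fix V r assume "grad V r (h n)" "\<And>x y. V (x, y) = (LBINT s. indicator {- (N + 1)..y} s * h n (x, s))"
   then show ?thesis by (intro exI[of _ V] exI[of _ r] conjI allI)
  qed
 qed
 then obtain V r where V: "\<And>n. grad (V n) (r n) (h n)"
  "\<And>n x y. V n (x, y) = (LBINT s. indicator {- (N + 1)..y} s * h n (x, s))" by metis
 have G0: "0 \<le> G" using g(2)[of 0] by linarith
 have K0: "0 \<le> K" using K(1)[of 0] by linarith
 define U where "U n z = - (pi / 2) + V n z" for n z
 have U: "grad (U n) (r n) (h n)" for n
  by (rule grad_cong[OF grad_add[OF grad_const[of "- (pi / 2)"] V(1)[of n]]]) (auto simp: U_def)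
 have sU: "grad (\<lambda>z. sin (U n z)) (\<lambda>z. cos (U n z) * r n z) (\<lambda>z. cos (U n z) * h n z)" for n
  by (rule grad_compose[OF U DERIV_sin]) (intro continuous_intros)
 define Q where "Q n z = qa z * sin (U n z) + a z * (cos (U n z) * h n z)" for n z
 define Q0 where "Q0 z = qa z * sin (W z) + a z * (cos (W z) * g z)" for z
 have ab: "\<bar>a z\<bar> \<le> B" for z
 proof -
  have "(a z)\<^sup>2 \<le> B\<^sup>2" using b(1)[of z] zero_le_power2[of "\<phi> z"] by linarith
  then show ?thesis using \<open>0 < B\<close> abs_le_square_iff[of "a z" B] by auto
 qed
 have Qb: "\<bar>Q n z\<bar> \<le> K + B * (G + 1)" for n z
 proof -
  have "\<bar>qa z * sin (U n z)\<bar> \<le> K * 1" unfolding abs_mult using K(2)[of z] K0 by (intro mult_mono) auto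
  moreover have "\<bar>a z * (cos (U n z) * h n z)\<bar> \<le> B * (1 * (G + 1))" unfolding abs_mult
   using ab[of z] h(2)[of n z] \<open>0 < B\<close> G0 by (intro mult_mono) auto
  ultimately show ?thesis unfolding Q_def by linarith
 qed
 have le: "(LBINT z:A. gdiv \<alpha> p1 (Q n) z) \<le> B * C" for n
  unfolding Q_def[abs_def]
 proof (rule half_le_noncompact[OF assms(1,2) A fin \<phi>(1) grad_mult[OF \<phi>(2) sU] \<open>0 < B\<close>, where M = M and K = "K + B * (G + 1)"])
  fix z
  have "(sin (U n z))\<^sup>2 \<le> 1" by (simp add: abs_square_le_1)
  then have "(a z * sin (U n z))\<^sup>2 \<le> (a z)\<^sup>2" using mult_left_mono[of "(sin (U n z))\<^sup>2" 1 "(a z)\<^sup>2"]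
   by (simp add: power_mult_distrib)
  then show "(\<phi> z)\<^sup>2 + (a z * sin (U n z))\<^sup>2 \<le> B\<^sup>2" using b(1)[of z] by linarith
  show "\<bar>p1 z\<bar> \<le> K + B * (G + 1)" using K(1)[of z] \<open>0 < B\<close> G0 by (intro order_trans[OF K(1)]) auto
  show "\<bar>qa z * sin (U n z) + a z * (cos (U n z) * h n z)\<bar> \<le> K + B * (G + 1)" using Qb[of n z] by (simp add: Q_def)
 qed (use b(2) M in auto)
 note [measurable] = grad_borel[OF \<phi>(1)] grad_borel[OF \<phi>(2)] wt_borel[OF \<open>0 \<le> \<alpha>\<close>] grad_borel[OF U] g(1)
 have [measurable]: "W \<in> borel_measurable borel" unfolding W by (intro borel_measurable_add borel_measurable_const borel_antiderivative g)
 have Qm[measurable]: "Q n \<in> borel_measurable borel" "Q0 \<in> borel_measurable borel" for n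
  unfolding Q_def[abs_def] Q0_def[abs_def] by measurable
 define Wm where "Wm = wt \<alpha> M"
 have qa0: "qa z = 0" if "\<bar>fst z\<bar> > M" for z
  by (rule grad_zero_outside(2)[OF \<phi>(2), of "{z. \<bar>fst z\<bar> > M}"])
    (use that M in \<open>auto intro!: open_Collect_less continuous_intros\<close>)
 have bound: "\<bar>gdiv \<alpha> p1 (Q n) z\<bar> \<le> K + Wm * (K + B * (G + 1))" for n z
 proof -
  have "\<bar>wt \<alpha> (fst z) * Q n z\<bar> \<le> Wm * (K + B * (G + 1))"
  proof (cases "\<bar>fst z\<bar> > M")
   case True
   then have "Q n z = 0" using qa0 M by (simp add: Q_def)
   then show ?thesis using K0 \<open>0 < B\<close> G0 unfolding Wm_def by simp
  next
   case False
   then have "wt \<alpha> (fst z) \<le> Wm" unfolding Wm_def by (intro wt_mono[OF \<open>0 \<le> \<alpha>\<close>]) auto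
   moreover have "0 \<le> Wm" by (simp add: Wm_def)
   ultimately show ?thesis unfolding abs_mult using Qb[of n z] by (intro mult_mono) auto
  qed
  then show ?thesis unfolding gdiv_def using K(1)[of z] by linarith
 qed
 have Ulim: "AE z in lborel. (\<lambda>n. U n z) \<longlonglongrightarrow> W z"
 proof -
  have "AE z in (lborel \<Otimes>\<^sub>M lborel). (\<lambda>n. h n z) \<longlonglongrightarrow> g z" unfolding lborel_prod by (rule h(4))
  then have "AE x in lborel. AE s in lborel. (\<lambda>n. h n (x, s)) \<longlonglongrightarrow> g (x, s)" by (rule lborel_pair.AE_pair)
  then have "AE z in lborel. AE s in lborel. (\<lambda>n. h n (fst (z :: plane), s)) \<longlonglongrightarrow> g (fst z, s)" by (rule AE_fst)
  then show ?thesis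
  proof eventually_elim
   fix z :: plane
   assume z: "AE s in lborel. (\<lambda>n. h n (fst z, s)) \<longlonglongrightarrow> g (fst z, s)"
   have hm: "(\<lambda>s. h n (fst z, s)) \<in> borel_measurable borel" for n
    using grad_borel(3)[OF U[of n]] by measurable
   have gm: "(\<lambda>s. g (fst z, s)) \<in> borel_measurable borel" by measurable
   have "(\<lambda>n. LBINT s:{- (N + 1)..snd z}. h n (fst z, s)) \<longlonglongrightarrow> (LBINT s:{- (N + 1)..snd z}. g (fst z, s))"
    by (rule bounded_convergence[OF _ _ hm gm, where D = "G + 1"])
      (use z h(2) in \<open>auto simp: emeasure_lborel_Icc_eq\<close>)
   then have "(\<lambda>n. V n z) \<longlonglongrightarrow> (LBINT s. indicator {- (N + 1)..snd z} s * g (fst z, s))"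
    unfolding set_int_def using V(2)[of _ "fst z" "snd z"] by simp
   then show "(\<lambda>n. U n z) \<longlonglongrightarrow> W z" unfolding U_def W by (intro tendsto_intros)
  qed
 qed
 have "(\<lambda>n. LBINT z:A. gdiv \<alpha> p1 (Q n) z) \<longlonglongrightarrow> (LBINT z:A. gdiv \<alpha> p1 Q0 z)"
 proof (rule bounded_convergence[OF A fin])
  show "gdiv \<alpha> p1 (Q n) \<in> borel_measurable borel" "gdiv \<alpha> p1 Q0 \<in> borel_measurable borel" for n
   using \<open>0 \<le> \<alpha>\<close> by (intro gdiv_borel; measurable)+
  show "AE z in lborel. z \<in> A \<longrightarrow> (\<lambda>n. gdiv \<alpha> p1 (Q n) z) \<longlonglongrightarrow> gdiv \<alpha> p1 Q0 z"
   using Ulim h(4)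
  proof eventually_elim
   fix z assume "(\<lambda>n. U n z) \<longlonglongrightarrow> W z" "(\<lambda>n. h n z) \<longlonglongrightarrow> g z"
   then show "z \<in> A \<longrightarrow> (\<lambda>n. gdiv \<alpha> p1 (Q n) z) \<longlonglongrightarrow> gdiv \<alpha> p1 Q0 z"
    unfolding gdiv_def Q_def Q0_def by (intro impI tendsto_intros)
  qed
 qed (use bound in auto)
 then have "(LBINT z:A. gdiv \<alpha> p1 Q0 z) \<le> B * C" using le by (intro LIMSEQ_le_const2) auto
 then show ?thesis unfolding Q0_def[abs_def] .
qed

section \<open>The gain along a single section\<close>

lemma continuous_antiderivative:
 fixes f :: "real \<Rightarrow> real"
 assumes "continuous_on UNIV f"
 obtains F where "\<And>x. (F has_real_derivative f x) (at x)"
proof -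
 have "\<exists>F. \<forall>x. - \<infinity> < ereal x \<longrightarrow> ereal x < \<infinity> \<longrightarrow> (F has_vector_derivative f x) (at x)"
  by (rule einterval_antiderivative) (use assms continuous_on_eq_continuous_at in auto)
 then show ?thesis using that by (auto simp: has_real_derivative_iff_has_vector_derivative)
qed

lemma continuous_approximation:
 fixes g :: "real \<Rightarrow> real"
 assumes "g \<in> borel_measurable borel" "\<And>x. lo \<le> g x" "\<And>x. g x \<le> hi"
 obtains h where "\<And>n::nat. continuous_on UNIV (h n)" "\<And>n x. lo \<le> h n x" "\<And>n x. h n x \<le> hi"
  "AE x in lborel. (\<lambda>n. h n x) \<longlonglongrightarrow> g x"
proof -
 have lh: "lo \<le> hi" using assms(2,3) order_trans by blast
 have "g \<in> borel_measurable lebesgue" using assms(1) by (simp add: measurable_completion)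
 then have "g measurable_on UNIV" by (intro lebesgue_measurable_imp_measurable_on) auto
 then obtain S h0 where S: "negligible S" "\<And>n. continuous_on UNIV (h0 n)" "\<And>z. z \<notin> S \<Longrightarrow> (\<lambda>n. h0 n z) \<longlonglongrightarrow> g z"
  unfolding measurable_on_def by auto
 show ?thesis
 proof (rule that[of "\<lambda>n x. max lo (min hi (h0 n x))"])
  show "continuous_on UNIV (\<lambda>x. max lo (min hi (h0 n x)))" for n
   by (intro continuous_intros S)
  have "AE z in lebesgue. z \<notin> S" using S(1) by (intro AE_not_in) (simp add: negligible_iff_null_sets)
  then have "AE z in lborel. z \<notin> S" by (simp add: AE_completion_iff)
  then show "AE x in lborel. (\<lambda>n. max lo (min hi (h0 n x))) \<longlonglongrightarrow> g x"
  proof eventually_elim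
   fix x assume "x \<notin> S"
   then have "(\<lambda>n. max lo (min hi (h0 n x))) \<longlonglongrightarrow> max lo (min hi (g x))" by (intro tendsto_intros S(3))
   then show "(\<lambda>n. max lo (min hi (h0 n x))) \<longlonglongrightarrow> g x" using assms(2,3)[of x] by simp
  qed
 qed (use lh in auto)
qed

text \<open>The fundamental theorem for sin V when the derivative of \<open>V\<close> is only
  bounded and measurable. It holds for continuous densities and passes to the limit by bounded
  convergence.\<close>

lemma integral_cos_antiderivative:
 fixes g :: "real \<Rightarrow> real"
 assumes g[measurable]: "g \<in> borel_measurable borel" "\<And>x. \<bar>g x\<bar> \<le> G"
  and V: "\<And>y. V y = c + (LBINT s. indicator {lo..y} s * g s)" and "lo \<le> s" "s \<le> t"
 shows "(LBINT y. indicator {s..t} y * (cos (V y) * g y)) = sin (V t) - sin (V s)"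
proof -
 obtain h where h: "\<And>n::nat. continuous_on UNIV (h n)" "\<And>n x. - G \<le> h n x" "\<And>n x. h n x \<le> G"
  "AE x in lborel. (\<lambda>n. h n x) \<longlonglongrightarrow> g x"
  using continuous_approximation[of g "-G" G] g by (auto simp: abs_le_iff minus_le_iff)
 have [measurable]: "h n \<in> borel_measurable borel" for n by (rule borel_measurable_continuous_onI[OF h(1)])
 have hb: "\<bar>h n x\<bar> \<le> G" for n x using h(2,3) by (auto simp: abs_le_iff minus_le_iff)
 have "\<exists>H. \<forall>x. (H has_real_derivative h n x) (at x)" for n
  using continuous_antiderivative[OF h(1)] by metis
 then obtain H where H: "\<And>n x. (H n has_real_derivative h n x) (at x)" by metis
 define Vn where "Vn n y = c + (H n y - H n lo)" for n y
 have Vi: "Vn n y = c + (LBINT s:{lo..y}. h n s)" if "lo \<le> y" for n y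
 proof -
  have "(LBINT s. h n s * indicator {lo..y} s) = H n y - H n lo"
   by (rule integral_FTC_Icc_real[OF that H]) (use h(1)[of n] continuous_on_eq_continuous_at[OF open_UNIV, of "h n"] in auto)
  then show ?thesis unfolding Vn_def set_int_def by (simp add: mult.commute)
 qed
 have Vlim: "(\<lambda>n. Vn n y) \<longlonglongrightarrow> V y" if "lo \<le> y" for y
 proof -
  have "(\<lambda>n. LBINT s:{lo..y}. h n s) \<longlonglongrightarrow> (LBINT s:{lo..y}. g s)"
   by (rule bounded_convergence[where D = G]) (use h(4) hb in \<open>auto simp: emeasure_lborel_Icc_eq\<close>)
  then show ?thesis unfolding Vi[OF that] V set_int_def by (intro tendsto_intros) simp
 qed
 have Vd: "(Vn n has_real_derivative h n y) (at y)" for n y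
  unfolding Vn_def[abs_def] by (auto intro!: derivative_eq_intros H)
 have Vc: "continuous_on S (Vn n)" for S n by (rule DERIV_imp_continuous_on[OF Vd])
 have Vm[measurable]: "Vn n \<in> borel_measurable borel" for n by (rule borel_measurable_continuous_onI[OF Vc])
 have VM[measurable]: "(\<lambda>y. if lo \<le> y then V y else 0) \<in> borel_measurable borel"
  by (rule borel_measurable_LIMSEQ_real[where u = "\<lambda>n y. if lo \<le> y then Vn n y else 0"]) (use Vlim in auto)
 \<comment> \<open>Measurability is obtained from the limit, which is available only above
   \<open>lo\<close>; the value 0 below is arbitrary.\<close>
 define V' where "V' y = (if lo \<le> y then V y else 0)" for y
 have [measurable]: "V' \<in> borel_measurable borel" using VM unfolding V'_def[abs_def] .
 have eq: "(LBINT y:{s..t}. cos (Vn n y) * h n y) = sin (Vn n t) - sin (Vn n s)" for n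
 proof -
  have "((\<lambda>y. sin (Vn n y)) has_real_derivative cos (Vn n y) * h n y) (at y)" for y
   by (rule DERIV_chain2[OF DERIV_sin Vd])
  moreover have "isCont (\<lambda>y. cos (Vn n y) * h n y) y" for y
  proof -
   have "continuous_on UNIV (\<lambda>y. cos (Vn n y) * h n y)" by (intro continuous_intros Vc h(1))
   then show ?thesis using continuous_on_eq_continuous_at by blast
  qed
  ultimately have "(LBINT y. (cos (Vn n y) * h n y) * indicator {s..t} y) = sin (Vn n t) - sin (Vn n s)"
   by (intro integral_FTC_Icc_real[OF \<open>s \<le> t\<close>, of "\<lambda>y. sin (Vn n y)" "\<lambda>y. cos (Vn n y) * h n y"])
  then show ?thesis unfolding set_int_def by (simp add: mult.commute)
 qed
 have G0: "0 \<le> G" using g(2)[of 0] by linarith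
 have "(\<lambda>n. LBINT y:{s..t}. cos (Vn n y) * h n y) \<longlonglongrightarrow> (LBINT y:{s..t}. cos (V' y) * g y)"
 proof (rule bounded_convergence[where D = G])
  show "\<bar>cos (Vn n z) * h n z\<bar> \<le> G" for n z
   using mult_mono[of "\<bar>cos (Vn n z)\<bar>" 1 "\<bar>h n z\<bar>" G] hb[of n z] G0 by (simp add: abs_mult)
  show "AE z in lborel. z \<in> {s..t} \<longrightarrow> (\<lambda>n. cos (Vn n z) * h n z) \<longlonglongrightarrow> cos (V' z) * g z"
   using h(4) Vlim \<open>lo \<le> s\<close> by (auto intro!: tendsto_intros simp: V'_def)
 qed (auto simp: emeasure_lborel_Icc_eq)
 moreover have "(\<lambda>n. sin (Vn n t) - sin (Vn n s)) \<longlonglongrightarrow> sin (V t) - sin (V s)"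
  using assms by (intro tendsto_intros Vlim) auto
 ultimately have "(LBINT y:{s..t}. cos (V' y) * g y) = sin (V t) - sin (V s)"
  unfolding eq using LIMSEQ_unique by blast
 moreover have "(LBINT y:{s..t}. cos (V' y) * g y) = (LBINT y. indicator {s..t} y * (cos (V y) * g y))"
  unfolding set_int_def using \<open>lo \<le> s\<close>
  by (intro Bochner_Integration.integral_cong) (auto simp: V'_def indicator_def)
 ultimately show ?thesis by simp
qed

text \<open>The angle rises at constant speed on \<open>B\<close> and rests elsewhere, so
  \<open>B\<close> collects the whole increase of the sine from -1 to 1.\<close>

lemma one_jump_gain:
 fixes B :: "real set" and N :: real
 assumes [measurable]: "B \<in> sets borel" and b: "measure lborel (B \<inter> {-N<..<N}) > 0"
  and g: "\<And>y. g y = indicator (B \<inter> {-N<..<N}) y * (pi / measure lborel (B \<inter> {-N<..<N}))"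
  and V: "\<And>y. V y = - (pi / 2) + (LBINT s. indicator {-(N+1)..y} s * g s)" and "0 \<le> N"
 shows "(LBINT y. indicator B y * (cos (V y) * g y)) = 2"
proof -
 define b where "b = measure lborel (B \<inter> {-N<..<N})"
 have "(LBINT y. indicator {-(N+1)..N} y * (cos (V y) * g y)) = sin (V N) - sin (V (-(N+1)))"
 proof (rule integral_cos_antiderivative[OF _ _ V, where G = "pi / b"])
  show "g \<in> borel_measurable borel" unfolding g by measurable
  show "\<bar>g y\<bar> \<le> pi / b" for y using b by (auto simp: g b_def indicator_def)
 qed (use \<open>0 \<le> N\<close> in auto)
 moreover have "(\<lambda>y. indicator {-(N+1)..N} y * (cos (V y) * g y)) = (\<lambda>y. indicator B y * (cos (V y) * g y))"
  by (auto simp: g indicator_def)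
 moreover have "V (-(N+1)) = - (pi/2)"
 proof -
  have "(\<lambda>s. indicator {-(N+1)..-(N+1)} s * g s) = (\<lambda>s. 0)" by (auto simp: g indicator_def)
  then show ?thesis unfolding V by simp
 qed
 moreover have "V N = pi / 2"
 proof -
  have "(\<lambda>s. indicator {-(N+1)..N} s * g s) = (\<lambda>s. indicator (B \<inter> {-N<..<N}) s * (pi / b))" by (auto simp: g b_def indicator_def)
  then have "V N = - (pi / 2) + b * (pi / b)" unfolding V by (simp add: b_def)
  then show ?thesis using b unfolding b_def[symmetric] by simp
 qed
 ultimately show ?thesis by simp
qed

text \<open>The angle rises on the lower part of \<open>B\<close>, returns to -\<pi>/2 across the
  gap and rises again on the upper part. The return takes place outside \<open>B\<close> and costs
  nothing, so a section with a gap pays for four end points instead of two.\<close>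

lemma two_jump_gain:
 fixes B :: "real set" and N :: real
 assumes [measurable]: "B \<in> sets borel" and y: "-N < y0" "y0 < y1" "y1 < N"
  and b: "b1 = measure lborel (B \<inter> {-N<..<y0})" "b2 = measure lborel ({y0<..<y1} - B)" "b3 = measure lborel (B \<inter> {y1<..<N})"
   "b1 > 0" "b2 > 0" "b3 > 0"
  and g: "\<And>y. g y = indicator (B \<inter> {-N<..<y0}) y * (pi / b1) - indicator ({y0<..<y1} - B) y * (pi / b2)
    + indicator (B \<inter> {y1<..<N}) y * (pi / b3)"
  and V: "\<And>y. V y = - (pi / 2) + (LBINT s. indicator {-(N+1)..y} s * g s)"
 shows "(LBINT y. indicator B y * (cos (V y) * g y)) = 4"
proof -
 define k1 k2 k3 where "k1 = pi / b1" and "k2 = pi / b2" and "k3 = pi / b3"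
 have k: "b1 * k1 = pi" "b2 * k2 = pi" "b3 * k3 = pi" "0 < k1" "0 < k2" "0 < k3"
  using b by (auto simp: k1_def k2_def k3_def)
 note g = g[folded k1_def k2_def k3_def]
 have gm[measurable]: "g \<in> borel_measurable borel" unfolding g by measurable
 have gb: "\<bar>g y\<bar> \<le> k1 + k2 + k3" for y
  using k y by (auto simp: g indicator_def)
 have e1: "(LBINT y. indicator {-(N+1)..y0} y * (cos (V y) * g y)) = sin (V y0) - sin (V (-(N+1)))"
  by (rule integral_cos_antiderivative[OF gm gb V]) (use y in auto)
 have e2: "(LBINT y. indicator {y1..N} y * (cos (V y) * g y)) = sin (V N) - sin (V y1)"
  by (rule integral_cos_antiderivative[OF gm gb V]) (use y in auto)
 have fm: "emeasure lborel (B \<inter> {-N<..<y0}) < \<infinity>" "emeasure lborel ({y0<..<y1} - B) < \<infinity>" "emeasure lborel (B \<inter> {y1<..<N}) < \<infinity>"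
 proof -
  show "emeasure lborel (B \<inter> {-N<..<y0}) < \<infinity>"
   by (rule le_less_trans[OF emeasure_mono[of _ "{-N<..<y0}"]]) (use y in auto)
  show "emeasure lborel ({y0<..<y1} - B) < \<infinity>"
   by (rule le_less_trans[OF emeasure_mono[of _ "{y0<..<y1}"]]) (use y in auto)
  show "emeasure lborel (B \<inter> {y1<..<N}) < \<infinity>"
   by (rule le_less_trans[OF emeasure_mono[of _ "{y1<..<N}"]]) (use y in auto)
 qed
 have ii: "integrable lborel (\<lambda>s. indicator (B \<inter> {-N<..<y0}) s * k1)"
  "integrable lborel (\<lambda>s. indicator ({y0<..<y1} - B) s * k2)"
  "integrable lborel (\<lambda>s. indicator (B \<inter> {y1<..<N}) s * k3)"
  using fm by (intro integrable_mult_left integrable_real_indicator; simp)+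
 have V0: "V (-(N+1)) = - (pi/2)"
 proof -
  have "(\<lambda>s. indicator {-(N+1)..-(N+1)} s * g s) = (\<lambda>s. 0)" using y by (auto simp: g indicator_def)
  then show ?thesis unfolding V by simp
 qed
 have V1: "V y0 = pi / 2"
 proof -
  have "(\<lambda>s. indicator {-(N+1)..y0} s * g s) = (\<lambda>s. indicator (B \<inter> {-N<..<y0}) s * k1)"
   using y by (intro ext) (auto simp: g indicator_def)
  then have "V y0 = - (pi / 2) + b1 * k1" unfolding V b by simp
  then show ?thesis using k by simp
 qed
 have V2: "V y1 = - (pi / 2)"
 proof -
  have "(\<lambda>s. indicator {-(N+1)..y1} s * g s) = (\<lambda>s. indicator (B \<inter> {-N<..<y0}) s * k1 - indicator ({y0<..<y1} - B) s * k2)"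
   using y by (intro ext) (auto simp: g indicator_def)
  then have "V y1 = - (pi / 2) + (b1 * k1 - b2 * k2)" unfolding V
   using Bochner_Integration.integral_diff[OF ii(1,2)] b(1,2) by simp
  then show ?thesis using k by simp
 qed
 have V3: "V N = pi / 2"
 proof -
  have "(\<lambda>s. indicator {-(N+1)..N} s * g s) = (\<lambda>s. indicator (B \<inter> {-N<..<y0}) s * k1 - indicator ({y0<..<y1} - B) s * k2
    + indicator (B \<inter> {y1<..<N}) s * k3)"
   using y by (intro ext) (auto simp: g indicator_def)
  then have "V N = - (pi / 2) + (b1 * k1 - b2 * k2 + b3 * k3)" unfolding V
   using Bochner_Integration.integral_diff[OF ii(1,2)] b(1-3)
    Bochner_Integration.integral_add[OF Bochner_Integration.integrable_diff[OF ii(1,2)] ii(3)] by simp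
  then show ?thesis using k by simp
 qed
 have Vm: "(\<lambda>y. V y) \<in> borel_measurable borel"
 proof -
  have "(\<lambda>z :: plane. g (snd z)) \<in> borel_measurable borel" by measurable
  note F = borel_antiderivative[OF this, of "-(N+1)"]
  have "(\<lambda>y::real. (0::real, y)) \<in> borel \<rightarrow>\<^sub>M borel" by measurable
  from measurable_compose[OF this F]
  have "(\<lambda>y. (LBINT s. indicator {-(N+1)..y} s * g s)) \<in> borel_measurable borel" by simp
  then show ?thesis unfolding V by simp
 qed
 have int: "integrable lborel (\<lambda>y. indicator {c..d} y * (cos (V y) * g y))" for c d
 proof (rule Bochner_Integration.integrable_bound[where f = "\<lambda>y. indicator {c..d} y * (k1 + k2 + k3)"])
  show "integrable lborel (\<lambda>y. indicator {c..d} y * (k1 + k2 + k3))"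
   by (intro integrable_mult_left integrable_real_indicator) (auto simp: emeasure_lborel_Icc_eq)
  show "(\<lambda>y. indicator {c..d} y * (cos (V y) * g y)) \<in> borel_measurable lborel" using Vm by measurable
  have "\<bar>cos (V y) * g y\<bar> \<le> 1 * (k1 + k2 + k3)" for y unfolding abs_mult
   using gb[of y] by (intro mult_mono) auto
  moreover have "0 \<le> k1 + k2 + k3" using k by auto
  ultimately show "AE x in lborel. norm (indicator {c..d} x * (cos (V x) * g x)) \<le> norm (indicator {c..d} x * (k1 + k2 + k3))"
   by (auto simp: indicator_def)
 qed
 have "(LBINT y. indicator B y * (cos (V y) * g y)) =
   (LBINT y. indicator {-(N+1)..y0} y * (cos (V y) * g y) + indicator {y1..N} y * (cos (V y) * g y))"
  by (rule Bochner_Integration.integral_cong) (use y in \<open>auto simp: g indicator_def\<close>)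
 also have "\<dots> = (sin (V y0) - sin (V (-(N+1)))) + (sin (V N) - sin (V y1))"
  unfolding e1[symmetric] e2[symmetric] by (rule Bochner_Integration.integral_add) (use int in auto)
 also have "\<dots> = 4" unfolding V0 V1 V2 V3 by simp
 finally show ?thesis .
qed

section \<open>Integrating the gain over all sections\<close>

lemma set_integrable_bounded:
 fixes f :: "'a::euclidean_space \<Rightarrow> real"
 assumes A[measurable]: "A \<in> sets borel" and fin: "emeasure lborel A < \<infinity>"
  and [measurable]: "f \<in> borel_measurable borel" and bd: "\<And>z. z \<in> A \<Longrightarrow> \<bar>f z\<bar> \<le> D"
 shows "set_integrable lborel A f"
 unfolding set_integrable_def
proof (rule Bochner_Integration.integrable_bound[where f = "\<lambda>y. indicator A y * D"])
 show "integrable lborel (\<lambda>y. indicator A y * D)" using fin by (intro integrable_mult_left integrable_real_indicator) auto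
 have "norm (indicator A x *\<^sub>R f x) \<le> norm (indicator A x * D)" for x
 proof (cases "x \<in> A")
  case True then show ?thesis using bd[OF True] by simp
 qed simp
 then show "AE x in lborel. norm (indicator A x *\<^sub>R f x) \<le> norm (indicator A x * D)" by simp
qed auto

text \<open>With a first component \<open>u\<close> and an amplitude \<open>a\<close> depending on x
  alone, the divergence is u' plus the weighted derivative of a sin W; Fubini's theorem leaves a
  one-dimensional gain on each section.\<close>

lemma slice_bound:
 assumes h: "half_le \<alpha> A C" "0 \<le> \<alpha>" and A[measurable]: "A \<in> sets borel" and fin: "emeasure lborel A < \<infinity>"
  and u: "\<And>x. (u has_real_derivative u' x) (at x)" "continuous_on UNIV u'"
  and a: "\<And>x. (a has_real_derivative a' x) (at x)" "continuous_on UNIV a'" and "0 < B"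
  and b: "\<And>x. (u x)\<^sup>2 + (a x)\<^sup>2 \<le> B\<^sup>2" "\<bar>u 0\<bar> \<le> B / 2"
  and M: "\<And>x. \<bar>x\<bar> > M \<Longrightarrow> a x = 0" and K: "\<And>x. \<bar>u' x\<bar> \<le> K"
  and g[measurable]: "g \<in> borel_measurable borel" and g': "\<And>z. \<bar>g z\<bar> \<le> G" "\<And>z. \<bar>fst z\<bar> \<ge> N \<or> \<bar>snd z\<bar> \<ge> N \<Longrightarrow> g z = 0" and "0 \<le> N"
  and W: "\<And>z. W z = - (pi / 2) + (LBINT s. indicator {- (N + 1)..snd z} s * g (fst z, s))"
 shows "(LBINT z:A. u' (fst z)) +
  (LBINT x. wt \<alpha> x * a x * (LBINT y. indicator A (x, y) * (cos (W (x, y)) * g (x, y)))) \<le> B * C"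
proof -
 have K0: "0 \<le> K" using K[of 0] by linarith
 have G0: "0 \<le> G" using g'(1)[of 0] by linarith
 have le: "(LBINT z:A. gdiv \<alpha> (\<lambda>z. u' (fst z)) (\<lambda>z. 0 * sin (W z) + a (fst z) * (cos (W z) * g z)) z) \<le> B * C"
  by (rule half_le_angle[OF h A fin grad_fst[OF u] grad_fst[OF a] \<open>0 < B\<close> _ _ _ _ _ g g' \<open>0 \<le> N\<close> W, of M K])
    (use b M K K0 in auto)
 have um[measurable]: "u' \<in> borel_measurable borel" using u(2) by (rule borel_measurable_continuous_onI)
 have ac: "continuous_on UNIV a" by (rule DERIV_imp_continuous_on[OF a(1)])
 have am[measurable]: "a \<in> borel_measurable borel" by (rule borel_measurable_continuous_onI[OF ac])
 have Wm[measurable]: "W \<in> borel_measurable borel" unfolding W by (intro borel_measurable_add borel_measurable_const borel_antiderivative g)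
 note [measurable] = wt_borel[OF \<open>0 \<le> \<alpha>\<close>]
 have ab: "\<bar>a x\<bar> \<le> B" for x
 proof -
  have "(a x)\<^sup>2 \<le> B\<^sup>2" using b(1)[of x] zero_le_power2[of "u x"] by linarith
  then show ?thesis using \<open>0 < B\<close> abs_le_square_iff[of "a x" B] by auto
 qed
 define Q where "Q z = wt \<alpha> (fst z) * (a (fst z) * (cos (W z) * g z))" for z
 have Qm[measurable]: "Q \<in> borel_measurable borel" unfolding Q_def[abs_def] by measurable
 have Qb: "\<bar>Q z\<bar> \<le> wt \<alpha> M * (B * (1 * G))" for z
 proof (cases "\<bar>fst z\<bar> > M")
  case True
  then show ?thesis using M[of "fst z"] \<open>0 < B\<close> G0 by (simp add: Q_def)
 next
  case False
  then have "wt \<alpha> (fst z) \<le> wt \<alpha> M" by (intro wt_mono[OF \<open>0 \<le> \<alpha>\<close>]) auto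
  then show ?thesis unfolding Q_def abs_mult using ab[of "fst z"] g'(1)[of z] \<open>0 < B\<close> G0
   by (intro mult_mono) auto
 qed
 have i1: "set_integrable lborel A (\<lambda>z. u' (fst z))"
  by (rule set_integrable_bounded[OF A fin _ K]) measurable
 have i2: "set_integrable lborel A Q"
  by (rule set_integrable_bounded[OF A fin _ Qb]) measurable
 have "(LBINT z:A. gdiv \<alpha> (\<lambda>z. u' (fst z)) (\<lambda>z. 0 * sin (W z) + a (fst z) * (cos (W z) * g z)) z) = (LBINT z:A. u' (fst z) + Q z)"
  by (simp add: gdiv_def Q_def)
 also have "\<dots> = (LBINT z:A. u' (fst z)) + (LBINT z:A. Q z)"
  by (rule set_integral_add(2)[OF i1 i2])
 also have "(LBINT z:A. Q z) = (LBINT x. wt \<alpha> x * a x * (LBINT y. indicator A (x, y) * (cos (W (x, y)) * g (x, y))))"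
 proof -
  have "integrable (lborel \<Otimes>\<^sub>M lborel) (\<lambda>z. indicator A z *\<^sub>R Q z)" using i2 unfolding set_integrable_def lborel_prod .
  from lborel_pair.integral_fst'[OF this]
  have "(LBINT z:A. Q z) = (\<integral>x. \<integral>y. indicator A (x, y) *\<^sub>R Q (x, y) \<partial>lborel \<partial>lborel)"
   unfolding set_int_def lborel_prod by simp
  also have "\<dots> = (\<integral>x. \<integral>y. wt \<alpha> x * a x * (indicator A (x, y) * (cos (W (x, y)) * g (x, y))) \<partial>lborel \<partial>lborel)"
   by (simp add: Q_def mult_ac)
  finally show ?thesis by simp
 qed
 finally show ?thesis using le by simp
qed

lemma section_borel [measurable]:
 assumes "A \<in> sets (borel :: plane measure)"
 shows "{y. (x, y) \<in> A} \<in> sets borel"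
proof -
 note [measurable] = assms
 show ?thesis by measurable
qed

lemma section_measure_borel:
 assumes A[measurable]: "A \<in> sets (borel :: plane measure)"
 shows "(\<lambda>x. emeasure lborel {y. (x, y) \<in> A}) \<in> borel_measurable borel"
  "(\<lambda>x. measure lborel {y. (x, y) \<in> A}) \<in> borel_measurable borel"
proof -
 have "A \<in> sets (borel \<Otimes>\<^sub>M lborel)" using A by (simp add: borel_prod[symmetric] cong: sets_pair_measure_cong)
 from lborel.measurable_emeasure_Pair[OF this]
 show "(\<lambda>x. emeasure lborel {y. (x, y) \<in> A}) \<in> borel_measurable borel" by (simp add: vimage_def)
 then show "(\<lambda>x. measure lborel {y. (x, y) \<in> A}) \<in> borel_measurable borel"
  unfolding measure_def by measurable
qed

text \<open>A gap in quantitative form: the three pieces have measure above \<kappa> inside a fixed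
  window, so the speeds \<pi>/b of the angle in \<open>two_jump_gain\<close> stay below
  \<pi>/\<kappa> uniformly in x.\<close>

abbreviation (input) section_gap :: "plane set \<Rightarrow> real \<Rightarrow> real \<Rightarrow> real \<Rightarrow> real \<Rightarrow> real \<Rightarrow> bool" where
 "section_gap A N y0 y1 \<kappa> x \<equiv> \<bar>x\<bar> < N \<and> measure lborel ({y. (x, y) \<in> A} \<inter> {-N<..<y0}) > \<kappa> \<and>
   measure lborel ({y0<..<y1} - {y. (x, y) \<in> A}) > \<kappa> \<and> measure lborel ({y. (x, y) \<in> A} \<inter> {y1<..<N}) > \<kappa>"

text \<open>Abscissae in \<open>X\<close> get the angle with two rises, the remaining ones the angle
  with one rise. Since the density of the angle must be bounded with bounded support, sections are
  truncated at \<open>N n\<close>; in the limit every section of positive measure is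
  reached.\<close>

lemma slices_lower:
 assumes h: "half_le \<alpha> A C" "0 \<le> \<alpha>" and A[measurable]: "A \<in> sets borel" and fin: "emeasure lborel A < \<infinity>"
  and u: "\<And>x. (u has_real_derivative u' x) (at x)" "continuous_on UNIV u'"
  and a: "\<And>x. (a has_real_derivative a' x) (at x)" "continuous_on UNIV a'" and "0 < B"
  and b: "\<And>x. (u x)\<^sup>2 + (a x)\<^sup>2 \<le> B\<^sup>2" "\<bar>u 0\<bar> \<le> B / 2"
  and M: "\<And>x. \<bar>x\<bar> > M \<Longrightarrow> a x = 0" and K: "\<And>x. \<bar>u' x\<bar> \<le> K"
  and X[measurable]: "X \<in> sets borel" and N0: "-N0 < y0" "y0 < y1" "y1 < N0" "0 < \<kappa>"
  and XX: "\<And>x. x \<in> X \<Longrightarrow> section_gap A N0 y0 y1 \<kappa> x"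
  and S: "S = (x_support A)"
 shows "(LBINT z:A. u' (fst z)) +
  (LBINT x. wt \<alpha> x * a x * (2 * indicator S x + 2 * indicator X x)) \<le> B * C"
proof -
 define sec where "sec x = {y. (x, y) \<in> A}" for x
 have sec[measurable]: "sec x \<in> sets borel" for x unfolding sec_def by measurable
 have msec: "(\<lambda>x. measure lborel (sec x \<inter> T)) \<in> borel_measurable borel" if [measurable]: "T \<in> sets borel" for T
 proof -
  have "A \<inter> {z. snd z \<in> T} \<in> sets borel" by measurable
  from section_measure_borel(2)[OF this] show ?thesis by (simp add: sec_def Int_def)
 qed
 have msec': "(\<lambda>x. measure lborel (T - sec x)) \<in> borel_measurable borel" if [measurable]: "T \<in> sets borel" for T
 proof -
  have "{z. snd z \<in> T \<and> z \<notin> A} \<in> sets borel" by measurable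
  from section_measure_borel(2)[OF this] show ?thesis by (simp add: sec_def set_diff_eq)
 qed
 have [measurable]: "S \<in> sets borel" unfolding S using section_measure_borel(1)[OF A] by measurable
 \<comment> \<open>The windows start beyond \<open>N0\<close>, so the gaps described by
   \<open>XX\<close> are seen in all of them.\<close>
 define N where "N n = N0 + real (Suc n)" for n
 have N: "N0 < N n" "0 < N n" for n using N0 by (auto simp: N_def)
 define b1 where "b1 n x = measure lborel (sec x \<inter> {-N n<..<y0})" for n x
 define b2 where "b2 x = measure lborel ({y0<..<y1} - sec x)" for x
 define b3 where "b3 n x = measure lborel (sec x \<inter> {y1<..<N n})" for n x
 define bN where "bN n x = measure lborel (sec x \<inter> {-N n<..<N n})" for n x
 note [measurable] = msec msec'
 have bm[measurable]: "b1 n \<in> borel_measurable borel" "b2 \<in> borel_measurable borel" "b3 n \<in> borel_measurable borel"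
   "bN n \<in> borel_measurable borel" for n
  unfolding b1_def[abs_def] b2_def[abs_def] b3_def[abs_def] bN_def[abs_def] by measurable
 have mono: "measure lborel (sec x \<inter> {c<..<d}) \<le> measure lborel (sec x \<inter> {c'<..<d'})" if "c' \<le> c" "d \<le> d'" "c' \<le> d'" for x c d c' d'
 proof (rule measure_mono_fmeasurable)
  show "sec x \<inter> {c'<..<d'} \<in> fmeasurable lborel"
   by (rule fmeasurableI, measurable) (rule le_less_trans[OF emeasure_mono[of _ "{c'<..<d'}"]], use that in auto)
 qed (use that in auto)
 have bX: "b1 n x > \<kappa>" "b2 x > \<kappa>" "b3 n x > \<kappa>" if "x \<in> X" for n x
  using XX[OF that, folded sec_def] mono[of "- N n" "- N0" y0 y0 x] mono[of y1 y1 N0 "N n" x] N[of n] N0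
  unfolding b1_def b2_def b3_def by auto
 \<comment> \<open>The threshold \<open>1 / N n\<close> bounds the speed of the angle by
   \<open>pi * N n\<close>; every section of positive measure exceeds it for large n.\<close>
 define SN where "SN n = {x. \<bar>x\<bar> < N n \<and> bN n x > 1 / N n}" for n
 have [measurable]: "SN n \<in> sets borel" for n unfolding SN_def by measurable
 define g where "g n z = (if fst z \<in> X then
    indicator (sec (fst z) \<inter> {-N n<..<y0}) (snd z) * (pi / b1 n (fst z)) - indicator ({y0<..<y1} - sec (fst z)) (snd z) * (pi / b2 (fst z))
    + indicator (sec (fst z) \<inter> {y1<..<N n}) (snd z) * (pi / b3 n (fst z))
   else if fst z \<in> SN n then indicator (sec (fst z) \<inter> {-N n<..<N n}) (snd z) * (pi / bN n (fst z)) else 0)" for n z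
 have ind: "indicator (sec (fst z) \<inter> T) (snd z) = (indicator (A \<inter> {z. snd z \<in> T}) z :: real)"
  "indicator (T - sec (fst z)) (snd z) = (indicator ({z. snd z \<in> T} - A) z :: real)" for z T
  by (auto simp: sec_def indicator_def)
 have gm[measurable]: "g n \<in> borel_measurable borel" for n unfolding g_def[abs_def] ind by measurable
 have gb: "\<bar>g n z\<bar> \<le> pi / \<kappa> + pi / \<kappa> + pi / \<kappa> + pi * N n" for n z
 proof -
  have "pi / b \<le> pi / \<kappa>" "0 \<le> pi / b" if "b > \<kappa>" for b using that N0 by (auto intro!: divide_left_mono)
  then have i1: "\<bar>indicator T y * (pi / b)\<bar> \<le> pi / \<kappa>" if "b > \<kappa>" for T b and y :: real using that N0 by (auto simp: indicator_def)
  have i2: "\<bar>indicator T y * (pi / b)\<bar> \<le> pi * N n" if "b > 1 / N n" for T b and y :: real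
  proof -
   have "0 < b" using that N[of n] by (meson divide_pos_pos less_trans zero_less_one)
   then have "1 / b \<le> N n" using that N[of n] by (simp add: divide_simps mult.commute)
   then have "pi * (1 / b) \<le> pi * N n" by (intro mult_left_mono) auto
   then show ?thesis using \<open>0 < b\<close> N[of n] by (auto simp: indicator_def)
  qed
  have nn: "0 \<le> pi / \<kappa>" "0 \<le> pi * N n" using N0 N[of n] by auto
  consider "fst z \<in> X" | "fst z \<notin> X" "fst z \<in> SN n" | "fst z \<notin> X" "fst z \<notin> SN n" by blast
  then show ?thesis
  proof cases
   case 1
   note bb = bX(1)[OF 1, of n] bX(2)[OF 1] bX(3)[OF 1, of n]
   have "g n z = indicator (sec (fst z) \<inter> {-N n<..<y0}) (snd z) * (pi / b1 n (fst z)) - indicator ({y0<..<y1} - sec (fst z)) (snd z) * (pi / b2 (fst z))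
    + indicator (sec (fst z) \<inter> {y1<..<N n}) (snd z) * (pi / b3 n (fst z))" using 1 by (simp add: g_def)
   then show ?thesis
    using i1[OF bb(1), of "sec (fst z) \<inter> {-N n<..<y0}" "snd z"]
     i1[OF bb(2), of "{y0<..<y1} - sec (fst z)" "snd z"]
     i1[OF bb(3), of "sec (fst z) \<inter> {y1<..<N n}" "snd z"] nn
    by linarith
  next
   case 2
   then have "bN n (fst z) > 1 / N n" by (simp add: SN_def)
   from i2[OF this, of "sec (fst z) \<inter> {-N n<..<N n}" "snd z"]
   show ?thesis using 2 nn by (simp add: g_def)
  next
   case 3
   then show ?thesis using nn by (simp add: g_def)
  qed
 qed
 have g0: "g n z = 0" if "\<bar>fst z\<bar> \<ge> N n \<or> \<bar>snd z\<bar> \<ge> N n" for n z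
 proof (cases "\<bar>fst z\<bar> \<ge> N n")
  case True
  then have "fst z \<notin> X" "fst z \<notin> SN n" using XX[of "fst z"] N[of n] by (auto simp: SN_def)
  then show ?thesis by (simp add: g_def)
 next
  case False
  then have "snd z \<le> - N n \<or> N n \<le> snd z" using that by auto
  then show ?thesis using N0 N[of n] by (auto simp: g_def indicator_def)
 qed
 define W where "W n z = - (pi / 2) + (LBINT s. indicator {- (N n + 1)..snd z} s * g n (fst z, s))" for n z
 define \<gamma> where "\<gamma> n x = (2 * indicator (SN n \<union> X) x + 2 * indicator X x :: real)" for n x
 have gain: "(LBINT y. indicator A (x, y) * (cos (W n (x, y)) * g n (x, y))) = \<gamma> n x" for n x
 proof -
  have e: "indicator A (x, y) = (indicator (sec x) y :: real)" for y by (simp add: sec_def indicator_def)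
  consider "x \<in> X" | "x \<notin> X" "x \<in> SN n" | "x \<notin> X" "x \<notin> SN n" by blast
  then show ?thesis
  proof cases
   case 1
   have "(LBINT y. indicator (sec x) y * (cos (W n (x, y)) * g n (x, y))) = 4"
    by (rule two_jump_gain[where N = "N n" and ?b1.0 = "b1 n x" and ?b2.0 = "b2 x" and ?b3.0 = "b3 n x"])
      (use N0 N[of n] bX(1)[OF 1, of n] bX(2)[OF 1] bX(3)[OF 1, of n] 1 in \<open>auto simp: b1_def b2_def b3_def g_def W_def\<close>)
   then show ?thesis using 1 by (simp add: e \<gamma>_def)
  next
   case 2
   have "0 < 1 / N n" using N[of n] by simp
   then have "bN n x > 0" using 2 unfolding SN_def by (metis (mono_tags, lifting) less_trans mem_Collect_eq)
   then have "(LBINT y. indicator (sec x) y * (cos (W n (x, y)) * g n (x, y))) = 2"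
    by (intro one_jump_gain[where N = "N n"])
      (use N[of n] 2 in \<open>auto simp: bN_def g_def W_def\<close>)
   then show ?thesis using 2 by (simp add: e \<gamma>_def)
  next
   case 3
   then show ?thesis by (simp add: \<gamma>_def g_def)
  qed
 qed
 have le: "(LBINT z:A. u' (fst z)) + (LBINT x. wt \<alpha> x * a x * \<gamma> n x) \<le> B * C" for n
  unfolding gain[symmetric]
  by (rule slice_bound[OF h A fin u a \<open>0 < B\<close> b M K gm gb g0]) (use N[of n] in \<open>auto simp: W_def\<close>)
 have ac: "continuous_on UNIV a" by (rule DERIV_imp_continuous_on[OF a(1)])
 have am[measurable]: "a \<in> borel_measurable borel" by (rule borel_measurable_continuous_onI[OF ac])
 note [measurable] = wt_borel[OF \<open>0 \<le> \<alpha>\<close>]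
 have ab: "\<bar>a x\<bar> \<le> B" for x
 proof -
  have "(a x)\<^sup>2 \<le> B\<^sup>2" using b(1)[of x] zero_le_power2[of "u x"] by linarith
  then show ?thesis using \<open>0 < B\<close> abs_le_square_iff[of "a x" B] by auto
 qed
 have restr: "(LBINT x. wt \<alpha> x * a x * f x) = (LBINT x:{-M..M}. wt \<alpha> x * a x * f x)" for f
  unfolding set_int_def
 proof (rule Bochner_Integration.integral_cong)
  fix x show "wt \<alpha> x * a x * f x = indicator {-M..M} x *\<^sub>R (wt \<alpha> x * a x * f x)"
   using M[of x] by (cases "\<bar>x\<bar> > M") (auto simp: indicator_def abs_le_iff)
 qed simp
 have \<gamma>lim: "(\<lambda>n. \<gamma> n x) \<longlonglongrightarrow> 2 * indicator S x + 2 * indicator X x" for x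
 proof (cases "x \<in> S")
  case False
  have "emeasure lborel (sec x \<inter> T) = 0" if "T \<in> sets borel" for T
   using False emeasure_mono[of "sec x \<inter> T" "sec x" lborel] unfolding S sec_def[symmetric] by simp
  then have "measure lborel (sec x \<inter> T) = 0" if "T \<in> sets borel" for T
   using that by (simp add: measure_def)
  then have "bN n x = 0" "b1 n x = 0" for n by (auto simp: bN_def b1_def)
  then have "x \<notin> SN n" "x \<notin> X" for n using N[of n] bX(1)[of x n] N0 by (auto simp: SN_def not_less)
  then show ?thesis using False by (simp add: \<gamma>_def)
 next
  case True
  have "\<exists>k. emeasure lborel (sec x \<inter> {-real k<..<real k}) \<noteq> 0"
  proof (rule ccontr)
   assume "\<not> ?thesis"
   then have "sec x \<inter> {-real k<..<real k} \<in> null_sets lborel" for k by (intro null_setsI) auto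
   then have "(\<Union>k. sec x \<inter> {-real k<..<real k}) \<in> null_sets lborel" by (intro null_sets_UN)
   moreover have "(\<Union>k. sec x \<inter> {-real k<..<real k}) = sec x"
   proof -
    have "y \<in> (\<Union>k. sec x \<inter> {-real k<..<real k})" if "y \<in> sec x" for y
     using reals_Archimedean2[of "\<bar>y\<bar>"] that by (auto simp: abs_less_iff minus_less_iff)
    then show ?thesis by blast
   qed
   ultimately show False using True unfolding S sec_def[symmetric] by auto
  qed
  then obtain k where k: "emeasure lborel (sec x \<inter> {-real k<..<real k}) \<noteq> 0" by blast
  define c where "c = measure lborel (sec x \<inter> {-real k<..<real k})"
  have "emeasure lborel (sec x \<inter> {-real k<..<real k}) < \<infinity>"
   by (rule le_less_trans[OF emeasure_mono[of _ "{-real k<..<real k}"]]) auto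
  then have c: "c > 0" using k unfolding c_def
   by (simp add: measure_def enn2real_positive_iff zero_less_iff_neq_zero)
  obtain n0 where n0: "real n0 > \<bar>x\<bar> + real k + 1 / c + \<bar>N0\<bar>" using reals_Archimedean2 by blast
  have "\<forall>\<^sub>F n in sequentially. \<gamma> n x = 2 * indicator S x + 2 * indicator X x"
   unfolding eventually_sequentially
  proof (intro exI[of _ n0] allI impI)
   fix n assume "n0 \<le> n"
   then have "N n > \<bar>x\<bar> + real k + 1 / c" using n0 by (auto simp: N_def)
   then have l: "N n > \<bar>x\<bar>" "N n \<ge> real k" "N n > 1 / c"
    using c zero_less_divide_1_iff[of c] by (auto simp: add.assoc intro: less_trans)
     (smt (verit, best) of_nat_0_le_iff zero_less_divide_1_iff)+
   have "bN n x \<ge> c" unfolding bN_def c_def by (rule mono) (use l N[of n] in auto)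
   moreover have "c > 1 / N n" using l(3) c N[of n] by (simp add: divide_simps mult.commute)
   ultimately have "x \<in> SN n" using l(1) by (simp add: SN_def)
   then show "\<gamma> n x = 2 * indicator S x + 2 * indicator X x" using True by (simp add: \<gamma>_def)
  qed
  then show ?thesis by (rule tendsto_eventually)
 qed
 have "(\<lambda>n. LBINT x:{-M..M}. wt \<alpha> x * a x * \<gamma> n x) \<longlonglongrightarrow>
   (LBINT x:{-M..M}. wt \<alpha> x * a x * (2 * indicator S x + 2 * indicator X x))"
 proof (rule bounded_convergence[where D = "wt \<alpha> M * B * 4"])
  fix n x assume "x \<in> {-M..M}"
  then have "wt \<alpha> x \<le> wt \<alpha> M" by (intro wt_mono[OF \<open>0 \<le> \<alpha>\<close>]) auto
  then show "\<bar>wt \<alpha> x * a x * \<gamma> n x\<bar> \<le> wt \<alpha> M * B * 4"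
   unfolding abs_mult using ab[of x] \<open>0 < B\<close> by (intro mult_mono) (auto simp: \<gamma>_def indicator_def)
 next
  show "AE x in lborel. x \<in> {-M..M} \<longrightarrow> (\<lambda>n. wt \<alpha> x * a x * \<gamma> n x) \<longlonglongrightarrow>
    wt \<alpha> x * a x * (2 * indicator S x + 2 * indicator X x)"
   by (intro AE_I2 impI tendsto_mult tendsto_const \<gamma>lim)
 qed (auto simp: emeasure_lborel_Icc_eq \<gamma>_def[abs_def])
 then have "(\<lambda>n. (LBINT z:A. u' (fst z)) + (LBINT x. wt \<alpha> x * a x * \<gamma> n x)) \<longlonglongrightarrow>
  (LBINT z:A. u' (fst z)) + (LBINT x. wt \<alpha> x * a x * (2 * indicator S x + 2 * indicator X x))"
  unfolding restr by (intro tendsto_intros)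
 then show ?thesis using le by (intro LIMSEQ_le_const2) auto
qed

section \<open>The distribution function of the set of abscissae\<close>

text \<open>\<open>h n\<close> are continuous densities for the indicator of \<open>T\<close> and
  \<open>H n\<close> their primitives, smooth substitutes for the measure of
  \<open>T \<inter> {..x}\<close>. The condition \<open>H n 0 = 0\<close> keeps the first component
  of the field at exactly -1/2 on the axis.\<close>

definition approximates_indicator :: "real set \<Rightarrow> real \<Rightarrow> (nat \<Rightarrow> real \<Rightarrow> real) \<Rightarrow> (nat \<Rightarrow> real \<Rightarrow> real) \<Rightarrow> bool" where
 "approximates_indicator T M h H \<longleftrightarrow> (\<forall>n. continuous_on UNIV (h n)) \<and>
   (\<forall>n x. (H n has_real_derivative h n x) (at x)) \<and> (\<forall>n x. 0 \<le> h n x) \<and> (\<forall>n x. h n x \<le> 1) \<and>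
   (AE x in lborel. (\<lambda>n. h n x) \<longlonglongrightarrow> indicator T x) \<and> (\<forall>n. H n 0 = 0) \<and>
   (\<forall>x. (\<lambda>n. H n x) \<longlonglongrightarrow> measure lborel (T \<inter> {..x})) \<and> (\<forall>n x. 0 \<le> H n x) \<and>
   (\<forall>n x. H n x \<le> H n (M + 1)) \<and> (\<forall>n x. H n x \<le> M + 1)"

lemma indicator_approximation:
 fixes T :: "real set"
 assumes T[measurable]: "T \<in> sets borel" "T \<subseteq> {0<..<M}" and "0 < M"
 shows "\<exists>h H. approximates_indicator T M h H"
proof -
 obtain h0 where h0: "\<And>n::nat. continuous_on UNIV (h0 n)" "\<And>n x. 0 \<le> h0 n x" "\<And>n x. h0 n x \<le> 1"
  "AE x in lborel. (\<lambda>n. h0 n x) \<longlonglongrightarrow> (indicator T x :: real)"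
  using continuous_approximation[of "indicator T" 0 1] by auto
 \<comment> \<open>The factor removes the density outside the interval from 0 to M + 1 and becomes 1
   at each point of \<open>T\<close>; hence \<open>H n\<close> vanishes on the left of 0 and is
   constant on the right of M + 1.\<close>
 define k where "k n x = max 0 (min 1 (real (Suc n) * x)) * max 0 (min 1 (M + 1 - x))" for n x
 have k: "0 \<le> k n x" "k n x \<le> 1" for n x unfolding k_def by (auto intro!: mult_le_one)
 define h where "h n x = h0 n x * k n x" for n x
 have hc: "continuous_on S (h n)" for S n unfolding h_def k_def
  by (intro continuous_intros continuous_on_subset[OF h0(1)]) auto
 have hp: "0 \<le> h n x" for n x unfolding h_def using h0(2) k by auto
 have h1: "h n x \<le> 1" for n x unfolding h_def using h0(2,3) k by (auto intro!: mult_le_one)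
 have hz: "h n x = 0" if "x \<le> 0 \<or> M + 1 \<le> x" for n x
 proof -
  have "x \<le> 0 \<Longrightarrow> real (Suc n) * x \<le> 0" by (rule mult_nonneg_nonpos) auto
  then have "k n x = 0" using that unfolding k_def by (auto simp del: of_nat_Suc)
  then show ?thesis by (simp add: h_def)
 qed
 have hi: "isCont (h n) x" for n x using hc continuous_on_eq_continuous_at[OF open_UNIV] by blast
 have hlim: "AE x in lborel. (\<lambda>n. h n x) \<longlonglongrightarrow> indicator T x"
  using h0(4)
 proof eventually_elim
  fix x assume l: "(\<lambda>n. h0 n x) \<longlonglongrightarrow> indicator T x"
  show "(\<lambda>n. h n x) \<longlonglongrightarrow> indicator T x"
  proof (cases "x \<in> T")
   case True
   then have x: "0 < x" "x < M" using T(2) by auto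
   obtain n0 where n0: "1 / real (Suc n0) < x" using nat_approx_posE[OF x(1)] by blast
   have "\<forall>\<^sub>F n in sequentially. h0 n x = h n x"
    unfolding eventually_sequentially
   proof (intro exI[of _ n0] allI impI)
    fix n assume "n0 \<le> n"
    then have "1 / real (Suc n) \<le> 1 / real (Suc n0)" by (simp add: divide_simps)
    then have "1 / real (Suc n) < x" using n0 by linarith
    then have "1 \<le> real (Suc n) * x" by (simp add: divide_simps mult.commute del: of_nat_Suc)
    then have "k n x = 1" using x unfolding k_def by (simp add: max_def min_def del: of_nat_Suc)
    then show "h0 n x = h n x" by (simp add: h_def)
   qed
   then show ?thesis using l by (rule Lim_transform_eventually[rotated])
  next
   case False
   then have "(\<lambda>n. h0 n x) \<longlonglongrightarrow> 0" using l by simp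
   then have "(\<lambda>n. h n x) \<longlonglongrightarrow> 0"
    by (rule Lim_null_comparison[rotated])
      (use h0(2) k in \<open>auto intro!: always_eventually simp: h_def abs_mult mult_left_le\<close>)
   then show ?thesis using False by simp
  qed
 qed
 have "\<exists>F. \<forall>x. (F has_real_derivative h n x) (at x)" for n
  using continuous_antiderivative[OF hc] by metis
 then obtain F where F: "\<And>n x. (F n has_real_derivative h n x) (at x)" by metis
 define H where "H n x = F n x - F n 0" for n x
 have Hd: "(H n has_real_derivative h n x) (at x)" for n x
  unfolding H_def[abs_def] by (auto intro!: derivative_eq_intros F)
 have H0: "H n 0 = 0" for n by (simp add: H_def)
 have mono: "H n x \<le> H n y" if "x \<le> y" for n x y
  by (rule DERIV_nonneg_imp_nondecreasing[OF that]) (use Hd hp in blast)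
 have FTC: "(LBINT s:{x..y}. h n s) = H n y - H n x" if "x \<le> y" for n x y
  using integral_FTC_Icc_real[OF that Hd hi] unfolding set_int_def by (simp add: mult.commute)
 have Hneg: "H n x = 0" if "x \<le> 0" for n x
 proof -
  have "(LBINT s:{x..0}. h n s) = (LBINT s:{x..0}. 0)" by (rule set_lebesgue_integral_cong) (auto simp: hz)
  then show ?thesis using FTC[OF that, of n] H0 by simp
 qed
 have Hbig: "H n x = H n (M + 1)" if "M + 1 \<le> x" for n x
 proof -
  have "(LBINT s:{M+1..x}. h n s) = (LBINT s:{M+1..x}. 0)" by (rule set_lebesgue_integral_cong) (auto simp: hz)
  then show ?thesis using FTC[OF that, of n] by simp
 qed
 have [measurable]: "h n \<in> borel_measurable borel" for n by (rule borel_measurable_continuous_onI[OF hc])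
 have Hlim: "(\<lambda>n. H n x) \<longlonglongrightarrow> measure lborel (T \<inter> {..x})" for x
 proof (cases "x \<le> 0")
  case True
  then have "T \<inter> {..x} = {}" using T(2) by auto
  then show ?thesis using Hneg[OF True] by simp
 next
  case False
  then have x: "0 \<le> x" by simp
  have "(\<lambda>n. LBINT s:{0..x}. h n s) \<longlonglongrightarrow> (LBINT s:{0..x}. indicator T s)"
   by (rule bounded_convergence[where D = 1]) (use hlim hp h1 in \<open>auto simp: emeasure_lborel_Icc_eq\<close>)
  moreover have "(LBINT s:{0..x}. (indicator T s :: real)) = measure lborel (T \<inter> {..x})"
  proof -
   have "(LBINT s:{0..x}. (indicator T s :: real)) = (LBINT s. indicator (T \<inter> {..x}) s)"
    unfolding set_int_def
    by (rule Bochner_Integration.integral_cong) (use T(2) in \<open>auto simp: indicator_def\<close>)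
   then show ?thesis by simp
  qed
  ultimately show ?thesis unfolding FTC[OF x] H0 by simp
 qed
 have up: "H n x \<le> H n (M + 1)" for n x using mono[of x "M + 1" n] Hbig[of x n] by (cases "x \<le> M + 1") auto
 have Hb: "H n (M + 1) \<le> M + 1" for n
 proof -
  have "(LBINT s:{0..M+1}. h n s) \<le> (LBINT s:{0..M+1}. 1)"
   by (rule set_integral_mono) (auto intro!: set_integrable_bounded[where D = 1] simp: hp h1 emeasure_lborel_Icc_eq abs_le_iff order_trans[OF _ hp])
  also have "\<dots> = M + 1" using \<open>0 < M\<close> by (simp add: set_int_def)
  finally show ?thesis using FTC[of 0 "M + 1" n] \<open>0 < M\<close> H0 by simp
 qed
 have Hp: "0 \<le> H n x" for n x using mono[of 0 x n] H0[of n] Hneg[of x n] by (cases "0 \<le> x") auto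
 have "approximates_indicator T M h H"
  unfolding approximates_indicator_def
  using hc Hd hp h1 hlim H0 Hlim Hp up order_trans[OF up Hb] by (intro conjI allI) auto
 then show ?thesis by blast
qed

text \<open>The distribution function carries Lebesgue measure on \<open>T\<close> to Lebesgue
  measure on an interval of the same length. For a primitive \<open>K\<close> of \<open>k\<close>
  this is the fundamental theorem applied to \<open>K (H n x)\<close>, followed by a limit.\<close>

lemma integral_distribution_function:
 fixes T :: "real set" and k :: "real \<Rightarrow> real"
 assumes T[measurable]: "T \<in> sets borel" "T \<subseteq> {0<..<M}" and "0 < M" and k: "continuous_on UNIV k"
 shows "(LBINT x:T. k (measure lborel (T \<inter> {..x}))) = (LBINT s:{0..measure lborel T}. k s)"
proof -
 obtain h H where hH: "approximates_indicator T M h H"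
  using indicator_approximation[OF T \<open>0 < M\<close>] by blast
 have h: "\<And>n::nat. continuous_on UNIV (h n)" "\<And>n x. (H n has_real_derivative h n x) (at x)"
  "\<And>n x. 0 \<le> h n x" "\<And>n x. h n x \<le> 1" "AE x in lborel. (\<lambda>n. h n x) \<longlonglongrightarrow> indicator T x"
  "\<And>n. H n 0 = 0" "\<And>x. (\<lambda>n. H n x) \<longlonglongrightarrow> measure lborel (T \<inter> {..x})"
  "\<And>n x. 0 \<le> H n x" "\<And>n x. H n x \<le> H n (M + 1)" "\<And>n x. H n x \<le> M + 1"
  using hH unfolding approximates_indicator_def by blast+
 obtain K where K: "\<And>x. (K has_real_derivative k x) (at x)" using continuous_antiderivative[OF k] by metis
 have Hc: "continuous_on S (H n)" for S n by (rule DERIV_imp_continuous_on[OF h(2)])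
 have [measurable]: "h n \<in> borel_measurable borel" "H n \<in> borel_measurable borel" "k \<in> borel_measurable borel" for n
  using h(1) Hc k by (auto intro: borel_measurable_continuous_onI)
 define t where "t x = measure lborel (T \<inter> {..x})" for x
 have [measurable]: "t \<in> borel_measurable borel" unfolding t_def[abs_def]
  by (rule borel_measurable_LIMSEQ_real[OF h(7)]) measurable
 have eq: "(LBINT x:{0..M+1}. k (H n x) * h n x) = K (H n (M+1)) - K 0" for n
 proof -
  have "((\<lambda>x. K (H n x)) has_real_derivative k (H n x) * h n x) (at x)" for x
   by (rule DERIV_chain2[OF K h(2)])
  moreover have "isCont (\<lambda>x. k (H n x) * h n x) x" for x
  proof -
   have "continuous_on UNIV (\<lambda>x. k (H n x) * h n x)" by (intro continuous_intros h(1) continuous_on_compose2[OF k Hc]) auto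
   then show ?thesis using continuous_on_eq_continuous_at[OF open_UNIV] by blast
  qed
  ultimately have "(LBINT x. (k (H n x) * h n x) * indicator {0..M+1} x) = K (H n (M+1)) - K (H n 0)"
   using \<open>0 < M\<close> by (intro integral_FTC_Icc_real[of 0 "M + 1" "\<lambda>x. K (H n x)"]) auto
  then show ?thesis unfolding set_int_def by (simp add: mult.commute h(6))
 qed
 have "bounded (k ` {0..M+1})"
  by (intro compact_imp_bounded compact_continuous_image continuous_on_subset[OF k]) auto
 then obtain D where D: "\<forall>s\<in>{0..M+1}. \<bar>k s\<bar> \<le> D" by (auto simp: bounded_iff)
 then have D0: "0 \<le> D" using \<open>0 < M\<close> by (metis abs_ge_zero atLeastAtMost_iff add_nonneg_nonneg less_imp_le order_trans zero_le_one order_refl)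
 have kc: "isCont k s" for s using k continuous_on_eq_continuous_at[OF open_UNIV] by blast
 have "(\<lambda>n. LBINT x:{0..M+1}. k (H n x) * h n x) \<longlonglongrightarrow> (LBINT x:{0..M+1}. k (t x) * indicator T x)"
 proof (rule bounded_convergence[where D = D])
  show "\<bar>k (H n x) * h n x\<bar> \<le> D" for n x
   using D h(3,4,8,10)[of n x] D0 mult_mono[of "\<bar>k (H n x)\<bar>" D "\<bar>h n x\<bar>" 1] by (simp add: abs_mult)
  show "AE x in lborel. x \<in> {0..M+1} \<longrightarrow> (\<lambda>n. k (H n x) * h n x) \<longlonglongrightarrow> k (t x) * indicator T x"
   using h(5)
  proof eventually_elim
   fix x assume "(\<lambda>n. h n x) \<longlonglongrightarrow> indicator T x"
   then show "x \<in> {0..M+1} \<longrightarrow> (\<lambda>n. k (H n x) * h n x) \<longlonglongrightarrow> k (t x) * indicator T x"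
    using isCont_tendsto_compose[OF kc h(7)[of x]] unfolding t_def by (auto intro!: tendsto_intros)
  qed
 qed (auto simp: emeasure_lborel_Icc_eq)
 moreover have "(\<lambda>n. K (H n (M+1)) - K 0) \<longlonglongrightarrow> K (measure lborel T) - K 0"
 proof -
  have "T \<inter> {..M+1} = T" using T(2) by auto
  then have "(\<lambda>n. H n (M+1)) \<longlonglongrightarrow> measure lborel T" using h(7)[of "M+1"] by simp
  then show ?thesis by (intro tendsto_intros isCont_tendsto_compose[OF DERIV_isCont[OF K]])
 qed
 ultimately have "(LBINT x:{0..M+1}. k (t x) * indicator T x) = K (measure lborel T) - K 0"
  unfolding eq using LIMSEQ_unique by blast
 moreover have "(LBINT x:{0..M+1}. k (t x) * indicator T x) = (LBINT x:T. k (t x))"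
  unfolding set_int_def
  by (rule Bochner_Integration.integral_cong) (use T(2) in \<open>auto simp: indicator_def\<close>)
 moreover have "(LBINT s:{0..measure lborel T}. k s) = K (measure lborel T) - K 0"
  using integral_FTC_Icc_real[of 0 "measure lborel T" K k] K kc unfolding set_int_def by (simp add: mult.commute)
 ultimately show ?thesis unfolding t_def by simp
qed

section \<open>The calibrating field\<close>

text \<open>The condition \<mu> |T| \<le> 3/2 keeps \<mu> t - 1/2 between -1/2 and 1, so the value
  on the axis is admissible and the square root is real. At u = 1 the root is not differentiable;
  the field is therefore built in a ball of radius sqrt (1 + \<delta>), which multiplies
  \<open>C\<close> by this radius until \<delta> tends to 0.\<close>

lemma slices_calibration:
 assumes h: "half_le \<alpha> A C" "0 \<le> \<alpha>" and A[measurable]: "A \<in> sets borel" and fin: "emeasure lborel A < \<infinity>"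
  and S: "S = (x_support A)" and T: "T = S \<inter> {0<..<M}" and "0 < M"
  and X[measurable]: "X \<in> sets borel" and N0: "-N0 < y0" "y0 < y1" "y1 < N0" "0 < \<kappa>"
  and XX: "\<And>x. x \<in> X \<Longrightarrow> section_gap A N0 y0 y1 \<kappa> x"
  and XT: "X \<subseteq> T" and lam: "0 < \<mu>" "\<mu> * measure lborel T \<le> 3 / 2"
 shows "\<mu> * (LBINT z:A. indicator T (fst z)) +
   2 * (LBINT x:T. wt \<alpha> x * sqrt (1 - (\<mu> * measure lborel (T \<inter> {..x}) - 1 / 2)\<^sup>2)) +
   2 * (LBINT x:X. wt \<alpha> x * sqrt (1 - (\<mu> * measure lborel (T \<inter> {..x}) - 1 / 2)\<^sup>2)) \<le> C"
  (is "?L \<le> C")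
proof -
 have Sm[measurable]: "S \<in> sets borel" unfolding S using section_measure_borel(1)[OF A] by measurable
 have Tm[measurable]: "T \<in> sets borel" unfolding T by measurable
 have TM: "T \<subseteq> {0<..<M}" unfolding T by auto
 note [measurable] = wt_borel[OF \<open>0 \<le> \<alpha>\<close>]
 obtain h H where hH: "approximates_indicator T M h H"
  using indicator_approximation[OF Tm TM \<open>0 < M\<close>] by blast
 have h: "\<And>n::nat. continuous_on UNIV (h n)" "\<And>n x. (H n has_real_derivative h n x) (at x)"
  "\<And>n x. 0 \<le> h n x" "\<And>n x. h n x \<le> 1" "AE x in lborel. (\<lambda>n. h n x) \<longlonglongrightarrow> indicator T x"
  "\<And>n. H n 0 = 0" "\<And>x. (\<lambda>n. H n x) \<longlonglongrightarrow> measure lborel (T \<inter> {..x})"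
  "\<And>n x. 0 \<le> H n x" "\<And>n x. H n x \<le> H n (M + 1)" "\<And>n x. H n x \<le> M + 1"
  using hH unfolding approximates_indicator_def by blast+
 have Hc: "continuous_on S (H n)" for S n by (rule DERIV_imp_continuous_on[OF h(2)])
 have [measurable]: "h n \<in> borel_measurable borel" "H n \<in> borel_measurable borel" for n
  using h(1) Hc by (auto intro: borel_measurable_continuous_onI)
 define t where "t x = measure lborel (T \<inter> {..x})" for x
 have tm[measurable]: "t \<in> borel_measurable borel" unfolding t_def[abs_def]
  by (rule borel_measurable_LIMSEQ_real[OF h(7)]) measurable
 have Tfin: "T \<in> fmeasurable lborel"
  by (rule fmeasurableI, measurable) (rule le_less_trans[OF emeasure_mono[OF TM]], use \<open>0 < M\<close> in auto)
 have t0: "0 \<le> t x" "t x \<le> measure lborel T" for x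
  unfolding t_def using measure_mono_fmeasurable[OF _ _ Tfin, of "T \<inter> {..x}"] by auto
 define u where "u x = \<mu> * t x - 1 / 2" for x
 have u: "- (1/2) \<le> u x" "u x \<le> 1" for x
 proof -
  have "\<mu> * t x \<le> \<mu> * measure lborel T" "0 \<le> \<mu> * t x" using t0[of x] lam by (auto intro!: mult_left_mono)
  then show "- (1/2) \<le> u x" "u x \<le> 1" using lam(2) unfolding u_def by linarith+
 qed
 have u2: "(u x)\<^sup>2 \<le> 1" for x using u[of x] by (simp add: abs_square_le_1 abs_le_iff)
 \<comment> \<open>A plateau equal to 1 over the interval from 0 to M, which contains
   \<open>T\<close>; it makes the second component vanish for large x as \<open>slices_lower\<close>
   demands.\<close>
 define pl where "pl x = ramp (x + 1) * ramp (M + 1 - x)" for x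
 define pl' where "pl' x = ramp' (x + 1) * ramp (M + 1 - x) - ramp (x + 1) * ramp' (M + 1 - x)" for x
 have rc: "continuous_on S ramp" for S by (rule DERIV_imp_continuous_on[OF ramp_DERIV])
 have plc: "continuous_on UNIV pl" unfolding pl_def[abs_def]
  by (intro continuous_intros continuous_on_compose2[OF rc]) auto
 have plc': "continuous_on UNIV pl'"
  unfolding pl'_def[abs_def]
  by (intro continuous_intros continuous_on_compose2[OF ramp'_continuous] continuous_on_compose2[OF rc]) auto
 have pld: "(pl has_real_derivative pl' x) (at x)" for x
  unfolding pl_def[abs_def] pl'_def by (auto intro!: derivative_eq_intros DERIV_chain2[OF ramp_DERIV])
 have plb: "0 \<le> pl x" "pl x \<le> 1" for x unfolding pl_def using ramp_simps(1,2) by (auto intro!: mult_le_one)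
 have pl0: "pl x = 0" if "M + 1 < \<bar>x\<bar>" for x
 proof -
  have "x + 1 \<le> 0 \<or> M + 1 - x \<le> 0" using that \<open>0 < M\<close> by linarith
  then show ?thesis unfolding pl_def using ramp_simps(3) by auto
 qed
 have pl1: "pl x = 1" if "0 \<le> x" "x \<le> M" for x
  unfolding pl_def using that ramp_simps(4)[of "x + 1"] ramp_simps(4)[of "M + 1 - x"] by auto
 have [measurable]: "pl \<in> borel_measurable borel" by (rule borel_measurable_continuous_onI[OF plc])
 have main: "?L \<le> sqrt (1 + \<delta>) * C" if \<delta>: "0 < \<delta>" "\<delta> \<le> 1" for \<delta>
 proof -
  define un where "un n x = \<mu> * H n x - 1 / 2" for n x
  define an where "an n x = pl x * sqrt (1 + \<delta> - (un n x)\<^sup>2)" for n x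
  define an' where "an' n x = pl' x * sqrt (1 + \<delta> - (un n x)\<^sup>2)
    + pl x * (inverse (sqrt (1 + \<delta> - (un n x)\<^sup>2)) / 2 * (- (2 * un n x * (\<mu> * h n x))))" for n x
  have "(\<lambda>n. \<mu> * H n (M + 1)) \<longlonglongrightarrow> \<mu> * measure lborel T"
  proof -
   have "T \<inter> {..M+1} = T" using TM by auto
   then have "(\<lambda>n. H n (M+1)) \<longlonglongrightarrow> measure lborel T" using h(7)[of "M+1"] by simp
   then show ?thesis by (intro tendsto_intros)
  qed
  then have "\<forall>\<^sub>F n in sequentially. \<mu> * H n (M + 1) < 3 / 2 + \<delta> / 8"
   by (rule order_tendstoD(2)) (use lam \<delta> in auto)
  \<comment> \<open>The total mass of \<open>h n\<close> may exceed that of \<open>T\<close>; from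
    \<open>n0\<close> on the excess stays within the tolerance \<delta>/8 of
    \<open>square_near_one\<close>.\<close>
  then obtain n0 where n0: "\<And>n. n0 \<le> n \<Longrightarrow> \<mu> * H n (M + 1) < 3 / 2 + \<delta> / 8"
   unfolding eventually_sequentially by blast
  have un: "(un n x)\<^sup>2 \<le> 1 + \<delta> / 2" if "n0 \<le> n" for n x
  proof -
   have "\<mu> * H n x \<le> 3 / 2 + \<delta> / 8" using n0[OF that] mult_left_mono[OF h(9)[of n x], of \<mu>] lam by linarith
   moreover have "0 \<le> \<mu> * H n x" using h(8)[of n x] lam by simp
   ultimately have "\<bar>un n x\<bar> \<le> 1 + \<delta> / 8" unfolding un_def using \<delta> by linarith
   then show ?thesis using square_near_one[of \<delta> "un n x"] \<delta> by simp
  qed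
  have pos: "0 < 1 + \<delta> - (un n x)\<^sup>2" if "n0 \<le> n" for n x using un[OF that, of x] \<delta> by linarith
  have und: "(un n has_real_derivative \<mu> * h n x) (at x)" for n x
   unfolding un_def[abs_def] by (auto intro!: derivative_eq_intros h(2))
  have unc: "continuous_on UNIV (un n)" for n unfolding un_def[abs_def] by (intro continuous_intros Hc)
  have ad: "(an n has_real_derivative an' n x) (at x)" if "n0 \<le> n" for n x
  proof -
   have "((\<lambda>x. 1 + \<delta> - (un n x)\<^sup>2) has_real_derivative - (2 * un n x * (\<mu> * h n x))) (at x)"
    by (auto intro!: derivative_eq_intros und)
   from DERIV_chain2[OF DERIV_real_sqrt[OF pos[OF that]] this]
   have "((\<lambda>x. sqrt (1 + \<delta> - (un n x)\<^sup>2)) has_real_derivative inverse (sqrt (1 + \<delta> - (un n x)\<^sup>2)) / 2 * - (2 * un n x * (\<mu> * h n x))) (at x)" .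
   from DERIV_mult'[OF pld this] show ?thesis unfolding an_def[abs_def] an'_def by (simp add: algebra_simps)
  qed
  have ac: "continuous_on UNIV (an' n)" if "n0 \<le> n" for n
   unfolding an'_def[abs_def] using pos[OF that]
   by (intro continuous_intros plc plc' unc h(1)) (auto simp: less_imp_neq[symmetric] less_imp_neq dest: less_imp_neq)
  have sb: "sqrt (1 + \<delta>) > 0" "1 \<le> sqrt (1 + \<delta>)" "(sqrt (1 + \<delta>))\<^sup>2 = 1 + \<delta>" "sqrt (1 + \<delta>) \<le> 2"
  proof -
   show "sqrt (1 + \<delta>) \<le> 2" by (rule real_le_lsqrt) (use \<delta> in auto)
  qed (use \<delta> in auto)
  have ab: "0 \<le> an n x" "an n x \<le> sqrt (1 + \<delta>)" if "n0 \<le> n" for n x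
  proof -
   show "0 \<le> an n x" unfolding an_def using pos[OF that, of x] plb by (intro mult_nonneg_nonneg) auto
   have "an n x \<le> 1 * sqrt (1 + \<delta>)" unfolding an_def using pos[OF that, of x] plb by (intro mult_mono) auto
   then show "an n x \<le> sqrt (1 + \<delta>)" by simp
  qed
  have le: "(LBINT z:A. \<mu> * h n (fst z)) +
    (LBINT x. wt \<alpha> x * an n x * (2 * indicator S x + 2 * indicator X x)) \<le> sqrt (1 + \<delta>) * C" if n: "n0 \<le> n" for n
  proof (rule slices_lower[OF assms(1,2) A fin und _ ad[OF n] ac[OF n] sb(1) _ _ _ _ X N0 XX S, where M = "M + 1" and K = \<mu>])
   show "continuous_on UNIV (\<lambda>x. \<mu> * h n x)" by (intro continuous_intros h(1))
   show "(un n x)\<^sup>2 + (an n x)\<^sup>2 \<le> (sqrt (1 + \<delta>))\<^sup>2" for x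
   proof -
    have "(an n x)\<^sup>2 = (pl x)\<^sup>2 * (1 + \<delta> - (un n x)\<^sup>2)"
     unfolding an_def using pos[OF n, of x] by (simp add: power_mult_distrib)
    also have "\<dots> \<le> 1 * (1 + \<delta> - (un n x)\<^sup>2)" using pos[OF n, of x] plb[of x] by (intro mult_right_mono) (auto simp: power_le_one)
    finally show ?thesis unfolding sb(3) by simp
   qed
   show "\<bar>un n 0\<bar> \<le> sqrt (1 + \<delta>) / 2" using sb(2) by (simp add: un_def h(6))
   show "\<bar>x\<bar> > M + 1 \<Longrightarrow> an n x = 0" for x by (simp add: an_def pl0)
   show "\<bar>\<mu> * h n x\<bar> \<le> \<mu>" for x using h(3,4)[of n x] lam by (simp add: abs_mult mult_left_le)
  qed auto
  define aa where "aa x = pl x * sqrt (1 + \<delta> - (u x)\<^sup>2)" for x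
  have [measurable]: "aa \<in> borel_measurable borel" "an n \<in> borel_measurable borel" for n
   unfolding aa_def[abs_def] u_def[abs_def] an_def[abs_def] un_def[abs_def] by measurable
  have anlim: "(\<lambda>n. an n x) \<longlonglongrightarrow> aa x" for x
   unfolding an_def aa_def un_def u_def t_def by (intro tendsto_intros h(7))
  define wM where "wM = wt \<alpha> (M + 1)"
  have wM: "wt \<alpha> x \<le> wM" if "x \<in> {-(M+1)..M+1}" for x
   unfolding wM_def using that by (intro wt_mono[OF \<open>0 \<le> \<alpha>\<close>]) auto
  have wM0: "0 \<le> wM" by (simp add: wM_def)
  have T1: "(\<lambda>n. LBINT x:{-(M+1)..M+1}. wt \<alpha> x * an (n + n0) x * (2 * indicator S x + 2 * indicator X x)) \<longlonglongrightarrow>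
   (LBINT x:{-(M+1)..M+1}. wt \<alpha> x * aa x * (2 * indicator S x + 2 * indicator X x))"
  proof (rule bounded_convergence[where D = "wM * 2 * 4"])
   fix n x assume "x \<in> {-(M+1)..M+1}"
   then show "\<bar>wt \<alpha> x * an (n + n0) x * (2 * indicator S x + 2 * indicator X x)\<bar> \<le> wM * 2 * 4"
    unfolding abs_mult using wM[of x] ab[of "n + n0" x] sb(4) wM0
    by (intro mult_mono) (auto simp: indicator_def)
  next
   have "(\<lambda>n. an (n + n0) x) \<longlonglongrightarrow> aa x" for x using anlim[of x] by (rule LIMSEQ_ignore_initial_segment)
   then show "AE x in lborel. x \<in> {-(M+1)..M+1} \<longrightarrow> (\<lambda>n. wt \<alpha> x * an (n + n0) x * (2 * indicator S x + 2 * indicator X x))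
     \<longlonglongrightarrow> wt \<alpha> x * aa x * (2 * indicator S x + 2 * indicator X x)"
    by (intro AE_I2 impI tendsto_intros)
  qed (auto simp: emeasure_lborel_Icc_eq)
  have restr: "(LBINT x. wt \<alpha> x * f x * g x) = (LBINT x:{-(M+1)..M+1}. wt \<alpha> x * f x * g x)"
   if "\<And>x. \<bar>x\<bar> > M + 1 \<Longrightarrow> f x = 0" for f g
   unfolding set_int_def
  proof (rule Bochner_Integration.integral_cong)
   fix x show "wt \<alpha> x * f x * g x = indicator {-(M+1)..M+1} x *\<^sub>R (wt \<alpha> x * f x * g x)"
    using that[of x] by (cases "\<bar>x\<bar> > M + 1") (auto simp: indicator_def abs_le_iff)
  qed simp
  have an0: "an n x = 0" "aa x = 0" if "\<bar>x\<bar> > M + 1" for n x using pl0[OF that] by (auto simp: an_def aa_def)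
  have T2: "(\<lambda>n. LBINT z:A. \<mu> * h (n + n0) (fst z)) \<longlonglongrightarrow> (LBINT z:A. \<mu> * indicator T (fst z))"
  proof (rule bounded_convergence[OF A fin, where D = \<mu>])
   show "\<bar>\<mu> * h (n + n0) (fst z)\<bar> \<le> \<mu>" for n and z :: plane
    using h(3,4)[of "n + n0" "fst z"] lam by (simp add: abs_mult mult_left_le)
   show "AE z in lborel. z \<in> A \<longrightarrow> (\<lambda>n. \<mu> * h (n + n0) (fst z)) \<longlonglongrightarrow> \<mu> * indicator T (fst z)"
    using AE_fst[OF h(5)]
   proof eventually_elim
    fix z :: plane assume "(\<lambda>n. h n (fst z)) \<longlonglongrightarrow> indicator T (fst z)"
    then have "(\<lambda>n. h (n + n0) (fst z)) \<longlonglongrightarrow> indicator T (fst z)" by (rule LIMSEQ_ignore_initial_segment)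
    then show "z \<in> A \<longrightarrow> (\<lambda>n. \<mu> * h (n + n0) (fst z)) \<longlonglongrightarrow> \<mu> * indicator T (fst z)" by (intro impI tendsto_intros)
   qed
  qed measurable
  have ra: "(LBINT x. wt \<alpha> x * an n x * (2 * indicator S x + 2 * indicator X x))
    = (LBINT x:{-(M+1)..M+1}. wt \<alpha> x * an n x * (2 * indicator S x + 2 * indicator X x))" for n
   by (rule restr) (rule an0)
  have rb: "(LBINT x. wt \<alpha> x * aa x * (2 * indicator S x + 2 * indicator X x))
    = (LBINT x:{-(M+1)..M+1}. wt \<alpha> x * aa x * (2 * indicator S x + 2 * indicator X x))"
   by (rule restr) (rule an0)
  have "(LBINT z:A. \<mu> * indicator T (fst z)) +
    (LBINT x. wt \<alpha> x * aa x * (2 * indicator S x + 2 * indicator X x)) \<le> sqrt (1 + \<delta>) * C"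
   unfolding rb
   by (rule LIMSEQ_le_const2[OF tendsto_add[OF T2 T1]]) (use le[unfolded ra] in auto)
  moreover have "(LBINT z:A. \<mu> * indicator T (fst z)) = \<mu> * (LBINT z:A. indicator T (fst z))" by simp
  \<comment> \<open>On \<open>T\<close> the plateau is 1 and the root with 1 + \<delta> dominates
    the root with 1; outside \<open>T\<close> the integrand is nonnegative and is discarded.\<close>
  moreover have "2 * (LBINT x:T. wt \<alpha> x * sqrt (1 - (u x)\<^sup>2)) + 2 * (LBINT x:X. wt \<alpha> x * sqrt (1 - (u x)\<^sup>2))
    \<le> (LBINT x. wt \<alpha> x * aa x * (2 * indicator S x + 2 * indicator X x))"
  proof -
   have cm[measurable]: "(\<lambda>x. wt \<alpha> x * sqrt (1 - (u x)\<^sup>2)) \<in> borel_measurable borel"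
    unfolding u_def[abs_def] by measurable
   have cb: "\<bar>wt \<alpha> x * sqrt (1 - (u x)\<^sup>2)\<bar> \<le> wM * 1" if "x \<in> {0<..<M}" for x
    unfolding abs_mult using wM[of x] u2[of x] wM0 that by (intro mult_mono) auto
   have i1: "integrable lborel (\<lambda>x. indicator T x *\<^sub>R (wt \<alpha> x * sqrt (1 - (u x)\<^sup>2)))"
    by (rule set_integrable_bounded[unfolded set_integrable_def, OF Tm _ cm cb])
      (use Tfin TM in \<open>auto simp: fmeasurable_def\<close>)
   have "emeasure lborel X < \<infinity>" using emeasure_mono[OF XT, of lborel] Tfin by (auto simp: fmeasurable_def)
   then have i2: "integrable lborel (\<lambda>x. indicator X x *\<^sub>R (wt \<alpha> x * sqrt (1 - (u x)\<^sup>2)))"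
    by (rule set_integrable_bounded[unfolded set_integrable_def, OF X _ cm cb])
      (use XT TM in auto)
   have aab: "0 \<le> aa x" "aa x \<le> 2" for x
   proof -
    have "0 \<le> 1 + \<delta> - (u x)\<^sup>2" using u2[of x] \<delta> by linarith
    moreover have "sqrt (1 + \<delta> - (u x)\<^sup>2) \<le> sqrt (1 + \<delta>)" by simp
    then have "sqrt (1 + \<delta> - (u x)\<^sup>2) \<le> 2" using sb(4) by linarith
    ultimately show "0 \<le> aa x" "aa x \<le> 2" unfolding aa_def using plb[of x] mult_mono[of "pl x" 1 "sqrt (1 + \<delta> - (u x)\<^sup>2)" 2] sb(4) by auto
   qed
   have i3: "integrable lborel (\<lambda>x. indicator {-(M+1)..M+1} x *\<^sub>R (wt \<alpha> x * aa x * (2 * indicator S x + 2 * indicator X x)))"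
   proof (rule set_integrable_bounded[unfolded set_integrable_def, where D = "wM * 2 * 4"])
    fix x assume "x \<in> {-(M+1)..M+1}"
    then show "\<bar>wt \<alpha> x * aa x * (2 * indicator S x + 2 * indicator X x)\<bar> \<le> wM * 2 * 4"
     unfolding abs_mult using wM[of x] aab[of x] wM0
     by (intro mult_mono) (auto simp: indicator_def)
   qed (auto simp: emeasure_lborel_Icc_eq)
   have "2 * (LBINT x:T. wt \<alpha> x * sqrt (1 - (u x)\<^sup>2)) + 2 * (LBINT x:X. wt \<alpha> x * sqrt (1 - (u x)\<^sup>2))
    = (LBINT x. 2 * (indicator T x *\<^sub>R (wt \<alpha> x * sqrt (1 - (u x)\<^sup>2))) + 2 * (indicator X x *\<^sub>R (wt \<alpha> x * sqrt (1 - (u x)\<^sup>2))))"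
    unfolding set_int_def using i1 i2 by (subst Bochner_Integration.integral_add) auto
   also have "\<dots> \<le> (LBINT x. indicator {-(M+1)..M+1} x *\<^sub>R (wt \<alpha> x * aa x * (2 * indicator S x + 2 * indicator X x)))"
   proof (rule integral_mono)
    show "integrable lborel (\<lambda>x. 2 * (indicator T x *\<^sub>R (wt \<alpha> x * sqrt (1 - (u x)\<^sup>2))) + 2 * (indicator X x *\<^sub>R (wt \<alpha> x * sqrt (1 - (u x)\<^sup>2))))"
     using i1 i2 by (intro Bochner_Integration.integrable_add integrable_mult_right) auto
    fix x :: real
    show "2 * (indicator T x *\<^sub>R (wt \<alpha> x * sqrt (1 - (u x)\<^sup>2))) + 2 * (indicator X x *\<^sub>R (wt \<alpha> x * sqrt (1 - (u x)\<^sup>2)))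
     \<le> indicator {-(M+1)..M+1} x *\<^sub>R (wt \<alpha> x * aa x * (2 * indicator S x + 2 * indicator X x))"
    proof (cases "x \<in> T")
     case False
     then show ?thesis using XT aab(1)[of x] by (auto simp: indicator_def)
    next
     case True
     then have x: "x \<in> S" "0 < x" "x < M" using T by auto
     have "wt \<alpha> x * sqrt (1 - (u x)\<^sup>2) \<le> wt \<alpha> x * aa x"
      using x \<delta> by (intro mult_left_mono) (auto simp: aa_def pl1)
     then show ?thesis using True x by (auto simp: indicator_def)
    qed
   qed (rule i3)
   also have "\<dots> = (LBINT x. wt \<alpha> x * aa x * (2 * indicator S x + 2 * indicator X x))"
    unfolding rb set_int_def ..
   finally show ?thesis .
  qed
  ultimately show ?thesis unfolding u_def t_def by linarith
 qed
 have "(\<lambda>n. sqrt (1 + 1 / real (Suc n)) * C) \<longlonglongrightarrow> sqrt (1 + 0) * C"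
  by (intro tendsto_intros LIMSEQ_Suc[OF lim_1_over_n])
 then have "(\<lambda>n. sqrt (1 + 1 / real (Suc n)) * C) \<longlonglongrightarrow> C" by simp
 moreover have "?L \<le> sqrt (1 + 1 / real (Suc n)) * C" for n by (rule main) auto
 ultimately show ?thesis by (intro LIMSEQ_le_const) auto
qed

section \<open>The calibrated value and its minimiser\<close>

text \<open>The integral of \<open>cap_scale\<close> for r = 1: the expression 3/2 s - 1/2 runs from
  the weight of the axis, -1/2, to the closing value 1.\<close>

definition cap_const :: "real \<Rightarrow> real" where
 "cap_const \<alpha> = 2 * (LBINT s:{0..1}. wt \<alpha> s * sqrt (1 - (3 / 2 * s - 1 / 2)\<^sup>2))"

text \<open>Substitution s = r x; the factor \<open>wt \<alpha> r\<close> leaves the integral by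
  homogeneity of the weight.\<close>

lemma cap_scale:
 assumes "0 < r"
 shows "2 * (LBINT s:{0..r}. wt \<alpha> s * sqrt (1 - (3 / (2 * r) * s - 1 / 2)\<^sup>2)) = cap_const \<alpha> * wt \<alpha> r * r"
proof -
 have "(LBINT s:{0..r}. wt \<alpha> s * sqrt (1 - (3 / (2 * r) * s - 1 / 2)\<^sup>2))
  = \<bar>r\<bar> *\<^sub>R (LBINT x. indicator {0..r} (0 + r * x) *\<^sub>R (wt \<alpha> (0 + r * x) * sqrt (1 - (3 / (2 * r) * (0 + r * x) - 1 / 2)\<^sup>2)))"
  unfolding set_int_def by (rule lborel_integral_real_affine) (use assms in auto)
 also have "\<dots> = r * (LBINT x. wt \<alpha> r * (indicator {0..1} x *\<^sub>R (wt \<alpha> x * sqrt (1 - (3 / 2 * x - 1 / 2)\<^sup>2))))"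
 proof -
  have "indicator {0..r} (0 + r * x) *\<^sub>R (wt \<alpha> (0 + r * x) * sqrt (1 - (3 / (2 * r) * (0 + r * x) - 1 / 2)\<^sup>2))
    = wt \<alpha> r * (indicator {0..1} x *\<^sub>R (wt \<alpha> x * sqrt (1 - (3 / 2 * x - 1 / 2)\<^sup>2)))" for x
   using assms by (auto simp: indicator_def wt_mult zero_le_mult_iff)
  then have "(LBINT x. indicator {0..r} (0 + r * x) *\<^sub>R (wt \<alpha> (0 + r * x) * sqrt (1 - (3 / (2 * r) * (0 + r * x) - 1 / 2)\<^sup>2)))
   = (LBINT x. wt \<alpha> r * (indicator {0..1} x *\<^sub>R (wt \<alpha> x * sqrt (1 - (3 / 2 * x - 1 / 2)\<^sup>2))))"
   by (rule Bochner_Integration.integral_cong[OF refl])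
  then show ?thesis using assms by (simp only: abs_of_pos real_scaleR_def)
 qed
 finally show ?thesis unfolding cap_const_def set_int_def by simp
qed

lemma cap_const_pos:
 assumes "0 \<le> \<alpha>" shows "0 < cap_const \<alpha>"
proof -
 define f where "f s = wt \<alpha> s * sqrt (1 - (3 / 2 * s - 1 / 2)\<^sup>2)" for s :: real
 note [measurable] = wt_borel[OF assms]
 have sq: "(3 / 2 * s - 1 / 2)\<^sup>2 \<le> 1" if "0 \<le> s" "s \<le> 1" for s :: real
  using that by (simp add: abs_square_le_1 abs_le_iff)
 have sq': "(3 / 2 * s - 1 / 2)\<^sup>2 < 1" if "0 \<le> s" "s < 1" for s :: real
  using that by (simp add: abs_square_less_1 abs_less_iff)
 have f0: "0 \<le> f s" if "0 \<le> s" "s \<le> 1" for s unfolding f_def using sq[OF that] by (intro mult_nonneg_nonneg) auto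
 have fc: "continuous_on UNIV f" unfolding f_def[abs_def]
  by (intro continuous_intros continuous_on_compose2[OF wt_continuous[OF assms, of UNIV]]) auto
 have i: "integrable lborel (\<lambda>s. indicator {0..1} s *\<^sub>R f s)"
  by (rule borel_integrable_compact) (auto intro: continuous_on_subset[OF fc])
 have "(LBINT s. indicator {0..1} s *\<^sub>R f s) \<noteq> 0"
 proof
  assume "(LBINT s. indicator {0..1} s *\<^sub>R f s) = 0"
  then have "AE s in lborel. indicator {0..1} s *\<^sub>R f s = 0"
   using i f0 by (subst (asm) integral_nonneg_eq_0_iff_AE) (auto simp: indicator_def)
  then have "AE s in lborel. s \<notin> {0<..<1::real}"
  proof eventually_elim
   fix s assume "indicator {0..1} s *\<^sub>R f s = 0"
   moreover have "f s > 0" if "0 < s" "s < 1"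
    unfolding f_def using sq'[of s] that wt_pos[of s \<alpha>] by (intro mult_pos_pos) auto
   ultimately show "s \<notin> {0<..<1}" by (auto simp: indicator_def)
  qed
  then have "{0<..<1::real} \<in> null_sets lborel" by (subst AE_iff_null_sets) auto
  then show False by (simp add: null_sets_def)
 qed
 moreover have "0 \<le> (LBINT s. indicator {0..1} s *\<^sub>R f s)"
  by (rule integral_nonneg_AE) (use f0 in \<open>auto simp: indicator_def\<close>)
 ultimately show ?thesis unfolding cap_const_def set_int_def f_def by simp
qed

lemma weight_powr: "0 < r \<Longrightarrow> wt \<alpha> r * r = r powr (\<alpha> + 1)"
 by (auto simp: grushin_weight_def powr_add)

lemma bernoulli_powr:
 fixes p x :: real
 assumes "1 \<le> p" "0 < x"
 shows "1 + p * (x - 1) \<le> x powr p"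
proof -
 have d: "((\<lambda>x. x powr p) has_real_derivative p) (at 1 within {0<..})"
  by (rule DERIV_subset[OF _ subset_UNIV]) (auto intro!: derivative_eq_intros)
 have "(\<lambda>x. x powr p) x - (\<lambda>x. x powr p) 1 \<ge> p * (x - 1)"
  by (rule convex_on_imp_above_tangent[OF powr_convex[OF assms(1)] _ _ _ d]) (use assms in \<open>auto simp: interior_open\<close>)
 then show ?thesis by simp
qed

text \<open>What the calibration with \<mu> = 3/(2r) yields: the second term is \<mu> v, from the
  first component integrated over the half of area v, and the first term is the gain of the
  sections.\<close>

definition cap_value :: "real \<Rightarrow> real \<Rightarrow> real \<Rightarrow> real" where
 "cap_value \<alpha> v r = cap_const \<alpha> * wt \<alpha> r * r + 3 * v / (2 * r)"

text \<open>The derivative of \<open>cap_value \<alpha> v\<close> vanishes at \<open>R\<close>,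
  written without division by R^2.\<close>

abbreviation (input) critical :: "real \<Rightarrow> real \<Rightarrow> real \<Rightarrow> bool" where
 "critical \<alpha> v R \<equiv> cap_const \<alpha> * (\<alpha> + 1) * (wt \<alpha> R * R) * R = 3 * v / 2"

lemma cap_radius_exists:
 assumes "0 \<le> \<alpha>" "0 < v"
 shows "\<exists>R > 0. critical \<alpha> v R"
proof -
 define c where "c = 3 * v / 2 / (cap_const \<alpha> * (\<alpha> + 1))"
 have c: "0 < c" unfolding c_def using assms cap_const_pos[OF assms(1)] by (intro divide_pos_pos mult_pos_pos) auto
 define R where "R = c powr (1 / (\<alpha> + 2))"
 have R: "0 < R" using c by (simp add: R_def)
 have "wt \<alpha> R * R * R = R powr (\<alpha> + 2)"
  unfolding weight_powr[OF R] using R by (simp add: powr_add powr_numeral power2_eq_square)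
 also have "\<dots> = c" unfolding R_def using c assms by (simp add: powr_powr)
 finally have "wt \<alpha> R * R * R = c" .
 then have "cap_const \<alpha> * (\<alpha> + 1) * (wt \<alpha> R * R) * R = cap_const \<alpha> * (\<alpha> + 1) * c" by (simp add: mult_ac)
 also have "\<dots> = 3 * v / 2" unfolding c_def using cap_const_pos[OF assms(1)] assms by simp
 finally show ?thesis using R by blast
qed

text \<open>In terms of \<rho> = r/R the value is a positive multiple of \<rho> powr (\<alpha> + 1)
  + (\<alpha> + 1)/\<rho>. By Bernoulli's inequality it exceeds its value at \<rho> = 1 by at least
  (\<alpha> + 1) (\<rho> - 1)^2/\<rho>, which gives minimality and uniqueness together.\<close>

lemma cap_value_min:
 assumes "0 \<le> \<alpha>" "0 < v" "0 < R" and R: "critical \<alpha> v R" and "0 < r"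
 shows "cap_value \<alpha> v R \<le> cap_value \<alpha> v r" "cap_value \<alpha> v r = cap_value \<alpha> v R \<Longrightarrow> r = R"
proof -
 define \<rho> where "\<rho> = r / R"
 have \<rho>: "0 < \<rho>" "r = R * \<rho>" using assms by (auto simp: \<rho>_def)
 define k where "k = cap_const \<alpha> * (wt \<alpha> R * R)"
 have k: "0 < k" unfolding k_def using cap_const_pos[OF assms(1)] assms(3) wt_pos[of R \<alpha>] by auto
 have v: "3 * v / 2 = k * (\<alpha> + 1) * R" using R by (simp add: k_def mult_ac)
 have e: "cap_value \<alpha> v r = k * (\<rho> powr (\<alpha> + 1) + (\<alpha> + 1) / \<rho>)"
 proof -
  have "wt \<alpha> r * r = (wt \<alpha> R * R) * \<rho> powr (\<alpha> + 1)"
   unfolding weight_powr[OF \<rho>(1), symmetric] unfolding \<rho>(2) wt_mult by (simp add: mult_ac)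
  moreover have "3 * v / (2 * r) = k * ((\<alpha> + 1) / \<rho>)"
  proof -
   have "3 * v / (2 * r) = (3 * v / 2) / r" by simp
   also have "\<dots> = k * (\<alpha> + 1) * R / (R * \<rho>)" unfolding v \<rho>(2) ..
   finally show ?thesis using \<open>0 < R\<close> by simp
  qed
  ultimately show ?thesis unfolding cap_value_def k_def by (simp add: algebra_simps)
 qed
 have eR: "cap_value \<alpha> v R = k * (\<alpha> + 2)"
 proof -
  have "3 * v / (2 * R) = k * (\<alpha> + 1)" using v \<open>0 < R\<close> by (simp add: field_simps)
  then show ?thesis unfolding cap_value_def k_def by (simp add: algebra_simps)
 qed
 have B: "1 + (\<alpha> + 1) * (\<rho> - 1) \<le> \<rho> powr (\<alpha> + 1)" using assms(1) \<rho>(1) by (intro bernoulli_powr) auto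
 have q: "\<rho> - 1 + 1 / \<rho> = 1 + (\<rho> - 1)\<^sup>2 / \<rho>" using \<rho>(1) by (simp add: field_simps power2_eq_square)
 have "(\<alpha> + 2) + (\<alpha> + 1) * ((\<rho> - 1)\<^sup>2 / \<rho>) = 1 + (\<alpha> + 1) * (\<rho> - 1 + 1 / \<rho>)" unfolding q by (simp add: algebra_simps)
 also have "\<dots> \<le> \<rho> powr (\<alpha> + 1) + (\<alpha> + 1) / \<rho>" using B by (simp add: algebra_simps)
 finally have G: "(\<alpha> + 2) + (\<alpha> + 1) * ((\<rho> - 1)\<^sup>2 / \<rho>) \<le> \<rho> powr (\<alpha> + 1) + (\<alpha> + 1) / \<rho>" .
 have nn: "0 \<le> (\<alpha> + 1) * ((\<rho> - 1)\<^sup>2 / \<rho>)" using assms(1) \<rho>(1) by auto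
 show "cap_value \<alpha> v R \<le> cap_value \<alpha> v r" unfolding e eR using G nn k by (intro mult_left_mono) auto
 assume "cap_value \<alpha> v r = cap_value \<alpha> v R"
 then have "\<rho> powr (\<alpha> + 1) + (\<alpha> + 1) / \<rho> = \<alpha> + 2" unfolding e eR using k by simp
 then have "(\<alpha> + 1) * ((\<rho> - 1)\<^sup>2 / \<rho>) = 0" using G nn by linarith
 then have "\<rho> = 1" using assms(1) \<rho>(1) by auto
 then show "r = R" using \<rho>(2) by simp
qed

section \<open>The lower bound for one half\<close>

lemma section_support:
 assumes A[measurable]: "A \<in> sets (borel :: plane measure)" and S: "S = (x_support A)"
 shows "AE z in lborel. z \<in> A \<longrightarrow> fst z \<in> S"
proof -
 have Sm[measurable]: "S \<in> sets borel" unfolding S using section_measure_borel(1)[OF A] by measurable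
 define B where "B = A \<inter> {z. fst z \<notin> S}"
 have Bm: "B \<in> sets borel" unfolding B_def by measurable
 have Bp: "B \<in> sets (borel \<Otimes>\<^sub>M borel)" unfolding borel_prod by (rule Bm)
 have "emeasure (lborel \<Otimes>\<^sub>M lborel) B = (\<integral>\<^sup>+ x. emeasure lborel (Pair x -` B) \<partial>lborel)"
  by (rule lborel.emeasure_pair_measure_alt) (use Bp in simp)
 also have "\<dots> = (\<integral>\<^sup>+ x. 0 \<partial>(lborel :: real measure))"
 proof (rule nn_integral_cong)
  fix x :: real
  show "emeasure lborel (Pair x -` B) = 0"
  proof (cases "x \<in> S")
   case True then have "Pair x -` B = {}" by (auto simp: B_def)
   then show ?thesis by simp
  next
   case False
   then have "Pair x -` B = {y. (x, y) \<in> A}" by (auto simp: B_def)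
   then show ?thesis using False unfolding S by simp
  qed
 qed
 finally have "emeasure lborel B = 0" unfolding lborel_prod by simp
 then have "B \<in> null_sets lborel" using Bm by (simp add: null_sets_def)
 then have "AE z in lborel. z \<notin> B" by (rule AE_not_in)
 then show ?thesis by eventually_elim (auto simp: B_def)
qed

text \<open>One half of the partition in abstract form: a Borel set in the open right half-plane,
  its area, and a bound for its half-weighted perimeter. The left half becomes an instance after
  reflection.\<close>

locale half_set =
 fixes \<alpha> C v :: real and A :: "plane set" and S :: "real set"
 assumes alpha: "0 \<le> \<alpha>" and half: "half_le \<alpha> A C" and A_borel: "A \<in> sets borel"
  and A_pos: "A \<subseteq> {z. fst z > 0}" and A_vol: "emeasure lborel A = ennreal v" and v_pos: "0 < v"
  and S_def: "S = (x_support A)"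
begin

lemma A_fin: "emeasure lborel A < \<infinity>" using A_vol by simp

lemma A_measure: "measure lborel A = v" using A_vol v_pos by (simp add: measure_def)

lemma S_borel [measurable]: "S \<in> sets borel"
 unfolding S_def using section_measure_borel(1)[OF A_borel] by measurable

lemma S_pos: "S \<subseteq> {0<..}"
proof
 fix x assume "x \<in> S"
 then have "emeasure lborel {y. (x, y) \<in> A} \<noteq> 0" unfolding S_def by simp
 then have "{y. (x, y) \<in> A} \<noteq> {}" by (metis emeasure_empty)
 then show "x \<in> {0<..}" using A_pos by auto
qed

lemma trunc_fmeasurable: "S \<inter> {0<..<M} \<in> fmeasurable lborel"
proof (cases "0 < M")
 case True
 show ?thesis
  by (rule fmeasurableI, measurable) (rule le_less_trans[OF emeasure_mono[of _ "{0<..<M}"]], use True in auto)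
qed simp

lemma trunc_volume: "(\<lambda>n. LBINT z:A. (indicator (S \<inter> {0<..<real n}) (fst z) :: real)) \<longlonglongrightarrow> v"
proof -
 note [measurable] = A_borel
 have "(\<lambda>n. LBINT z:A. (indicator (S \<inter> {0<..<real n}) (fst z) :: real)) \<longlonglongrightarrow> (LBINT z:A. 1)"
 proof (rule bounded_convergence[OF A_borel A_fin, where D = 1])
  show "AE z in lborel. z \<in> A \<longrightarrow> (\<lambda>n. indicator (S \<inter> {0<..<real n}) (fst z)) \<longlonglongrightarrow> (1 :: real)"
   using section_support[OF A_borel S_def]
  proof eventually_elim
   fix z :: plane assume z: "z \<in> A \<longrightarrow> fst z \<in> S"
   show "z \<in> A \<longrightarrow> (\<lambda>n. indicator (S \<inter> {0<..<real n}) (fst z)) \<longlonglongrightarrow> (1 :: real)"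
   proof
    assume "z \<in> A"
    then have zS: "fst z \<in> S" "0 < fst z" using z S_pos by auto
    obtain n0 where n0: "fst z < real n0" using reals_Archimedean2 by blast
    have "\<forall>\<^sub>F n in sequentially. indicator (S \<inter> {0<..<real n}) (fst z) = (1 :: real)"
     unfolding eventually_sequentially
     by (intro exI[of _ n0] allI impI) (use n0 zS in \<open>auto simp: indicator_def\<close>)
    then show "(\<lambda>n. indicator (S \<inter> {0<..<real n}) (fst z)) \<longlonglongrightarrow> (1 :: real)" by (rule tendsto_eventually)
   qed
  qed
 qed (auto simp: indicator_def)
 then show ?thesis using A_measure by (simp add: set_int_def)
qed

lemma calib:
 assumes "0 < M" "0 < \<mu>" "\<mu> * measure lborel (S \<inter> {0<..<M}) \<le> 3 / 2"
 shows "\<mu> * (LBINT z:A. indicator (S \<inter> {0<..<M}) (fst z)) +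
   2 * (LBINT x:S \<inter> {0<..<M}. wt \<alpha> x * sqrt (1 - (\<mu> * measure lborel (S \<inter> {0<..<M} \<inter> {..x}) - 1 / 2)\<^sup>2)) \<le> C"
 using slices_calibration[OF half alpha A_borel A_fin S_def refl assms(1), of "{}" 1 0 "1/2" 1, OF _ _ _ _ _ _ _ assms(2,3)]
 by (simp add: set_int_def)

text \<open>Finiteness of |S| is not yet available, so \<open>S\<close> is truncated and the
  nonnegative area term is dropped. Since t x \<le> x, the weight at x dominates the weight at t x,
  and the latter integrates to the cap integral by
  \<open>integral_distribution_function\<close>.\<close>

lemma trunc_bound:
 "cap_const \<alpha> * (wt \<alpha> (measure lborel (S \<inter> {0<..<M})) * measure lborel (S \<inter> {0<..<M})) \<le> C"
 if "0 < M" "0 < measure lborel (S \<inter> {0<..<M})"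
proof -
 define T where "T = S \<inter> {0<..<M}"
 define r where "r = measure lborel T"
 define \<mu> where "\<mu> = 3 / (2 * r)"
 have r: "0 < r" using that by (simp add: r_def T_def)
 have Tb[measurable]: "T \<in> sets borel" unfolding T_def by measurable
 have Tf: "T \<in> fmeasurable lborel" unfolding T_def by (rule trunc_fmeasurable)
 note [measurable] = wt_borel[OF alpha]
 define t where "t x = measure lborel (T \<inter> {..x})" for x
 have t0: "0 \<le> t x" "t x \<le> r" for x
  unfolding t_def r_def using measure_mono_fmeasurable[OF _ _ Tf, of "T \<inter> {..x}"] by auto
 have tx: "t x \<le> x" if "0 < x" for x
 proof -
  have "t x \<le> measure lborel {0..x}" unfolding t_def
   by (rule measure_mono_fmeasurable) (auto simp: T_def fmeasurable_def emeasure_lborel_Icc_eq)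
  then show ?thesis using that by simp
 qed
 have c: "\<mu> * (LBINT z:A. indicator T (fst z)) + 2 * (LBINT x:T. wt \<alpha> x * sqrt (1 - (\<mu> * t x - 1 / 2)\<^sup>2)) \<le> C"
  unfolding T_def t_def by (rule calib) (use that r in \<open>auto simp: \<mu>_def r_def T_def\<close>)
 have sq: "(\<mu> * t x - 1 / 2)\<^sup>2 \<le> 1" for x
 proof -
  have "0 \<le> \<mu> * t x" "\<mu> * t x \<le> 3 / 2" using t0[of x] r by (auto simp: \<mu>_def divide_simps)
  then show ?thesis by (simp add: abs_square_le_1 abs_le_iff)
 qed
 have [measurable]: "t \<in> borel_measurable borel"
  by (rule borel_measurable_mono) (auto simp: mono_def t_def intro!: measure_mono_fmeasurable fmeasurable_Int_fmeasurable Tf)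
 have wM: "\<bar>wt \<alpha> x' * sqrt (1 - (\<mu> * t x - 1 / 2)\<^sup>2)\<bar> \<le> wt \<alpha> M * 1" if "\<bar>x'\<bar> \<le> M" for x x'
  unfolding abs_mult using sq[of x] that wt_mono[OF alpha, of x' M] by (intro mult_mono) auto
 have "cap_const \<alpha> * wt \<alpha> r * r = 2 * (LBINT s:{0..r}. wt \<alpha> s * sqrt (1 - (\<mu> * s - 1 / 2)\<^sup>2))"
  unfolding \<mu>_def using cap_scale[OF r] by simp
 also have "(LBINT s:{0..r}. wt \<alpha> s * sqrt (1 - (\<mu> * s - 1 / 2)\<^sup>2)) = (LBINT x:T. wt \<alpha> (t x) * sqrt (1 - (\<mu> * t x - 1 / 2)\<^sup>2))"
  unfolding r_def t_def
  by (rule integral_distribution_function[symmetric, of T M])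
    (use that in \<open>auto simp: T_def intro!: continuous_intros continuous_on_compose2[OF wt_continuous[OF alpha, of UNIV]]\<close>)
 also have "2 * \<dots> \<le> 2 * (LBINT x:T. wt \<alpha> x * sqrt (1 - (\<mu> * t x - 1 / 2)\<^sup>2))"
 proof -
  have "(LBINT x:T. wt \<alpha> (t x) * sqrt (1 - (\<mu> * t x - 1 / 2)\<^sup>2)) \<le> (LBINT x:T. wt \<alpha> x * sqrt (1 - (\<mu> * t x - 1 / 2)\<^sup>2))"
  proof (rule set_integral_mono)
   have Tx: "x \<in> T \<Longrightarrow> \<bar>x\<bar> \<le> M \<and> \<bar>t x\<bar> \<le> M" for x using tx[of x] t0(1)[of x] by (auto simp: T_def)
   have fin: "emeasure lborel T < \<infinity>" using Tf by (auto simp: fmeasurable_def)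
   show "set_integrable lborel T (\<lambda>x. wt \<alpha> (t x) * sqrt (1 - (\<mu> * t x - 1 / 2)\<^sup>2))"
    by (rule set_integrable_bounded[OF Tb fin _ wM]) (use Tx in auto)
   show "set_integrable lborel T (\<lambda>x. wt \<alpha> x * sqrt (1 - (\<mu> * t x - 1 / 2)\<^sup>2))"
    by (rule set_integrable_bounded[OF Tb fin _ wM]) (use Tx in auto)
   show "wt \<alpha> (t x) * sqrt (1 - (\<mu> * t x - 1 / 2)\<^sup>2) \<le> wt \<alpha> x * sqrt (1 - (\<mu> * t x - 1 / 2)\<^sup>2)" if "x \<in> T" for x
    using tx[of x] t0(1)[of x] that sq[of x] by (intro mult_right_mono wt_mono[OF alpha]) (auto simp: T_def)
  qed
  then show ?thesis by simp
 qed
 also have "\<dots> \<le> C"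
 proof -
  have "0 \<le> \<mu> * (LBINT z:A. indicator T (fst z))"
   unfolding set_int_def using r by (intro mult_nonneg_nonneg integral_nonneg_AE) (auto simp: \<mu>_def)
  then show ?thesis using c by linarith
 qed
 finally show ?thesis unfolding r_def T_def by (simp add: mult_ac)
qed

text \<open>The weight is at least 1 beyond abscissa 1, so \<open>trunc_bound\<close> forces
  \<open>cap_const \<alpha> * r \<le> C\<close> for every truncation of measure r > 1.\<close>

lemma S_fin: "S \<in> fmeasurable lborel"
proof -
 define D where "D = max 1 (C / cap_const \<alpha>)"
 have k: "0 < cap_const \<alpha>" by (rule cap_const_pos[OF alpha])
 have b: "measure lborel (S \<inter> {0<..<real n}) \<le> D" for n
 proof (cases "1 < measure lborel (S \<inter> {0<..<real n})")
  case True
  define r where "r = measure lborel (S \<inter> {0<..<real n})"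
  have "0 < real n" using True by (cases "n = 0") auto
  from trunc_bound[OF this] have "cap_const \<alpha> * (wt \<alpha> r * r) \<le> C" using True by (simp add: r_def)
  moreover have "1 * r \<le> wt \<alpha> r * r"
   using True alpha by (intro mult_right_mono) (auto simp: r_def grushin_weight_def ge_one_powr_ge_zero)
  ultimately have "cap_const \<alpha> * r \<le> C" using k mult_left_mono[of "1 * r" "wt \<alpha> r * r" "cap_const \<alpha>"] by linarith
  then have "r \<le> C / cap_const \<alpha>" using k by (simp add: field_simps)
  then show ?thesis by (simp add: r_def D_def)
 qed (simp add: D_def)
 have "emeasure lborel (\<Union>n. S \<inter> {0<..<real n}) = (SUP n. emeasure lborel (S \<inter> {0<..<real n}))"
  by (rule SUP_emeasure_incseq[symmetric]) (auto simp: incseq_def)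
 also have "\<dots> \<le> ennreal D"
 proof (rule SUP_least)
  fix n
  have "emeasure lborel (S \<inter> {0<..<real n}) = ennreal (measure lborel (S \<inter> {0<..<real n}))"
   using trunc_fmeasurable by (intro emeasure_eq_measure2)
  then show "emeasure lborel (S \<inter> {0<..<real n}) \<le> ennreal D" using b[of n] by (simp add: ennreal_leI)
 qed
 also have "(\<Union>n. S \<inter> {0<..<real n}) = S"
 proof -
  have "x \<in> (\<Union>n. S \<inter> {0<..<real n})" if "x \<in> S" for x
   using reals_Archimedean2[of x] that S_pos by auto
  then show ?thesis by blast
 qed
 finally have "emeasure lborel S < \<infinity>" by (simp add: le_less_trans)
 then show ?thesis by (intro fmeasurableI) auto
qed

end

lemma (in half_set) S_measure_pos: "0 < measure lborel S"
proof (rule ccontr)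
 assume "\<not> ?thesis"
 then have "measure lborel S = 0" using measure_nonneg[of lborel S] by linarith
 then have "emeasure lborel S = 0" using S_fin by (simp add: emeasure_eq_measure2)
 then have "S \<in> null_sets lborel" using S_borel by (simp add: null_sets_def)
 then have "AE x in lborel. x \<notin> S" by (rule AE_not_in)
 from AE_fst[OF this] section_support[OF A_borel S_def] have "AE z in lborel. z \<notin> A"
  by eventually_elim auto
 then have "A \<in> null_sets lborel" using A_borel by (subst AE_iff_null_sets) auto
 then show False using A_vol v_pos by (simp add: null_sets_def)
qed

text \<open>The slope belongs to the full measure r while the truncations of \<open>S\<close> grow
  to \<open>S\<close>. Besides the cap value, two nonnegative quantities are retained because the
  equality case rests on them: the loss from replacing the weight at x by that at t x, and the extra
  gain of sections with a gap. Both are kept over a bounded window, which avoids integrability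
  questions at infinity.\<close>

lemma (in half_set) calibration:
 assumes r: "r = measure lborel S"
  and X[measurable]: "X \<in> sets borel" and N0: "-N0 < y0" "y0 < y1" "y1 < N0" "0 < \<kappa>"
  and XX: "\<And>x. x \<in> X \<Longrightarrow> section_gap A N0 y0 y1 \<kappa> x"
  and XT: "X \<subseteq> S \<inter> {0<..<M}" and "0 < M"
 shows "cap_value \<alpha> v r
   + 2 * (LBINT x:S \<inter> {0<..<M}. (wt \<alpha> x - wt \<alpha> (measure lborel (S \<inter> {..x}))) * sqrt (1 - (3 / (2 * r) * measure lborel (S \<inter> {..x}) - 1 / 2)\<^sup>2))
   + 2 * (LBINT x:X. wt \<alpha> x * sqrt (1 - (3 / (2 * r) * measure lborel (S \<inter> {..x}) - 1 / 2)\<^sup>2)) \<le> C"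
proof -
 define \<mu> where "\<mu> = 3 / (2 * r)"
 have r0: "0 < r" using S_measure_pos by (simp add: r)
 note [measurable] = wt_borel[OF alpha]
 define T where "T n = S \<inter> {0<..<real n}" for n
 define t where "t x = measure lborel (S \<inter> {..x})" for x
 have t0: "0 \<le> t x" "t x \<le> r" for x
  unfolding t_def r using measure_mono_fmeasurable[OF _ _ S_fin, of "S \<inter> {..x}"] by auto
 have tx: "t x \<le> x" if "0 < x" for x
 proof -
  have "t x \<le> measure lborel {0..x}" unfolding t_def
   by (rule measure_mono_fmeasurable) (use S_pos in \<open>auto simp: fmeasurable_def emeasure_lborel_Icc_eq\<close>)
  then show ?thesis using that by simp
 qed
 have sq: "(\<mu> * t x - 1 / 2)\<^sup>2 \<le> 1" for x
 proof -
  have "0 \<le> \<mu> * t x" "\<mu> * t x \<le> 3 / 2" using t0[of x] r0 by (auto simp: \<mu>_def divide_simps)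
  then show ?thesis by (simp add: abs_square_le_1 abs_le_iff)
 qed
 have tm[measurable]: "t \<in> borel_measurable borel"
  by (rule borel_measurable_mono) (auto simp: mono_def t_def intro!: measure_mono_fmeasurable fmeasurable_Int_fmeasurable S_fin)
 define c where "c x = sqrt (1 - (\<mu> * t x - 1 / 2)\<^sup>2)" for x
 have c0: "0 \<le> c x" "c x \<le> 1" for x using sq[of x] by (auto simp: c_def)
 have [measurable]: "c \<in> borel_measurable borel" unfolding c_def[abs_def] by measurable
 have Tb[measurable]: "T n \<in> sets borel" for n unfolding T_def by measurable
 have Tf: "T n \<in> fmeasurable lborel" for n unfolding T_def by (rule trunc_fmeasurable)
 have Tfin: "emeasure lborel (T n) < \<infinity>" for n using Tf by (auto simp: fmeasurable_def)
 \<comment> \<open>At a point of the truncation no mass of \<open>S\<close> to its left has been cut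
   away, so the two distribution functions agree there.\<close>
 have tT: "measure lborel (T n \<inter> {..x}) = t x" if "x \<in> T n" for n x
 proof -
  have "T n \<inter> {..x} = S \<inter> {..x}" using that S_pos by (auto simp: T_def)
  then show ?thesis by (simp add: t_def)
 qed
 have wb: "wt \<alpha> y \<le> wt \<alpha> (real n)" if "x \<in> T n" "\<bar>y\<bar> \<le> x" for x y n
  using that by (intro wt_mono[OF alpha]) (auto simp: T_def)
 have si: "set_integrable lborel (T n) (\<lambda>x. wt \<alpha> (f x) * c x)"
  if [measurable]: "f \<in> borel_measurable borel" and f: "\<And>x. 0 < x \<Longrightarrow> \<bar>f x\<bar> \<le> x" for n f
 proof (rule set_integrable_bounded[OF Tb Tfin])
  fix x assume x: "x \<in> T n"
  then have "\<bar>f x\<bar> \<le> x" using f[of x] by (auto simp: T_def)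
  from wb[OF x this] show "\<bar>wt \<alpha> (f x) * c x\<bar> \<le> wt \<alpha> (real n) * 1"
   unfolding abs_mult using c0[of x] by (intro mult_mono) auto
 qed measurable
 have s1: "set_integrable lborel (T n) (\<lambda>x. wt \<alpha> x * c x)" for n by (rule si) auto
 have s2: "set_integrable lborel (T n) (\<lambda>x. wt \<alpha> (t x) * c x)" for n by (rule si) (use t0 tx in auto)
 have s3: "set_integrable lborel (T n) (\<lambda>x. (wt \<alpha> x - wt \<alpha> (t x)) * c x)" for n
  using set_integral_diff(1)[OF s1[of n] s2[of n]] by (simp add: left_diff_distrib)
 define k where "k s = wt \<alpha> s * sqrt (1 - (\<mu> * s - 1 / 2)\<^sup>2)" for s
 have kc: "continuous_on UNIV k" unfolding k_def[abs_def]
  by (intro continuous_intros continuous_on_compose2[OF wt_continuous[OF alpha, of UNIV]]) auto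
 obtain n1 where n1: "M < real n1" using reals_Archimedean2 by blast
 define D where "D = (LBINT x:S \<inter> {0<..<M}. (wt \<alpha> x - wt \<alpha> (t x)) * c x)"
 have le: "\<mu> * (LBINT z:A. indicator (T n) (fst z)) + 2 * (LBINT s:{0..measure lborel (T n)}. k s) + 2 * D
   + 2 * (LBINT x:X. wt \<alpha> x * c x) \<le> C" if n: "n1 \<le> n" for n
 proof -
  have n0: "0 < real n" using n n1 \<open>0 < M\<close> by linarith
  have MT: "S \<inter> {0<..<M} \<subseteq> T n" using n n1 by (auto simp: T_def)
  have "measure lborel (T n) \<le> r" unfolding r by (rule measure_mono_fmeasurable) (use S_fin in \<open>auto simp: T_def\<close>)
  then have mu: "0 < \<mu>" "\<mu> * measure lborel (T n) \<le> 3 / 2" using r0 by (auto simp: \<mu>_def divide_simps)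
  have XTn: "X \<subseteq> T n" using XT MT by blast
  have "\<mu> * (LBINT z:A. indicator (T n) (fst z)) +
   2 * (LBINT x:T n. wt \<alpha> x * sqrt (1 - (\<mu> * measure lborel (T n \<inter> {..x}) - 1 / 2)\<^sup>2)) +
   2 * (LBINT x:X. wt \<alpha> x * sqrt (1 - (\<mu> * measure lborel (T n \<inter> {..x}) - 1 / 2)\<^sup>2)) \<le> C"
   by (rule slices_calibration[OF half alpha A_borel A_fin S_def _ n0 X N0 XX XTn mu]) (auto simp: T_def)
  moreover have "(LBINT x:T n. wt \<alpha> x * sqrt (1 - (\<mu> * measure lborel (T n \<inter> {..x}) - 1 / 2)\<^sup>2))
    = (LBINT x:T n. wt \<alpha> x * c x)"
   by (rule set_lebesgue_integral_cong) (auto simp: tT c_def)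
  moreover have "(LBINT x:X. wt \<alpha> x * sqrt (1 - (\<mu> * measure lborel (T n \<inter> {..x}) - 1 / 2)\<^sup>2))
    = (LBINT x:X. wt \<alpha> x * c x)"
   by (rule set_lebesgue_integral_cong) (use XTn in \<open>auto simp: tT c_def\<close>)
  moreover have "(LBINT x:T n. wt \<alpha> x * c x)
    = (LBINT x:T n. wt \<alpha> (t x) * c x) + (LBINT x:T n. (wt \<alpha> x - wt \<alpha> (t x)) * c x)"
   unfolding set_integral_add(2)[OF s2 s3, symmetric] by (simp add: algebra_simps)
  moreover have "(LBINT x:T n. wt \<alpha> (t x) * c x) = (LBINT s:{0..measure lborel (T n)}. k s)"
  proof -
   have "(LBINT x:T n. wt \<alpha> (t x) * c x) = (LBINT x:T n. k (measure lborel (T n \<inter> {..x})))"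
    by (rule set_lebesgue_integral_cong) (auto simp: tT c_def k_def)
   also have "\<dots> = (LBINT s:{0..measure lborel (T n)}. k s)"
    by (rule integral_distribution_function[OF _ _ n0 kc]) (auto simp: T_def)
   finally show ?thesis .
  qed
  moreover have "D \<le> (LBINT x:T n. (wt \<alpha> x - wt \<alpha> (t x)) * c x)"
   unfolding D_def set_int_def
  proof (rule integral_mono)
   have "S \<inter> {0<..<M} \<in> sets borel" by measurable
   then show "integrable lborel (\<lambda>x. indicator (S \<inter> {0<..<M}) x *\<^sub>R ((wt \<alpha> x - wt \<alpha> (t x)) * c x))"
    using set_integrable_subset[OF s3[of n] _ MT] unfolding set_integrable_def by simp
   show "integrable lborel (\<lambda>x. indicator (T n) x *\<^sub>R ((wt \<alpha> x - wt \<alpha> (t x)) * c x))"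
    using s3[of n] unfolding set_integrable_def .
   fix x
   have "0 \<le> (wt \<alpha> x - wt \<alpha> (t x)) * c x" if "x \<in> T n"
   proof -
    have "0 < x" using that by (auto simp: T_def)
    then have "wt \<alpha> (t x) \<le> wt \<alpha> x" using tx[of x] t0(1)[of x] by (intro wt_mono[OF alpha]) auto
    then show ?thesis using c0[of x] by simp
   qed
   then show "indicator (S \<inter> {0<..<M}) x *\<^sub>R ((wt \<alpha> x - wt \<alpha> (t x)) * c x)
     \<le> indicator (T n) x *\<^sub>R ((wt \<alpha> x - wt \<alpha> (t x)) * c x)"
    using MT by (cases "x \<in> T n") (auto simp: indicator_def)
  qed
  ultimately show ?thesis by linarith
 qed
 have rl: "(\<lambda>n. measure lborel (T n)) \<longlonglongrightarrow> r"
 proof -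
  have "(\<lambda>n. measure lborel (T n)) \<longlonglongrightarrow> measure lborel (\<Union>n. T n)"
  proof (rule Lim_measure_incseq)
   have "(\<Union>n. T n) \<subseteq> S" by (auto simp: T_def)
   from emeasure_mono[OF this, of lborel] show "emeasure lborel (\<Union>n. T n) \<noteq> \<infinity>"
    using S_fin by (auto simp: fmeasurable_def top.extremum_unique)
  qed (auto simp: incseq_def T_def)
  also have "(\<Union>n. T n) = S"
  proof -
   have "x \<in> (\<Union>n. T n)" if "x \<in> S" for x using reals_Archimedean2[of x] that S_pos by (auto simp: T_def)
   then show ?thesis by (auto simp: T_def)
  qed
  finally show ?thesis by (simp add: r)
 qed
 obtain K where K: "\<And>x. (K has_real_derivative k x) (at x)" using continuous_antiderivative[OF kc] by metis
 have Ki: "(LBINT s:{0..q}. k s) = K q - K 0" if "0 \<le> q" for q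
  using integral_FTC_Icc_real[OF that K] kc continuous_on_eq_continuous_at[OF open_UNIV, of k]
  unfolding set_int_def by (simp add: mult.commute)
 have kl: "(\<lambda>n. LBINT s:{0..measure lborel (T n)}. k s) \<longlonglongrightarrow> (LBINT s:{0..r}. k s)"
  unfolding Ki[OF measure_nonneg] Ki[OF less_imp_le[OF r0]]
  by (intro tendsto_intros isCont_tendsto_compose[OF DERIV_isCont[OF K] rl])
 have "(\<lambda>n. \<mu> * (LBINT z:A. indicator (T n) (fst z)) + 2 * (LBINT s:{0..measure lborel (T n)}. k s) + 2 * D
   + 2 * (LBINT x:X. wt \<alpha> x * c x)) \<longlonglongrightarrow> \<mu> * v + 2 * (LBINT s:{0..r}. k s) + 2 * D
   + 2 * (LBINT x:X. wt \<alpha> x * c x)"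
  by (intro tendsto_intros kl) (unfold T_def, rule trunc_volume)
 then have "\<mu> * v + 2 * (LBINT s:{0..r}. k s) + 2 * D + 2 * (LBINT x:X. wt \<alpha> x * c x) \<le> C"
  by (rule LIMSEQ_le_const2) (use le in auto)
 moreover have "2 * (LBINT s:{0..r}. k s) = cap_const \<alpha> * wt \<alpha> r * r"
  unfolding k_def \<mu>_def by (rule cap_scale[OF r0])
 moreover have "\<mu> * v = 3 * v / (2 * r)" by (simp add: \<mu>_def)
 ultimately show ?thesis unfolding cap_value_def D_def c_def t_def \<mu>_def by linarith
qed

lemma (in half_set) weight_defect_nonneg:
 assumes "r = measure lborel S" "x \<in> S"
 shows "0 \<le> (wt \<alpha> x - wt \<alpha> (measure lborel (S \<inter> {..x}))) * sqrt (1 - (3 / (2 * r) * measure lborel (S \<inter> {..x}) - 1 / 2)\<^sup>2)"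
proof -
 define t where "t = measure lborel (S \<inter> {..x})"
 have x: "0 < x" using assms S_pos by auto
 have r0: "0 < r" using S_measure_pos by (simp add: assms)
 have t0: "0 \<le> t" "t \<le> r"
  unfolding t_def assms(1) using measure_mono_fmeasurable[OF _ _ S_fin, of "S \<inter> {..x}"] by auto
 have "t \<le> measure lborel {0..x}" unfolding t_def
  by (rule measure_mono_fmeasurable) (use S_pos in \<open>auto simp: fmeasurable_def emeasure_lborel_Icc_eq\<close>)
 then have tx: "t \<le> x" using x by simp
 have "0 \<le> 3 / (2 * r) * t" "3 / (2 * r) * t \<le> 3 / 2" using t0 r0 by (auto simp: divide_simps)
 then have "(3 / (2 * r) * t - 1 / 2)\<^sup>2 \<le> 1" by (simp add: abs_square_le_1 abs_le_iff)
 moreover have "wt \<alpha> t \<le> wt \<alpha> x" using tx t0 by (intro wt_mono[OF alpha]) auto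
 ultimately show ?thesis unfolding t_def[symmetric] by (intro mult_nonneg_nonneg) auto
qed

lemma (in half_set) cap_value_le: "cap_value \<alpha> v (measure lborel S) \<le> C"
proof -
 define r where "r = measure lborel S"
 have "0 \<le> (LBINT x:S \<inter> {0<..<1}. (wt \<alpha> x - wt \<alpha> (measure lborel (S \<inter> {..x}))) * sqrt (1 - (3 / (2 * r) * measure lborel (S \<inter> {..x}) - 1 / 2)\<^sup>2))"
  unfolding set_int_def
  by (rule integral_nonneg_AE) (use weight_defect_nonneg[OF r_def] in \<open>auto simp: indicator_def\<close>)
 moreover have "cap_value \<alpha> v r
   + 2 * (LBINT x:S \<inter> {0<..<1}. (wt \<alpha> x - wt \<alpha> (measure lborel (S \<inter> {..x}))) * sqrt (1 - (3 / (2 * r) * measure lborel (S \<inter> {..x}) - 1 / 2)\<^sup>2))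
   + 2 * (LBINT x:{}. wt \<alpha> x * sqrt (1 - (3 / (2 * r) * measure lborel (S \<inter> {..x}) - 1 / 2)\<^sup>2)) \<le> C"
  by (rule calibration[OF r_def, of "{}" 1 0 "1/2" 1 1]) auto
 ultimately show ?thesis unfolding r_def[symmetric] by (simp add: set_int_def)
qed

section \<open>Equality: the abscissae and the sections are intervals\<close>

text \<open>The end points are the infimum of the points with mass to their left and the supremum of
  the points with mass to their right. Gaps are excluded for rational p and q only, because the
  hypothesis will hold for almost every section and countably many exceptions can be
  collected.\<close>

lemma interval_of_no_gaps:
 fixes B :: "real set"
 assumes B[measurable]: "B \<in> sets borel" and pos: "emeasure lborel B \<noteq> 0" and fin: "emeasure lborel B < \<infinity>"
  and gaps: "\<And>p q. p \<in> \<rat> \<Longrightarrow> q \<in> \<rat> \<Longrightarrow> p < q \<Longrightarrow> emeasure lborel (B \<inter> {..<p}) = 0 \<or>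
   emeasure lborel ({p<..<q} - B) = 0 \<or> emeasure lborel (B \<inter> {q<..}) = 0"
 obtains a b where "a < b" "AE y in lborel. y \<in> B \<longleftrightarrow> a < y \<and> y < b"
proof -
 define P where "P y \<longleftrightarrow> emeasure lborel (B \<inter> {..<y}) \<noteq> 0" for y
 define Q where "Q y \<longleftrightarrow> emeasure lborel (B \<inter> {y<..}) \<noteq> 0" for y
 have Pup: "P y'" if "P y" "y \<le> y'" for y y'
  using that emeasure_mono[of "B \<inter> {..<y}" "B \<inter> {..<y'}" lborel] unfolding P_def by force
 have Qdn: "Q y'" if "Q y" "y' \<le> y" for y y'
  using that emeasure_mono[of "B \<inter> {y<..}" "B \<inter> {y'<..}" lborel] unfolding Q_def by force
 \<comment> \<open>Arbitrary end points are reached by exhausting the interval with rational ones,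
   for which the hypothesis is available.\<close>
 have fill: "{y0<..<y1} - B \<in> null_sets lborel" if "P y0" "Q y1" for y0 y1
 proof -
  have "{y0<..<y1} - B = (\<Union>p\<in>{p\<in>\<rat>. y0 < p}. \<Union>q\<in>{q\<in>\<rat>. q < y1 \<and> p < q}. {p<..<q} - B)" (is "_ = ?U")
  proof (intro equalityI subsetI)
   fix y assume y: "y \<in> {y0<..<y1} - B"
   then obtain p q where "p \<in> \<rat>" "y0 < p" "p < y" "q \<in> \<rat>" "y < q" "q < y1"
    using Rats_dense_in_real[of y0 y] Rats_dense_in_real[of y y1] by auto
   then show "y \<in> ?U" using y by (intro UN_I[of p] UN_I[of q]) auto
  qed auto
  moreover have "?U \<in> null_sets lborel"
  proof (intro null_sets_UN')
   show "countable {p\<in>\<rat>. y0 < p}" "countable {q\<in>\<rat>. q < y1 \<and> p < q}" for p :: real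
    by (rule countable_subset[OF _ countable_rat], auto)+
   fix p q assume "p \<in> {p\<in>\<rat>. y0 < p}" "q \<in> {q\<in>\<rat>. q < y1 \<and> p < q}"
   then have pq: "p \<in> \<rat>" "q \<in> \<rat>" "p < q" "P p" "Q q" using Pup[OF that(1), of p] Qdn[OF that(2), of q] by auto
   then have "emeasure lborel ({p<..<q} - B) = 0" using gaps[of p q] unfolding P_def Q_def by auto
   then show "{p<..<q} - B \<in> null_sets lborel" by (intro null_setsI) auto
  qed
  ultimately show ?thesis by simp
 qed
 have cov: "(\<Union>n. B \<inter> {..<real n}) = B" "(\<Union>n. B \<inter> {- real n<..}) = B"
 proof -
  have "y \<in> (\<Union>n. B \<inter> {..<real n}) \<and> y \<in> (\<Union>n. B \<inter> {- real n<..})" if "y \<in> B" for y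
   using reals_Archimedean2[of y] reals_Archimedean2[of "-y"] that by (auto simp: minus_less_iff)
  then show "(\<Union>n. B \<inter> {..<real n}) = B" "(\<Union>n. B \<inter> {- real n<..}) = B" by blast+
 qed
 have exP: "\<exists>y. P y"
 proof (rule ccontr)
  assume "\<nexists>y. P y"
  then have "(\<Union>n. B \<inter> {..<real n}) \<in> null_sets lborel" unfolding P_def by (intro null_sets_UN null_setsI) auto
  then show False using pos unfolding cov by auto
 qed
 have exQ: "\<exists>y. Q y"
 proof (rule ccontr)
  assume "\<nexists>y. Q y"
  then have "(\<Union>n. B \<inter> {- real n<..}) \<in> null_sets lborel" unfolding Q_def by (intro null_sets_UN null_setsI) auto
  then show False using pos unfolding cov by auto
 qed
 define m where "m = measure lborel B"
 have em: "emeasure lborel B = ennreal m" unfolding m_def using fin by (intro emeasure_eq_ennreal_measure) auto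
 \<comment> \<open>The interval between such points lies in \<open>B\<close> up to a null set; its
   length is bounded by the measure of \<open>B\<close>, and so the infimum and the supremum are
   finite.\<close>
 have len: "y1 - y0 \<le> m" if "P y0" "Q y1" for y0 y1
 proof (cases "y0 \<le> y1")
  case True
  have "ennreal (y1 - y0) = emeasure lborel {y0<..<y1}" using True by simp
  also have "\<dots> \<le> emeasure lborel (B \<union> ({y0<..<y1} - B))" by (rule emeasure_mono) auto
  also have "\<dots> \<le> emeasure lborel B + emeasure lborel ({y0<..<y1} - B)" by (rule emeasure_subadditive) auto
  also have "\<dots> = ennreal m" using fill[OF that] em by (simp add: null_sets_def)
  finally show ?thesis by (simp add: m_def)
 qed (simp add: m_def add_increasing2 measure_nonneg le_diff_eq[symmetric] order_trans[OF _ measure_nonneg])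
 obtain p0 q0 where p0: "P p0" and q0: "Q q0" using exP exQ by blast
 have bP: "bdd_below {y. P y}" using len[OF _ q0] by (intro bdd_belowI[of _ "q0 - m"]) (auto simp: algebra_simps)
 have bQ: "bdd_above {y. Q y}" using len[OF p0] by (intro bdd_aboveI[of _ "m + p0"]) (auto simp: algebra_simps)
 define a where "a = Inf {y. P y}"
 define b where "b = Sup {y. Q y}"
 have Pa: "P y" if "a < y" for y
 proof -
  have "{y. P y} \<noteq> {}" using p0 by blast
  from cInf_lessD[OF this that[unfolded a_def]] obtain y' where "P y'" "y' < y" by blast
  then show ?thesis using Pup[of y' y] by simp
 qed
 have Pn: "\<not> P y" if "y < a" for y using that cInf_lower[OF _ bP, of y] unfolding a_def by force
 have Qb: "Q y" if "y < b" for y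
 proof -
  have "{y. Q y} \<noteq> {}" using q0 by blast
  from less_cSupD[OF this that[unfolded b_def]] obtain y' where "Q y'" "y < y'" by blast
  then show ?thesis using Qdn[of y' y] by simp
 qed
 have Qn: "\<not> Q y" if "b < y" for y using that cSup_upper[OF _ bQ, of y] unfolding b_def by force
 have n1: "B \<inter> {..<a} \<in> null_sets lborel"
 proof -
  have "B \<inter> {..<a} = (\<Union>q\<in>{q\<in>\<rat>. q < a}. B \<inter> {..<q})"
  proof (intro equalityI subsetI)
   fix y assume y: "y \<in> B \<inter> {..<a}"
   then obtain q where "q \<in> \<rat>" "y < q" "q < a" using Rats_dense_in_real[of y a] by auto
   then show "y \<in> (\<Union>q\<in>{q\<in>\<rat>. q < a}. B \<inter> {..<q})" using y by auto
  qed auto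
  moreover have "(\<Union>q\<in>{q\<in>\<rat>. q < a}. B \<inter> {..<q}) \<in> null_sets lborel"
  proof (rule null_sets_UN')
   show "countable {q\<in>\<rat>. q < a}" by (rule countable_subset[OF _ countable_rat]) auto
  qed (use Pn in \<open>auto simp: P_def intro!: null_setsI\<close>)
  ultimately show ?thesis by simp
 qed
 have n2: "B \<inter> {b<..} \<in> null_sets lborel"
 proof -
  have "B \<inter> {b<..} = (\<Union>q\<in>{q\<in>\<rat>. b < q}. B \<inter> {q<..})"
  proof (intro equalityI subsetI)
   fix y assume y: "y \<in> B \<inter> {b<..}"
   then obtain q where "q \<in> \<rat>" "b < q" "q < y" using Rats_dense_in_real[of b y] by auto
   then show "y \<in> (\<Union>q\<in>{q\<in>\<rat>. b < q}. B \<inter> {q<..})" using y by auto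
  qed auto
  moreover have "(\<Union>q\<in>{q\<in>\<rat>. b < q}. B \<inter> {q<..}) \<in> null_sets lborel"
  proof (rule null_sets_UN')
   show "countable {q\<in>\<rat>. b < q}" by (rule countable_subset[OF _ countable_rat]) auto
  qed (use Qn in \<open>auto simp: Q_def intro!: null_setsI\<close>)
  ultimately show ?thesis by simp
 qed
 have n3: "{a<..<b} - B \<in> null_sets lborel"
 proof -
  have "{a<..<b} - B = (\<Union>p\<in>{p\<in>\<rat>. a < p}. \<Union>q\<in>{q\<in>\<rat>. q < b}. {p<..<q} - B)" (is "_ = ?U")
  proof (intro equalityI subsetI)
   fix y assume y: "y \<in> {a<..<b} - B"
   then obtain p q where "p \<in> \<rat>" "a < p" "p < y" "q \<in> \<rat>" "y < q" "q < b"
    using Rats_dense_in_real[of a y] Rats_dense_in_real[of y b] by auto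
   then show "y \<in> ?U" using y by (intro UN_I[of p] UN_I[of q]) auto
  qed auto
  moreover have "?U \<in> null_sets lborel"
  proof (intro null_sets_UN')
   show "countable {p\<in>\<rat>. a < p}" "countable {q\<in>\<rat>. q < b}"
    by (rule countable_subset[OF _ countable_rat], auto)+
  qed (use Pa Qb fill in auto)
  ultimately show ?thesis by simp
 qed
 have "AE y in lborel. y \<noteq> a" "AE y in lborel. y \<noteq> b" by (rule AE_lborel_singleton)+
 then have ae: "AE y in lborel. y \<in> B \<longleftrightarrow> a < y \<and> y < b"
  using AE_not_in[OF n1] AE_not_in[OF n2] AE_not_in[OF n3] by eventually_elim auto
 have "a < b"
 proof (rule ccontr)
  assume "\<not> a < b"
  then have "AE y in lborel. y \<notin> B" using ae by (auto elim: eventually_mono)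
  then have "B \<in> null_sets lborel" by (subst AE_iff_null_sets) auto
  then show False using pos by auto
 qed
 then show ?thesis using ae by (rule that)
qed

lemma (in half_set) measure_initial:
 assumes S: "AE x in lborel. x \<in> S \<longleftrightarrow> 0 < x \<and> x < R" and "0 < x" "x < R"
 shows "measure lborel (S \<inter> {..x}) = x"
proof -
 have "AE z in lborel. z \<in> S \<inter> {..x} \<longleftrightarrow> z \<in> {0<..x}"
  using S by eventually_elim (use assms in auto)
 then have "measure lborel (S \<inter> {..x}) = measure lborel {0<..x}"
  by (intro measure_eq_AE) auto
 then show ?thesis using assms by simp
qed

text \<open>Uniqueness of the optimal radius gives |S| = R, and the weight loss in
  \<open>calibration\<close> must vanish. For \<alpha> > 0 the weight is strictly increasing, so t x
  = x almost everywhere on \<open>S\<close>: no mass is missing to the left of such points and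
  \<open>S\<close> fills the interval from 0 to R.\<close>

lemma (in half_set) equality_sections:
 assumes "0 < \<alpha>" "0 < R" and R: "critical \<alpha> v R" and C: "C \<le> cap_value \<alpha> v R"
 shows "measure lborel S = R" "AE x in lborel. x \<in> S \<longleftrightarrow> 0 < x \<and> x < R"
proof -
 define r where "r = measure lborel S"
 have r0: "0 < r" using S_measure_pos by (simp add: r_def)
 note cmin = cap_value_min[OF alpha v_pos \<open>0 < R\<close> R r0]
 have "cap_value \<alpha> v r = cap_value \<alpha> v R" using cap_value_le C cmin(1) unfolding r_def by linarith
 then have rR: "r = R" by (rule cmin(2))
 then show "measure lborel S = R" by (simp add: r_def)
 have Cr: "C \<le> cap_value \<alpha> v r" using C rR by simp
 note [measurable] = wt_borel[OF alpha]
 define t where "t x = measure lborel (S \<inter> {..x})" for x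
 have t0: "0 \<le> t x" "t x \<le> r" for x
  unfolding t_def r_def using measure_mono_fmeasurable[OF _ _ S_fin, of "S \<inter> {..x}"] by auto
 have tmono: "t x \<le> t y" if "x \<le> y" for x y
  unfolding t_def using that by (intro measure_mono_fmeasurable fmeasurable_Int_fmeasurable S_fin) auto
 have tx: "t x \<le> x" if "0 < x" for x
 proof -
  have "t x \<le> measure lborel {0..x}" unfolding t_def
   by (rule measure_mono_fmeasurable) (use S_pos in \<open>auto simp: fmeasurable_def emeasure_lborel_Icc_eq\<close>)
  then show ?thesis using that by simp
 qed
 have tm[measurable]: "t \<in> borel_measurable borel"
  by (rule borel_measurable_mono) (auto simp: mono_def tmono)
 define h where "h x = (wt \<alpha> x - wt \<alpha> (t x)) * sqrt (1 - (3 / (2 * r) * t x - 1 / 2)\<^sup>2)" for x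
 have hm[measurable]: "h \<in> borel_measurable borel" unfolding h_def[abs_def] by measurable
 have h0: "0 \<le> h x" if "x \<in> S" for x using weight_defect_nonneg[OF r_def that] by (simp add: h_def t_def)
 have sq: "(3 / (2 * r) * t x - 1 / 2)\<^sup>2 \<le> 1" for x
 proof -
  have "0 \<le> 3 / (2 * r) * t x" "3 / (2 * r) * t x \<le> 3 / 2" using t0[of x] r0 by (auto simp: divide_simps)
  then show ?thesis by (simp add: abs_square_le_1 abs_le_iff)
 qed
 have hz: "AE x in lborel. x \<in> S \<inter> {0<..<real (Suc n)} \<longrightarrow> h x = 0" for n
 proof -
  define T where "T = S \<inter> {0<..<real (Suc n)}"
  have Tb[measurable]: "T \<in> sets borel" unfolding T_def by measurable
  have Tf: "emeasure lborel T < \<infinity>" unfolding T_def using trunc_fmeasurable by (auto simp: fmeasurable_def)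
  have "cap_value \<alpha> v r + 2 * (LBINT x:T. h x) + 2 * (LBINT x:{}. wt \<alpha> x * sqrt (1 - (3 / (2 * r) * measure lborel (S \<inter> {..x}) - 1 / 2)\<^sup>2)) \<le> C"
   unfolding h_def t_def T_def by (rule calibration[OF r_def, of "{}" 1 0 "1/2" 1]) auto
  then have le: "(LBINT x:T. h x) \<le> 0" using Cr by (simp add: set_int_def)
  have si: "set_integrable lborel T h"
  proof (rule set_integrable_bounded[OF Tb Tf hm])
   fix x assume x: "x \<in> T"
   have "0 \<le> wt \<alpha> x - wt \<alpha> (t x)"
    using x tx[of x] t0(1)[of x] wt_mono[OF alpha, of "t x" x] by (auto simp: T_def)
   moreover have "wt \<alpha> x \<le> wt \<alpha> (real (Suc n))"
    using x by (intro wt_mono[OF alpha]) (auto simp: T_def)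
   ultimately have "\<bar>wt \<alpha> x - wt \<alpha> (t x)\<bar> \<le> wt \<alpha> (real (Suc n))"
    using wt_nonneg[of \<alpha> "t x"] by linarith
   then show "\<bar>h x\<bar> \<le> wt \<alpha> (real (Suc n)) * 1"
    unfolding h_def abs_mult using sq[of x] by (intro mult_mono) auto
  qed
  have "0 \<le> (LBINT x:T. h x)" unfolding set_int_def
   by (rule integral_nonneg_AE) (use h0 in \<open>auto simp: T_def indicator_def\<close>)
  then have "(LBINT x. indicator T x *\<^sub>R h x) = 0" using le by (simp add: set_int_def)
  then have "AE x in lborel. indicator T x *\<^sub>R h x = 0"
   using si h0 by (subst (asm) integral_nonneg_eq_0_iff_AE) (auto simp: set_integrable_def T_def indicator_def)
  then show ?thesis by eventually_elim (auto simp: T_def indicator_def split: if_splits)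
 qed
 then have "AE x in lborel. \<forall>n. x \<in> S \<inter> {0<..<real (Suc n)} \<longrightarrow> h x = 0"
  unfolding AE_all_countable by (rule allI)
 then have hS: "AE x in lborel. x \<in> S \<longrightarrow> h x = 0"
 proof eventually_elim
  fix x assume a: "\<forall>n. x \<in> S \<inter> {0<..<real (Suc n)} \<longrightarrow> h x = 0"
  obtain n where "x < real n" using reals_Archimedean2 by blast
  then have "x < real (Suc n)" by simp
  then show "x \<in> S \<longrightarrow> h x = 0" using a S_pos by auto
 qed
 \<comment> \<open>Where t has reached r the root is zero and the vanishing loss gives no
   information; these points have to be shown negligible.\<close>
 have end_null: "AE x in lborel. x \<in> S \<longrightarrow> t x < r"
 proof -
  define Z where "Z = {x \<in> S. t x = r}"
  have q0: "S \<inter> {q<..} \<in> null_sets lborel" if "t q = r" for q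
  proof -
   have "measure lborel S = measure lborel (S \<inter> {..q}) + measure lborel (S \<inter> {q<..})"
   proof -
    have "S = (S \<inter> {..q}) \<union> (S \<inter> {q<..})" by auto
    then have "measure lborel S = measure lborel ((S \<inter> {..q}) \<union> (S \<inter> {q<..}))" by simp
    also have "\<dots> = measure lborel (S \<inter> {..q}) + measure lborel (S \<inter> {q<..})"
    proof (rule measure_Union)
     have "S \<inter> {..q} \<in> fmeasurable lborel" "S \<inter> {q<..} \<in> fmeasurable lborel"
      by (rule fmeasurable_Int_fmeasurable[OF S_fin], simp)+
     then show "emeasure lborel (S \<inter> {..q}) \<noteq> \<infinity>" "emeasure lborel (S \<inter> {q<..}) \<noteq> \<infinity>"
      by (auto simp: fmeasurable_def)
    qed auto
    finally show ?thesis .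
   qed
   then have "measure lborel (S \<inter> {q<..}) = 0" using that by (simp add: t_def r_def)
   moreover have "S \<inter> {q<..} \<in> fmeasurable lborel" by (intro fmeasurable_Int_fmeasurable S_fin) auto
   ultimately have "emeasure lborel (S \<inter> {q<..}) = 0" using emeasure_eq_measure2 by (metis ennreal_0)
   then show ?thesis by (intro null_setsI) auto
  qed
  \<comment> \<open>Past a rational q with t q = r only a null part of \<open>S\<close> remains.
    Every point of \<open>Z\<close> lies past such a q, with the possible exception of a least one,
    called c.\<close>
  have "\<exists>c. Z \<subseteq> {c} \<union> (\<Union>q\<in>{q\<in>\<rat>. t q = r}. S \<inter> {q<..})"
  proof (cases "\<exists>c\<in>Z. \<forall>z\<in>Z. c \<le> z")
   case True
   then obtain c where c: "c \<in> Z" "\<forall>z\<in>Z. c \<le> z" by blast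
   have "z = c \<or> z \<in> (\<Union>q\<in>{q\<in>\<rat>. t q = r}. S \<inter> {q<..})" if z: "z \<in> Z" for z
   proof (cases "z = c")
    case False
    then have "c < z" using c z by force
    then obtain q where q: "q \<in> \<rat>" "c < q" "q < z" using Rats_dense_in_real by blast
    have "t q = r" using tmono[of c q] t0(2)[of q] q c by (auto simp: Z_def)
    then show ?thesis using q z by (auto simp: Z_def)
   qed simp
   then show ?thesis by blast
  next
   case False
   have "z \<in> (\<Union>q\<in>{q\<in>\<rat>. t q = r}. S \<inter> {q<..})" if z: "z \<in> Z" for z
   proof -
    obtain c where c: "c \<in> Z" "c < z" using False z by (meson not_le)
    then obtain q where q: "q \<in> \<rat>" "c < q" "q < z" using Rats_dense_in_real by blast
    have "t q = r" using tmono[of c q] t0(2)[of q] q c by (auto simp: Z_def)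
    then show ?thesis using q z by (auto simp: Z_def)
   qed
   then show ?thesis by blast
  qed
  then obtain c where c: "Z \<subseteq> {c} \<union> (\<Union>q\<in>{q\<in>\<rat>. t q = r}. S \<inter> {q<..})" by blast
  have "(\<Union>q\<in>{q\<in>\<rat>. t q = r}. S \<inter> {q<..}) \<in> null_sets lborel"
  proof (rule null_sets_UN')
   show "countable {q\<in>\<rat>. t q = r}" by (rule countable_subset[OF _ countable_rat]) auto
  qed (use q0 in auto)
  then have "{c} \<union> (\<Union>q\<in>{q\<in>\<rat>. t q = r}. S \<inter> {q<..}) \<in> null_sets lborel" by (intro null_sets.Un) auto
  from AE_not_in[OF this] show ?thesis
  proof eventually_elim
   fix x assume "x \<notin> {c} \<union> (\<Union>q\<in>{q\<in>\<rat>. t q = r}. S \<inter> {q<..})"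
   then have "x \<notin> Z" using c by blast
   then show "x \<in> S \<longrightarrow> t x < r" using t0(2)[of x] by (auto simp: Z_def)
  qed
 qed
 have sub: "AE x in lborel. x \<in> S \<longrightarrow> x \<in> {0<..<r}"
  using hS end_null
 proof eventually_elim
  fix x assume h: "x \<in> S \<longrightarrow> h x = 0" and e: "x \<in> S \<longrightarrow> t x < r"
  show "x \<in> S \<longrightarrow> x \<in> {0<..<r}"
  proof
   assume xS: "x \<in> S"
   then have x0: "0 < x" using S_pos by auto
   have "3 / (2 * r) * t x - 1 / 2 < 1" using e xS r0 by (simp add: divide_simps)
   moreover have "3 / (2 * r) * t x - 1 / 2 > - 1"
   proof -
    have "0 \<le> 3 / (2 * r) * t x" using t0[of x] r0 by simp
    then show ?thesis by linarith
   qed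
   ultimately have "(3 / (2 * r) * t x - 1 / 2)\<^sup>2 < 1" by (simp add: abs_square_less_1 abs_less_iff)
   then have "wt \<alpha> x = wt \<alpha> (t x)" using h xS by (simp add: h_def)
   then have "\<not> t x < x" using wt_strict_mono[OF \<open>0 < \<alpha>\<close>, of "t x" x] t0(1)[of x] x0 by auto
   then have "t x = x" using tx[OF x0] by simp
   then show "x \<in> {0<..<r}" using e xS x0 by simp
  qed
 qed
 define N where "N = {0<..<r} - S"
 have Nm[measurable]: "N \<in> sets borel" unfolding N_def by measurable
 have "AE x in lborel. x \<in> S \<longleftrightarrow> x \<in> {0<..<r} - N" using sub by eventually_elim (auto simp: N_def)
 then have "measure lborel S = measure lborel ({0<..<r} - N)" by (intro measure_eq_AE) auto
 also have "\<dots> = measure lborel {0<..<r} - measure lborel N"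
  by (rule measure_Diff) (use r0 in \<open>auto simp: N_def\<close>)
 also have "\<dots> = r - measure lborel N" using r0 by simp
 finally have "measure lborel N = 0" by (simp add: r_def)
 moreover have "N \<in> fmeasurable lborel"
  by (rule fmeasurableI, measurable) (rule le_less_trans[OF emeasure_mono[of _ "{0<..<r}"]], use r0 in \<open>auto simp: N_def\<close>)
 ultimately have "emeasure lborel N = 0" using emeasure_eq_measure2 by (metis ennreal_0)
 then have "N \<in> null_sets lborel" by (intro null_setsI) auto
 from AE_not_in[OF this] sub show "AE x in lborel. x \<in> S \<longleftrightarrow> 0 < x \<and> x < R"
  by eventually_elim (auto simp: N_def rR)
qed

lemma positive_truncation:
 fixes B :: "real set"
 assumes B[measurable]: "B \<in> sets borel" and "emeasure lborel B \<noteq> 0"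
 obtains n0 where "\<And>n. n0 \<le> n \<Longrightarrow> 0 < measure lborel (B \<inter> {- real n<..<real n})"
proof -
 have "\<exists>k. emeasure lborel (B \<inter> {-real k<..<real k}) \<noteq> 0"
 proof (rule ccontr)
  assume "\<not> ?thesis"
  then have "(\<Union>k. B \<inter> {-real k<..<real k}) \<in> null_sets lborel" by (intro null_sets_UN null_setsI) auto
  moreover have "(\<Union>k. B \<inter> {-real k<..<real k}) = B"
  proof -
   have "y \<in> (\<Union>k. B \<inter> {-real k<..<real k})" if "y \<in> B" for y
    using reals_Archimedean2[of "\<bar>y\<bar>"] that by (auto simp: abs_less_iff minus_less_iff)
   then show ?thesis by blast
  qed
  ultimately show False using assms(2) by auto
 qed
 then obtain k where k: "emeasure lborel (B \<inter> {-real k<..<real k}) \<noteq> 0" by blast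
 have "0 < measure lborel (B \<inter> {- real n<..<real n})" if "k \<le> n" for n
 proof -
  have "emeasure lborel (B \<inter> {-real k<..<real k}) \<le> emeasure lborel (B \<inter> {-real n<..<real n})"
   by (rule emeasure_mono) (use that in auto)
  then have "emeasure lborel (B \<inter> {-real n<..<real n}) \<noteq> 0" using k by force
  moreover have "emeasure lborel (B \<inter> {-real n<..<real n}) < \<infinity>"
   by (rule le_less_trans[OF emeasure_mono[of _ "{-real n<..<real n}"]]) auto
  ultimately show ?thesis by (simp add: measure_def enn2real_positive_iff zero_less_iff_neq_zero)
 qed
 then show ?thesis by (rule that)
qed

lemma (in half_set) finite_sections: "AE x in lborel. emeasure lborel {y. (x, y) \<in> A} < \<infinity>"
proof -
 have Ap: "A \<in> sets (borel \<Otimes>\<^sub>M borel)" unfolding borel_prod by (rule A_borel)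
 have "emeasure (lborel \<Otimes>\<^sub>M lborel) A = (\<integral>\<^sup>+ x. emeasure lborel (Pair x -` A) \<partial>lborel)"
  by (rule lborel.emeasure_pair_measure_alt) (use Ap in simp)
 then have "(\<integral>\<^sup>+ x. emeasure lborel {y. (x, y) \<in> A} \<partial>lborel) = emeasure lborel A" unfolding lborel_prod by (simp add: vimage_def)
 then have "(\<integral>\<^sup>+ x. emeasure lborel {y. (x, y) \<in> A} \<partial>lborel) \<noteq> \<infinity>" using A_fin by simp
 from nn_integral_PInf_AE[OF _ this] show ?thesis
  using section_measure_borel(1)[OF A_borel] by (auto simp: less_top[symmetric])
qed

definition sec_len :: "plane set \<Rightarrow> real \<Rightarrow> real" where
 "sec_len A x = measure lborel {y. (x, y) \<in> A}"

text \<open>The centre of mass of a section, which is the midpoint when the section is an interval.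
  As a quotient of integrals it is measurable in x.\<close>

definition sec_mid :: "plane set \<Rightarrow> real \<Rightarrow> real" where
 "sec_mid A x = (LBINT y. indicator A (x, y) * y) / sec_len A x"

abbreviation (input) interval_section :: "plane set \<Rightarrow> real \<Rightarrow> bool" where
 "interval_section A x \<equiv> (AE y in lborel. (x, y) \<in> A \<longleftrightarrow> sec_mid A x - sec_len A x / 2 < y \<and> y < sec_mid A x + sec_len A x / 2)"

abbreviation (input) interval_sections :: "plane set \<Rightarrow> real \<Rightarrow> real \<Rightarrow> bool" where
 "interval_sections A R x \<equiv> (0 < x \<and> x < R \<longrightarrow> 0 < sec_len A x \<and> interval_section A x) \<and> (\<not> (0 < x \<and> x < R) \<longrightarrow> (AE y in lborel. (x, y) \<notin> A))"

lemma section_borel_measurable: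
 assumes [measurable]: "A \<in> sets (borel :: plane measure)"
 shows "sec_len A \<in> borel_measurable borel" "sec_mid A \<in> borel_measurable borel"
proof -
 show l: "sec_len A \<in> borel_measurable borel"
  unfolding sec_len_def[abs_def] by (rule section_measure_borel(2)[OF assms])
 have "(\<lambda>(x, y). indicator A (x, y) * y :: real) \<in> borel_measurable (borel \<Otimes>\<^sub>M lborel)" by measurable
 then have "(\<lambda>x. \<integral>y. indicator A (x, y) * y \<partial>lborel) \<in> borel_measurable borel"
  by (rule lborel.borel_measurable_lebesgue_integral)
 then show "sec_mid A \<in> borel_measurable borel"
  unfolding sec_mid_def[abs_def] using l by measurable
qed

text \<open>The extra gain in \<open>calibration\<close> must vanish, although its integrand is
  positive for abscissae between 0 and R. So for each rational gap, window n and threshold 1/(k +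
  1), almost no section shows it; countably many such statements exclude all gaps at once.\<close>

lemma (in half_set) equality_intervals:
 assumes "0 < \<alpha>" "0 < R" and R: "critical \<alpha> v R" and C: "C \<le> cap_value \<alpha> v R"
 shows "AE x in lborel. 0 < x \<and> x < R \<longrightarrow> 0 < sec_len A x \<and>
  interval_section A x"
proof -
 note [measurable] = A_borel wt_borel[OF alpha]
 note S = equality_sections[OF assms]
 define sec where "sec x = {y. (x, y) \<in> A}" for x
 have sec[measurable]: "sec x \<in> sets borel" for x unfolding sec_def by measurable
 have msec: "(\<lambda>x. measure lborel (sec x \<inter> T)) \<in> borel_measurable borel" if [measurable]: "T \<in> sets borel" for T
 proof -
  have "A \<inter> {z. snd z \<in> T} \<in> sets borel" by measurable
  from section_measure_borel(2)[OF this] show ?thesis by (simp add: sec_def Int_def)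
 qed
 have msec': "(\<lambda>x. measure lborel (T - sec x)) \<in> borel_measurable borel" if [measurable]: "T \<in> sets borel" for T
 proof -
  have "{z. snd z \<in> T \<and> z \<notin> A} \<in> sets borel" by measurable
  from section_measure_borel(2)[OF this] show ?thesis by (simp add: sec_def set_diff_eq)
 qed
 note [measurable] = msec msec'
 define X where "X p q n k = {x \<in> S. 0 < x \<and> x < R \<and> \<bar>x\<bar> < real n \<and> measure lborel (sec x \<inter> {- real n<..<p}) > 1 / real (Suc k) \<and>
    measure lborel ({p<..<q} - sec x) > 1 / real (Suc k) \<and> measure lborel (sec x \<inter> {q<..<real n}) > 1 / real (Suc k)}" for p q n k
 have Xm[measurable]: "X p q n k \<in> sets borel" for p q n k unfolding X_def by measurable
 have Xnull: "AE x in lborel. x \<notin> X p q n k" if pq: "- real n < p" "p < q" "q < real n" for p q n k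
 proof -
  define c where "c x = wt \<alpha> x * sqrt (1 - (3 / (2 * R) * x - 1 / 2)\<^sup>2)" for x
  have cpos: "0 < c x" if "0 < x" "x < R" for x
  proof -
   have "0 < 3 / (2 * R) * x" "3 / (2 * R) * x < 3 / 2" using that by (auto simp: divide_simps)
   then have "(3 / (2 * R) * x - 1 / 2)\<^sup>2 < 1" by (simp add: abs_square_less_1 abs_less_iff)
   then show ?thesis unfolding c_def using that wt_pos[of x \<alpha>] by auto
  qed
  have cle: "c x \<le> wt \<alpha> R" if "0 < x" "x < R" for x
  proof -
   have "sqrt (1 - (3 / (2 * R) * x - 1 / 2)\<^sup>2) \<le> 1" by simp
   moreover have "0 \<le> sqrt (1 - (3 / (2 * R) * x - 1 / 2)\<^sup>2)" using cpos[OF that] unfolding c_def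
    by (metis wt_nonneg less_eq_real_def linorder_not_le mult_nonneg_nonpos)
   ultimately have "c x \<le> wt \<alpha> R * 1"
    unfolding c_def using that by (intro mult_mono wt_mono[OF alpha]) auto
   then show ?thesis by simp
  qed
  have [measurable]: "c \<in> borel_measurable borel" unfolding c_def[abs_def] by measurable
  have XX: "X p q n k \<subseteq> S \<inter> {0<..<R}" by (auto simp: X_def)
  have "cap_value \<alpha> v R
   + 2 * (LBINT x:S \<inter> {0<..<R}. (wt \<alpha> x - wt \<alpha> (measure lborel (S \<inter> {..x}))) * sqrt (1 - (3 / (2 * R) * measure lborel (S \<inter> {..x}) - 1 / 2)\<^sup>2))
   + 2 * (LBINT x:X p q n k. wt \<alpha> x * sqrt (1 - (3 / (2 * R) * measure lborel (S \<inter> {..x}) - 1 / 2)\<^sup>2)) \<le> C"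
   by (rule calibration[OF S(1)[symmetric] Xm pq _ _ XX \<open>0 < R\<close>, of "1 / real (Suc k)"]) (auto simp: X_def sec_def)
  moreover have "0 \<le> (LBINT x:S \<inter> {0<..<R}. (wt \<alpha> x - wt \<alpha> (measure lborel (S \<inter> {..x}))) * sqrt (1 - (3 / (2 * R) * measure lborel (S \<inter> {..x}) - 1 / 2)\<^sup>2))"
   unfolding set_int_def
   by (rule integral_nonneg_AE) (use weight_defect_nonneg[OF S(1)[symmetric]] in \<open>auto simp: indicator_def\<close>)
  moreover have "(LBINT x:X p q n k. wt \<alpha> x * sqrt (1 - (3 / (2 * R) * measure lborel (S \<inter> {..x}) - 1 / 2)\<^sup>2)) = (LBINT x:X p q n k. c x)"
   by (rule set_lebesgue_integral_cong) (auto simp: c_def X_def measure_initial[OF S(2)])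
  ultimately have le: "(LBINT x:X p q n k. c x) \<le> 0" using C by linarith
  have "set_integrable lborel (X p q n k) c"
  proof (rule set_integrable_bounded)
   show "emeasure lborel (X p q n k) < \<infinity>"
    by (rule le_less_trans[OF emeasure_mono[of _ "{0<..<R}"]]) (use \<open>0 < R\<close> in \<open>auto simp: X_def\<close>)
   show "\<bar>c x\<bar> \<le> wt \<alpha> R" if "x \<in> X p q n k" for x
    using that cpos[of x] cle[of x] by (auto simp: X_def)
  qed measurable
  moreover have "0 \<le> (LBINT x:X p q n k. c x)" unfolding set_int_def
   by (rule integral_nonneg_AE) (use cpos in \<open>auto simp: X_def indicator_def intro: less_imp_le\<close>)
  then have "(LBINT x. indicator (X p q n k) x *\<^sub>R c x) = 0" using le by (simp add: set_int_def)
  ultimately have "AE x in lborel. indicator (X p q n k) x *\<^sub>R c x = 0"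
   using cpos by (subst (asm) integral_nonneg_eq_0_iff_AE) (auto simp: set_integrable_def X_def indicator_def intro: less_imp_le)
  then show ?thesis
  proof eventually_elim
   fix x assume "indicator (X p q n k) x *\<^sub>R c x = 0"
   then show "x \<notin> X p q n k" using cpos[of x] by (auto simp: X_def)
  qed
 qed
 have "AE x in lborel. \<forall>p\<in>\<rat>. \<forall>q\<in>\<rat>. \<forall>n. \<forall>k. - real n < p \<and> p < q \<and> q < real n \<longrightarrow> x \<notin> X p q n k"
  unfolding AE_ball_countable[OF countable_rat] AE_all_countable
 proof (intro ballI allI)
  fix p q n k
  show "AE x in lborel. - real n < p \<and> p < q \<and> q < real n \<longrightarrow> x \<notin> X p q n k"
   using Xnull[of n p q k] by (cases "- real n < p \<and> p < q \<and> q < real n") auto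
 qed
 with S(2) finite_sections show ?thesis
 proof eventually_elim
  fix x assume xS: "x \<in> S \<longleftrightarrow> 0 < x \<and> x < R" and xf: "emeasure lborel {y. (x, y) \<in> A} < \<infinity>"
   and gap: "\<forall>p\<in>\<rat>. \<forall>q\<in>\<rat>. \<forall>n. \<forall>k. - real n < p \<and> p < q \<and> q < real n \<longrightarrow> x \<notin> X p q n k"
  show "0 < x \<and> x < R \<longrightarrow> 0 < sec_len A x \<and>
   interval_section A x"
  proof
   assume x: "0 < x \<and> x < R"
   have e0: "emeasure lborel (sec x) \<noteq> 0" using x xS unfolding S_def sec_def by simp
   obtain a b where ab: "a < b" "AE y in lborel. y \<in> sec x \<longleftrightarrow> a < y \<and> y < b"
   proof (rule interval_of_no_gaps[OF sec e0])
    show "emeasure lborel (sec x) < \<infinity>" using xf by (simp add: sec_def)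
    fix p q :: real assume pq: "p \<in> \<rat>" "q \<in> \<rat>" "p < q"
    show "emeasure lborel (sec x \<inter> {..<p}) = 0 \<or> emeasure lborel ({p<..<q} - sec x) = 0 \<or> emeasure lborel (sec x \<inter> {q<..}) = 0"
    proof (rule ccontr)
     assume "\<not> ?thesis"
     then have ne: "emeasure lborel (sec x \<inter> {..<p}) \<noteq> 0" "emeasure lborel ({p<..<q} - sec x) \<noteq> 0" "emeasure lborel (sec x \<inter> {q<..}) \<noteq> 0" by auto
     obtain n1 where n1: "\<And>n. n1 \<le> n \<Longrightarrow> 0 < measure lborel ((sec x \<inter> {..<p}) \<inter> {- real n<..<real n})"
      using positive_truncation[OF _ ne(1)] by (metis borel_open open_lessThan sec sets.Int)
     obtain n2 where n2: "\<And>n. n2 \<le> n \<Longrightarrow> 0 < measure lborel (({p<..<q} - sec x) \<inter> {- real n<..<real n})"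
      using positive_truncation[OF _ ne(2)] by (metis borel_open open_greaterThanLessThan sec sets.Diff)
     obtain n3 where n3: "\<And>n. n3 \<le> n \<Longrightarrow> 0 < measure lborel ((sec x \<inter> {q<..}) \<inter> {- real n<..<real n})"
      using positive_truncation[OF _ ne(3)] by (metis borel_open open_greaterThan sec sets.Int)
     obtain n4 where n4: "\<bar>x\<bar> + \<bar>p\<bar> + \<bar>q\<bar> < real n4" using reals_Archimedean2 by blast
     define n where "n = max (max n1 n2) (max n3 n4)"
     have "real n4 \<le> real n" by (simp add: n_def)
     then have n: "\<bar>x\<bar> < real n" "- real n < p" "q < real n" "p < real n" "- real n < q" using n4 by linarith+
     have "(sec x \<inter> {..<p}) \<inter> {- real n<..<real n} = sec x \<inter> {- real n<..<p}"
      "({p<..<q} - sec x) \<inter> {- real n<..<real n} = {p<..<q} - sec x"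
      "(sec x \<inter> {q<..}) \<inter> {- real n<..<real n} = sec x \<inter> {q<..<real n}" using n pq(3) by auto
     then have pos: "0 < measure lborel (sec x \<inter> {- real n<..<p})" "0 < measure lborel ({p<..<q} - sec x)"
       "0 < measure lborel (sec x \<inter> {q<..<real n})"
      using n1[of n] n2[of n] n3[of n] by (auto simp: n_def)
     define \<kappa> where "\<kappa> = min (measure lborel (sec x \<inter> {- real n<..<p})) (min (measure lborel ({p<..<q} - sec x)) (measure lborel (sec x \<inter> {q<..<real n})))"
     have "0 < \<kappa>" using pos by (simp add: \<kappa>_def)
     then obtain k where k: "1 / real (Suc k) < \<kappa>" using nat_approx_posE by blast
     then have "x \<in> X p q n k" using x xS n by (auto simp: X_def \<kappa>_def)
     then show False using gap pq n by blast
    qed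
   qed
   have len: "sec_len A x = b - a"
   proof -
    have "measure lborel (sec x) = measure lborel {a<..<b}" using ab(2) by (intro measure_eq_AE) auto
    then show ?thesis using ab(1) by (simp add: sec_len_def sec_def)
   qed
   have "(LBINT y. indicator A (x, y) * y) = (LBINT y. y * indicator {a..b} y)"
   proof (rule integral_cong_AE)
    have "AE y in lborel. y \<noteq> a" "AE y in lborel. y \<noteq> b" by (rule AE_lborel_singleton)+
    with ab(2) show "AE y in lborel. indicator A (x, y) * y = y * indicator {a..b} y"
     by eventually_elim (auto simp: sec_def indicator_def)
   qed measurable
   also have "\<dots> = b\<^sup>2 / 2 - a\<^sup>2 / 2"
    by (rule integral_FTC_Icc_real[of a b "\<lambda>y. y\<^sup>2 / 2"]) (use ab(1) in \<open>auto intro!: derivative_eq_intros\<close>)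
   also have "\<dots> = (a + b) / 2 * (b - a)" by (simp add: power2_eq_square field_simps)
   finally have cen: "sec_mid A x = (a + b) / 2" unfolding sec_mid_def len using ab(1) by simp
   have "sec_mid A x - sec_len A x / 2 = a" "sec_mid A x + sec_len A x / 2 = b"
    unfolding cen len by (auto simp: field_simps)
   then show "0 < sec_len A x \<and>
   interval_section A x"
    using ab len by (simp add: sec_def)
  qed
 qed
qed

section \<open>The optimal profile\<close>

text \<open>The equation for f says that the Grushin normal of its graph, proportional to (-f', w),
  is the unit vector (u, c) with c = sqrt (1 - u^2): the boundary is everywhere orthogonal to the
  calibrating field. At R the slope is infinite, so differentiability is asked only in the
  interior.\<close>

locale cap =
 fixes \<alpha> v R :: real and f :: "real \<Rightarrow> real"
 assumes alpha: "0 \<le> \<alpha>" and v_pos: "0 < v" and R_pos: "0 < R"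
  and R_eq: "critical \<alpha> v R"
  and f_cont: "continuous_on {0..R} f" and f_end: "f R = 0"
  and f_deriv: "\<And>x. 0 < x \<Longrightarrow> x < R \<Longrightarrow> (f has_real_derivative
    - (wt \<alpha> x * (3 / (2 * R) * x - 1 / 2) / sqrt (1 - (3 / (2 * R) * x - 1 / 2)\<^sup>2))) (at x)"
begin

definition u :: "real \<Rightarrow> real" where "u x = 3 / (2 * R) * x - 1 / 2"
definition c :: "real \<Rightarrow> real" where "c x = sqrt (1 - (u x)\<^sup>2)"
definition f' :: "real \<Rightarrow> real" where "f' x = - (wt \<alpha> x * u x / c x)"

lemma f_DERIV: "0 < x \<Longrightarrow> x < R \<Longrightarrow> (f has_real_derivative f' x) (at x)"
 using f_deriv by (simp add: f'_def u_def c_def)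

lemma u_bounds: "0 \<le> x \<Longrightarrow> x \<le> R \<Longrightarrow> - (1/2) \<le> u x \<and> u x \<le> 1"
 "0 \<le> x \<Longrightarrow> x < R \<Longrightarrow> u x < 1"
proof -
 show "0 \<le> x \<Longrightarrow> x \<le> R \<Longrightarrow> - (1/2) \<le> u x \<and> u x \<le> 1"
  using R_pos by (auto simp: u_def field_simps)
 show "0 \<le> x \<Longrightarrow> x < R \<Longrightarrow> u x < 1"
  using R_pos by (auto simp: u_def field_simps)
qed

lemma c_pos: "0 \<le> x \<Longrightarrow> x < R \<Longrightarrow> 0 < c x"
proof -
 assume "0 \<le> x" "x < R"
 then have "- 1 < u x" "u x < 1" using u_bounds[of x] by auto
 then have "(u x)\<^sup>2 < 1" by (simp add: abs_square_less_1 abs_less_iff)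
 then show ?thesis by (simp add: c_def)
qed

lemma c_bounds: "0 \<le> x \<Longrightarrow> x \<le> R \<Longrightarrow> 0 \<le> c x \<and> c x \<le> 1 \<and> (c x)\<^sup>2 = 1 - (u x)\<^sup>2"
proof -
 assume x: "0 \<le> x" "x \<le> R"
 then have "(u x)\<^sup>2 \<le> 1" using u_bounds(1)[of x] by (simp add: abs_square_le_1 abs_le_iff)
 then show ?thesis by (simp add: c_def)
qed

lemma u_cont: "continuous_on T u" unfolding u_def[abs_def] using R_pos by (intro continuous_intros) auto
lemma c_cont: "continuous_on T c" unfolding c_def[abs_def] by (intro continuous_intros u_cont)

lemma u_DERIV: "(u has_real_derivative 3 / (2 * R)) (at x)"
 unfolding u_def[abs_def] using R_pos by (auto intro!: derivative_eq_intros)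

lemma c_DERIV: "0 \<le> x \<Longrightarrow> x < R \<Longrightarrow> (c has_real_derivative - (3 / (2 * R) * u x / c x)) (at x)"
proof -
 assume x: "0 \<le> x" "x < R"
 have "((\<lambda>x. 1 - (u x)\<^sup>2) has_real_derivative - (2 * u x * (3 / (2 * R)))) (at x)"
  by (auto intro!: derivative_eq_intros u_DERIV)
 moreover have "0 < 1 - (u x)\<^sup>2" using c_pos[OF x] by (simp add: c_def)
 ultimately have "((\<lambda>x. sqrt (1 - (u x)\<^sup>2)) has_real_derivative inverse (sqrt (1 - (u x)\<^sup>2)) / 2 * - (2 * u x * (3 / (2 * R)))) (at x)"
  by (intro DERIV_chain2[OF DERIV_real_sqrt])
 then show ?thesis unfolding c_def[abs_def] by (simp add: field_simps)
qed

lemma c_end: "c R = 0"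
proof -
 have "R \<noteq> 0" using R_pos by simp
 then have "u R = 1" by (simp add: u_def)
 then show ?thesis by (simp add: c_def)
qed

lemma f'_cont: "continuous_on {0..<R} f'"
 unfolding f'_def[abs_def]
proof (intro continuous_intros u_cont c_cont wt_continuous[OF alpha])
 show "\<forall>x\<in>{0..<R}. c x \<noteq> 0" by (metis c_pos atLeastLessThan_iff less_irrefl)
qed

text \<open>The constant is chosen so that the derivative of f minus the multiple of
  \<open>c\<close> is - (w(x) - w(R/3)) u/c. Since u changes sign exactly at R/3 and the weight is
  monotone, this is never positive, and both functions vanish at R.\<close>

lemma f_lower:
 assumes "0 \<le> x" "x \<le> R"
 shows "wt \<alpha> (R / 3) * (2 * R / 3) * c x \<le> f x"
proof -
 define K where "K = wt \<alpha> (R / 3) * (2 * R / 3)"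
 have "f R - K * c R \<le> f x - K * c x"
 proof (rule DERIV_nonpos_imp_decreasing_open[OF assms(2)])
  show "\<exists>y. ((\<lambda>x. f x - K * c x) has_real_derivative y) (at t) \<and> y \<le> 0" if t: "x < t" "t < R" for t
  proof (intro exI conjI)
   have t': "0 < t" "t < R" using t assms by auto
   show "((\<lambda>x. f x - K * c x) has_real_derivative (f' t - K * (- (3 / (2 * R) * u t / c t)))) (at t)"
    using t' by (intro DERIV_diff DERIV_cmult f_DERIV c_DERIV) auto
   have "f' t - K * (- (3 / (2 * R) * u t / c t)) = - ((wt \<alpha> t - wt \<alpha> (R / 3)) * u t) / c t"
    using R_pos c_pos[of t] t' by (simp add: f'_def K_def field_simps)
   moreover have "0 \<le> (wt \<alpha> t - wt \<alpha> (R / 3)) * u t"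
   proof (cases "R / 3 \<le> t")
    case True
    then have "wt \<alpha> (R / 3) \<le> wt \<alpha> t" "0 \<le> u t"
     using R_pos by (auto intro!: wt_mono[OF alpha] simp: u_def field_simps)
    then show ?thesis by simp
   next
    case False
    then have "wt \<alpha> t \<le> wt \<alpha> (R / 3)" "u t \<le> 0"
     using R_pos t' by (auto intro!: wt_mono[OF alpha] simp: u_def field_simps)
    then show ?thesis by (simp add: mult_nonpos_nonpos)
   qed
   ultimately show "f' t - K * (- (3 / (2 * R) * u t / c t)) \<le> 0" using c_pos[of t] t' by (simp add: divide_nonpos_pos)
  qed
  show "continuous_on {x..R} (\<lambda>x. f x - K * c x)"
   using assms by (intro continuous_intros c_cont continuous_on_subset[OF f_cont]) auto
 qed
 then show ?thesis using f_end c_end by (simp add: K_def)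
qed

lemma f_pos: "0 \<le> x \<Longrightarrow> x < R \<Longrightarrow> 0 < f x"
 using f_lower[of x] c_pos[of x] R_pos wt_pos[of "R / 3" \<alpha>]
 by (smt (verit) divide_pos_pos mult_pos_pos)

lemma wc_integral: "((\<lambda>x. wt \<alpha> x * c x) has_integral cap_const \<alpha> * wt \<alpha> R * R / 2) {0..R}"
proof -
 have cont: "continuous_on {0..R} (\<lambda>x. wt \<alpha> x * c x)"
  by (intro continuous_intros c_cont wt_continuous[OF alpha])
 then have "set_integrable lborel {0..R} (\<lambda>x. wt \<alpha> x * c x)"
  unfolding set_integrable_def by (intro borel_integrable_compact) auto
 from set_borel_integral_eq_integral[OF this]
 have "(\<lambda>x. wt \<alpha> x * c x) integrable_on {0..R}"
  "(LBINT x:{0..R}. wt \<alpha> x * c x) = integral {0..R} (\<lambda>x. wt \<alpha> x * c x)" by auto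
 moreover have "2 * (LBINT x:{0..R}. wt \<alpha> x * c x) = cap_const \<alpha> * wt \<alpha> R * R"
  unfolding c_def u_def by (rule cap_scale[OF R_pos])
 ultimately show ?thesis by (simp add: has_integral_iff)
qed

text \<open>Integrating by parts twice, the area under the profile is expressed through the same integral
 that enters the equation for the radius.\<close>

lemma f_integral: "(f has_integral v / 2) {0..R}"
proof -
 define G where "G x = x * f x - (2 * R / 3) * ((wt \<alpha> x * x) * c x)" for x
 have wd: "((\<lambda>x. wt \<alpha> x * x) has_real_derivative (\<alpha> + 1) * wt \<alpha> x) (at x)" if "0 < x" for x
 proof -
  have "wt \<alpha> x = x powr \<alpha>" using that by (simp add: grushin_weight_def)
  then have "((\<lambda>x. x powr (\<alpha> + 1)) has_real_derivative (\<alpha> + 1) * wt \<alpha> x) (at x)"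
   using that by (auto intro!: derivative_eq_intros)
  then show ?thesis
   by (rule has_field_derivative_transform_within_open[of _ _ _ "{0<..}"]) (use that in \<open>auto simp: weight_powr\<close>)
 qed
 have "((\<lambda>x. f x - (2 * R / 3) * (\<alpha> + 1) * (wt \<alpha> x * c x)) has_integral G R - G 0) {0..R}"
 proof (rule fundamental_theorem_of_calculus_interior)
  show "continuous_on {0..R} G" unfolding G_def[abs_def]
   by (intro continuous_intros f_cont c_cont wt_continuous[OF alpha])
  fix x assume "x \<in> {0<..<R}"
  then have x: "0 < x" "x < R" by auto
  have "(G has_real_derivative (1 * f x + f' x * x) - (2 * R / 3) * (((\<alpha> + 1) * wt \<alpha> x) * c x + - (3 / (2 * R) * u x / c x) * (wt \<alpha> x * x))) (at x)"
   unfolding G_def[abs_def] using x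
   by (intro DERIV_diff DERIV_cmult DERIV_mult DERIV_ident wd f_DERIV c_DERIV) auto
  moreover have "(1 * f x + f' x * x) - (2 * R / 3) * (((\<alpha> + 1) * wt \<alpha> x) * c x + - (3 / (2 * R) * u x / c x) * (wt \<alpha> x * x))
    = f x - (2 * R / 3) * (\<alpha> + 1) * (wt \<alpha> x * c x)"
   using x R_pos c_pos[of x] by (simp add: f'_def field_simps)
  ultimately show "(G has_vector_derivative f x - (2 * R / 3) * (\<alpha> + 1) * (wt \<alpha> x * c x)) (at x)"
   by (metis has_real_derivative_iff_has_vector_derivative)
 qed (use R_pos in auto)
 moreover have "G R - G 0 = 0" by (simp add: G_def f_end c_end)
 ultimately have "((\<lambda>x. f x - (2 * R / 3) * (\<alpha> + 1) * (wt \<alpha> x * c x)) has_integral 0) {0..R}" by simp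
 from has_integral_add[OF this has_integral_mult_right[OF wc_integral, of "(2 * R / 3) * (\<alpha> + 1)"]]
 have "(f has_integral (2 * R / 3) * (\<alpha> + 1) * (cap_const \<alpha> * wt \<alpha> R * R / 2)) {0..R}" by simp
 moreover have "(2 * R / 3) * (\<alpha> + 1) * (cap_const \<alpha> * wt \<alpha> R * R / 2) = v / 2"
  using R_eq by (simp add: algebra_simps)
 ultimately show ?thesis by (simp only:)
qed

end

text \<open>The equation is singular at R, where the root vanishes. With u = - sin s the
  differential of x cancels the root, so f is a primitive of a continuous function of s composed
  with an arcsine, continuous up to R.\<close>

lemma cap_exists:
 assumes "0 \<le> \<alpha>" "0 < v"
 shows "\<exists>R f. cap \<alpha> v R f"
proof -
 obtain R where R: "0 < R" "critical \<alpha> v R"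
  using cap_radius_exists[OF assms] by blast
 \<comment> \<open>The argument of the weight is x solved from sin s = 1/2 - 3x/(2R), and the factor
   2R/3 comes from the change of variable.\<close>
 define k where "k s = - (2 * R / 3) * wt \<alpha> (2 * R / 3 * (1 / 2 - sin s)) * sin s" for s
 have kc: "continuous_on UNIV k" unfolding k_def[abs_def]
  by (intro continuous_intros continuous_on_compose2[OF wt_continuous[OF assms(1), of UNIV]]) auto
 obtain F where F: "\<And>s. (F has_real_derivative k s) (at s)" using continuous_antiderivative[OF kc] by metis
 have Fc: "continuous_on T F" for T by (rule DERIV_imp_continuous_on[OF F])
 define g where "g x = 1 / 2 - 3 / (2 * R) * x" for x
 have g: "-1 \<le> g x" "g x \<le> 1" if "0 \<le> x" "x \<le> R" for x using that R(1) by (auto simp: g_def field_simps)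
 have g': "-1 < g x" "g x < 1" if "0 < x" "x < R" for x using that R(1) by (auto simp: g_def field_simps)
 \<comment> \<open>The subtracted constant gives f R = 0, because g R = -1 corresponds to s =
   -\<pi>/2.\<close>
 define f where "f x = F (arcsin (g x)) - F (- (pi / 2))" for x
 have "cap \<alpha> v R f"
 proof
  have "continuous_on {0..R} (\<lambda>x. arcsin (g x))"
   by (rule continuous_on_compose2[OF continuous_on_arcsin']) (use g R(1) in \<open>auto simp: g_def intro!: continuous_intros\<close>)
  then show "continuous_on {0..R} f" unfolding f_def[abs_def]
   by (intro continuous_on_diff continuous_on_const continuous_on_compose2[OF Fc[of UNIV]]) auto
  show "f R = 0" using R(1) by (simp add: f_def g_def)
  fix x assume x: "0 < x" "x < R"
  have gd: "(g has_real_derivative - (3 / (2 * R))) (at x)" unfolding g_def[abs_def] using R(1) by (auto intro!: derivative_eq_intros)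
  have s: "sin (arcsin (g x)) = g x" using g'[OF x] by simp
  have "((\<lambda>x. arcsin (g x)) has_real_derivative inverse (sqrt (1 - (g x)\<^sup>2)) * - (3 / (2 * R))) (at x)"
   by (rule DERIV_chain2[OF DERIV_arcsin gd]) (use g'[OF x] in auto)
  from DERIV_chain2[OF F this]
  have "(f has_real_derivative k (arcsin (g x)) * (inverse (sqrt (1 - (g x)\<^sup>2)) * - (3 / (2 * R)))) (at x)"
   unfolding f_def[abs_def] by (auto intro!: derivative_eq_intros)
  moreover have "k (arcsin (g x)) * (inverse (sqrt (1 - (g x)\<^sup>2)) * - (3 / (2 * R)))
    = - (wt \<alpha> x * (3 / (2 * R) * x - 1 / 2) / sqrt (1 - (3 / (2 * R) * x - 1 / 2)\<^sup>2))"
  proof -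
   have "R \<noteq> 0" using R(1) by simp
   then have "2 * R / 3 * (1 / 2 - g x) = x" by (simp add: g_def)
   moreover have "(g x)\<^sup>2 = (3 / (2 * R) * x - 1 / 2)\<^sup>2" unfolding g_def by (rule power2_commute)
   moreover have B: "g x = - (3 / (2 * R) * x - 1 / 2)" by (simp add: g_def)
   ultimately have "k (arcsin (g x)) = - (2 * R / 3) * wt \<alpha> x * g x"
    unfolding k_def s by (simp only:)
   also have "\<dots> = (2 * R / 3) * wt \<alpha> x * (3 / (2 * R) * x - 1 / 2)" unfolding B by (simp only: mult_minus_left mult_minus_right minus_minus)
   finally have "k (arcsin (g x)) = (2 * R / 3) * wt \<alpha> x * (3 / (2 * R) * x - 1 / 2)" .
   moreover have "(2 * R / 3) * w * U * (inverse t * - (3 / (2 * R))) = - (w * U / t)" for w U t :: real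
   proof -
    have "(2 * R / 3) * w * U * (inverse t * - q) = - (w * U * inverse t) * ((2 * R / 3) * q)" for q
     by (simp add: algebra_simps)
    moreover have "(2 * R / 3) * (3 / (2 * R)) = 1" using \<open>R \<noteq> 0\<close> by simp
    ultimately show ?thesis by (simp only: divide_inverse mult_1_right mult_minus_left)
   qed
   ultimately show ?thesis unfolding \<open>(g x)\<^sup>2 = (3 / (2 * R) * x - 1 / 2)\<^sup>2\<close> by (simp only:)
  qed
  ultimately show "(f has_real_derivative - (wt \<alpha> x * (3 / (2 * R) * x - 1 / 2) / sqrt (1 - (3 / (2 * R) * x - 1 / 2)\<^sup>2))) (at x)" by simp
 qed (use assms R in auto)
 then show ?thesis by blast
qed

section \<open>Equality: first variation of the calibrating field\<close>

text \<open>C1 functions supported in a compact part of the open interval from 0 to R, together with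
  their derivative. Vanishing near both ends makes them compatible with coefficients such as u/c or
  1/f that are singular there.\<close>

definition test_fun :: "real \<Rightarrow> (real \<Rightarrow> real) \<Rightarrow> (real \<Rightarrow> real) \<Rightarrow> bool" where
 "test_fun R p p' \<longleftrightarrow> (\<forall>x. (p has_real_derivative p' x) (at x)) \<and> continuous_on UNIV p' \<and>
   (\<exists>\<rho>>0. \<forall>x. x \<le> \<rho> \<or> R - \<rho> \<le> x \<longrightarrow> p x = 0 \<and> p' x = 0)"

lemma test_fun_bounded:
 assumes "test_fun R p p'"
 shows "\<exists>B. \<forall>x. \<bar>p x\<bar> \<le> B \<and> \<bar>p' x\<bar> \<le> B"
proof -
 have d: "\<And>x. (p has_real_derivative p' x) (at x)" and c': "continuous_on UNIV p'"
  using assms by (auto simp: test_fun_def)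
 have c: "continuous_on UNIV p" by (rule DERIV_imp_continuous_on[OF d])
 obtain \<rho> where \<rho>: "0 < \<rho>" "\<And>x. x \<le> \<rho> \<or> R - \<rho> \<le> x \<Longrightarrow> p x = 0 \<and> p' x = 0"
  using assms by (auto simp: test_fun_def)
 have *: "\<exists>B. \<forall>x. \<bar>h x\<bar> \<le> B" if h: "continuous_on UNIV h" "\<And>x. x \<le> \<rho> \<or> R - \<rho> \<le> x \<Longrightarrow> h x = 0" for h :: "real \<Rightarrow> real"
 proof -
  have "bounded (h ` {0..R})"
   by (intro compact_imp_bounded compact_continuous_image continuous_on_subset[OF h(1)]) auto
  then obtain B where B: "\<forall>s\<in>{0..R}. \<bar>h s\<bar> \<le> B" by (auto simp: bounded_iff)
  have "\<bar>h x\<bar> \<le> max B 0" for x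
  proof (cases "x \<in> {0..R}")
   case False
   then have "h x = 0" using h(2)[of x] \<rho>(1) by auto
   then show ?thesis by simp
  qed (use B in force)
  then show ?thesis by blast
 qed
 obtain B1 where "\<And>x. \<bar>p x\<bar> \<le> B1" using *[OF c] \<rho>(2) by blast
 moreover obtain B2 where "\<And>x. \<bar>p' x\<bar> \<le> B2" using *[OF c'] \<rho>(2) by blast
 ultimately show ?thesis by (intro exI[of _ "max B1 B2"]) (auto simp: le_max_iff_disj)
qed

text \<open>The coefficient is differentiable only inside the interval; near the ends the product is
  zero, and the two descriptions cover the line by open sets.\<close>

lemma test_fun_mult:
 assumes "test_fun R p p'" and h: "\<And>x. 0 < x \<Longrightarrow> x < R \<Longrightarrow> (h has_real_derivative h' x) (at x)" "continuous_on {0<..<R} h'"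
 shows "test_fun R (\<lambda>x. p x * h x) (\<lambda>x. p' x * h x + p x * h' x)"
proof -
 have d: "\<And>x. (p has_real_derivative p' x) (at x)" and c': "continuous_on UNIV p'"
  using assms by (auto simp: test_fun_def)
 have c: "continuous_on UNIV p" by (rule DERIV_imp_continuous_on[OF d])
 obtain \<rho> where \<rho>: "0 < \<rho>" "\<And>x. x \<le> \<rho> \<or> R - \<rho> \<le> x \<Longrightarrow> p x = 0 \<and> p' x = 0"
  using assms by (auto simp: test_fun_def)
 have hc: "continuous_on {0<..<R} h" using h(1) DERIV_isCont continuous_at_imp_continuous_on by (metis greaterThanLessThan_iff)
 define U where "U = {..<\<rho>} \<union> {R - \<rho><..}"
 have U: "open U" "x \<notin> U \<Longrightarrow> 0 < x \<and> x < R" "x \<in> U \<Longrightarrow> p x = 0 \<and> p' x = 0" for x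
  using \<rho> by (auto simp: U_def)
 have der: "((\<lambda>x. p x * h x) has_real_derivative p' x * h x + p x * h' x) (at x)" for x
 proof (cases "x \<in> U")
  case True
  have "((\<lambda>x. 0) has_real_derivative p' x * h x + p x * h' x) (at x)" using U(3)[OF True] by simp
  then show ?thesis
   by (rule has_field_derivative_transform_within_open[OF _ U(1) True]) (use U(3) in auto)
 next
  case False
  then have "0 < x" "x < R" using U(2) by auto
  from DERIV_mult'[OF d h(1)[OF this]] show ?thesis by (simp add: algebra_simps)
 qed
 have "continuous_on (U \<union> {0<..<R}) (\<lambda>x. p' x * h x + p x * h' x)"
 proof (rule continuous_on_open_Un[OF U(1) open_greaterThanLessThan])
  have "continuous_on U (\<lambda>x. 0 :: real)" by (rule continuous_on_const)
  then show "continuous_on U (\<lambda>x. p' x * h x + p x * h' x)"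
   by (rule continuous_on_eq) (use U(3) in auto)
  show "continuous_on {0<..<R} (\<lambda>x. p' x * h x + p x * h' x)"
   by (intro continuous_intros hc h(2) continuous_on_subset[OF c] continuous_on_subset[OF c']) auto
 qed
 moreover have "U \<union> {0<..<R} = UNIV"
 proof -
  have "x \<in> U \<union> {0<..<R}" for x using U(2)[of x] by auto
  then show ?thesis by blast
 qed
 ultimately have "continuous_on UNIV (\<lambda>x. p' x * h x + p x * h' x)" by simp
 then show ?thesis unfolding test_fun_def using der \<rho> by (auto intro!: exI[of _ \<rho>])
qed

lemma bounded_of_compact_support:
 fixes h :: "real \<Rightarrow> real"
 assumes h: "continuous_on UNIV h" "\<And>x. \<bar>x\<bar> > M \<Longrightarrow> h x = 0"
 shows "\<exists>B\<ge>0. \<forall>x. \<bar>h x\<bar> \<le> B"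
proof -
 have "bounded (h ` {-M..M})"
  by (intro compact_imp_bounded compact_continuous_image continuous_on_subset[OF h(1)]) auto
 then obtain B where B: "\<forall>s\<in>{-M..M}. \<bar>h s\<bar> \<le> B" by (auto simp: bounded_iff)
 have "\<bar>h x\<bar> \<le> max B 0" for x
 proof (cases "x \<in> {-M..M}")
  case False
  then have "h x = 0" using h(2)[of x] by auto
  then show ?thesis by simp
 qed (use B in force)
 then show ?thesis by (intro exI[of _ "max B 0"]) auto
qed

lemma (in half_set) sections_ae:
 assumes "0 < \<alpha>" "0 < R" and R: "critical \<alpha> v R" and C: "C \<le> cap_value \<alpha> v R"
 shows "AE x in lborel. interval_sections A R x"
 using equality_intervals[OF assms] equality_sections(2)[OF assms]
proof eventually_elim
 fix x assume a: "0 < x \<and> x < R \<longrightarrow> 0 < sec_len A x \<and>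
  interval_section A x"
  and b: "x \<in> S \<longleftrightarrow> 0 < x \<and> x < R"
 have "AE y in lborel. (x, y) \<notin> A" if "\<not> (0 < x \<and> x < R)"
 proof -
  have "emeasure lborel {y. (x, y) \<in> A} = 0" using b that unfolding S_def by simp
  then have "{y. (x, y) \<in> A} \<in> null_sets lborel" using section_borel[OF A_borel] by (intro null_setsI) auto
  from AE_not_in[OF this] show ?thesis by simp
 qed
 then show "interval_sections A R x" using a by blast
qed

lemma (in half_set) length_integral:
 assumes "0 < \<alpha>" "0 < R" and R: "critical \<alpha> v R" and C: "C \<le> cap_value \<alpha> v R"
 shows "set_integrable lborel {0<..<R} (sec_len A)" "(LBINT x:{0<..<R}. sec_len A x) = v"
proof -
 note [measurable] = A_borel section_borel_measurable[OF A_borel]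
 have "integrable lborel (\<lambda>z. indicator A z :: real)" using A_fin by (intro integrable_real_indicator) auto
 then have i: "integrable (lborel \<Otimes>\<^sub>M lborel) (\<lambda>z. indicator A z :: real)" unfolding lborel_prod .
 have e: "(LBINT y. indicator A (x, y)) = sec_len A x" for x
 proof -
  have "(\<lambda>y. indicator A (x, y) :: real) = indicator {y. (x, y) \<in> A}" by (auto simp: indicator_def)
  then show ?thesis by (simp add: sec_len_def)
 qed
 have 1: "integrable lborel (sec_len A)"
  using lborel_pair.integrable_fst'[OF i] unfolding e .
 have 2: "(LBINT x. sec_len A x) = v"
  using lborel_pair.integral_fst'[OF i] A_measure unfolding e lborel_prod by simp
 show "set_integrable lborel {0<..<R} (sec_len A)"
  unfolding set_integrable_def using integrable_mult_indicator[OF _ 1, of "{0<..<R}"] by simp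
 have "(LBINT x:{0<..<R}. sec_len A x) = (LBINT x. sec_len A x)"
  unfolding set_int_def
 proof (rule integral_cong_AE)
  show "AE x in lborel. indicator {0<..<R} x *\<^sub>R sec_len A x = sec_len A x"
   using sections_ae[OF assms]
  proof eventually_elim
   fix x assume a: "interval_sections A R x"
   show "indicator {0<..<R} x *\<^sub>R sec_len A x = sec_len A x"
   proof (cases "0 < x \<and> x < R")
    case False
    then have "AE y in lborel. (x, y) \<notin> A" using a by blast
    then have "AE y in lborel. y \<notin> {y. (x, y) \<in> A}" by simp
    then have "{y. (x, y) \<in> A} \<in> null_sets lborel"
     using section_borel[OF A_borel, of x] by (subst AE_iff_null_sets) auto
    then have "sec_len A x = 0" by (simp add: sec_len_def measure_def null_sets_def)
    then show ?thesis by simp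
   qed simp
  qed
 qed auto
 then show "(LBINT x:{0<..<R}. sec_len A x) = v" using 2 by simp
qed

lemma (in cap) test_fun_slope:
 assumes p: "test_fun R p p'"
 obtains q' where "test_fun R (\<lambda>x. p x * (u x / c x)) q'"
proof -
 define uc' where "uc' x = (3 / (2 * R) * c x - u x * - (3 / (2 * R) * u x / c x)) / (c x * c x)" for x
 have cne: "c x \<noteq> 0" if "0 < x" "x < R" for x using c_pos[of x] that by auto
 have "test_fun R (\<lambda>x. p x * (u x / c x)) (\<lambda>x. p' x * (u x / c x) + p x * uc' x)"
 proof (rule test_fun_mult[OF p])
  show "((\<lambda>x. u x / c x) has_real_derivative uc' x) (at x)" if "0 < x" "x < R" for x
   unfolding uc'_def by (rule DERIV_divide[OF u_DERIV c_DERIV]) (use that cne in auto)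
  show "continuous_on {0<..<R} uc'" unfolding uc'_def[abs_def]
   by (intro continuous_intros u_cont c_cont) (use cne R_pos in auto)
 qed
 then show ?thesis by (rule that)
qed

text \<open>The vector (p, - p u/c) is tangent to the unit circle at (u, c). Adding \<epsilon> times
  it, modulated by cos (k y + \<beta>), lengthens the field only to second order but changes the
  divergence to first order. When \<open>C\<close> is the minimum, this first-order change cannot be
  positive. The area term of the perturbation gives the left side, and the values of the second
  component at the two ends of the section give the right side.\<close>

lemma (in half_set) weak_inequality:
 assumes cap: "cap \<alpha> v R f" and "0 < \<alpha>" and C: "C \<le> cap_value \<alpha> v R" and p: "test_fun R p p'"
 defines "sa \<equiv> \<lambda>x. sec_mid A x - sec_len A x / 2"
 defines "sb \<equiv> \<lambda>x. sec_mid A x + sec_len A x / 2"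
 shows "(LBINT x:{0<..<R}. p' x * (LBINT y:{sa x..sb x}. cos (k * y + \<beta>))) \<le>
  (LBINT x:{0<..<R}. wt \<alpha> x * (cap.u R x / cap.c R x) * p x * (cos (k * sa x + \<beta>) + cos (k * sb x + \<beta>)))"
proof -
 interpret K: cap \<alpha> v R f by (rule cap)
 note R_pos = K.R_pos
 note [measurable] = A_borel section_borel_measurable[OF A_borel] wt_borel[OF alpha]
 have sam[measurable]: "sa \<in> borel_measurable borel" "sb \<in> borel_measurable borel" unfolding sa_def sb_def by measurable
 define len where "len x = sec_len A x" for x
 have [measurable]: "len \<in> borel_measurable borel" unfolding len_def[abs_def] by measurable
 have sab: "sb x = sa x + len x" for x by (simp add: sa_def sb_def len_def)
 have len0: "0 \<le> len x" for x by (simp add: len_def sec_len_def)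
 define Y where "Y y = cos (k * y + \<beta>)" for y
 define Y' where "Y' y = - (k * sin (k * y + \<beta>))" for y
 have Yd: "(Y has_real_derivative Y' y) (at y)" for y
  unfolding Y_def[abs_def] Y'_def by (auto intro!: derivative_eq_intros)
 have Yc: "continuous_on T Y" "continuous_on T Y'" for T
  unfolding Y_def[abs_def] Y'_def[abs_def] by (intro continuous_intros)+
 have Yb: "\<bar>Y y\<bar> \<le> 1" "\<bar>Y' y\<bar> \<le> \<bar>k\<bar>" for y
  by (auto simp: Y_def Y'_def abs_mult mult_left_le)
 have [measurable]: "Y \<in> borel_measurable borel" "Y' \<in> borel_measurable borel"
  using Yc by (auto intro: borel_measurable_continuous_onI)
 have pd: "\<And>x. (p has_real_derivative p' x) (at x)" and pc': "continuous_on UNIV p'"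
  using p by (auto simp: test_fun_def)
 have pc: "continuous_on UNIV p" by (rule DERIV_imp_continuous_on[OF pd])
 obtain \<rho> where \<rho>: "0 < \<rho>" "\<And>x. x \<le> \<rho> \<or> R - \<rho> \<le> x \<Longrightarrow> p x = 0 \<and> p' x = 0"
  using p by (auto simp: test_fun_def)
 have pin: "0 < x \<and> x < R" if "p x \<noteq> 0" for x using \<rho>(2)[of x] \<rho>(1) that by force
 define q where "q x = p x * (K.u x / K.c x)" for x
 have cne: "K.c x \<noteq> 0" if "0 < x" "x < R" for x using K.c_pos[of x] that by auto
 obtain q' where qt: "test_fun R q q'" unfolding q_def[abs_def] using K.test_fun_slope[OF p] .
 have qd: "\<And>x. (q has_real_derivative q' x) (at x)" and qc': "continuous_on UNIV q'"
  using qt by (auto simp: test_fun_def)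
 have qc: "continuous_on UNIV q" by (rule DERIV_imp_continuous_on[OF qd])
 obtain QB where QB: "\<And>x. \<bar>q x\<bar> \<le> QB" using test_fun_bounded[OF qt] by blast
 have QB0: "0 \<le> QB" using QB[of 0] by linarith
 obtain PB where PB: "\<And>x. \<bar>p x\<bar> \<le> PB" "\<And>x. \<bar>p' x\<bar> \<le> PB" using test_fun_bounded[OF p] by blast
 have PB0: "0 \<le> PB" using PB(1)[of 0] by linarith
 obtain CB where CB: "\<And>x. \<bar>p x * (1 / (K.c x * K.c x))\<bar> \<le> CB"
 proof -
  define h' where "h' x = - (- (3 / (2 * R) * K.u x / K.c x) * K.c x + - (3 / (2 * R) * K.u x / K.c x) * K.c x) / ((K.c x * K.c x) * (K.c x * K.c x))" for x
  have "test_fun R (\<lambda>x. p x * (1 / (K.c x * K.c x))) (\<lambda>x. p' x * (1 / (K.c x * K.c x)) + p x * h' x)"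
  proof (rule test_fun_mult[OF p])
   show "((\<lambda>x. 1 / (K.c x * K.c x)) has_real_derivative h' x) (at x)" if "0 < x" "x < R" for x
   proof -
    have "((\<lambda>x. K.c x * K.c x) has_real_derivative - (3 / (2 * R) * K.u x / K.c x) * K.c x + - (3 / (2 * R) * K.u x / K.c x) * K.c x) (at x)"
     using that by (intro DERIV_mult K.c_DERIV) auto
    from DERIV_divide[OF DERIV_const[of 1] this] cne[OF that] show ?thesis by (simp add: h'_def)
   qed
   show "continuous_on {0<..<R} h'" unfolding h'_def[abs_def]
    by (intro continuous_intros K.u_cont K.c_cont) (use cne R_pos in auto)
  qed
  from test_fun_bounded[OF this] show ?thesis using that by blast
 qed
 have CB0: "0 \<le> CB" using CB[of 0] by linarith
 have [measurable]: "p \<in> borel_measurable borel" "p' \<in> borel_measurable borel" "q \<in> borel_measurable borel" "q' \<in> borel_measurable borel"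
  using pc pc' qc qc' by (auto intro: borel_measurable_continuous_onI)
 \<comment> \<open>\<open>L\<close> collects the second-order cost: 1 for the smoothing \<delta> =
   \<epsilon>^2, 2 CB for its product with the perturbation, PB CB for the square of the
   perturbation.\<close>
 define L where "L = 1 + 2 * CB + PB * CB"
 have L0: "0 \<le> L" using CB0 PB0 by (simp add: L_def)
 define Dy where "Dy x = (LBINT y:{sa x..sb x}. Y y)" for x
 have Dym[measurable]: "Dy \<in> borel_measurable borel"
 proof -
  have "(\<lambda>(x, y). if sa x \<le> y \<and> y \<le> sb x then Y y else 0) \<in> borel_measurable (borel \<Otimes>\<^sub>M lborel)" by measurable
  then have "(\<lambda>x. \<integral>y. (if sa x \<le> y \<and> y \<le> sb x then Y y else 0) \<partial>lborel) \<in> borel_measurable borel"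
   by (rule lborel.borel_measurable_lebesgue_integral)
  moreover have "(if sa x \<le> y \<and> y \<le> sb x then Y y else 0) = indicator {sa x..sb x} y *\<^sub>R Y y" for x y by (simp add: indicator_def)
  ultimately show ?thesis unfolding Dy_def[abs_def] set_int_def by simp
 qed
 have iconst: "set_integrable lborel {sa x..sb x} (\<lambda>y. c :: real)" for x c
  unfolding set_integrable_def by (intro borel_integrable_compact) auto
 have Dyb: "\<bar>Dy x\<bar> \<le> len x" for x
 proof -
  have i: "integrable lborel (\<lambda>y. indicator {sa x..sb x} y *\<^sub>R Y y)"
   by (intro borel_integrable_compact Yc) auto
  have "\<bar>Dy x\<bar> \<le> (LBINT y. \<bar>indicator {sa x..sb x} y *\<^sub>R Y y\<bar>)"
   unfolding Dy_def set_int_def by (rule integral_abs_bound)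
  also have "\<dots> \<le> (LBINT y. indicator {sa x..sb x} y *\<^sub>R 1)"
   by (rule integral_mono[OF integrable_abs[OF i] iconst[unfolded set_integrable_def]])
     (use Yb in \<open>auto simp: indicator_def\<close>)
  also have "\<dots> = len x" using len0[of x] by (simp add: sab)
  finally show ?thesis .
 qed
 define G where "G = (LBINT x:{0<..<R}. p' x * Dy x) - (LBINT x:{0<..<R}. wt \<alpha> x * q x * (Y (sa x) + Y (sb x)))"
 have lenI: "set_integrable lborel {0<..<R} len" "(LBINT x:{0<..<R}. len x) = v"
  unfolding len_def using length_integral[OF \<open>0 < \<alpha>\<close> R_pos K.R_eq C] by auto
 have wR: "wt \<alpha> x \<le> wt \<alpha> R" if "0 < x" "x < R" for x
  using that by (intro wt_mono[OF alpha]) auto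
 have setI: "set_integrable lborel {0<..<R} h" if [measurable]: "h \<in> borel_measurable borel"
  and hb: "\<And>x. 0 < x \<Longrightarrow> x < R \<Longrightarrow> \<bar>h x\<bar> \<le> k1 + k2 * len x" for h k1 k2
 proof -
  have "set_integrable lborel {0<..<R} (\<lambda>x. k1 + k2 * len x)"
   using R_pos by (intro set_integral_add(1) set_integrable_mult_right lenI) (simp add: set_integrable_def)
  then show ?thesis unfolding set_integrable_def
   by (rule Bochner_Integration.integrable_bound)
     (use order_trans[OF hb abs_ge_self] in \<open>auto simp: indicator_def intro!: AE_I2\<close>)
 qed
 have I1: "set_integrable lborel {0<..<R} (\<lambda>x. p' x * Dy x)"
 proof (rule setI[where ?k1.0 = 0 and ?k2.0 = PB])
  show "\<bar>p' x * Dy x\<bar> \<le> 0 + PB * len x" for x unfolding abs_mult using PB(2)[of x] Dyb[of x] PB0 by (simp add: mult_mono)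
 qed measurable
 have I2: "set_integrable lborel {0<..<R} (\<lambda>x. wt \<alpha> x * q x * (Y (sa x) + Y (sb x)))"
 proof (rule setI[where ?k1.0 = "wt \<alpha> R * QB * 2" and ?k2.0 = 0])
  fix x assume x: "0 < x" "x < R"
  have "\<bar>Y (sa x) + Y (sb x)\<bar> \<le> 2" using Yb(1)[of "sa x"] Yb(1)[of "sb x"] by linarith
  then show "\<bar>wt \<alpha> x * q x * (Y (sa x) + Y (sb x))\<bar> \<le> wt \<alpha> R * QB * 2 + 0 * len x"
   unfolding abs_mult using wR[OF x] QB[of x] QB0 by (simp add: mult_mono)
 qed measurable
 have key: "\<epsilon> * G \<le> \<epsilon>\<^sup>2 * (L * cap_value \<alpha> v R / 2)" if \<epsilon>: "0 < \<epsilon>" "\<epsilon> \<le> 1" for \<epsilon>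
 proof -
  \<comment> \<open>The smoothing parameter is tied to the perturbation, so that its cost is of
    second order as well.\<close>
  define \<delta> where "\<delta> = \<epsilon>\<^sup>2"
  have \<delta>: "0 < \<delta>" "\<delta> \<le> 1" using \<epsilon> by (auto simp: \<delta>_def power_le_one)
  \<comment> \<open>At distance d beyond either end the affine function u has moved by 3d/(2R) =
    \<delta>/8, the tolerance of \<open>square_near_one\<close>.\<close>
  define d where "d = \<delta> * R / 12"
  have d: "0 < d" using \<delta> R_pos by (simp add: d_def)
  define cut where "cut x = ramp ((x + d) / d) * ramp ((R + d - x) / d)" for x
  define cut' where "cut' x = ramp' ((x + d) / d) * (1 / d) * ramp ((R + d - x) / d) - ramp ((x + d) / d) * (ramp' ((R + d - x) / d) * (1 / d))" for x
  have rc: "continuous_on T ramp" for T by (rule DERIV_imp_continuous_on[OF ramp_DERIV])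
  have cutd: "(cut has_real_derivative cut' x) (at x)" for x
  proof -
   have "((\<lambda>x. ramp ((x + d) / d)) has_real_derivative ramp' ((x + d) / d) * (1 / d)) (at x)"
    by (rule DERIV_chain2[OF ramp_DERIV]) (use d in \<open>auto intro!: derivative_eq_intros\<close>)
   moreover have "((\<lambda>x. ramp ((R + d - x) / d)) has_real_derivative ramp' ((R + d - x) / d) * (- (1 / d))) (at x)"
    by (rule DERIV_chain2[OF ramp_DERIV]) (use d in \<open>auto intro!: derivative_eq_intros\<close>)
   ultimately have "((\<lambda>x. ramp ((x + d) / d) * ramp ((R + d - x) / d)) has_real_derivative
     ramp' ((x + d) / d) * (1 / d) * ramp ((R + d - x) / d) + ramp' ((R + d - x) / d) * (- (1 / d)) * ramp ((x + d) / d)) (at x)"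
    by (rule DERIV_mult)
   then show ?thesis unfolding cut_def[abs_def] cut'_def by (simp add: algebra_simps)
  qed
  have cutc': "continuous_on UNIV cut'" unfolding cut'_def[abs_def]
   by (intro continuous_intros continuous_on_compose2[OF ramp'_continuous] continuous_on_compose2[OF rc]) (use d in auto)
  have cutc: "continuous_on UNIV cut" by (rule DERIV_imp_continuous_on[OF cutd])
  have cutb: "0 \<le> cut x" "cut x \<le> 1" for x unfolding cut_def using ramp_simps(1,2) by (auto intro!: mult_le_one)
  have cut0: "cut x = 0 \<and> cut' x = 0" if "x \<le> - d \<or> R + d \<le> x" for x
  proof -
   have "(x + d) / d \<le> 0 \<or> (R + d - x) / d \<le> 0" using that d by (auto simp: divide_le_0_iff)
   then show ?thesis unfolding cut_def cut'_def by (auto simp: ramp_simps)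
  qed
  have cut1: "cut x = 1 \<and> cut' x = 0" if "0 \<le> x" "x \<le> R" for x
  proof -
   have "1 \<le> (x + d) / d" "1 \<le> (R + d - x) / d" using that d by (auto simp: divide_simps)
   then show ?thesis unfolding cut_def cut'_def by (simp add: ramp_simps)
  qed
  define U where "U x = K.u x * cut x" for x
  define U' where "U' x = 3 / (2 * R) * cut x + cut' x * K.u x" for x
  have Ud: "(U has_real_derivative U' x) (at x)" for x
   unfolding U_def[abs_def] U'_def by (rule DERIV_mult[OF K.u_DERIV cutd])
  have Uc': "continuous_on UNIV U'" unfolding U'_def[abs_def] by (intro continuous_intros cutc cutc' K.u_cont) (use R_pos in auto)
  have U2: "(U x)\<^sup>2 \<le> 1 + \<delta> / 2" for x
  proof (cases "- d < x \<and> x < R + d")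
   case False
   then have "U x = 0" using cut0[of x] by (auto simp: U_def not_less)
   then show ?thesis using \<delta> by simp
  next
   case True
   have "0 \<le> 3 / (2 * R)" using R_pos by simp
   then have "3 / (2 * R) * x \<le> 3 / (2 * R) * (R + d)" "3 / (2 * R) * (- d) \<le> 3 / (2 * R) * x"
    using True by (intro mult_left_mono; linarith)+
   then have "3 / (2 * R) * x - 1 / 2 \<le> 3 / (2 * R) * (R + d) - 1 / 2" "3 / (2 * R) * (- d) - 1 / 2 \<le> 3 / (2 * R) * x - 1 / 2"
    by linarith+
   moreover have "3 / (2 * R) * (R + d) - 1 / 2 = 1 + \<delta> / 8" "3 / (2 * R) * (- d) - 1 / 2 = - (1/2) - \<delta> / 8"
    using R_pos by (auto simp: d_def field_simps)
   ultimately have "\<bar>K.u x\<bar> \<le> 1 + \<delta> / 8" unfolding K.u_def using \<delta> by linarith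
   then have "\<bar>U x\<bar> \<le> (1 + \<delta> / 8) * 1" unfolding U_def abs_mult using cutb[of x] by (intro mult_mono) auto
   then show ?thesis using square_near_one[of \<delta> "U x"] \<delta> by simp
  qed
  have Upos: "0 < 1 + \<delta> - (U x)\<^sup>2" for x using U2[of x] \<delta> by linarith
  define ad where "ad x = cut x * sqrt (1 + \<delta> - (U x)\<^sup>2)" for x
  define ad' where "ad' x = cut' x * sqrt (1 + \<delta> - (U x)\<^sup>2) + (inverse (sqrt (1 + \<delta> - (U x)\<^sup>2)) / 2 * - (2 * U x * U' x)) * cut x" for x
  have Uc: "continuous_on UNIV U" by (rule DERIV_imp_continuous_on[OF Ud])
  have add: "(ad has_real_derivative ad' x) (at x)" for x
  proof -
   have "((\<lambda>x. 1 + \<delta> - (U x)\<^sup>2) has_real_derivative - (2 * U x * U' x)) (at x)"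
    by (auto intro!: derivative_eq_intros Ud)
   from DERIV_mult[OF cutd DERIV_chain2[OF DERIV_real_sqrt[OF Upos] this]]
   show ?thesis unfolding ad_def[abs_def] ad'_def .
  qed
  have sne: "sqrt (1 + \<delta> - (U x)\<^sup>2) \<noteq> 0" for x
   using Upos[of x] by (metis less_irrefl real_sqrt_eq_zero_cancel_iff)
  have adc': "continuous_on UNIV ad'" unfolding ad'_def[abs_def]
   by (intro continuous_intros cutc cutc' Uc Uc') (use sne in \<open>blast | simp\<close>)+
  have adc: "continuous_on UNIV ad" by (rule DERIV_imp_continuous_on[OF add])
  have adb: "0 \<le> ad x" "ad x \<le> 2" for x
  proof -
   show "0 \<le> ad x" unfolding ad_def using cutb[of x] Upos[of x] by (intro mult_nonneg_nonneg) auto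
   have "0 \<le> (U x)\<^sup>2" by simp
   then have "1 + \<delta> - (U x)\<^sup>2 \<le> 4" using \<delta> by linarith
   then have "sqrt (1 + \<delta> - (U x)\<^sup>2) \<le> sqrt 4" by (rule real_sqrt_le_mono)
   then have "sqrt (1 + \<delta> - (U x)\<^sup>2) \<le> 2" by simp
   then have "ad x \<le> 1 * 2" unfolding ad_def using cutb[of x] Upos[of x] by (intro mult_mono) auto
   then show "ad x \<le> 2" by simp
  qed
  \<comment> \<open>\<open>q\<close> is p u/c, so the pair of perturbations is a tangent vector of
    the unit circle; the test function keeps it away from both the axis and R, hence the value on
    the axis is untouched.\<close>
  define \<phi> where "\<phi> z = U (fst z) + \<epsilon> * (p (fst z) * Y (snd z))" for z
  define p1 where "p1 z = U' (fst z) + \<epsilon> * (p' (fst z) * Y (snd z))" for z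
  define a where "a z = ad (fst z) - \<epsilon> * (q (fst z) * Y (snd z))" for z
  define qa where "qa z = - (\<epsilon> * (q (fst z) * Y' (snd z)))" for z
  have \<phi>g: "grad \<phi> p1 (\<lambda>z. \<epsilon> * (p (fst z) * Y' (snd z)))"
   by (rule grad_cong[OF grad_add[OF grad_fst[OF Ud Uc'] grad_cmult[OF grad_mult[OF grad_fst[OF pd pc'] grad_snd[OF Yd Yc(2)]], of \<epsilon>]]])
     (auto simp: \<phi>_def p1_def)
  have ag: "grad a (\<lambda>z. ad' (fst z) - \<epsilon> * (q' (fst z) * Y (snd z))) qa"
   by (rule grad_cong[OF grad_diff[OF grad_fst[OF add adc'] grad_cmult[OF grad_mult[OF grad_fst[OF qd qc'] grad_snd[OF Yd Yc(2)]], of \<epsilon>]]])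
     (auto simp: a_def qa_def)
  define B where "B = sqrt (1 + \<epsilon>\<^sup>2 * L)"
  have B: "0 < B" "1 \<le> B" "B\<^sup>2 = 1 + \<epsilon>\<^sup>2 * L" using L0 by (auto simp: B_def add_pos_nonneg)
  have nrm: "(\<phi> z)\<^sup>2 + (a z)\<^sup>2 \<le> B\<^sup>2" for z
  proof (cases "p (fst z) = 0")
   case True
   then have "\<phi> z = U (fst z)" "a z = ad (fst z)" by (auto simp: \<phi>_def a_def q_def)
   moreover have "(ad (fst z))\<^sup>2 \<le> 1 * (1 + \<delta> - (U (fst z))\<^sup>2)"
    unfolding ad_def power_mult_distrib using Upos[of "fst z"] cutb[of "fst z"] by (intro mult_mono) (auto simp: power_le_one)
   moreover have "\<delta> * 1 \<le> \<delta> * L" using \<delta> CB0 PB0 by (intro mult_left_mono) (auto simp: L_def)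
   ultimately show ?thesis unfolding B(3) \<delta>_def by simp
  next
   case False
   define x where "x = fst z"
   define s where "s = p x * Y (snd z)"
   have x: "0 < x" "x < R" using pin[OF False] by (auto simp: x_def)
   have cp: "0 < K.c x" using K.c_pos[of x] x by simp
   have Ux: "U x = K.u x" using cut1[of x] x by (simp add: U_def)
   define h where "h = sqrt (1 + \<delta> - (K.u x)\<^sup>2)"
   have adx: "ad x = h" using cut1[of x] x by (simp add: ad_def Ux h_def)
   have h2: "h\<^sup>2 = 1 + \<delta> - (K.u x)\<^sup>2" unfolding h_def using Upos[of x] Ux by simp
   have c2: "(K.c x)\<^sup>2 = 1 - (K.u x)\<^sup>2" using K.c_bounds[of x] x by simp
   have hc: "K.c x \<le> h" unfolding h_def K.c_def using \<delta> by simp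
   have diff: "0 \<le> h - K.c x" "(h - K.c x) * K.c x \<le> \<delta>"
   proof -
    have "(h - K.c x) * K.c x \<le> (h - K.c x) * (h + K.c x)" using hc cp by (intro mult_left_mono) auto
    also have "\<dots> = h\<^sup>2 - (K.c x)\<^sup>2" by (simp add: power2_eq_square algebra_simps)
    finally show "(h - K.c x) * K.c x \<le> \<delta>" unfolding h2 c2 by simp
   qed (use hc in simp)
   define t where "t = K.u x / K.c x"
   have tu: "K.u x = t * K.c x" using cp by (simp add: t_def)
   \<comment> \<open>With u = t c the first-order term is proportional to c - h, where h is the
     smoothed root; this difference is of order \<delta> when c is bounded away from 0.\<close>
   have ee: "(\<phi> z)\<^sup>2 + (a z)\<^sup>2 = 1 + \<delta> + 2 * \<epsilon> * s * t * (K.c x - h) + \<epsilon>\<^sup>2 * (s\<^sup>2 * (1 + t\<^sup>2))"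
   proof -
    have P: "\<phi> z = K.u x + \<epsilon> * s" "a z = h - \<epsilon> * (t * s)"
     unfolding \<phi>_def a_def x_def[symmetric] Ux adx q_def s_def t_def by (auto simp: algebra_simps)
    have "(\<phi> z)\<^sup>2 + (a z)\<^sup>2 = ((K.u x)\<^sup>2 + h\<^sup>2) + 2 * \<epsilon> * s * (K.u x - t * h) + \<epsilon>\<^sup>2 * (s\<^sup>2 * (1 + t\<^sup>2))"
     unfolding P by (simp add: power2_eq_square algebra_simps)
    moreover have "K.u x - t * h = t * (K.c x - h)" using tu by (simp add: algebra_simps)
    ultimately show ?thesis unfolding h2 by simp
   qed
   have sb: "\<bar>s\<bar> \<le> \<bar>p x\<bar>" unfolding s_def abs_mult using Yb(1)[of "snd z"] by (simp add: mult_left_le)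
   have u1: "\<bar>K.u x\<bar> \<le> 1" using K.u_bounds(1)[of x] x by (simp add: abs_le_iff)
   have CBx: "\<bar>p x\<bar> / (K.c x * K.c x) \<le> CB" using CB[of x] by (simp add: abs_mult)
   have e1: "\<bar>2 * \<epsilon> * s * t * (K.c x - h)\<bar> \<le> 2 * \<epsilon> * (\<delta> * CB)"
   proof -
    have "\<bar>s * t * (K.c x - h)\<bar> = \<bar>s\<bar> * \<bar>K.u x\<bar> * (((h - K.c x) * K.c x) / (K.c x * K.c x))"
     using cp diff(1) by (simp add: abs_mult t_def abs_minus_commute)
    also have "\<dots> \<le> \<bar>p x\<bar> * 1 * (\<delta> / (K.c x * K.c x))"
     using sb u1 diff cp by (intro mult_mono divide_right_mono) auto
    also have "\<dots> = \<delta> * (\<bar>p x\<bar> / (K.c x * K.c x))" by simp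
    also have "\<dots> \<le> \<delta> * CB" using CBx \<delta> by (intro mult_left_mono) auto
    finally have "2 * \<epsilon> * \<bar>s * t * (K.c x - h)\<bar> \<le> 2 * \<epsilon> * (\<delta> * CB)" using \<epsilon> by (intro mult_left_mono) auto
    moreover have "\<bar>2 * \<epsilon> * s * t * (K.c x - h)\<bar> = \<bar>2 * \<epsilon>\<bar> * \<bar>s * t * (K.c x - h)\<bar>"
     by (simp only: abs_mult mult.assoc)
    ultimately show ?thesis using \<epsilon> by simp
   qed
   have e2: "s\<^sup>2 * (1 + t\<^sup>2) \<le> PB * CB"
   proof -
    have "1 + t\<^sup>2 = ((K.c x)\<^sup>2 + (K.u x)\<^sup>2) / (K.c x * K.c x)" using cp by (simp add: t_def power_divide add_divide_distrib power2_eq_square)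
    also have "\<dots> = 1 / (K.c x * K.c x)" unfolding c2 by simp
    finally have t2: "1 + t\<^sup>2 = 1 / (K.c x * K.c x)" .
    have "s\<^sup>2 = \<bar>s\<bar> * \<bar>s\<bar>" by (simp add: power2_eq_square)
    also have "\<dots> \<le> \<bar>p x\<bar> * \<bar>p x\<bar>" using sb by (intro mult_mono) auto
    finally have "s\<^sup>2 * (1 + t\<^sup>2) \<le> \<bar>p x\<bar> * \<bar>p x\<bar> * (1 / (K.c x * K.c x))" unfolding t2 using cp by (intro mult_right_mono) auto
    also have "\<dots> = \<bar>p x\<bar> * (\<bar>p x\<bar> / (K.c x * K.c x))" by simp
    also have "\<dots> \<le> PB * CB" using PB(1)[of x] CBx PB0 cp by (intro mult_mono) auto
    finally show ?thesis .
   qed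
   have "2 * \<epsilon> * s * t * (K.c x - h) \<le> 2 * \<epsilon> * (\<delta> * CB)" by (rule order_trans[OF abs_ge_self e1])
   moreover have "\<epsilon>\<^sup>2 * (s\<^sup>2 * (1 + t\<^sup>2)) \<le> \<epsilon>\<^sup>2 * (PB * CB)" by (rule mult_left_mono[OF e2]) simp
   ultimately have "(\<phi> z)\<^sup>2 + (a z)\<^sup>2 \<le> 1 + \<delta> + 2 * \<epsilon> * (\<delta> * CB) + \<epsilon>\<^sup>2 * (PB * CB)"
    unfolding ee by linarith
   also have "\<dots> \<le> 1 + \<delta> + 2 * 1 * (\<delta> * CB) + \<epsilon>\<^sup>2 * (PB * CB)"
   proof -
    have "\<epsilon> * (\<delta> * CB) \<le> 1 * (\<delta> * CB)" using \<epsilon> \<delta> CB0 by (intro mult_right_mono) auto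
    then show ?thesis by linarith
   qed
   also have "\<dots> = B\<^sup>2" unfolding B(3) L_def \<delta>_def by (simp add: algebra_simps)
   finally show ?thesis .
  qed
  have p0: "p 0 = 0" using \<rho> by simp
  have \<phi>0: "\<bar>\<phi> (0, y)\<bar> \<le> B / 2" for y
   using B(2) cut1[of 0] R_pos by (simp add: \<phi>_def U_def p0 K.u_def)
  have aM: "a z = 0" if "\<bar>fst z\<bar> > R + d" for z
  proof -
   have "fst z \<le> - d \<or> R + d \<le> fst z" using that d R_pos by linarith
   then have "cut (fst z) = 0" using cut0 by blast
   moreover have "\<not> (0 < fst z \<and> fst z < R)" using that d by linarith
   then have "p (fst z) = 0" using pin by blast
   ultimately show ?thesis by (simp add: a_def ad_def q_def)
  qed
  have U'0: "U' x = 0" if "\<bar>x\<bar> > R + d" for x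
  proof -
   have "x \<le> - d \<or> R + d \<le> x" using that d R_pos by linarith
   then have "cut x = 0 \<and> cut' x = 0" by (rule cut0)
   then show ?thesis by (simp add: U'_def)
  qed
  obtain KU where KU: "0 \<le> KU" "\<And>x. \<bar>U' x\<bar> \<le> KU" using bounded_of_compact_support[OF Uc' U'0] by blast
  have ep: "\<bar>\<epsilon> * (s * t)\<bar> \<le> S * T" if "\<bar>s\<bar> \<le> S" "\<bar>t\<bar> \<le> T" for s t S T :: real
  proof -
   have "\<bar>\<epsilon>\<bar> * (\<bar>s\<bar> * \<bar>t\<bar>) \<le> 1 * (S * T)" using \<epsilon> that by (intro mult_mono) auto
   then show ?thesis by (simp add: abs_mult)
  qed
  have p1b: "\<bar>p1 z\<bar> \<le> KU + PB * 1 + QB * \<bar>k\<bar>" for z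
  proof -
   have "\<bar>\<epsilon> * (p' (fst z) * Y (snd z))\<bar> \<le> PB * 1" by (rule ep[OF PB(2) Yb(1)])
   moreover have "0 \<le> QB * \<bar>k\<bar>" using QB0 by simp
   ultimately show ?thesis unfolding p1_def using KU(2)[of "fst z"] by linarith
  qed
  have qab: "\<bar>qa z\<bar> \<le> KU + PB * 1 + QB * \<bar>k\<bar>" for z
  proof -
   have "\<bar>\<epsilon> * (q (fst z) * Y' (snd z))\<bar> \<le> QB * \<bar>k\<bar>" by (rule ep[OF QB Yb(2)])
   then show ?thesis unfolding qa_def using KU(1) PB0 by simp
  qed
  \<comment> \<open>Sections whose ends and length are controlled, so that the angle has bounded
    speed and bounded support; every section over the open interval belongs to \<open>Xn n\<close>
    for large n, up to a null set.\<close>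
  define Xn where "Xn n = {x. 0 < x \<and> x < R \<and> \<bar>sa x\<bar> < real n \<and> \<bar>sb x\<bar> < real n \<and> len x > 1 / real (Suc n)}" for n
  have [measurable]: "Xn n \<in> sets borel" for n unfolding Xn_def by measurable
  define N where "N n = real n + R + 1" for n
  have N0: "0 \<le> N n" for n using R_pos by (simp add: N_def)
  define g where "g n z = (if fst z \<in> Xn n \<and> sa (fst z) < snd z \<and> snd z < sb (fst z) then pi / len (fst z) else 0)" for n z
  have gm[measurable]: "g n \<in> borel_measurable borel" for n unfolding g_def[abs_def] by measurable
  have gb: "\<bar>g n z\<bar> \<le> pi * real (Suc n)" for n z
  proof (cases "fst z \<in> Xn n")
   case True
   then have l: "1 / real (Suc n) < len (fst z)" by (simp add: Xn_def)
   have "0 < 1 / real (Suc n)" by simp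
   then have lp: "0 < len (fst z)" using l by linarith
   then have "1 / len (fst z) \<le> real (Suc n)" using l by (simp add: divide_simps mult.commute)
   then have "pi * (1 / len (fst z)) \<le> pi * real (Suc n)" by (intro mult_left_mono) auto
   then show ?thesis using lp by (simp add: g_def)
  qed (simp add: g_def)
  have g0: "g n z = 0" if "\<bar>fst z\<bar> \<ge> N n \<or> \<bar>snd z\<bar> \<ge> N n" for n z
   using that R_pos by (auto simp: g_def Xn_def N_def)
  define W where "W n z = - (pi / 2) + (LBINT s. indicator {- (N n + 1)..snd z} s * g n (fst z, s))" for n z
  define E where "E n = gdiv \<alpha> p1 (\<lambda>z. qa z * sin (W n z) + a z * (cos (W n z) * g n z))" for n
  have le: "(LBINT z:A. E n z) \<le> B * C" for n
   unfolding E_def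
   by (rule half_le_angle[OF half alpha A_borel A_fin \<phi>g ag B(1) nrm \<phi>0 aM p1b qab gm gb g0 N0]) (auto simp: W_def)
  have Wm[measurable]: "W n \<in> borel_measurable borel" for n
   unfolding W_def by (intro borel_measurable_add borel_measurable_const borel_antiderivative gm)
  note [measurable] = grad_borel[OF \<phi>g] grad_borel[OF ag]
  have Em[measurable]: "E n \<in> borel_measurable borel" for n
   unfolding E_def by (intro gdiv_borel alpha) measurable
  have aB: "\<bar>a z\<bar> \<le> B" for z
  proof -
   have "(a z)\<^sup>2 \<le> B\<^sup>2" using nrm[of z] zero_le_power2[of "\<phi> z"] by linarith
   then show ?thesis using B(1) abs_le_square_iff[of "a z" B] by auto
  qed
  define KK where "KK = KU + PB * 1 + QB * \<bar>k\<bar>"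
  have KK0: "0 \<le> KK" using KU(1) PB0 QB0 by (simp add: KK_def)
  define wM where "wM = wt \<alpha> (R + d)"
  have Eb: "\<bar>E n z\<bar> \<le> KK + wM * (KK * 1 + B * (1 * (pi * real (Suc n))))" for n z
  proof -
   have "\<bar>wt \<alpha> (fst z) * (qa z * sin (W n z) + a z * (cos (W n z) * g n z))\<bar> \<le> wM * (KK * 1 + B * (1 * (pi * real (Suc n))))"
   proof (cases "\<bar>fst z\<bar> > R + d")
    case True
    have "\<not> (0 < fst z \<and> fst z < R)" using True d by linarith
    then have "p (fst z) = 0" using pin by blast
    then have "qa z = 0" by (simp add: qa_def q_def)
    then show ?thesis using aM[OF True] B(1) KK0 by (simp add: wM_def)
   next
    case False
    then have w: "wt \<alpha> (fst z) \<le> wM" unfolding wM_def by (intro wt_mono[OF alpha]) auto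
    have "\<bar>qa z * sin (W n z)\<bar> \<le> KK * 1" unfolding abs_mult using qab[of z] KK0 by (intro mult_mono) (auto simp: KK_def)
    moreover have "\<bar>a z * (cos (W n z) * g n z)\<bar> \<le> B * (1 * (pi * real (Suc n)))" unfolding abs_mult
     using aB[of z] gb[of n z] B(1) by (intro mult_mono) auto
    ultimately have "\<bar>qa z * sin (W n z) + a z * (cos (W n z) * g n z)\<bar> \<le> KK * 1 + B * (1 * (pi * real (Suc n)))" by linarith
    moreover have "0 \<le> wM" by (simp add: wM_def)
    ultimately show ?thesis unfolding abs_mult[of "wt \<alpha> (fst z)"] using w by (intro mult_mono) auto
   qed
   then show ?thesis unfolding E_def gdiv_def using p1b[of z] by (simp add: KK_def)
  qed
  define T where "T n x = (LBINT y. indicator A (x, y) *\<^sub>R E n (x, y))" for n x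
  have EI: "set_integrable lborel A (E n)" for n
   by (rule set_integrable_bounded[OF A_borel A_fin Em Eb])
  have fub: "(LBINT z:A. E n z) = (LBINT x. T n x)" "integrable lborel (T n)" for n
  proof -
   have i: "integrable (lborel \<Otimes>\<^sub>M lborel) (\<lambda>z. indicator A z *\<^sub>R E n z)" using EI[of n] unfolding set_integrable_def lborel_prod .
   show "integrable lborel (T n)" unfolding T_def using lborel_pair.integrable_fst'[OF i] .
   show "(LBINT z:A. E n z) = (LBINT x. T n x)"
    unfolding T_def set_int_def using lborel_pair.integral_fst'[OF i] unfolding lborel_prod by simp
  qed
  \<comment> \<open>On \<open>Xn n\<close> the sine passes from -1 to 1 and the values at both ends
    add up; elsewhere the angle rests at -\<pi>/2 and only the difference of the two values of Y
    remains.\<close>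
  define J where "J n x = (if x \<in> Xn n then 2 * ad x - \<epsilon> * (q x * (Y (sa x) + Y (sb x))) else \<epsilon> * (q x * (Y (sb x) - Y (sa x))))" for n x
  define H where "H n x = 3 / (2 * R) * len x + \<epsilon> * (p' x * Dy x) + wt \<alpha> x * J n x" for n x
  have TH: "AE x in lborel. T n x = indicator {0<..<R} x *\<^sub>R H n x" for n
   using sections_ae[OF \<open>0 < \<alpha>\<close> R_pos K.R_eq C]
  proof eventually_elim
   fix x assume ae: "interval_sections A R x"
   show "T n x = indicator {0<..<R} x *\<^sub>R H n x"
   proof (cases "0 < x \<and> x < R")
    case False
    then have "AE y in lborel. (x, y) \<notin> A" using ae by blast
    then have "AE y in lborel. indicator A (x, y) *\<^sub>R E n (x, y) = 0" by eventually_elim auto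
    then have "T n x = 0" unfolding T_def by (rule integral_eq_zero_AE)
    then show ?thesis using False by auto
   next
    case True
    then have x: "0 < x" "x < R" by auto
    have lp: "0 < len x" and sec: "AE y in lborel. (x, y) \<in> A \<longleftrightarrow> sa x < y \<and> y < sb x"
     using ae True by (auto simp: len_def sa_def sb_def)
    have U'x: "U' x = 3 / (2 * R)" using cut1[of x] x by (simp add: U'_def)
    define V where "V y = (if x \<in> Xn n then - (pi / 2) + pi / len x * (y - sa x) else - (pi / 2))" for y
    define V' where "V' = (if x \<in> Xn n then pi / len x else 0)"
    have Vd: "(V has_real_derivative V') (at y)" for y
     unfolding V_def[abs_def] V'_def using lp by (auto intro!: derivative_eq_intros)
    have Vc: "continuous_on UNIV V" by (rule DERIV_imp_continuous_on[OF Vd])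
    have WV: "W n (x, y) = V y \<and> g n (x, y) = V'" if y: "sa x < y" "y < sb x" for y
    proof (cases "x \<in> Xn n")
     case False
     then show ?thesis by (simp add: W_def g_def V_def V'_def)
    next
     case True
     have "- (N n + 1) < sa x" using True R_pos by (auto simp: Xn_def N_def)
     then have "(\<lambda>s. indicator {- (N n + 1)..y} s * g n (x, s)) = (\<lambda>s. indicator {sa x<..y} s * (pi / len x))"
      using True y by (intro ext) (auto simp: g_def indicator_def)
     then have "(LBINT s. indicator {- (N n + 1)..y} s * g n (x, s)) = (y - sa x) * (pi / len x)"
      using y by simp
     then show ?thesis using True y by (simp add: W_def V_def V'_def g_def mult.commute)
    qed
    \<comment> \<open>A primitive in y of the divergence along the section, without the term that
      contains p'; that one integrates to \<open>Dy\<close>.\<close>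
    define \<Phi> where "\<Phi> y = 3 / (2 * R) * y + wt \<alpha> x * ((ad x - \<epsilon> * (q x * Y y)) * sin (V y))" for y
    define \<Phi>' where "\<Phi>' y = 3 / (2 * R) + wt \<alpha> x * (- (\<epsilon> * (q x * Y' y)) * sin (V y) + (ad x - \<epsilon> * (q x * Y y)) * (cos (V y) * V'))" for y
    have \<Phi>d: "(\<Phi> has_real_derivative \<Phi>' y) (at y)" for y
     unfolding \<Phi>_def[abs_def] \<Phi>'_def using R_pos by (auto intro!: derivative_eq_intros Yd Vd)
    have \<Phi>c: "continuous_on UNIV \<Phi>'" unfolding \<Phi>'_def[abs_def]
     by (intro continuous_intros Yc Vc)
    have ind: "AE y in lborel. indicator A (x, y) *\<^sub>R E n (x, y) = \<Phi>' y * indicator {sa x..sb x} y + \<epsilon> * (p' x * (indicator {sa x..sb x} y *\<^sub>R Y y))"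
    proof -
     have "AE y in lborel. y \<noteq> sa x" "AE y in lborel. y \<noteq> sb x" by (rule AE_lborel_singleton)+
     with sec show ?thesis
     proof eventually_elim
      fix y assume A: "((x, y) \<in> A) = (sa x < y \<and> y < sb x)" "y \<noteq> sa x" "y \<noteq> sb x"
      show "indicator A (x, y) *\<^sub>R E n (x, y) = \<Phi>' y * indicator {sa x..sb x} y + \<epsilon> * (p' x * (indicator {sa x..sb x} y *\<^sub>R Y y))"
      proof (cases "sa x < y \<and> y < sb x")
       case True
       then have "E n (x, y) = \<Phi>' y + \<epsilon> * (p' x * Y y)"
        using WV[of y] by (simp add: E_def gdiv_def p1_def qa_def a_def \<Phi>'_def U'x)
       then show ?thesis using True A(1) by simp
      next
       case False
       then have "y \<notin> {sa x..sb x}" using A(2,3) by auto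
       then show ?thesis using A(1) False by auto
      qed
     qed
    qed
    have iY: "integrable lborel (\<lambda>y. indicator {sa x..sb x} y *\<^sub>R Y y)" by (intro borel_integrable_compact Yc) auto
    have bi: "has_bochner_integral lborel (\<lambda>y. \<Phi>' y * indicator {sa x..sb x} y) (\<Phi> (sb x) - \<Phi> (sa x))"
     by (rule has_bochner_integral_FTC_Icc_real[OF _ \<Phi>d])
       (use \<Phi>c continuous_on_eq_continuous_at[OF open_UNIV, of \<Phi>'] lp in \<open>auto simp: sab\<close>)
    have "T n x = (LBINT y. \<Phi>' y * indicator {sa x..sb x} y + \<epsilon> * (p' x * (indicator {sa x..sb x} y *\<^sub>R Y y)))"
     unfolding T_def
    proof (rule integral_cong_AE[OF _ _ ind])
     have [measurable]: "\<Phi>' \<in> borel_measurable borel" by (rule borel_measurable_continuous_onI[OF \<Phi>c])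
     show "(\<lambda>y. \<Phi>' y * indicator {sa x..sb x} y + \<epsilon> * (p' x * (indicator {sa x..sb x} y *\<^sub>R Y y))) \<in> borel_measurable lborel" by measurable
    qed measurable
    also have "\<dots> = (\<Phi> (sb x) - \<Phi> (sa x)) + \<epsilon> * (p' x * Dy x)"
     using bi iY unfolding Dy_def set_int_def
     by (subst Bochner_Integration.integral_add) (auto simp: has_bochner_integral_iff)
    also have "\<Phi> (sb x) - \<Phi> (sa x) = 3 / (2 * R) * len x + wt \<alpha> x * J n x"
    proof -
     have e: "3 / (2 * R) * sb x - 3 / (2 * R) * sa x = 3 / (2 * R) * len x" unfolding sab by (simp add: distrib_left)
     have al: "w * ((A - e1 * (q1 * Yb)) * t) - w * ((A - e1 * (q1 * Ya)) * - 1) = w * ((t + 1) * A - e1 * (q1 * (Ya + t * Yb)))"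
      for w A e1 q1 Ya Yb t :: real by (simp add: algebra_simps)
     have s1: "sin (V (sa x)) = - 1" by (simp add: V_def)
     have s2: "sin (V (sb x)) = (if x \<in> Xn n then 1 else - 1)" using lp by (simp add: V_def sab)
     have "\<Phi> (sb x) - \<Phi> (sa x) = 3 / (2 * R) * len x + (wt \<alpha> x * ((ad x - \<epsilon> * (q x * Y (sb x))) * sin (V (sb x))) - wt \<alpha> x * ((ad x - \<epsilon> * (q x * Y (sa x))) * sin (V (sa x))))"
      unfolding \<Phi>_def using e by linarith
     also have "wt \<alpha> x * ((ad x - \<epsilon> * (q x * Y (sb x))) * sin (V (sb x))) - wt \<alpha> x * ((ad x - \<epsilon> * (q x * Y (sa x))) * sin (V (sa x)))
      = wt \<alpha> x * J n x"
      unfolding s1 al s2 J_def by (simp add: algebra_simps)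
     finally show ?thesis .
    qed
    finally show ?thesis using x by (simp add: H_def)
   qed
  qed
  define H0 where "H0 x = 3 / (2 * R) * len x + \<epsilon> * (p' x * Dy x) + wt \<alpha> x * (2 * ad x - \<epsilon> * (q x * (Y (sa x) + Y (sb x))))" for x
  have [measurable]: "ad \<in> borel_measurable borel" by (rule borel_measurable_continuous_onI[OF adc])
  have Hm: "H n \<in> borel_measurable borel" "H0 \<in> borel_measurable borel" for n
   unfolding H_def[abs_def] H0_def[abs_def] J_def by measurable
  have Jb: "\<bar>J n x\<bar> \<le> 4 + QB * 2" for n x
  proof -
   have "\<bar>Y (sa x) + Y (sb x)\<bar> \<le> 2" "\<bar>Y (sb x) - Y (sa x)\<bar> \<le> 2" using Yb(1)[of "sa x"] Yb(1)[of "sb x"] by linarith+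
   then have "\<bar>\<epsilon> * (q x * (Y (sa x) + Y (sb x)))\<bar> \<le> QB * 2" "\<bar>\<epsilon> * (q x * (Y (sb x) - Y (sa x)))\<bar> \<le> QB * 2"
    using ep[OF QB] by blast+
   then show ?thesis unfolding J_def using adb[of x] by auto
  qed
  have lim: "(\<lambda>n. \<integral>x. indicator {0<..<R} x *\<^sub>R H n x \<partial>lborel) \<longlonglongrightarrow> (LBINT x. indicator {0<..<R} x *\<^sub>R H0 x)"
  proof (rule integral_dominated_convergence[where w = "\<lambda>x. indicator {0<..<R} x *\<^sub>R (wt \<alpha> R * (4 + QB * 2) + (3 / (2 * R) + PB) * len x)"])
   show "integrable lborel (\<lambda>x. indicator {0<..<R} x *\<^sub>R (wt \<alpha> R * (4 + QB * 2) + (3 / (2 * R) + PB) * len x))"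
   proof (rule setI[unfolded set_integrable_def])
    fix x
    have "0 \<le> wt \<alpha> R * (4 + QB * 2)" "0 \<le> (3 / (2 * R) + PB) * len x"
     using QB0 PB0 len0[of x] R_pos by auto
    then show "\<bar>wt \<alpha> R * (4 + QB * 2) + (3 / (2 * R) + PB) * len x\<bar> \<le> wt \<alpha> R * (4 + QB * 2) + (3 / (2 * R) + PB) * len x" by simp
   qed measurable
   show "AE x in lborel. norm (indicator {0<..<R} x *\<^sub>R H n x) \<le> indicator {0<..<R} x *\<^sub>R (wt \<alpha> R * (4 + QB * 2) + (3 / (2 * R) + PB) * len x)" for n
   proof (rule AE_I2)
    fix x
    show "norm (indicator {0<..<R} x *\<^sub>R H n x) \<le> indicator {0<..<R} x *\<^sub>R (wt \<alpha> R * (4 + QB * 2) + (3 / (2 * R) + PB) * len x)"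
    proof (cases "0 < x \<and> x < R")
     case True
     have "\<bar>wt \<alpha> x * J n x\<bar> \<le> wt \<alpha> R * (4 + QB * 2)"
      unfolding abs_mult using wR[of x] Jb[of n x] True by (intro mult_mono) auto
     moreover have "\<bar>\<epsilon> * (p' x * Dy x)\<bar> \<le> PB * len x" by (rule ep[OF PB(2) Dyb])
     moreover have "\<bar>3 / (2 * R) * len x\<bar> = 3 / (2 * R) * len x" using len0[of x] R_pos by simp
     ultimately have "\<bar>H n x\<bar> \<le> wt \<alpha> R * (4 + QB * 2) + (3 / (2 * R) + PB) * len x"
      unfolding H_def distrib_right by linarith
     then show ?thesis using True by simp
    qed auto
   qed
   show "AE x in lborel. (\<lambda>n. indicator {0<..<R} x *\<^sub>R H n x) \<longlonglongrightarrow> indicator {0<..<R} x *\<^sub>R H0 x"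
    using sections_ae[OF \<open>0 < \<alpha>\<close> R_pos K.R_eq C]
   proof eventually_elim
    fix x assume ae: "interval_sections A R x"
    show "(\<lambda>n. indicator {0<..<R} x *\<^sub>R H n x) \<longlonglongrightarrow> indicator {0<..<R} x *\<^sub>R H0 x"
    proof (cases "0 < x \<and> x < R")
     case True
     then have lp: "0 < len x" using ae by (simp add: len_def)
     obtain n0 where n0: "real n0 > \<bar>sa x\<bar> + \<bar>sb x\<bar> + 1 / len x" using reals_Archimedean2 by blast
     have "\<forall>\<^sub>F n in sequentially. indicator {0<..<R} x *\<^sub>R H n x = indicator {0<..<R} x *\<^sub>R H0 x"
      unfolding eventually_sequentially
     proof (intro exI[of _ n0] allI impI)
      fix n assume "n0 \<le> n"
      then have n: "real n > \<bar>sa x\<bar> + \<bar>sb x\<bar> + 1 / len x" using n0 by linarith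
      have il: "0 < 1 / len x" using lp by simp
      have "real n < real (Suc n)" by simp
      then have 1: "\<bar>sa x\<bar> < real n" "\<bar>sb x\<bar> < real n" "1 / len x < real (Suc n)"
       using n il abs_ge_zero[of "sa x"] abs_ge_zero[of "sb x"] by linarith+
      then have "1 / real (Suc n) < len x" using lp by (simp add: divide_simps mult.commute)
      then have "x \<in> Xn n" using 1 True by (simp add: Xn_def)
      then show "indicator {0<..<R} x *\<^sub>R H n x = indicator {0<..<R} x *\<^sub>R H0 x" by (simp add: H_def H0_def J_def)
     qed
     then show ?thesis by (rule tendsto_eventually)
    qed auto
   qed
  qed (use Hm in measurable)
  have "(LBINT x. indicator {0<..<R} x *\<^sub>R H n x) \<le> B * C" for n
  proof -
   have "(LBINT x. T n x) = (LBINT x. indicator {0<..<R} x *\<^sub>R H n x)"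
    by (rule integral_cong_AE[OF _ _ TH]) (use fub(2)[of n] Hm in auto)
   then show ?thesis using le[of n] fub(1)[of n] by simp
  qed
  then have fin: "(LBINT x:{0<..<R}. H0 x) \<le> B * C"
   unfolding set_int_def by (intro LIMSEQ_le_const2[OF lim]) auto
  have I0: "set_integrable lborel {0<..<R} (\<lambda>x. 3 / (2 * R) * len x)" by (intro set_integrable_mult_right lenI)
  have I1': "set_integrable lborel {0<..<R} (\<lambda>x. \<epsilon> * (p' x * Dy x))" by (intro set_integrable_mult_right I1)
  have I3: "set_integrable lborel {0<..<R} (\<lambda>x. 2 * (wt \<alpha> x * ad x))"
  proof (rule setI[where ?k1.0 = "2 * (wt \<alpha> R * 2)" and ?k2.0 = 0])
   fix x assume x: "0 < x" "x < R"
   have "wt \<alpha> x * ad x \<le> wt \<alpha> R * 2" using wR[OF x] adb[of x] by (intro mult_mono) auto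
   moreover have "0 \<le> wt \<alpha> x * ad x" using adb[of x] by simp
   ultimately show "\<bar>2 * (wt \<alpha> x * ad x)\<bar> \<le> 2 * (wt \<alpha> R * 2) + 0 * len x" by linarith
  qed measurable
  have I2': "set_integrable lborel {0<..<R} (\<lambda>x. \<epsilon> * (wt \<alpha> x * q x * (Y (sa x) + Y (sb x))))" by (intro set_integrable_mult_right I2)
  have "(LBINT x:{0<..<R}. H0 x) = (LBINT x:{0<..<R}. (3 / (2 * R) * len x + \<epsilon> * (p' x * Dy x)) + (2 * (wt \<alpha> x * ad x) - \<epsilon> * (wt \<alpha> x * q x * (Y (sa x) + Y (sb x)))))"
   by (rule set_lebesgue_integral_cong) (auto simp: H0_def algebra_simps)
  also have "\<dots> = ((LBINT x:{0<..<R}. 3 / (2 * R) * len x) + (LBINT x:{0<..<R}. \<epsilon> * (p' x * Dy x))) +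
    ((LBINT x:{0<..<R}. 2 * (wt \<alpha> x * ad x)) - (LBINT x:{0<..<R}. \<epsilon> * (wt \<alpha> x * q x * (Y (sa x) + Y (sb x)))))"
   by (simp only: set_integral_add(2)[OF set_integral_add(1)[OF I0 I1'] set_integral_diff(1)[OF I3 I2']]
     set_integral_add(2)[OF I0 I1'] set_integral_diff(2)[OF I3 I2'])
  also have "\<dots> = 3 / (2 * R) * v + (LBINT x:{0<..<R}. 2 * (wt \<alpha> x * ad x)) + \<epsilon> * G"
   unfolding G_def set_integral_mult_right lenI(2) by (simp add: algebra_simps)
  finally have H0eq: "(LBINT x:{0<..<R}. H0 x) = 3 / (2 * R) * v + (LBINT x:{0<..<R}. 2 * (wt \<alpha> x * ad x)) + \<epsilon> * G" .
  have "cap_const \<alpha> * wt \<alpha> R * R \<le> (LBINT x:{0<..<R}. 2 * (wt \<alpha> x * ad x))"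
  proof -
   have [measurable]: "K.c \<in> borel_measurable borel" by (rule borel_measurable_continuous_onI[OF K.c_cont])
   have I4: "set_integrable lborel {0<..<R} (\<lambda>x. 2 * (wt \<alpha> x * K.c x))"
   proof (rule setI[where ?k1.0 = "2 * (wt \<alpha> R * 1)" and ?k2.0 = 0])
    fix x assume x: "0 < x" "x < R"
    have cb: "0 \<le> K.c x" "K.c x \<le> 1" using K.c_bounds[of x] x by auto
    have "wt \<alpha> x * K.c x \<le> wt \<alpha> R * 1" using wR[OF x] cb by (intro mult_mono) auto
    moreover have "0 \<le> wt \<alpha> x * K.c x" using cb by simp
    ultimately show "\<bar>2 * (wt \<alpha> x * K.c x)\<bar> \<le> 2 * (wt \<alpha> R * 1) + 0 * len x" by linarith
   qed measurable
   have "cap_const \<alpha> * wt \<alpha> R * R = 2 * (LBINT x:{0..R}. wt \<alpha> x * K.c x)"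
    unfolding K.c_def K.u_def by (rule cap_scale[OF R_pos, symmetric])
   also have "\<dots> = (LBINT x:{0..R}. 2 * (wt \<alpha> x * K.c x))" by simp
   also have "\<dots> = (LBINT x:{0<..<R}. 2 * (wt \<alpha> x * K.c x))"
    by (rule LBINT_Ioo_Icc[symmetric]) (use R_pos in simp)
   also have "\<dots> \<le> (LBINT x:{0<..<R}. 2 * (wt \<alpha> x * ad x))"
   proof (rule set_integral_mono[OF I4 I3])
    fix x assume "x \<in> {0<..<R}"
    then have x: "0 < x" "x < R" by auto
    have "K.c x \<le> ad x" using cut1[of x] x \<delta> by (simp add: ad_def U_def K.c_def)
    then show "2 * (wt \<alpha> x * K.c x) \<le> 2 * (wt \<alpha> x * ad x)" by (intro mult_left_mono) auto
   qed
   finally show ?thesis .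
  qed
  then have "cap_value \<alpha> v R + \<epsilon> * G \<le> B * C" using fin unfolding H0eq cap_value_def by simp
  also have "\<dots> \<le> B * cap_value \<alpha> v R" using B(1) C by (intro mult_left_mono) auto
  also have "\<dots> \<le> (1 + \<epsilon>\<^sup>2 * L / 2) * cap_value \<alpha> v R"
  proof (rule mult_right_mono)
   show "B \<le> 1 + \<epsilon>\<^sup>2 * L / 2" unfolding B_def
   proof (rule real_le_lsqrt)
    have "0 \<le> (\<epsilon>\<^sup>2 * L / 2)\<^sup>2" by simp
    then show "1 + \<epsilon>\<^sup>2 * L \<le> (1 + \<epsilon>\<^sup>2 * L / 2)\<^sup>2" unfolding power2_sum by simp
   qed (use L0 in auto)
   show "0 \<le> cap_value \<alpha> v R" unfolding cap_value_def
    using cap_const_pos[OF alpha] R_pos v_pos by (intro add_nonneg_nonneg mult_nonneg_nonneg divide_nonneg_nonneg) auto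
  qed
  finally show ?thesis by (simp add: algebra_simps)
 qed
 define V where "V = L * cap_value \<alpha> v R / 2"
 have V0: "0 \<le> V" unfolding V_def cap_value_def
  using cap_const_pos[OF alpha] R_pos v_pos L0 by (intro mult_nonneg_nonneg divide_nonneg_nonneg add_nonneg_nonneg) auto
 \<comment> \<open>Divided by \<epsilon>, the estimate \<open>key\<close> bounds G by a multiple of
   \<epsilon>, so a positive G is refuted by a small \<epsilon>.\<close>
 have "G \<le> 0"
 proof (rule ccontr)
  assume "\<not> ?thesis"
  then have G: "0 < G" by simp
  define \<epsilon> where "\<epsilon> = min 1 (G / (2 * (V + 1)))"
  have \<epsilon>: "0 < \<epsilon>" "\<epsilon> \<le> 1" "\<epsilon> \<le> G / (2 * (V + 1))" using G V0 by (auto simp: \<epsilon>_def)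
  have "\<epsilon> * G \<le> \<epsilon> * (\<epsilon> * V)" using key[OF \<epsilon>(1,2)] by (simp add: V_def power2_eq_square mult.assoc)
  then have "G \<le> \<epsilon> * V" using \<epsilon>(1) by simp
  also have "\<dots> \<le> G / (2 * (V + 1)) * V" using \<epsilon>(3) V0 by (intro mult_right_mono) auto
  also have "\<dots> \<le> G / 2"
   using V0 G by (simp add: divide_simps)
  finally show False using G by simp
 qed
 then show ?thesis unfolding G_def Dy_def Y_def q_def by (simp add: mult_ac)
qed

section \<open>From weak equations to the shape of the half\<close>

text \<open>The lemma of du Bois-Reymond: a function orthogonal to all derivatives of test functions
  is constant. The constant is the pairing with a fixed density \<open>b1\<close> of mass 1.\<close>

lemma weak_constant:
 fixes z :: "real \<Rightarrow> real"
 assumes "0 < R" and z: "z \<in> borel_measurable borel" "set_integrable lborel {0<..<R} z"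
  and weak: "\<And>p p'. test_fun R p p' \<Longrightarrow> (LBINT x:{0<..<R}. z x * p' x) = 0"
 shows "\<exists>c. AE x in lborel. 0 < x \<and> x < R \<longrightarrow> z x = c"
proof -
 note [measurable] = z(1)
 \<comment> \<open>A fixed ascent from 0 to 1 within the middle third. Subtracting a multiple of it
   makes the primitive of any density supported away from the ends vanish near R.\<close>
 define B1 where "B1 x = ramp ((x - R / 3) / (R / 3))" for x
 define b1 where "b1 x = ramp' ((x - R / 3) / (R / 3)) * (3 / R)" for x
 have B1d: "(B1 has_real_derivative b1 x) (at x)" for x
  unfolding B1_def[abs_def] b1_def
  by (rule DERIV_chain2[OF ramp_DERIV]) (use \<open>0 < R\<close> in \<open>auto intro!: derivative_eq_intros\<close>)
 have b1c: "continuous_on UNIV b1" unfolding b1_def[abs_def]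
  by (intro continuous_intros continuous_on_compose2[OF ramp'_continuous]) (use \<open>0 < R\<close> in auto)
 have b1l: "B1 x = 0 \<and> b1 x = 0" if "x \<le> R / 3" for x
 proof -
  have "(x - R / 3) / (R / 3) \<le> 0" using that \<open>0 < R\<close> by (simp add: divide_le_0_iff)
  then show ?thesis by (simp add: B1_def b1_def ramp_simps)
 qed
 have b1r: "B1 x = 1 \<and> b1 x = 0" if "2 * R / 3 \<le> x" for x
 proof -
  have "1 \<le> (x - R / 3) / (R / 3)" using that \<open>0 < R\<close> by (simp add: le_divide_eq)
  then show ?thesis by (simp add: B1_def b1_def ramp_simps)
 qed
 define c where "c = (LBINT x:{0<..<R}. z x * b1 x)"
 have zi: "set_integrable lborel {0<..<R} (\<lambda>x. z x * h x)" if [measurable]: "h \<in> borel_measurable borel" and hb: "\<And>x. \<bar>h x\<bar> \<le> K" for h K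
 proof -
  have "integrable lborel (\<lambda>x. K * \<bar>indicator {0<..<R} x *\<^sub>R z x\<bar>)"
   using z(2) unfolding set_integrable_def by (intro integrable_mult_right integrable_abs)
  then show ?thesis unfolding set_integrable_def
  proof (rule Bochner_Integration.integrable_bound)
   have "\<bar>z x\<bar> * \<bar>h x\<bar> \<le> \<bar>z x\<bar> * K" for x using hb[of x] by (intro mult_left_mono) auto
   moreover have "0 \<le> K" using hb[of 0] by linarith
   ultimately show "AE x in lborel. norm (indicator {0<..<R} x *\<^sub>R (z x * h x)) \<le> norm (K * \<bar>indicator {0<..<R} x *\<^sub>R z x\<bar>)"
    by (auto simp: indicator_def abs_mult mult.commute)
  qed measurable
 qed
 have cont_case: "(LBINT x:{0<..<R}. z x * h x) = (LBINT x:{0..R}. h x) * c"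
  if h: "continuous_on UNIV h" and \<rho>: "0 < \<rho>" "\<rho> \<le> R / 3" and hz: "\<And>x. x \<le> \<rho> \<or> R - \<rho> \<le> x \<Longrightarrow> h x = 0"
   and hb: "\<And>x. \<bar>h x\<bar> \<le> 1" for h \<rho>
 proof -
  obtain H0 where H0: "\<And>x. (H0 has_real_derivative h x) (at x)" using continuous_antiderivative[OF h] by metis
  define H where "H x = H0 x - H0 0" for x
  have Hd: "(H has_real_derivative h x) (at x)" for x unfolding H_def[abs_def] by (auto intro!: derivative_eq_intros H0)
  have hi: "isCont h x" for x using h continuous_on_eq_continuous_at[OF open_UNIV] by blast
  have FTC: "(LBINT s:{x..y}. h s) = H y - H x" if "x \<le> y" for x y
   using integral_FTC_Icc_real[OF that Hd hi] unfolding set_int_def by (simp add: mult.commute)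
  have HR: "H R = (LBINT x:{0..R}. h x)" using FTC[of 0 R] \<open>0 < R\<close> by (simp add: H_def)
  have H1: "H x = 0" if "x \<le> \<rho>" for x
  proof (cases "0 \<le> x")
   case True
   have "(LBINT s:{0..x}. h s) = (LBINT s:{0..x}. 0)" by (rule set_lebesgue_integral_cong) (use hz that in auto)
   then show ?thesis using FTC[OF True] by (simp add: H_def)
  next
   case False
   then have x0: "x \<le> 0" by simp
   have "(LBINT s:{x..0}. h s) = (LBINT s:{x..0}. 0)" by (rule set_lebesgue_integral_cong) (use hz \<rho> in auto)
   then show ?thesis using FTC[OF x0] by (simp add: H_def)
  qed
  have H2: "H x = H R" if "R - \<rho> \<le> x" for x
  proof (cases "R \<le> x")
   case True
   have "(LBINT s:{R..x}. h s) = (LBINT s:{R..x}. 0)" by (rule set_lebesgue_integral_cong) (use hz \<rho> in auto)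
   then show ?thesis using FTC[OF True] by simp
  next
   case False
   then have x0: "x \<le> R" by simp
   have "(LBINT s:{x..R}. h s) = (LBINT s:{x..R}. 0)" by (rule set_lebesgue_integral_cong) (use hz that in auto)
   then show ?thesis using FTC[OF x0] by simp
  qed
  have "test_fun R (\<lambda>x. H x - H R * B1 x) (\<lambda>x. h x - H R * b1 x)"
   unfolding test_fun_def
  proof (intro conjI allI exI[of _ \<rho>] impI)
   show "((\<lambda>x. H x - H R * B1 x) has_real_derivative h x - H R * b1 x) (at x)" for x
    by (intro DERIV_diff DERIV_cmult Hd B1d)
   show "continuous_on UNIV (\<lambda>x. h x - H R * b1 x)" by (intro continuous_intros h b1c)
   fix x assume x: "x \<le> \<rho> \<or> R - \<rho> \<le> x"
   then show "H x - H R * B1 x = 0" "h x - H R * b1 x = 0"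
    using H1[of x] H2[of x] hz[of x] b1l[of x] b1r[of x] \<rho> by auto
  qed (use \<rho> in auto)
  from weak[OF this] have "(LBINT x:{0<..<R}. z x * h x - H R * (z x * b1 x)) = 0" by (simp add: algebra_simps)
  moreover have "(LBINT x:{0<..<R}. z x * h x - H R * (z x * b1 x)) = (LBINT x:{0<..<R}. z x * h x) - (LBINT x:{0<..<R}. H R * (z x * b1 x))"
  proof (rule set_integral_diff(2))
   show "set_integrable lborel {0<..<R} (\<lambda>x. z x * h x)" by (rule zi[OF borel_measurable_continuous_onI[OF h] hb])
   have "\<bar>b1 x\<bar> \<le> 4 * (3 / R)" for x unfolding b1_def abs_mult using ramp'_bound[of "(x - R / 3) / (R / 3)"] \<open>0 < R\<close> by (intro mult_mono) auto
   from zi[OF borel_measurable_continuous_onI[OF b1c] this]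
   show "set_integrable lborel {0<..<R} (\<lambda>x. H R * (z x * b1 x))" by (intro set_integrable_mult_right) auto
  qed
  ultimately show ?thesis unfolding HR[symmetric] c_def by simp
 qed
 have const: "AE x in lborel. \<rho> < x \<and> x < R - \<rho> \<longrightarrow> z x = c" if \<rho>: "0 < \<rho>" "\<rho> \<le> R / 3" for \<rho>
 proof -
  define I where "I = {\<rho><..<R - \<rho>}"
  have IR: "I \<subseteq> {0<..<R}" using \<rho> by (auto simp: I_def)
  \<comment> \<open>Pairing z - c with its own sign gives the integral of |z - c|; the sign function
    is reached through continuous densities vanishing near the ends.\<close>
  define q where "q x = sgn (z x - c) * indicator I x" for x
  have [measurable]: "I \<in> sets borel" by (simp add: I_def)
  have [measurable]: "q \<in> borel_measurable borel" unfolding q_def[abs_def] by measurable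
  have qb: "- 1 \<le> q x" "q x \<le> 1" for x by (auto simp: q_def indicator_def sgn_if)
  obtain h0 where h0: "\<And>n::nat. continuous_on UNIV (h0 n)" "\<And>n x. - 1 \<le> h0 n x" "\<And>n x. h0 n x \<le> 1"
   "AE x in lborel. (\<lambda>n. h0 n x) \<longlonglongrightarrow> q x"
   using continuous_approximation[of q "-1" 1] qb by auto
  define kk where "kk n x = max 0 (min 1 (real (Suc n) * (x - \<rho>))) * max 0 (min 1 (real (Suc n) * ((R - \<rho>) - x)))" for n x
  have kk: "0 \<le> kk n x" "kk n x \<le> 1" for n x unfolding kk_def by (auto intro!: mult_le_one)
  define h where "h n x = h0 n x * kk n x" for n x
  have hc: "continuous_on UNIV (h n)" for n unfolding h_def kk_def by (intro continuous_intros h0)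
  have [measurable]: "h n \<in> borel_measurable borel" for n by (rule borel_measurable_continuous_onI[OF hc])
  have hb: "\<bar>h n x\<bar> \<le> 1" for n x
  proof -
   have "\<bar>h0 n x\<bar> \<le> 1" using h0(2,3)[of n x] by (simp add: abs_le_iff)
   then show ?thesis unfolding h_def abs_mult using kk[of n x] by (intro mult_le_one) auto
  qed
  have hz: "h n x = 0" if "x \<le> \<rho> \<or> R - \<rho> \<le> x" for n x
  proof -
   have "real (Suc n) * (x - \<rho>) \<le> 0 \<or> real (Suc n) * ((R - \<rho>) - x) \<le> 0"
    using that by (auto simp: mult_le_0_iff simp del: of_nat_Suc)
   then show ?thesis unfolding h_def kk_def by (auto simp del: of_nat_Suc)
  qed
  have hlim: "AE x in lborel. (\<lambda>n. h n x) \<longlonglongrightarrow> q x"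
   using h0(4)
  proof eventually_elim
   fix x assume l: "(\<lambda>n. h0 n x) \<longlonglongrightarrow> q x"
   show "(\<lambda>n. h n x) \<longlonglongrightarrow> q x"
   proof (cases "x \<in> I")
    case False
    then have "q x = 0" "h n x = 0" for n using hz[of x n] by (auto simp: q_def I_def not_less)
    then show ?thesis by simp
   next
    case True
    define m where "m = min (x - \<rho>) ((R - \<rho>) - x)"
    have m: "0 < m" using True by (auto simp: m_def I_def)
    obtain n0 where n0: "1 / real (Suc n0) < m" using nat_approx_posE[OF m] by blast
    have "\<forall>\<^sub>F n in sequentially. h0 n x = h n x"
     unfolding eventually_sequentially
    proof (intro exI[of _ n0] allI impI)
     fix n assume "n0 \<le> n"
     then have "1 / real (Suc n) \<le> 1 / real (Suc n0)" by (simp add: divide_simps)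
     then have "1 / real (Suc n) < m" using n0 by linarith
     then have "1 \<le> real (Suc n) * m" by (simp add: divide_simps mult.commute del: of_nat_Suc)
     moreover have "real (Suc n) * m \<le> real (Suc n) * (x - \<rho>)" "real (Suc n) * m \<le> real (Suc n) * ((R - \<rho>) - x)"
      by (intro mult_left_mono; simp add: m_def)+
     ultimately have "min 1 (real (Suc n) * (x - \<rho>)) = 1" "min 1 (real (Suc n) * ((R - \<rho>) - x)) = 1" by linarith+
     then have "kk n x = 1" unfolding kk_def by simp
     then show "h0 n x = h n x" by (simp add: h_def)
    qed
    then show ?thesis using l by (rule Lim_transform_eventually[rotated])
   qed
  qed
  have l1: "(\<lambda>n. LBINT x:{0<..<R}. z x * h n x) \<longlonglongrightarrow> (LBINT x:{0<..<R}. z x * q x)"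
   unfolding set_int_def
  proof (rule integral_dominated_convergence[where w = "\<lambda>x. \<bar>indicator {0<..<R} x *\<^sub>R z x\<bar>"])
   show "integrable lborel (\<lambda>x. \<bar>indicator {0<..<R} x *\<^sub>R z x\<bar>)" using z(2) unfolding set_integrable_def by (rule integrable_abs)
   show "AE x in lborel. norm (indicator {0<..<R} x *\<^sub>R (z x * h n x)) \<le> \<bar>indicator {0<..<R} x *\<^sub>R z x\<bar>" for n
    using hb[of n] by (intro AE_I2) (auto simp: abs_mult indicator_def mult_left_le)
   show "AE x in lborel. (\<lambda>n. indicator {0<..<R} x *\<^sub>R (z x * h n x)) \<longlonglongrightarrow> indicator {0<..<R} x *\<^sub>R (z x * q x)"
    using hlim by eventually_elim (intro tendsto_intros)
  qed measurable
  have l2: "(\<lambda>n. LBINT x:{0..R}. h n x) \<longlonglongrightarrow> (LBINT x:{0..R}. q x)"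
   by (rule bounded_convergence[where D = 1]) (use hb hlim in \<open>auto simp: emeasure_lborel_Icc_eq\<close>)
  have "(LBINT x:{0<..<R}. z x * h n x) = (LBINT x:{0..R}. h n x) * c" for n
   by (rule cont_case[OF hc \<rho> hz hb])
  then have "(LBINT x:{0<..<R}. z x * q x) = (LBINT x:{0..R}. q x) * c"
   using LIMSEQ_unique[OF l1] tendsto_mult[OF l2 tendsto_const[of c]] by simp
  moreover have "(LBINT x:{0..R}. q x) * c = (LBINT x:{0<..<R}. c * q x)"
  proof -
   have "(LBINT x:{0..R}. q x) = (LBINT x:{0<..<R}. q x)"
    unfolding set_int_def by (rule Bochner_Integration.integral_cong) (use IR in \<open>auto simp: q_def indicator_def\<close>)
   then show ?thesis by simp
  qed
  moreover have i1: "set_integrable lborel {0<..<R} (\<lambda>x. z x * q x)" by (rule zi[of q 1]) (use qb in \<open>auto simp: abs_le_iff minus_le_iff\<close>)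
  moreover have i2: "set_integrable lborel {0<..<R} (\<lambda>x. c * q x)"
   by (rule set_integrable_bounded[where D = "\<bar>c\<bar> * 1"])
     (use qb \<open>0 < R\<close> in \<open>auto simp: abs_mult abs_le_iff minus_le_iff intro!: mult_left_le\<close>)
  ultimately have "(LBINT x:{0<..<R}. z x * q x - c * q x) = 0" using set_integral_diff(2)[OF i1 i2] by simp
  moreover have pt: "indicator {0<..<R} x *\<^sub>R (z x * q x - c * q x) = indicator I x * \<bar>z x - c\<bar>" for x
   using IR by (auto simp: q_def indicator_def sgn_if algebra_simps)
  ultimately have "(LBINT x. indicator I x * \<bar>z x - c\<bar>) = 0" unfolding set_int_def pt by simp
  moreover have "integrable lborel (\<lambda>x. indicator I x * \<bar>z x - c\<bar>)"
   using set_integral_diff(1)[OF i1 i2] unfolding set_integrable_def pt .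
  ultimately have "AE x in lborel. indicator I x * \<bar>z x - c\<bar> = 0"
   by (subst (asm) integral_nonneg_eq_0_iff_AE) auto
  then show ?thesis by eventually_elim (auto simp: I_def indicator_def split: if_splits)
 qed
 \<comment> \<open>The shift by 3 keeps the margin at most R/3, as required by \<open>const\<close>;
   the margins shrink to 0 and exhaust the interval.\<close>
 have "AE x in lborel. \<forall>n. R / real (n + 3) < x \<and> x < R - R / real (n + 3) \<longrightarrow> z x = c"
  unfolding AE_all_countable
 proof
  fix n
  show "AE x in lborel. R / real (n + 3) < x \<and> x < R - R / real (n + 3) \<longrightarrow> z x = c"
  proof (rule const)
   show "0 < R / real (n + 3)" using \<open>0 < R\<close> by simp
   show "R / real (n + 3) \<le> R / 3" using \<open>0 < R\<close> by (intro divide_left_mono) auto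
  qed
 qed
 then have "AE x in lborel. 0 < x \<and> x < R \<longrightarrow> z x = c"
 proof eventually_elim
  fix x assume a: "\<forall>n. R / real (n + 3) < x \<and> x < R - R / real (n + 3) \<longrightarrow> z x = c"
  show "0 < x \<and> x < R \<longrightarrow> z x = c"
  proof
   assume x: "0 < x \<and> x < R"
   define m where "m = min x (R - x)"
   have m: "0 < m" using x by (simp add: m_def)
   obtain n where n: "R / m < real n" using reals_Archimedean2 by blast
   then have "R / m < real (n + 3)" by simp
   then have "R / real (n + 3) < m" using m by (simp add: divide_simps mult.commute del: of_nat_add)
   then have "R / real (n + 3) < x" "x < R - R / real (n + 3)" by (auto simp: m_def)
   then show "z x = c" using a by blast
  qed
 qed
 then show ?thesis by blast
qed

lemma test_fun_integral:
 assumes "test_fun R p p'" "0 < R"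
 shows "(LBINT x:{0<..<R}. p' x) = 0"
proof -
 have d: "\<And>x. (p has_real_derivative p' x) (at x)" and c: "continuous_on UNIV p'" and z: "p 0 = 0" "p R = 0"
  using assms by (auto simp: test_fun_def)
 have "(LBINT x. p' x * indicator {0..R} x) = p R - p 0"
  by (rule integral_FTC_Icc_real[OF _ d]) (use assms(2) c continuous_on_eq_continuous_at[OF open_UNIV, of p'] in auto)
 moreover have "(LBINT x:{0<..<R}. p' x) = (LBINT x. p' x * indicator {0..R} x)"
  unfolding LBINT_Ioo_Icc[OF less_imp_le[OF assms(2)]] by (simp add: set_int_def mult.commute)
 ultimately show ?thesis using z by simp
qed

text \<open>Shifting the phase \<beta> by \<pi> changes the sign of every cosine and hence reverses
  the inequality.\<close>

lemma (in half_set) weak_equality: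
 assumes cap: "cap \<alpha> v R f" and "0 < \<alpha>" and C: "C \<le> cap_value \<alpha> v R" and p: "test_fun R p p'"
 defines "sa \<equiv> \<lambda>x. sec_mid A x - sec_len A x / 2"
 defines "sb \<equiv> \<lambda>x. sec_mid A x + sec_len A x / 2"
 shows "(LBINT x:{0<..<R}. p' x * (LBINT y:{sa x..sb x}. cos (k * y + \<beta>))) =
  (LBINT x:{0<..<R}. wt \<alpha> x * (cap.u R x / cap.c R x) * p x * (cos (k * sa x + \<beta>) + cos (k * sb x + \<beta>)))"
proof -
 note w = weak_inequality[OF cap \<open>0 < \<alpha>\<close> C p, of k]
 have c: "cos (t + (\<beta> + pi)) = - cos (t + \<beta>)" for t by (simp add: add.assoc[symmetric] cos_add)
 have c2: "cos (s + (\<beta> + pi)) + cos (t + (\<beta> + pi)) = - (cos (s + \<beta>) + cos (t + \<beta>))" for s t by (simp add: c)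
 have "- (LBINT x:{0<..<R}. p' x * (LBINT y:{sa x..sb x}. cos (k * y + \<beta>))) \<le>
  - (LBINT x:{0<..<R}. wt \<alpha> x * (cap.u R x / cap.c R x) * p x * (cos (k * sa x + \<beta>) + cos (k * sb x + \<beta>)))"
  using w[of "\<beta> + pi"] unfolding sa_def sb_def c2 unfolding c set_int_def
  by (simp only: scaleR_minus_right mult_minus_right Bochner_Integration.integral_minus)
 with w[of \<beta>, folded sa_def sb_def] show ?thesis unfolding sa_def sb_def by linarith
qed

text \<open>Frequency 0 compares the length of a section with 2 f. At frequency k the sum formulas
  turn both sides of the weak equation into multiples of cos (k m + \<beta>), with m the centre, and
  a suitable test function leaves that this cosine is constant in x. Two phases and small
  frequencies then fix m.\<close>

lemma (in half_set) equality_shape: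
 assumes cap: "cap \<alpha> v R f" and "0 < \<alpha>" and C: "C \<le> cap_value \<alpha> v R"
 obtains \<sigma> where "AE x in lborel. 0 < x \<and> x < R \<longrightarrow> sec_len A x = 2 * f x \<and> sec_mid A x = \<sigma>"
proof -
 interpret K: cap \<alpha> v R f by (rule cap)
 note R_pos = K.R_pos
 note [measurable] = A_borel section_borel_measurable[OF A_borel] wt_borel[OF alpha]
 define len where "len x = sec_len A x" for x
 define ce where "ce x = sec_mid A x" for x
 have [measurable]: "len \<in> borel_measurable borel" "ce \<in> borel_measurable borel" unfolding len_def[abs_def] ce_def[abs_def] by measurable
 have len0: "0 \<le> len x" for x by (simp add: len_def sec_len_def)
 note W = weak_equality[OF cap \<open>0 < \<alpha>\<close> C, folded len_def ce_def]
 have lenI: "set_integrable lborel {0<..<R} len" "(LBINT x:{0<..<R}. len x) = v"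
  unfolding len_def using length_integral[OF \<open>0 < \<alpha>\<close> R_pos K.R_eq C] by auto
 have K_meas[measurable]: "K.u \<in> borel_measurable borel" "K.c \<in> borel_measurable borel"
  by (rule borel_measurable_continuous_onI[OF K.u_cont], rule borel_measurable_continuous_onI[OF K.c_cont])
 \<comment> \<open>f is specified only on the closed interval; its extension by 0 is Borel on the
   line.\<close>
 define f0 where "f0 x = indicator {0..R} x *\<^sub>R f x" for x
 have f0i: "integrable lborel f0" unfolding f0_def[abs_def] by (intro borel_integrable_compact K.f_cont) auto
 then have [measurable]: "f0 \<in> borel_measurable borel" by auto
 have f0x: "f0 x = f x" if "0 < x" "x < R" for x using that by (simp add: f0_def)
 have f'c: "continuous_on {0<..<R} K.f'" by (rule continuous_on_subset[OF K.f'_cont]) auto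
 have fI: "set_integrable lborel {0<..<R} f0" unfolding set_integrable_def
  using integrable_mult_indicator[OF _ f0i, of "{0<..<R}"] by simp
 have fv: "(LBINT x:{0<..<R}. f0 x) = v / 2"
 proof -
  have "set_integrable lborel {0..R} f" unfolding set_integrable_def by (intro borel_integrable_compact K.f_cont) auto
  then have "(LBINT x:{0..R}. f x) = v / 2" using set_borel_integral_eq_integral(2) K.f_integral by (metis integral_unique)
  moreover have "(LBINT x:{0..R}. f x) = (LBINT x:{0<..<R}. f0 x)"
   unfolding LBINT_Ioo_Icc[OF less_imp_le[OF R_pos]] by (rule set_lebesgue_integral_cong) (auto simp: f0_def)
  ultimately show ?thesis by simp
 qed
 have fK: "K.f' x = - (wt \<alpha> x * (K.u x / K.c x))" for x by (simp add: K.f'_def)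
 have len2: "AE x in lborel. 0 < x \<and> x < R \<longrightarrow> len x = 2 * f x"
 proof -
  \<comment> \<open>For k = 0 and \<beta> = 0 the inner integral is the length and both end values
    are 1, so the length and 2 f have the same weak derivative.\<close>
  have "\<exists>c. AE x in lborel. 0 < x \<and> x < R \<longrightarrow> len x - 2 * f0 x = c"
  proof (rule weak_constant[OF R_pos])
   show "set_integrable lborel {0<..<R} (\<lambda>x. len x - 2 * f0 x)"
    by (intro set_integral_diff(1) lenI(1) set_integrable_mult_right fI)
   fix p p' assume p: "test_fun R p p'"
   obtain PB where PB: "\<And>x. \<bar>p' x\<bar> \<le> PB" using test_fun_bounded[OF p] by blast
   have pm[measurable]: "p' \<in> borel_measurable borel" using p by (auto simp: test_fun_def intro: borel_measurable_continuous_onI)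
   have si: "set_integrable lborel {0<..<R} (\<lambda>x. p' x * h x)" if h: "set_integrable lborel {0<..<R} h" and [measurable]: "h \<in> borel_measurable borel" for h
   proof -
    have "integrable lborel (\<lambda>x. PB * \<bar>indicator {0<..<R} x *\<^sub>R h x\<bar>)"
     using h unfolding set_integrable_def by (intro integrable_mult_right integrable_abs)
    then show ?thesis unfolding set_integrable_def
    proof (rule Bochner_Integration.integrable_bound)
     have "\<bar>p' x\<bar> * \<bar>h x\<bar> \<le> PB * \<bar>h x\<bar>" for x using PB[of x] by (intro mult_right_mono) auto
     moreover have "0 \<le> PB" using PB[of 0] by linarith
     ultimately show "AE x in lborel. norm (indicator {0<..<R} x *\<^sub>R (p' x * h x)) \<le> norm (PB * \<bar>indicator {0<..<R} x *\<^sub>R h x\<bar>)"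
      by (auto simp: indicator_def abs_mult)
    qed measurable
   qed
   have e1: "(LBINT y:{ce x - len x / 2..ce x + len x / 2}. cos (0 * y + 0)) = len x" for x
    using len0[of x] by (simp add: set_int_def)
   have "(LBINT x:{0<..<R}. p' x * len x) = (LBINT x:{0<..<R}. wt \<alpha> x * (K.u x / K.c x) * p x * 2)"
    using W[OF p, of 0 0] unfolding e1 by simp
   also have "\<dots> = (LBINT x:{0<..<R}. p' x * (2 * f0 x))"
   proof -
    have t: "test_fun R (\<lambda>x. p x * f x) (\<lambda>x. p' x * f x + p x * K.f' x)"
     by (rule test_fun_mult[OF p K.f_DERIV f'c])
    obtain QB where QB: "\<And>x. \<bar>p' x * f x + p x * K.f' x\<bar> \<le> QB" using test_fun_bounded[OF t] by blast
    have tm[measurable]: "(\<lambda>x. p' x * f x + p x * K.f' x) \<in> borel_measurable borel"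
     using t by (auto simp: test_fun_def intro: borel_measurable_continuous_onI)
    have i1: "set_integrable lborel {0<..<R} (\<lambda>x. 2 * (p' x * f x + p x * K.f' x))"
     by (intro set_integrable_mult_right set_integrable_bounded[where D = QB]) (use QB R_pos in auto)
    have i2: "set_integrable lborel {0<..<R} (\<lambda>x. p' x * (2 * f0 x))"
     using si[of "\<lambda>x. 2 * f0 x"] fI by (simp add: set_integrable_mult_right)
    have "(LBINT x:{0<..<R}. wt \<alpha> x * (K.u x / K.c x) * p x * 2)
      = (LBINT x:{0<..<R}. p' x * (2 * f0 x) - 2 * (p' x * f x + p x * K.f' x))"
     by (rule set_lebesgue_integral_cong) (auto simp: f0x fK algebra_simps)
    also have "\<dots> = (LBINT x:{0<..<R}. p' x * (2 * f0 x)) - (LBINT x:{0<..<R}. 2 * (p' x * f x + p x * K.f' x))"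
     by (rule set_integral_diff(2)[OF i2 i1])
    also have "(LBINT x:{0<..<R}. 2 * (p' x * f x + p x * K.f' x)) = 0"
     using test_fun_integral[OF t R_pos] by (simp only: set_integral_mult_right mult_zero_right)
    finally show ?thesis by simp
   qed
   finally have "(LBINT x:{0<..<R}. p' x * len x) - (LBINT x:{0<..<R}. p' x * (2 * f0 x)) = 0" by simp
   moreover have "(LBINT x:{0<..<R}. p' x * len x - p' x * (2 * f0 x)) = (LBINT x:{0<..<R}. p' x * len x) - (LBINT x:{0<..<R}. p' x * (2 * f0 x))"
   proof (rule set_integral_diff(2))
    show "set_integrable lborel {0<..<R} (\<lambda>x. p' x * len x)" by (rule si[OF lenI(1)]) measurable
    show "set_integrable lborel {0<..<R} (\<lambda>x. p' x * (2 * f0 x))"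
     by (rule si) (intro set_integrable_mult_right fI, measurable)
   qed
   ultimately show "(LBINT x:{0<..<R}. (len x - 2 * f0 x) * p' x) = 0" by (simp add: algebra_simps)
  qed measurable
  then obtain c where c: "AE x in lborel. 0 < x \<and> x < R \<longrightarrow> len x - 2 * f0 x = c" by blast
  \<comment> \<open>The length integrates to v and f to v/2, so the constant is 0.\<close>
  have "(LBINT x:{0<..<R}. len x - 2 * f0 x) = (LBINT x:{0<..<R}. c)"
   by (rule set_lebesgue_integral_cong_AE) (use c in auto)
  also have "\<dots> = c * R" using R_pos by (simp add: set_int_def)
  finally have "(LBINT x:{0<..<R}. len x) - (LBINT x:{0<..<R}. 2 * f0 x) = c * R"
   using set_integral_diff(2)[OF lenI(1), of "\<lambda>x. 2 * f0 x"] fI by (simp add: set_integrable_mult_right)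
  then have "c = 0" using lenI(2) fv R_pos by simp
  then show ?thesis using c by (auto elim!: eventually_mono simp: f0x)
 qed
 have "bounded (f ` {0..R})" by (intro compact_imp_bounded compact_continuous_image K.f_cont) auto
 then obtain FB where FB: "\<forall>x\<in>{0..R}. \<bar>f x\<bar> \<le> FB" by (auto simp: bounded_iff)
 have FB0: "0 \<le> FB" using FB R_pos by (meson abs_ge_zero atLeastAtMost_iff less_imp_le order_refl order_trans)
 \<comment> \<open>Frequencies tending to 0, all below 1/max f: then k f stays below 1 and sin (k f)
   is positive inside the interval.\<close>
 define k where "k n = 1 / (FB + real (Suc n))" for n
 have k: "0 < k n" for n using FB0 by (auto simp: k_def add_nonneg_pos)
 have kf: "0 < k n * f x" "k n * f x < pi" if "0 < x" "x < R" for n x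
 proof -
  show "0 < k n * f x" using k K.f_pos[of x] that by simp
  have "f x \<le> FB" using FB that by (auto simp: abs_le_iff)
  then have "f x < FB + real (Suc n)" by simp
  then have "k n * f x < 1" using FB0 by (simp add: k_def divide_simps add_nonneg_pos)
  then show "k n * f x < pi" using pi_gt3 by linarith
 qed
 have osc: "\<exists>c. AE x in lborel. 0 < x \<and> x < R \<longrightarrow> cos (k n * ce x + \<beta>) = c" for n \<beta>
 proof (rule weak_constant[OF R_pos])
  define zz where "zz x = cos (k n * ce x + \<beta>)" for x
  show "set_integrable lborel {0<..<R} (\<lambda>x. cos (k n * ce x + \<beta>))"
   by (rule set_integrable_bounded[where D = 1]) (use R_pos in auto)
  fix r r' assume r: "test_fun R r r'"
  \<comment> \<open>The integral of cos (k y + \<beta>) over a section is 2 cos (k m + \<beta>) h,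
    and the sum of the end values is the same cosine times 2 cos (k f).\<close>
  define h where "h x = sin (k n * f x) / k n" for x
  define h' where "h' x = cos (k n * f x) * K.f' x" for x
  have hd: "(h has_real_derivative h' x) (at x)" if "0 < x" "x < R" for x
  proof -
   have "((\<lambda>x. sin (k n * f x)) has_real_derivative cos (k n * f x) * (k n * K.f' x)) (at x)"
    by (rule DERIV_chain2[OF DERIV_sin DERIV_cmult[OF K.f_DERIV[OF that]]])
   from DERIV_cdivide[OF this, of "k n"] show ?thesis unfolding h_def[abs_def] h'_def using k[of n] by simp
  qed
  have hpos: "0 < h x" if "0 < x" "x < R" for x
   unfolding h_def using sin_gt_zero[OF kf[OF that]] k by simp
  have fc: "continuous_on {0<..<R} f" by (rule continuous_on_subset[OF K.f_cont]) auto
  define i' where "i' x = - h' x / (h x * h x)" for x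
  \<comment> \<open>Testing with p = r/h turns p' h + p h' into r', the derivative of an arbitrary
    test function.\<close>
  define p where "p x = r x * (1 / h x)" for x
  define p' where "p' x = r' x * (1 / h x) + r x * i' x" for x
  have p: "test_fun R p p'" unfolding p_def[abs_def] p'_def[abs_def]
  proof (rule test_fun_mult[OF r])
   show "((\<lambda>x. 1 / h x) has_real_derivative i' x) (at x)" if "0 < x" "x < R" for x
    using DERIV_divide[OF DERIV_const[of 1] hd[OF that]] hpos[OF that] by (simp add: i'_def)
   have "h x * h x \<noteq> 0" if "x \<in> {0<..<R}" for x using hpos[of x] that by auto
   then show "continuous_on {0<..<R} i'" unfolding i'_def[abs_def] h'_def[abs_def]
    using k[of n] by (intro continuous_intros f'c fc) (auto simp: h_def intro!: continuous_intros fc)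
  qed
  define D where "D x = (sin (k n * (ce x + len x / 2) + \<beta>) - sin (k n * (ce x - len x / 2) + \<beta>)) / k n" for x
  have De: "(LBINT y:{ce x - len x / 2..ce x + len x / 2}. cos (k n * y + \<beta>)) = D x" for x
  proof -
   have "(LBINT y. cos (k n * y + \<beta>) * indicator {ce x - len x / 2..ce x + len x / 2} y)
     = sin (k n * (ce x + len x / 2) + \<beta>) / k n - sin (k n * (ce x - len x / 2) + \<beta>) / k n"
   proof (rule integral_FTC_Icc_real[where F = "\<lambda>y. sin (k n * y + \<beta>) / k n"])
    show "((\<lambda>y. sin (k n * y + \<beta>) / k n) has_real_derivative cos (k n * y + \<beta>)) (at y)" for y
     using k[of n] by (auto intro!: derivative_eq_intros)
   qed (use len0[of x] in auto)
   then show ?thesis by (simp add: set_int_def mult.commute D_def diff_divide_distrib)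
  qed
  obtain PB where PB: "\<And>x. \<bar>p x\<bar> \<le> PB" "\<And>x. \<bar>p' x\<bar> \<le> PB" using test_fun_bounded[OF p] by blast
  have PB0: "0 \<le> PB" using PB(1)[of 0] by linarith
  have pd: "(p has_real_derivative p' x) (at x)" for x using p by (simp add: test_fun_def)
  have p'c: "continuous_on UNIV p'" using p by (simp add: test_fun_def)
  have pc: "continuous_on UNIV p" by (rule DERIV_imp_continuous_on[OF pd])
  have [measurable]: "p \<in> borel_measurable borel" "p' \<in> borel_measurable borel"
   using pc p'c by (auto intro: borel_measurable_continuous_onI)
  obtain q' where qt: "test_fun R (\<lambda>x. p x * (K.u x / K.c x)) q'" using K.test_fun_slope[OF p] .
  obtain QB where QB: "\<And>x. \<bar>p x * (K.u x / K.c x)\<bar> \<le> QB" using test_fun_bounded[OF qt] by blast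
  have QB0: "0 \<le> QB" using QB[of 0] by linarith
  define Z where "Z x = wt \<alpha> x * (K.u x / K.c x) * p x * (cos (k n * (ce x - len x / 2) + \<beta>) + cos (k n * (ce x + len x / 2) + \<beta>))" for x
  have eq: "(LBINT x:{0<..<R}. p' x * D x) = (LBINT x:{0<..<R}. Z x)"
   using W[OF p, of "k n" \<beta>] unfolding De Z_def .
  have [measurable]: "D \<in> borel_measurable borel" "Z \<in> borel_measurable borel" unfolding D_def[abs_def] Z_def[abs_def] by measurable
  have i1: "set_integrable lborel {0<..<R} (\<lambda>x. p' x * D x)"
  proof (rule set_integrable_bounded[where D = "PB * (2 / k n)"])
   fix x
   have "\<bar>sin (k n * (ce x + len x / 2) + \<beta>) - sin (k n * (ce x - len x / 2) + \<beta>)\<bar> \<le> 2"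
    using abs_sin_le_one[of "k n * (ce x + len x / 2) + \<beta>"] abs_sin_le_one[of "k n * (ce x - len x / 2) + \<beta>"] by linarith
   then have "\<bar>D x\<bar> \<le> 2 / k n" unfolding D_def using k[of n] by (simp add: divide_right_mono)
   then show "\<bar>p' x * D x\<bar> \<le> PB * (2 / k n)" unfolding abs_mult using PB(2)[of x] PB0 by (intro mult_mono) auto
  qed (use R_pos in auto)
  have i2: "set_integrable lborel {0<..<R} Z"
  proof (rule set_integrable_bounded[where D = "wt \<alpha> R * (QB * 2)"])
   fix x assume "x \<in> {0<..<R}"
   then have w: "wt \<alpha> x \<le> wt \<alpha> R" by (intro wt_mono[OF alpha]) auto
   have c2: "\<bar>cos (k n * (ce x - len x / 2) + \<beta>) + cos (k n * (ce x + len x / 2) + \<beta>)\<bar> \<le> 2"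
    using abs_cos_le_one[of "k n * (ce x + len x / 2) + \<beta>"] abs_cos_le_one[of "k n * (ce x - len x / 2) + \<beta>"] by linarith
   have "Z x = wt \<alpha> x * ((p x * (K.u x / K.c x)) * (cos (k n * (ce x - len x / 2) + \<beta>) + cos (k n * (ce x + len x / 2) + \<beta>)))"
    by (simp add: Z_def)
   also have "\<bar>\<dots>\<bar> \<le> wt \<alpha> R * (QB * 2)"
    unfolding abs_mult[of "wt \<alpha> x"] abs_mult[of "p x * (K.u x / K.c x)"] using w QB[of x] c2 QB0 by (intro mult_mono) auto
   finally show "\<bar>Z x\<bar> \<le> wt \<alpha> R * (QB * 2)" .
  qed (use R_pos in auto)
  have [measurable]: "r' \<in> borel_measurable borel" using r by (auto simp: test_fun_def intro: borel_measurable_continuous_onI)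
  have [measurable]: "zz \<in> borel_measurable borel" unfolding zz_def[abs_def] by measurable
  have "0 = (LBINT x:{0<..<R}. p' x * D x - Z x)" using eq set_integral_diff(2)[OF i1 i2] by simp
  also have "\<dots> = (LBINT x:{0<..<R}. 2 * (zz x * r' x))"
  proof (rule set_lebesgue_integral_cong_AE)
   show "AE x\<in>{0<..<R} in lborel. p' x * D x - Z x = 2 * (zz x * r' x)"
    using len2
   proof eventually_elim
    fix x assume l: "0 < x \<and> x < R \<longrightarrow> len x = 2 * f x"
    show "x \<in> {0<..<R} \<longrightarrow> p' x * D x - Z x = 2 * (zz x * r' x)"
    proof
     assume "x \<in> {0<..<R}"
     then have x: "0 < x" "x < R" by auto
     have lf: "len x / 2 = f x" using l x by simp
     have a1: "k n * (ce x + f x) + \<beta> = (k n * ce x + \<beta>) + k n * f x" "k n * (ce x - f x) + \<beta> = (k n * ce x + \<beta>) - k n * f x"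
      by (auto simp: algebra_simps)
     have D2: "D x = 2 * zz x * h x" unfolding D_def lf a1 sin_add sin_diff zz_def h_def using k[of n] by (simp add: field_simps)
     have "wt \<alpha> x * (K.u x / K.c x) = - K.f' x" by (simp add: fK)
     then have Z2: "Z x = - (2 * zz x * (p x * h' x))"
      unfolding Z_def lf a1 cos_add cos_diff zz_def h'_def by (simp add: algebra_simps)
     have hx: "h x \<noteq> 0" using hpos[OF x] by simp
     have ph: "p x * h x = r x" unfolding p_def using hx by simp
     have "p' x * h x = r' x + r x * (i' x * h x)" unfolding p'_def using hx by (simp add: algebra_simps)
     also have "i' x * h x = - h' x / h x" unfolding i'_def using hx by simp
     finally have "p' x * h x + p x * h' x = r' x" unfolding p_def by simp
     then have "2 * zz x * (p' x * h x + p x * h' x) = 2 * zz x * r' x" by simp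
     then show "p' x * D x - Z x = 2 * (zz x * r' x)" unfolding D2 Z2 by (simp add: algebra_simps)
    qed
   qed
  qed auto
  finally show "(LBINT x:{0<..<R}. cos (k n * ce x + \<beta>) * r' x) = 0" by (simp add: zz_def)
 qed measurable
 have "\<forall>n. \<exists>c. AE x in lborel. 0 < x \<and> x < R \<longrightarrow> cos (k n * ce x) = c"
  using osc[of _ 0] by simp
 from choice[OF this] obtain ca where ca: "\<And>n. AE x in lborel. 0 < x \<and> x < R \<longrightarrow> cos (k n * ce x) = ca n" by blast
 \<comment> \<open>The phase -\<pi>/2 turns the cosine into a sine; both together determine k m
   modulo 2\<pi>.\<close>
 have cs: "cos (t + - (pi / 2)) = sin t" for t :: real unfolding cos_add by simp
 have "\<forall>n. \<exists>c. AE x in lborel. 0 < x \<and> x < R \<longrightarrow> sin (k n * ce x) = c"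
  using osc[of _ "- (pi / 2)"] unfolding cs by blast
 from choice[OF this] obtain sa where sa: "\<And>n. AE x in lborel. 0 < x \<and> x < R \<longrightarrow> sin (k n * ce x) = sa n" by blast
 have ae: "AE x in lborel. 0 < x \<and> x < R \<longrightarrow> (\<forall>n. cos (k n * ce x) = ca n \<and> sin (k n * ce x) = sa n)"
 proof -
  have "AE x in lborel. \<forall>n. 0 < x \<and> x < R \<longrightarrow> cos (k n * ce x) = ca n \<and> sin (k n * ce x) = sa n"
   unfolding AE_all_countable
  proof
   fix n show "AE x in lborel. 0 < x \<and> x < R \<longrightarrow> cos (k n * ce x) = ca n \<and> sin (k n * ce x) = sa n"
    using ca[of n] sa[of n] by eventually_elim blast
  qed
  then show ?thesis by eventually_elim blast
 qed
 have "\<exists>x0. 0 < x0 \<and> x0 < R \<and> (\<forall>n. cos (k n * ce x0) = ca n \<and> sin (k n * ce x0) = sa n)"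
 proof (rule ccontr)
  assume "\<not> ?thesis"
  then have "AE x in lborel. x \<notin> {0<..<R}" using ae by (auto elim!: eventually_mono)
  then have "{0<..<R} \<in> null_sets lborel" by (subst AE_iff_null_sets) auto
  then show False using R_pos by (simp add: null_sets_def)
 qed
 then obtain x0 where x0: "\<And>n. cos (k n * ce x0) = ca n" "\<And>n. sin (k n * ce x0) = sa n" by blast
 \<comment> \<open>For large n the frequency is so small that k n d has modulus below 1, where the
   sine vanishes only at 0; hence the centre is determined and not only determined modulo a
   period.\<close>
 have uniq: "y = ce x0" if y: "\<And>n. cos (k n * y) = ca n" "\<And>n. sin (k n * y) = sa n" for y
 proof -
  define d where "d = y - ce x0"
  have sd: "sin (k n * d) = 0" for n
  proof -
   have "k n * d = k n * y - k n * ce x0" by (simp add: d_def algebra_simps)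
   then show ?thesis by (simp add: sin_diff y x0)
  qed
  obtain n where n: "\<bar>d\<bar> < real n" using reals_Archimedean2 by blast
  have "\<bar>k n * d\<bar> = \<bar>d\<bar> / (FB + real (Suc n))" using FB0 by (simp add: k_def abs_mult)
  also have "\<dots> < 1" using n FB0 by (simp add: divide_simps)
  finally have "\<bar>k n * d\<bar> < pi" using pi_gt3 by linarith
  then have "k n * d = 0" using sin_eq_0_pi[OF _ _ sd[of n]] by linarith
  then show ?thesis using k[of n] by (simp add: d_def)
 qed
 have "AE x in lborel. 0 < x \<and> x < R \<longrightarrow> sec_len A x = 2 * f x \<and> sec_mid A x = ce x0"
  using ae len2
 proof eventually_elim
  fix x assume a: "0 < x \<and> x < R \<longrightarrow> (\<forall>n. cos (k n * ce x) = ca n \<and> sin (k n * ce x) = sa n)" "0 < x \<and> x < R \<longrightarrow> len x = 2 * f x"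
  show "0 < x \<and> x < R \<longrightarrow> sec_len A x = 2 * f x \<and> sec_mid A x = ce x0"
   using a uniq[of "ce x"] by (simp add: len_def ce_def)
 qed
 then show ?thesis by (rule that)
qed

text \<open>The statements about almost every section are assembled by Fubini's theorem; the half is
  a vertical translate of the optimal one.\<close>

lemma (in half_set) equality_set:
 assumes cap: "cap \<alpha> v R f" and "0 < \<alpha>" and C: "C \<le> cap_value \<alpha> v R"
 obtains \<sigma> where "AE z in lborel. z \<in> A \<longleftrightarrow> 0 < fst z \<and> fst z < R \<and> \<bar>snd z - \<sigma>\<bar> < f (fst z)"
proof -
 interpret K: cap \<alpha> v R f by (rule cap)
 note [measurable] = A_borel
 obtain \<sigma> where s: "AE x in lborel. 0 < x \<and> x < R \<longrightarrow> sec_len A x = 2 * f x \<and> sec_mid A x = \<sigma>"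
  using equality_shape[OF cap \<open>0 < \<alpha>\<close> C] .
 define f0 where "f0 x = indicator {0..R} x *\<^sub>R f x" for x
 have "integrable lborel f0" unfolding f0_def[abs_def] by (intro borel_integrable_compact K.f_cont) auto
 then have [measurable]: "f0 \<in> borel_measurable borel" by auto
 define P where "P z \<longleftrightarrow> (z \<in> A \<longleftrightarrow> 0 < fst z \<and> fst z < R \<and> \<bar>snd z - \<sigma>\<bar> < f0 (fst z))" for z
 have "AE x in lborel. AE y in lborel. P (x, y)"
  using s sections_ae[OF \<open>0 < \<alpha>\<close> K.R_pos K.R_eq C]
 proof eventually_elim
  fix x assume 1: "0 < x \<and> x < R \<longrightarrow> sec_len A x = 2 * f x \<and> sec_mid A x = \<sigma>"
   and 2: "interval_sections A R x"
  show "AE y in lborel. P (x, y)"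
  proof (cases "0 < x \<and> x < R")
   case True
   then have "AE y in lborel. (x, y) \<in> A \<longleftrightarrow> \<sigma> - f x < y \<and> y < \<sigma> + f x" using 1 2 by simp
   then show ?thesis by eventually_elim (use True in \<open>auto simp: P_def f0_def abs_less_iff\<close>)
  next
   case False
   then have "AE y in lborel. (x, y) \<notin> A" using 2 by blast
   then show ?thesis by eventually_elim (use False in \<open>auto simp: P_def\<close>)
  qed
 qed
 moreover have "{z \<in> space (lborel \<Otimes>\<^sub>M lborel). P z} \<in> sets (lborel \<Otimes>\<^sub>M (lborel :: real measure))"
  unfolding lborel_prod P_def by measurable
 ultimately have "AE z in lborel \<Otimes>\<^sub>M lborel. P z" by (intro lborel_pair.AE_pair_measure)
 then have "AE z in lborel. P z" unfolding lborel_prod .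
 then show ?thesis by (intro that[of \<sigma>]) (auto elim!: eventually_mono simp: P_def f0_def)
qed

section \<open>The perimeter of the minimiser\<close>

lemma equivalent_refl: "equivalent_sets E E"
 by (simp add: equivalent_sets_def)

context cap
begin

definition cap_right :: "plane set" where
 "cap_right = {z. 0 < fst z \<and> fst z < R \<and> \<bar>snd z\<bar> < f (fst z)}"

text \<open>The Grushin length of the graph of f over the interval from 0 to R, the integral of w/c.
  Since w/c = w c - f' u, integration by parts expresses it by the cap integral, by f 0 with factor
  -1/2, and by the area under f.\<close>

definition arc :: real where
 "arc = cap_const \<alpha> * wt \<alpha> R * R / 2 - f 0 / 2 + 3 * v / (4 * R)"

lemma cap_value_arc: "cap_value \<alpha> v R = f 0 + 2 * arc"
 using R_pos by (simp add: arc_def cap_value_def field_simps)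

lemma f_nonneg: "0 \<le> x \<Longrightarrow> x \<le> R \<Longrightarrow> 0 \<le> f x"
 using f_pos[of x] f_end by (cases "x = R") auto

lemma cap_right_open: "open cap_right"
proof -
 have "continuous_on ({0<..<R} \<times> UNIV) (\<lambda>z. f (fst z) - \<bar>snd z\<bar>)"
  by (intro continuous_intros continuous_on_compose2[OF f_cont]) auto
 then have "open ((\<lambda>z. f (fst z) - \<bar>snd z\<bar>) -` {0<..} \<inter> ({0<..<R} \<times> UNIV))"
  by (intro continuous_on_open_vimage[THEN iffD1, rule_format]) (auto intro: open_Times)
 moreover have "(\<lambda>z. f (fst z) - \<bar>snd z\<bar>) -` {0<..} \<inter> ({0<..<R} \<times> UNIV) = cap_right"
  by (auto simp: cap_right_def)
 ultimately show ?thesis by simp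
qed

lemma cap_right_borel [measurable]: "cap_right \<in> sets borel"
 using cap_right_open by (rule borel_open)

lemma f_bounded: "\<exists>B. \<forall>x. 0 \<le> x \<and> x \<le> R \<longrightarrow> f x < B"
proof -
 have "bounded (f ` {0..R})" by (intro compact_imp_bounded compact_continuous_image f_cont) auto
 then obtain B where "\<forall>x\<in>{0..R}. \<bar>f x\<bar> \<le> B" by (auto simp: bounded_iff)
 then show ?thesis by (intro exI[of _ "B + 1"]) force
qed

text \<open>With \<open>Y\<close> a primitive of \<open>\<phi>1\<close> in the second variable, \<open>Y (x, f x) - Y (x, - f x)\<close> is
 differentiated by the chain rule; this avoids an integral over a moving interval.\<close>

lemma divergence_le:
 assumes g1: "grad \<phi>1 p1 q1" and g2: "grad \<phi>2 p2 q2"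
  and K: "\<And>z. norm z > K \<Longrightarrow> \<phi>1 z = 0 \<and> \<phi>2 z = 0" and bd: "\<And>z. (\<phi>1 z)\<^sup>2 + (\<phi>2 z)\<^sup>2 \<le> 1"
 shows "(LBINT z:cap_right. gdiv \<alpha> p1 q2 z) \<le> 2 * arc - (LBINT y:{- f 0..f 0}. \<phi>1 (0, y))"
proof -
 have z1: "\<phi>1 z = 0" if "\<bar>snd z\<bar> \<ge> \<bar>K\<bar> + 1" for z
 proof -
  have "\<bar>snd z\<bar> \<le> norm z" using norm_snd_le[of "snd z" "fst z"] by simp
  then show ?thesis using K[of z] that by linarith
 qed
 obtain Y Yx where Y: "grad Y Yx \<phi>1"
  and Yx: "\<And>x y F. (\<And>s. (F has_real_derivative p1 (x, s)) (at s)) \<Longrightarrow> Yx (x, y) = F y - F (- (\<bar>K\<bar> + 1))"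
 proof (rule C1_antiderivative[OF g1 z1])
  fix W r assume a: "grad W r \<phi>1" "\<And>x y F. (\<And>s. (F has_real_derivative p1 (x, s)) (at s)) \<Longrightarrow> r (x, y) = F y - F (- (\<bar>K\<bar> + 1))"
  show ?thesis by (rule that[OF a(1)]) (rule a(2))
 qed
 have c: "continuous_on UNIV p1" "continuous_on UNIV q2" "continuous_on UNIV \<phi>1" "continuous_on UNIV \<phi>2"
  "continuous_on UNIV Yx" "continuous_on UNIV Y"
  using gradD[OF g1] gradD[OF g2] gradD[OF Y] by auto
 note cc = c[THEN continuous_on_compose2]
 have line: "continuous_on T (\<lambda>y. h (x, y))" if "continuous_on UNIV h" for h :: "plane \<Rightarrow> real" and x T
  by (rule continuous_on_compose2[OF that]) (auto intro!: continuous_intros)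
 have lineC: "isCont (\<lambda>y. h (x, y)) y" if "continuous_on UNIV h" for h :: "plane \<Rightarrow> real" and x y
  using line[OF that, of UNIV x] continuous_on_eq_continuous_at[OF open_UNIV] by blast
 have FTC: "(LBINT y:{a..b}. h (x, y)) = H (x, b) - H (x, a)"
  if "a \<le> b" "continuous_on UNIV h" "\<And>y. ((\<lambda>s. H (x, s)) has_real_derivative h (x, y)) (at y)" for a b x and h H :: "plane \<Rightarrow> real"
  using integral_FTC_Icc_real[OF that(1), of "\<lambda>s. H (x, s)" "\<lambda>y. h (x, y)"] that(3) lineC[OF that(2)]
  unfolding set_int_def by (simp add: mult.commute)
 \<comment> \<open>\<open>Yx\<close> is obtained merely as a continuous function; its formula
   through a primitive of p1 supplies the derivative in y.\<close>
 have DYx: "((\<lambda>s. Yx (x, s)) has_real_derivative p1 (x, y)) (at y)" for x y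
 proof -
  obtain F where F: "\<And>s. (F has_real_derivative p1 (x, s)) (at s)" using continuous_antiderivative[OF line[OF c(1)]] by metis
  have "((\<lambda>s. F s - F (- (\<bar>K\<bar> + 1))) has_real_derivative p1 (x, y)) (at y)" by (auto intro!: derivative_eq_intros F)
  then show ?thesis unfolding Yx[OF F] .
 qed
 define G where "G x = Y (x, f x) - Y (x, - f x)" for x
 define G' where "G' x = Yx (x, f x) - Yx (x, - f x) + f' x * (\<phi>1 (x, f x) + \<phi>1 (x, - f x))" for x
 \<comment> \<open>The integral of the divergence over the section at x, by the fundamental theorem
   in y.\<close>
 define Q where "Q x = Yx (x, f x) - Yx (x, - f x) + wt \<alpha> x * (\<phi>2 (x, f x) - \<phi>2 (x, - f x))" for x
 have chain: "((\<lambda>x. Y (x, h x)) has_real_derivative Yx (x, h x) + h' * \<phi>1 (x, h x)) (at x)"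
  if "(h has_real_derivative h') (at x)" for h h' x
 proof -
  have "((\<lambda>x. (x, h x)) has_derivative (\<lambda>t. (t, h' * t))) (at x)"
   using that unfolding has_field_derivative_def by (intro has_derivative_Pair has_derivative_ident) auto
  from has_derivative_compose[OF this gradD(1)[OF Y]] show ?thesis
   unfolding has_field_derivative_def by (rule back_subst[where P = "\<lambda>d. (_ has_derivative d) _"]) (auto simp: algebra_simps)
 qed
 have GD: "(G has_real_derivative G' x) (at x)" if "0 < x" "x < R" for x
  using DERIV_diff[OF chain[OF f_DERIV[OF that]] chain[OF DERIV_minus[OF f_DERIV[OF that]]]]
  unfolding G_def[abs_def] G'_def by (simp add: algebra_simps)
 have QI: "(Q has_integral (LBINT z:cap_right. gdiv \<alpha> p1 q2 z)) {0..R}"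
 proof -
  have Qc: "continuous_on {0..R} Q" unfolding Q_def[abs_def]
   by (intro continuous_intros cc wt_continuous[OF alpha] f_cont) auto
  have Qi: "set_integrable lborel {0..R} Q" unfolding set_integrable_def by (intro borel_integrable_compact Qc) auto
  have [measurable]: "gdiv \<alpha> p1 q2 \<in> borel_measurable borel" using grad_borel[OF g1] grad_borel[OF g2] alpha by (intro gdiv_borel) auto
  have "set_integrable lborel cap_right (gdiv \<alpha> p1 q2)"
   by (intro set_integrable_subset_borel gdiv_integrable[OF alpha g1 g2 K]) auto
  then have i: "integrable (lborel \<Otimes>\<^sub>M lborel) (\<lambda>z. indicator cap_right z *\<^sub>R gdiv \<alpha> p1 q2 z)"
   unfolding set_integrable_def lborel_prod .
  have sl: "(LBINT y. indicator cap_right (x, y) *\<^sub>R gdiv \<alpha> p1 q2 (x, y)) = indicator {0<..<R} x *\<^sub>R Q x" for x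
  proof (cases "0 < x \<and> x < R")
   case True
   define H where "H z = Yx z + wt \<alpha> (fst z) * \<phi>2 z" for z
   have "(LBINT y. indicator cap_right (x, y) *\<^sub>R gdiv \<alpha> p1 q2 (x, y)) = (LBINT y:{- f x..f x}. gdiv \<alpha> p1 q2 (x, y))"
    unfolding set_int_def
   proof (rule integral_cong_AE)
    have "AE y in lborel. y \<noteq> - f x" "AE y in lborel. y \<noteq> f x" by (rule AE_lborel_singleton)+
    then show "AE y in lborel. indicator cap_right (x, y) *\<^sub>R gdiv \<alpha> p1 q2 (x, y) = indicator {- f x..f x} y *\<^sub>R gdiv \<alpha> p1 q2 (x, y)"
     by eventually_elim (use True in \<open>auto simp: indicator_def cap_right_def abs_less_iff\<close>)
   qed measurable
   also have "\<dots> = H (x, f x) - H (x, - f x)"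
   proof (rule FTC)
    show "- f x \<le> f x" using f_nonneg[of x] True by simp
    show "continuous_on UNIV (gdiv \<alpha> p1 q2)" by (rule gdiv_continuous[OF alpha c(1,2)])
    show "((\<lambda>s. H (x, s)) has_real_derivative gdiv \<alpha> p1 q2 (x, y)) (at y)" for y
     unfolding H_def gdiv_def fst_conv by (intro DERIV_add DERIV_cmult DYx grad_DERIV_y[OF g2])
   qed
   finally show ?thesis using True by (simp add: H_def Q_def algebra_simps)
  qed (auto simp: cap_right_def)
  have "(LBINT z:cap_right. gdiv \<alpha> p1 q2 z) = (LBINT x:{0<..<R}. Q x)"
   using lborel_pair.integral_fst'[OF i] unfolding sl set_int_def lborel_prod by simp
  also have "\<dots> = (LBINT x:{0..R}. Q x)"
   by (rule LBINT_Ioo_Icc) (use R_pos in simp)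
  finally show ?thesis using set_borel_integral_eq_integral[OF Qi] by (simp add: has_integral_iff)
 qed
 have gI: "(G' has_integral G R - G 0) {0..R}"
 proof (rule fundamental_theorem_of_calculus_interior)
  show "continuous_on {0..R} G" unfolding G_def[abs_def] by (intro continuous_intros cc f_cont) auto
  show "(G has_vector_derivative G' x) (at x)" if "x \<in> {0<..<R}" for x
   using GD[of x] that by (simp add: has_real_derivative_iff_has_vector_derivative)
 qed (use R_pos in auto)
 have uI: "((\<lambda>x. 3 / (2 * R) * f x + f' x * u x) has_integral u R * f R - u 0 * f 0) {0..R}"
 proof (rule fundamental_theorem_of_calculus_interior[where f = "\<lambda>x. u x * f x"])
  show "continuous_on {0..R} (\<lambda>x. u x * f x)" by (intro continuous_intros u_cont f_cont)
  show "((\<lambda>x. u x * f x) has_vector_derivative 3 / (2 * R) * f x + f' x * u x) (at x)" if "x \<in> {0<..<R}" for x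
   using DERIV_mult[OF u_DERIV f_DERIV[of x]] that by (simp add: has_real_derivative_iff_has_vector_derivative)
 qed (use R_pos in auto)
 have "(LBINT z:cap_right. gdiv \<alpha> p1 q2 z) \<le> (G R - G 0) + 2 * ((cap_const \<alpha> * wt \<alpha> R * R / 2 - (u R * f R - u 0 * f 0)) + 3 / (2 * R) * (v / 2))"
 proof (rule has_integral_le[OF QI has_integral_add[OF gI has_integral_mult_right[OF
    has_integral_add[OF has_integral_diff[OF wc_integral uI] has_integral_mult_right[OF f_integral]]]]])
  fix x assume "x \<in> {0..R}"
  then have x: "0 \<le> x" "x \<le> R" by auto
  \<comment> \<open>The bracket equals w/c, the length element; the term with f is added and
    subtracted so that each summand is a function whose integral is known.\<close>
  let ?r = "G' x + 2 * (wt \<alpha> x * c x - (3 / (2 * R) * f x + f' x * u x) + 3 / (2 * R) * f x)"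
  show "Q x \<le> ?r"
  proof (cases "x = R")
   case True then show ?thesis by (simp add: Q_def G'_def f_end c_end f'_def)
  next
   case False
   then have cp: "0 < c x" using c_pos[of x] x by simp
   \<comment> \<open>The Cauchy-Schwarz inequality with the unit normal (u, c), applied on the upper
     and, with the second component reversed, on the lower boundary arc.\<close>
   have cs: "c x * a + u x * b \<le> 1" if "b\<^sup>2 + a\<^sup>2 \<le> 1" for a b
   proof -
    have "0 \<le> (c x - a)\<^sup>2 + (u x - b)\<^sup>2" by simp
    then have "2 * (c x * a + u x * b) \<le> ((c x)\<^sup>2 + (u x)\<^sup>2) + (b\<^sup>2 + a\<^sup>2)" by (simp add: power2_eq_square algebra_simps)
    moreover have "(c x)\<^sup>2 + (u x)\<^sup>2 = 1" using c_bounds[of x] x by simp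
    moreover have "X \<le> 1" if "2 * X \<le> C + B" "C = 1" "B \<le> 1" for X C B :: real using that by linarith
    ultimately show ?thesis using that by blast
   qed
   have "?r - Q x = 2 * (w * k - (- (w * U / k)) * U) + - (w * U / k) * (a + a') - w * (b - b')"
    if "w = wt \<alpha> x" "k = c x" "U = u x" "a = \<phi>1 (x, f x)" "a' = \<phi>1 (x, - f x)" "b = \<phi>2 (x, f x)" "b' = \<phi>2 (x, - f x)" for w k U a a' b b'
    unfolding Q_def G'_def f'_def that by simp
   moreover have "2 * (w * k - (- (w * U / k)) * U) + - (w * U / k) * (a + a') - w * (b - b')
     = w / k * (2 * (k\<^sup>2 + U\<^sup>2) - (k * b + U * a) - (k * - b' + U * a'))" if "0 < k" for w k U a a' b b' :: real
    using that by (simp add: field_simps power2_eq_square)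
   ultimately have "?r - Q x = wt \<alpha> x / c x * (2 * ((c x)\<^sup>2 + (u x)\<^sup>2) - (c x * \<phi>2 (x, f x) + u x * \<phi>1 (x, f x))
     - (c x * - \<phi>2 (x, - f x) + u x * \<phi>1 (x, - f x)))" using cp by presburger
   moreover have "0 \<le> wt \<alpha> x / c x * (2 * ((c x)\<^sup>2 + (u x)\<^sup>2) - (c x * \<phi>2 (x, f x) + u x * \<phi>1 (x, f x))
     - (c x * - \<phi>2 (x, - f x) + u x * \<phi>1 (x, - f x)))"
   proof (rule mult_nonneg_nonneg)
    show "0 \<le> 2 * ((c x)\<^sup>2 + (u x)\<^sup>2) - (c x * \<phi>2 (x, f x) + u x * \<phi>1 (x, f x)) - (c x * - \<phi>2 (x, - f x) + u x * \<phi>1 (x, - f x))"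
     using cs[OF bd[of "(x, f x)"]] cs[of "\<phi>1 (x, - f x)" "- \<phi>2 (x, - f x)"] bd[of "(x, - f x)"] c_bounds[of x] x by simp
   qed (use cp in simp)
   ultimately show ?thesis by linarith
  qed
 qed
 moreover have "G R = 0" by (simp add: G_def f_end)
 moreover have "G 0 = (LBINT y:{- f 0..f 0}. \<phi>1 (0, y))"
  using FTC[of "- f 0" "f 0" \<phi>1 Y 0] f_nonneg[of 0] R_pos c(3) grad_DERIV_y[OF Y] by (simp add: G_def)
 moreover have "(cap_const \<alpha> * wt \<alpha> R * R / 2 - (u R * f R - u 0 * f 0)) + 3 / (2 * R) * (v / 2) = arc"
  by (simp add: arc_def f_end u_def)
 ultimately show ?thesis by simp
qed

text \<open>Strict inequalities make the set open and its vertical sections open intervals, as the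
  Schwarz class asks.\<close>

definition cap_set :: "plane set" where
 "cap_set = {z. \<bar>fst z\<bar> < R \<and> \<bar>snd z\<bar> < f \<bar>fst z\<bar>}"

lemma cap_set_open: "open cap_set"
proof -
 have "continuous_on ({-R<..<R} \<times> UNIV) (\<lambda>z. f \<bar>fst z\<bar> - \<bar>snd z\<bar>)"
  by (intro continuous_intros continuous_on_compose2[OF f_cont]) auto
 then have "open ((\<lambda>z. f \<bar>fst z\<bar> - \<bar>snd z\<bar>) -` {0<..} \<inter> ({-R<..<R} \<times> UNIV))"
  by (intro continuous_on_open_vimage[THEN iffD1, rule_format]) (auto intro: open_Times)
 moreover have "(\<lambda>z. f \<bar>fst z\<bar> - \<bar>snd z\<bar>) -` {0<..} \<inter> ({-R<..<R} \<times> UNIV) = cap_set"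
  by (auto simp: cap_set_def abs_less_iff)
 ultimately show ?thesis by simp
qed

lemma cap_set_borel [measurable]: "cap_set \<in> sets borel"
 using cap_set_open by (rule borel_open)

lemma cap_right_eq: "cap_right = cap_set \<inter> {z. 0 < fst z}" "cap_set \<inter> {z. fst z < 0} = {z. (- fst z, snd z) \<in> cap_right}"
 by (auto simp: cap_right_def cap_set_def)

lemma reflected_divergence_le:
 assumes g1: "grad \<phi>1 p1 q1" and g2: "grad \<phi>2 p2 q2"
  and K: "\<And>z. norm z > K \<Longrightarrow> \<phi>1 z = 0 \<and> \<phi>2 z = 0" and bd: "\<And>z. (\<phi>1 z)\<^sup>2 + (\<phi>2 z)\<^sup>2 \<le> 1"
 shows "(LBINT z:{z. (- fst z, snd z) \<in> cap_right}. gdiv \<alpha> p1 q2 z) \<le> 2 * arc + (LBINT y:{- f 0..f 0}. \<phi>1 (0, y))"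
proof -
 have m: "gdiv \<alpha> p1 q2 \<in> borel_measurable borel" using grad_borel[OF g1] grad_borel[OF g2] alpha by (intro gdiv_borel) auto
 then have m': "(\<lambda>z. gdiv \<alpha> p1 q2 (-1 * fst z, 1 * snd z)) \<in> borel_measurable borel"
  by (rule measurable_compose[OF borel_scale_prod])
 have 1: "grad (\<lambda>z. - \<phi>1 (- fst z, snd z)) (\<lambda>z. p1 (- fst z, snd z)) (\<lambda>z. - q1 (- fst z, snd z))"
  using grad_cmult[OF grad_scale[OF g1, of "-1" 1], of "-1"] by simp
 have 2: "grad (\<lambda>z. \<phi>2 (- fst z, snd z)) (\<lambda>z. - p2 (- fst z, snd z)) (\<lambda>z. q2 (- fst z, snd z))"
  using grad_scale[OF g2, of "-1" 1] by simp
 have "- \<phi>1 (- fst z, snd z) = 0 \<and> \<phi>2 (- fst z, snd z) = 0" if "norm z > K" for z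
  using K[of "(- fst z, snd z)"] that by (simp add: norm_reflect)
 moreover have "(- \<phi>1 (- fst z, snd z))\<^sup>2 + (\<phi>2 (- fst z, snd z))\<^sup>2 \<le> 1" for z
  using bd by simp
 ultimately have "(LBINT z:cap_right. gdiv \<alpha> (\<lambda>z. p1 (- fst z, snd z)) (\<lambda>z. q2 (- fst z, snd z)) z)
  \<le> 2 * arc - (LBINT y:{- f 0..f 0}. - \<phi>1 (0, y))"
  using divergence_le[OF 1 2, of K] by simp
 moreover have "gdiv \<alpha> (\<lambda>z. p1 (- fst z, snd z)) (\<lambda>z. q2 (- fst z, snd z)) z = gdiv \<alpha> p1 q2 (- fst z, snd z)" for z
  by (simp add: gdiv_def grushin_weight_def)
 moreover have "(LBINT z:{z. (- fst z, snd z) \<in> cap_right}. gdiv \<alpha> p1 q2 z) = (LBINT z:cap_right. gdiv \<alpha> p1 q2 (- fst z, snd z))"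
  using set_integral_reflect[OF cap_right_borel m'] by simp
 moreover have "(LBINT y:{- f 0..f 0}. - \<phi>1 (0, y)) = - (LBINT y:{- f 0..f 0}. \<phi>1 (0, y))"
  by (simp add: set_int_def)
 ultimately show ?thesis by simp
qed

lemma base_integral_le:
 assumes g: "grad \<phi>1 p1 q1" and bd: "\<And>z. (\<phi>1 z)\<^sup>2 + (\<phi>2 z)\<^sup>2 \<le> 1"
 shows "\<bar>LBINT y:{- f 0..f 0}. \<phi>1 (0, y)\<bar> \<le> 2 * f 0"
proof -
 have b: "\<bar>\<phi>1 z\<bar> \<le> 1" for z
  using bd[of z] zero_le_power2[of "\<phi>2 z"] abs_square_le_1[of "\<phi>1 z"] by linarith
 have [measurable]: "(\<lambda>y. \<phi>1 (0, y)) \<in> borel_measurable borel"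
  by (intro borel_measurable_continuous_onI continuous_on_compose2[OF gradD(4)[OF g]]) (auto intro!: continuous_intros)
 have "\<bar>LBINT y:{- f 0..f 0}. \<phi>1 (0, y)\<bar> \<le> (LBINT y:{- f 0..f 0}. \<bar>\<phi>1 (0, y)\<bar>)"
  using integral_abs_bound[of lborel "\<lambda>y. indicator {- f 0..f 0} y * \<phi>1 (0, y)"] by (simp add: set_int_def abs_mult)
 also have "\<dots> \<le> (LBINT y:{- f 0..f 0}. 1)"
  by (rule set_integral_mono) (use b in \<open>auto intro!: set_integrable_bounded[where D = 1] simp: emeasure_lborel_Icc_eq\<close>)
 also have "\<dots> = 2 * f 0" using f_nonneg[of 0] R_pos by (simp add: set_int_def)
 finally show ?thesis .
qed

text \<open>Each half pays its two arcs and the segment of length 2 f 0 on the axis; for the whole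
  set the contributions of the segment cancel. Half the total is 4 arc + 2 f 0, twice the cap
  value.\<close>

lemma cap_set_perimeter: "partition_perimeter_x \<alpha> cap_set \<le> ereal (2 * cap_value \<alpha> v R)"
proof -
 let ?L = "{z. (- fst z, snd z) \<in> cap_right}"
 have L[measurable]: "?L \<in> sets borel" unfolding cap_right_eq(2)[symmetric] by measurable
 have 1: "grushin_perimeter \<alpha> cap_right \<le> ereal (2 * arc + 2 * f 0)"
 proof (rule perimeter_le[OF alpha _ cap_right_borel equivalent_refl])
  fix \<phi>1 \<phi>2 p1 q1 p2 q2 K
  assume a: "grad \<phi>1 p1 q1" "grad \<phi>2 p2 q2" "\<And>z. norm z > K \<Longrightarrow> \<phi>1 z = 0 \<and> \<phi>2 z = 0" "\<And>z. (\<phi>1 z)\<^sup>2 + (\<phi>2 z)\<^sup>2 \<le> 1"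
  show "(LBINT z:cap_right. gdiv \<alpha> p1 q2 z) \<le> 2 * arc + 2 * f 0"
   using divergence_le[OF a(1,2), of K] a(3,4) base_integral_le[OF a(1,4)] by force
 qed simp
 have 2: "grushin_perimeter \<alpha> ?L \<le> ereal (2 * arc + 2 * f 0)"
 proof (rule perimeter_le[OF alpha _ L equivalent_refl])
  fix \<phi>1 \<phi>2 p1 q1 p2 q2 K
  assume a: "grad \<phi>1 p1 q1" "grad \<phi>2 p2 q2" "\<And>z. norm z > K \<Longrightarrow> \<phi>1 z = 0 \<and> \<phi>2 z = 0" "\<And>z. (\<phi>1 z)\<^sup>2 + (\<phi>2 z)\<^sup>2 \<le> 1"
  show "(LBINT z:?L. gdiv \<alpha> p1 q2 z) \<le> 2 * arc + 2 * f 0"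
   using reflected_divergence_le[OF a(1,2), of K] a(3,4) base_integral_le[OF a(1,4)] by force
 qed simp
 \<comment> \<open>\<open>divergence_le\<close> and \<open>reflected_divergence_le\<close> contain
   the integral of \<phi>1 over the axis segment with opposite signs.\<close>
 have 3: "grushin_perimeter \<alpha> cap_set \<le> ereal (4 * arc)"
 proof (rule perimeter_le[OF alpha, of _ "cap_right \<union> ?L"])
  have "AE x in lborel. x \<noteq> (0::real)" by (rule AE_lborel_singleton)
  then have "AE z in lborel. fst (z :: plane) \<noteq> 0" by (rule AE_fst)
  then obtain N where N: "{z :: plane. fst z = 0} \<subseteq> N" "N \<in> null_sets lborel" by (auto simp: eventually_ae_filter)
  have "(cap_set - (cap_right \<union> ?L)) \<union> (cap_right \<union> ?L - cap_set) \<subseteq> N"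
   using N(1) by (force simp: cap_set_def cap_right_def)
  then show "equivalent_sets cap_set (cap_right \<union> ?L)" unfolding equivalent_sets_def
   using N(2) null_sets_completion_subset null_sets_completionI by blast
  fix \<phi>1 \<phi>2 p1 q1 p2 q2 K
  assume a: "grad \<phi>1 p1 q1" "grad \<phi>2 p2 q2" "\<And>z. norm z > K \<Longrightarrow> \<phi>1 z = 0 \<and> \<phi>2 z = 0" "\<And>z. (\<phi>1 z)\<^sup>2 + (\<phi>2 z)\<^sup>2 \<le> 1"
  have "(LBINT z:cap_right \<union> ?L. gdiv \<alpha> p1 q2 z) = (LBINT z:cap_right. gdiv \<alpha> p1 q2 z) + (LBINT z:?L. gdiv \<alpha> p1 q2 z)"
  proof (rule set_integral_Un)
   show "cap_right \<inter> ?L = {}" by (auto simp: cap_right_def)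
  qed (use L a(3) in \<open>auto intro!: set_integrable_subset_borel gdiv_integrable[OF alpha a(1,2)]\<close>)
  then show "(LBINT z:cap_right \<union> ?L. gdiv \<alpha> p1 q2 z) \<le> 4 * arc"
   using divergence_le[OF a(1,2), of K] reflected_divergence_le[OF a(1,2), of K] a(3,4) by force
 qed auto
 have p: "right_part cap_set = cap_right" "left_part cap_set = ?L"
  by (auto simp: right_part_def left_part_def cap_set_def cap_right_def)
 have "grushin_perimeter \<alpha> cap_right + grushin_perimeter \<alpha> ?L + grushin_perimeter \<alpha> cap_set
   \<le> ereal (2 * arc + 2 * f 0) + ereal (2 * arc + 2 * f 0) + ereal (4 * arc)"
  by (intro add_mono 1 2 3)
 then have "partition_perimeter_x \<alpha> cap_set \<le> ereal (8 * arc + 4 * f 0) / 2"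
  unfolding partition_perimeter_x_def p by (intro ereal_divide_right_mono) (auto simp: algebra_simps)
 moreover have "(8 * arc + 4 * f 0) / 2 = 2 * cap_value \<alpha> v R" unfolding cap_value_arc by simp
 ultimately show ?thesis by simp
qed

end

section \<open>Dilations and the intermediate value argument\<close>

text \<open>The image under (x, y) to (k x, y/k), given as a preimage so that measurability is
  immediate; the area is preserved.\<close>

definition dilation :: "real \<Rightarrow> plane set \<Rightarrow> plane set" where
 "dilation k E = {z. (1 / k * fst z, k * snd z) \<in> E}"

lemma dilation_borel [measurable]: "E \<in> sets borel \<Longrightarrow> dilation k E \<in> sets borel"
 using measurable_sets[OF borel_scale_prod, of E "1 / k" k] by (simp add: dilation_def vimage_def)

lemma dilation_measure: "k \<noteq> 0 \<Longrightarrow> E \<in> sets borel \<Longrightarrow> emeasure lborel (dilation k E) = emeasure lborel E"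
 unfolding dilation_def by (rule emeasure_scale_prod) auto

lemma dilation_dilation: "dilation k (dilation l E) = dilation (k * l) E"
 by (simp add: dilation_def mult_ac)

lemma dilation_parts:
 assumes "0 < k"
 shows "right_part (dilation k E) = dilation k (right_part E)" "left_part (dilation k E) = dilation k (left_part E)"
 using assms by (auto simp: dilation_def right_part_def left_part_def zero_less_divide_iff divide_less_0_iff)

text \<open>Vertical boundary pieces shrink by 1/k while weighted horizontal ones grow by w(k) k;
  the larger factor bounds the change of perimeter.\<close>

definition dil_factor :: "real \<Rightarrow> real \<Rightarrow> real" where
 "dil_factor \<alpha> k = max (1 / k) (wt \<alpha> k * k)"

text \<open>The test field is pulled back, and its components are multiplied by factors a, b \<le> 1
  that compensate the two different scalings; its divergence is then the original one divided by the
  dilation factor.\<close>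

lemma grushin_perimeter_dilation:
 assumes alpha: "0 \<le> \<alpha>" and "0 < k" and [measurable]: "E \<in> sets borel" and P: "grushin_perimeter \<alpha> E \<le> ereal p"
 shows "grushin_perimeter \<alpha> (dilation k E) \<le> ereal (dil_factor \<alpha> k * p)"
proof (rule perimeter_le[OF alpha _ _ equivalent_refl])
 fix \<phi>1 \<phi>2 p1 q1 p2 q2 K
 assume g1: "grad \<phi>1 p1 q1" and g2: "grad \<phi>2 p2 q2" and K: "\<And>z. norm z > K \<Longrightarrow> \<phi>1 z = 0 \<and> \<phi>2 z = 0"
  and bd: "\<And>z. (\<phi>1 z)\<^sup>2 + (\<phi>2 z)\<^sup>2 \<le> 1"
 define M where "M = dil_factor \<alpha> k"
 define a where "a = 1 / k / M"
 define b where "b = wt \<alpha> k * k / M"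
 have M: "0 < M" "1 / k \<le> M" "wt \<alpha> k * k \<le> M" using \<open>0 < k\<close> by (auto simp: M_def dil_factor_def less_max_iff_disj)
 have ab: "0 \<le> a" "a \<le> 1" "0 \<le> b" "b \<le> 1" unfolding a_def b_def using M \<open>0 < k\<close> by (auto simp: divide_le_eq mult.commute)
 have m: "gdiv \<alpha> p1 q2 \<in> borel_measurable borel" using grad_borel[OF g1] grad_borel[OF g2] alpha by (intro gdiv_borel) auto
 have m2: "(\<lambda>z. indicator (dilation k E) z *\<^sub>R gdiv \<alpha> p1 q2 z) \<in> borel_measurable borel" using m by measurable
 have 1: "grad (\<lambda>z. a * \<phi>1 (k * fst z, 1 / k * snd z)) (\<lambda>z. a * (k * p1 (k * fst z, 1 / k * snd z))) (\<lambda>z. a * (1 / k * q1 (k * fst z, 1 / k * snd z)))"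
  by (intro grad_cmult grad_scale g1)
 have 2: "grad (\<lambda>z. b * \<phi>2 (k * fst z, 1 / k * snd z)) (\<lambda>z. b * (k * p2 (k * fst z, 1 / k * snd z))) (\<lambda>z. b * (1 / k * q2 (k * fst z, 1 / k * snd z)))"
  by (intro grad_cmult grad_scale g2)
 have "ereal (LBINT z:E. gdiv \<alpha> (\<lambda>z. a * (k * p1 (k * fst z, 1 / k * snd z))) (\<lambda>z. b * (1 / k * q2 (k * fst z, 1 / k * snd z))) z) \<le> grushin_perimeter \<alpha> E"
 proof (rule perimeter_ge[OF alpha _ _ equivalent_refl 1 2])
  fix z :: plane
  show "(a * \<phi>1 (k * fst z, 1 / k * snd z))\<^sup>2 + (b * \<phi>2 (k * fst z, 1 / k * snd z))\<^sup>2 \<le> 1"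
  proof -
   have "a\<^sup>2 \<le> 1" "b\<^sup>2 \<le> 1" using ab by (auto simp: power_le_one)
   then have "a\<^sup>2 * (\<phi>1 (k * fst z, 1 / k * snd z))\<^sup>2 \<le> (\<phi>1 (k * fst z, 1 / k * snd z))\<^sup>2" "b\<^sup>2 * (\<phi>2 (k * fst z, 1 / k * snd z))\<^sup>2 \<le> (\<phi>2 (k * fst z, 1 / k * snd z))\<^sup>2"
    by (auto intro: mult_left_le_one_le)
   then show ?thesis using bd[of "(k * fst z, 1 / k * snd z)"] unfolding power_mult_distrib by linarith
  qed
  \<comment> \<open>The scaling and its inverse change norms at most by k + 1/k, hence this radius
    for the support.\<close>
  assume z: "norm z > \<bar>K\<bar> * (k + 1 / k)"
  define y where "y = (k * fst z, 1 / k * snd z)"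
  have "z = (1 / k * fst y, k * snd y)" using \<open>0 < k\<close> by (simp add: y_def)
  then have "norm z \<le> norm (1 / k * fst y) + norm (k * snd y)" using norm_Pair_le by metis
  also have "\<dots> = 1 / k * \<bar>fst y\<bar> + k * \<bar>snd y\<bar>" using \<open>0 < k\<close> by (simp add: abs_mult)
  also have "\<dots> \<le> 1 / k * norm y + k * norm y"
   using \<open>0 < k\<close> norm_fst_le[of "fst y" "snd y"] norm_snd_le[of "snd y" "fst y"] by (intro add_mono mult_left_mono) auto
  finally have "\<bar>K\<bar> * (k + 1 / k) < norm y * (k + 1 / k)" using z by (simp add: algebra_simps)
  then have "\<bar>K\<bar> < norm y" using \<open>0 < k\<close> by (simp add: mult_less_cancel_right add_pos_pos)
  then show "a * \<phi>1 (k * fst z, 1 / k * snd z) = 0 \<and> b * \<phi>2 (k * fst z, 1 / k * snd z) = 0"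
   using K[of y] unfolding y_def by simp
 qed auto
 then have le: "(LBINT z:E. gdiv \<alpha> (\<lambda>z. a * (k * p1 (k * fst z, 1 / k * snd z))) (\<lambda>z. b * (1 / k * q2 (k * fst z, 1 / k * snd z))) z) \<le> p"
  using P order_trans ereal_less_eq(3) by blast
 have e: "gdiv \<alpha> (\<lambda>z. a * (k * p1 (k * fst z, 1 / k * snd z))) (\<lambda>z. b * (1 / k * q2 (k * fst z, 1 / k * snd z))) z
  = gdiv \<alpha> p1 q2 (k * fst z, 1 / k * snd z) / M" for z
  using \<open>0 < k\<close> M(1) wt_mult[of \<alpha> k "fst z"] by (simp add: gdiv_def a_def b_def add_divide_distrib mult_ac)
 have "(LBINT z:dilation k E. gdiv \<alpha> p1 q2 z) = (LBINT z:E. gdiv \<alpha> p1 q2 (k * fst z, 1 / k * snd z))"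
  using integral_scale_prod[OF _ m2, of k "1 / k"] \<open>0 < k\<close> unfolding set_int_def
  by (simp add: dilation_def indicator_def)
 also have "\<dots> = M * (LBINT z:E. gdiv \<alpha> p1 q2 (k * fst z, 1 / k * snd z) / M)" using M(1) by simp
 also have "\<dots> \<le> M * p" using le M(1) unfolding e by (intro mult_left_mono) auto
 finally show "(LBINT z:dilation k E. gdiv \<alpha> p1 q2 z) \<le> dil_factor \<alpha> k * p" unfolding M_def .
qed auto

lemma right_left_borel:
 assumes "E \<in> sets (borel :: plane measure)"
 shows "right_part E \<in> sets borel" "left_part E \<in> sets borel"
proof -
 note [measurable] = assms
 have "right_part E = E \<inter> {z. 0 < fst z}" "left_part E = E \<inter> {z. fst z < 0}" by (auto simp: right_part_def left_part_def)
 moreover have "E \<inter> {z. 0 < fst z} \<in> sets borel" "E \<inter> {z. fst z < 0} \<in> sets borel" by measurable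
 ultimately show "right_part E \<in> sets borel" "left_part E \<in> sets borel" by simp_all
qed

lemma partition_perimeter_dilation:
 assumes alpha: "0 \<le> \<alpha>" and k: "0 < k" and E: "E \<in> sets borel" and P: "partition_perimeter_x \<alpha> E \<le> ereal p"
 shows "partition_perimeter_x \<alpha> (dilation k E) \<le> ereal (dil_factor \<alpha> k * p)"
proof -
 let ?a = "grushin_perimeter \<alpha> (right_part E)" and ?b = "grushin_perimeter \<alpha> (left_part E)" and ?c = "grushin_perimeter \<alpha> E"
 have n: "0 \<le> ?a" "0 \<le> ?b" "0 \<le> ?c" by (rule perimeter_nonneg)+
 have "(?a + ?b + ?c) / 2 \<noteq> \<infinity>" using P unfolding partition_perimeter_x_def by auto
 then have "?a \<noteq> \<infinity>" "?b \<noteq> \<infinity>" "?c \<noteq> \<infinity>" using n by auto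
 then obtain a b c where abc: "?a = ereal a" "?b = ereal b" "?c = ereal c" using n by (cases ?a; cases ?b; cases ?c) auto
 have "(a + b + c) / 2 \<le> p" using P unfolding partition_perimeter_x_def abc by simp
 moreover have "0 \<le> dil_factor \<alpha> k" using k by (simp add: dil_factor_def le_max_iff_disj)
 ultimately have m: "dil_factor \<alpha> k * ((a + b + c) / 2) \<le> dil_factor \<alpha> k * p" by (rule mult_left_mono)
 have "partition_perimeter_x \<alpha> (dilation k E) \<le> (ereal (dil_factor \<alpha> k * a) + ereal (dil_factor \<alpha> k * b) + ereal (dil_factor \<alpha> k * c)) / 2"
  unfolding partition_perimeter_x_def dilation_parts[OF k]
  by (intro ereal_divide_right_mono add_mono grushin_perimeter_dilation alpha k E right_left_borel) (auto simp: abc)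
 also have "\<dots> = ereal (dil_factor \<alpha> k * ((a + b + c) / 2))" by (simp add: algebra_simps add_divide_distrib)
 finally show ?thesis using m by (meson ereal_less_eq(3) order_trans)
qed

lemma partition_perimeter_nonneg: "0 \<le> partition_perimeter_x \<alpha> E"
proof -
 have "0 / 2 \<le> (grushin_perimeter \<alpha> (right_part E) + grushin_perimeter \<alpha> (left_part E) + grushin_perimeter \<alpha> E) / 2"
  by (intro ereal_divide_right_mono add_nonneg_nonneg perimeter_nonneg) auto
 then show ?thesis unfolding partition_perimeter_x_def by simp
qed

lemma dil_factor_tendsto:
 assumes alpha: "0 \<le> \<alpha>" and g: "(g \<longlongrightarrow> 1) F"
 shows "((\<lambda>x. dil_factor \<alpha> (g x)) \<longlongrightarrow> 1) F"
proof -
 have "isCont (wt \<alpha>) 1"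
  using wt_continuous[OF alpha, of UNIV] continuous_on_eq_continuous_at[OF open_UNIV] by blast
 then have "((\<lambda>x. wt \<alpha> (g x)) \<longlongrightarrow> wt \<alpha> 1) F" using g by (rule isCont_tendsto_compose)
 then have "((\<lambda>x. max (1 / g x) (wt \<alpha> (g x) * g x)) \<longlongrightarrow> max (1 / 1) (wt \<alpha> 1 * 1)) F"
  using g by (intro tendsto_intros) auto
 then show ?thesis by (simp add: dil_factor_def grushin_weight_def)
qed

text \<open>A dilation by k is one by l followed by one by k/l, so perimeters at k and l bound each
  other up to factors tending to 1. This gives continuity in k, and the intermediate value theorem
  applies between the undilated set and one of perimeter at least p.\<close>

lemma dilation_intermediate:
 assumes alpha: "0 \<le> \<alpha>" and E: "E \<in> sets borel" and fin: "partition_perimeter_x \<alpha> E \<le> ereal p0" and "p0 \<le> p"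
  and unb: "\<exists>k\<ge>1. ereal p \<le> partition_perimeter_x \<alpha> (dilation k E)"
 shows "\<exists>k\<ge>1. partition_perimeter_x \<alpha> (dilation k E) = ereal p"
proof -
 define h where "h k = real_of_ereal (partition_perimeter_x \<alpha> (dilation k E))" for k
 have h: "partition_perimeter_x \<alpha> (dilation k E) = ereal (h k)" if "0 < k" for k
  using partition_perimeter_dilation[OF alpha that E fin] partition_perimeter_nonneg[of \<alpha> "dilation k E"]
  unfolding h_def by (cases "partition_perimeter_x \<alpha> (dilation k E)") auto
 have cmp: "h k \<le> dil_factor \<alpha> (k / l) * h l" if "0 < k" "0 < l" for k l
 proof -
  have "partition_perimeter_x \<alpha> (dilation (k / l) (dilation l E)) \<le> ereal (dil_factor \<alpha> (k / l) * h l)"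
   using that h[of l] by (intro partition_perimeter_dilation alpha dilation_borel E) auto
  then show ?thesis using that h[of k] by (simp add: dilation_dilation)
 qed
 have fpos: "0 < dil_factor \<alpha> k" if "0 < k" for k using that by (simp add: dil_factor_def less_max_iff_disj)
 \<comment> \<open>The upper bound compares k with l, the lower bound l with k; both bounding
   functions tend to h l.\<close>
 have cont: "isCont h l" if l: "0 < l" for l
 proof -
  have near: "\<forall>\<^sub>F k in at l. 0 < k" using l order_tendstoD(1)[OF tendsto_ident_at] by blast
  have t1: "((\<lambda>k. k / l) \<longlongrightarrow> 1) (at l)" "((\<lambda>k. l / k) \<longlongrightarrow> 1) (at l)"
   using l by (auto intro!: tendsto_eq_intros)
  have "(h \<longlongrightarrow> h l) (at l)"
  proof (rule tendsto_sandwich)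
   show "((\<lambda>k. h l / dil_factor \<alpha> (l / k)) \<longlongrightarrow> h l) (at l)"
    using tendsto_divide[OF tendsto_const[of "h l"] dil_factor_tendsto[OF alpha t1(2)]] by simp
   show "((\<lambda>k. dil_factor \<alpha> (k / l) * h l) \<longlongrightarrow> h l) (at l)"
    using tendsto_mult[OF dil_factor_tendsto[OF alpha t1(1)] tendsto_const[of "h l"]] by simp
   show "\<forall>\<^sub>F k in at l. h l / dil_factor \<alpha> (l / k) \<le> h k" using near
    by eventually_elim (use l cmp fpos in \<open>auto simp: divide_le_eq mult.commute\<close>)
   show "\<forall>\<^sub>F k in at l. h k \<le> dil_factor \<alpha> (k / l) * h l" using near by eventually_elim (use l cmp in auto)
  qed
  then show ?thesis by (simp add: isCont_def)
 qed
 obtain k where k: "1 \<le> k" "p \<le> h k" using unb h by force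
 have "dilation 1 E = E" by (simp add: dilation_def)
 then have "h 1 \<le> p" using fin h[of 1] \<open>p0 \<le> p\<close> by simp
 then obtain l where "1 \<le> l" "l \<le> k" "h l = p" using IVT[of h 1 p k] k cont by auto
 then show ?thesis using h[of l] by auto
qed

section \<open>Admissibility, symmetry and regularity of the dilated minimisers\<close>

context cap
begin

lemma cap_right_measure: "emeasure lborel cap_right = ennreal v"
proof -
 have fi: "set_integrable lborel {0..R} f" unfolding set_integrable_def by (intro borel_integrable_compact f_cont) auto
 then have fv: "(LBINT x:{0..R}. f x) = v / 2" using set_borel_integral_eq_integral(2)[OF fi] f_integral by (metis integral_unique)
 have i: "integrable lborel (\<lambda>x. 2 * (indicator {0..R} x *\<^sub>R f x))"
  using fi unfolding set_integrable_def by (intro integrable_mult_right) auto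
 have "emeasure (lborel \<Otimes>\<^sub>M lborel) cap_right = (\<integral>\<^sup>+ x. emeasure lborel (Pair x -` cap_right) \<partial>lborel)"
  by (rule lborel.emeasure_pair_measure_alt) (unfold lborel_prod, simp add: cap_right_borel)
 also have "\<dots> = (\<integral>\<^sup>+ x. ennreal (2 * (indicator {0..R} x *\<^sub>R f x)) \<partial>lborel)"
 proof (rule nn_integral_cong_AE)
  have "AE x in lborel. x \<noteq> 0" "AE x in lborel. x \<noteq> R" by (rule AE_lborel_singleton)+
  then show "AE x in lborel. emeasure lborel (Pair x -` cap_right) = ennreal (2 * (indicator {0..R} x *\<^sub>R f x))"
  proof eventually_elim
   fix x assume x: "x \<noteq> 0" "x \<noteq> R"
   show "emeasure lborel (Pair x -` cap_right) = ennreal (2 * (indicator {0..R} x *\<^sub>R f x))"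
   proof (cases "0 < x \<and> x < R")
    case True
    then have "Pair x -` cap_right = {- f x<..<f x}" by (auto simp: cap_right_def abs_less_iff)
    then show ?thesis using True f_nonneg[of x] by simp
   next
    case False
    then have "Pair x -` cap_right = {}" by (auto simp: cap_right_def)
    then show ?thesis using False x by (auto simp: indicator_def)
   qed
  qed
 qed
 also have "\<dots> = ennreal (LBINT x. 2 * (indicator {0..R} x *\<^sub>R f x))"
  by (rule nn_integral_eq_integral[OF i]) (auto simp: indicator_def f_nonneg)
 also have "(LBINT x. 2 * (indicator {0..R} x *\<^sub>R f x)) = v"
  using fv unfolding set_int_def by simp
 finally show ?thesis unfolding lborel_prod .
qed

lemma cap_parts: "right_part cap_set = cap_right" "left_part cap_set = {z. (- fst z, snd z) \<in> cap_right}"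
 by (auto simp: right_part_def left_part_def cap_set_def cap_right_def)

lemma dilation_admissible:
 assumes "0 < k" shows "dilation k cap_set \<in> admissible_x v"
proof -
 have m: "emeasure lebesgue (dilation k B) = ennreal v" if "B \<in> sets borel" "emeasure lborel B = ennreal v" for B
  using dilation_measure[of k B] dilation_borel[OF that(1), of k] that assms by simp
 have "emeasure lborel (left_part cap_set) = ennreal v"
  using emeasure_scale_prod[of "-1" 1 cap_right] cap_right_measure by (simp add: cap_parts)
 from m[OF right_left_borel(2)[OF cap_set_borel] this]
 have "emeasure lebesgue (left_part (dilation k cap_set)) = ennreal v" unfolding dilation_parts[OF assms] .
 moreover have "emeasure lebesgue (right_part (dilation k cap_set)) = ennreal v"
  unfolding dilation_parts[OF assms] cap_parts by (rule m[OF cap_right_borel cap_right_measure])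
 ultimately show ?thesis unfolding admissible_x_def using dilation_borel[OF cap_set_borel, of k] by auto
qed

lemma dilation_section:
 assumes "0 < k"
 shows "{y. (x, y) \<in> dilation k cap_set} = (if \<bar>x\<bar> < k * R then {- (f (\<bar>x\<bar> / k) / k)<..<f (\<bar>x\<bar> / k) / k} else {})"
proof -
 have "\<bar>1 / k * x\<bar> = \<bar>x\<bar> / k" "\<bar>k * y\<bar> = k * \<bar>y\<bar>" for y using assms by (auto simp: abs_mult)
 moreover have "k * \<bar>y\<bar> < q \<longleftrightarrow> - (q / k) < y \<and> y < q / k" for y q
  using pos_less_divide_eq[OF assms, of "\<bar>y\<bar>" q] by (auto simp: mult.commute abs_less_iff)
 moreover have "\<bar>x\<bar> / k < R \<longleftrightarrow> \<bar>x\<bar> < k * R" using assms by (simp add: pos_divide_less_eq mult.commute)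
 ultimately show ?thesis by (auto simp: dilation_def cap_set_def)
qed

lemma dilation_x_symmetric: "dilation k cap_set \<in> x_symmetric_sets"
 using dilation_borel[OF cap_set_borel, of k] by (auto simp: x_symmetric_sets_def dilation_def cap_set_def)

lemma dilation_y_schwarz:
 assumes "0 < k" shows "dilation k cap_set \<in> y_schwarz_sets"
proof -
 have "open {y. (t, y) \<in> dilation k cap_set} \<and> is_interval {y. (t, y) \<in> dilation k cap_set}" for t
  unfolding dilation_section[OF assms] by (simp add: is_interval_convex)
 moreover have "(x, - y) \<in> dilation k cap_set" if "(x, y) \<in> dilation k cap_set" for x y
  using that by (simp add: dilation_def cap_set_def)
 ultimately show ?thesis using dilation_borel[OF cap_set_borel, of k] by (auto simp: y_schwarz_sets_def)
qed

lemma dilation_bounded: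
 assumes "0 < k" shows "bounded (dilation k cap_set)"
proof -
 obtain B where B: "\<And>x. 0 \<le> x \<Longrightarrow> x \<le> R \<Longrightarrow> f x < B" using f_bounded by blast
 have "dilation k cap_set \<subseteq> {-(k * R)..k * R} \<times> {-(B / k)..B / k}"
 proof
  fix z assume z: "z \<in> dilation k cap_set"
  then have y: "snd z \<in> {y. (fst z, y) \<in> dilation k cap_set}" by simp
  then have x: "\<bar>fst z\<bar> < k * R" unfolding dilation_section[OF assms] by (auto split: if_splits)
  then have "\<bar>fst z\<bar> / k \<le> R" using assms by (simp add: pos_divide_le_eq mult.commute)
  then have "f (\<bar>fst z\<bar> / k) / k \<le> B / k" using B[of "\<bar>fst z\<bar> / k"] assms by (simp add: divide_right_mono)
  then show "z \<in> {-(k * R)..k * R} \<times> {-(B / k)..B / k}"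
   using x y unfolding dilation_section[OF assms] by (auto simp: mem_Times_iff abs_less_iff)
 qed
 then show ?thesis by (rule bounded_subset[rotated]) (intro bounded_Times bounded_closed_interval)
qed

text \<open>In the variable \<open>\<xi> = x powr (\<alpha> + 1) / (\<alpha> + 1)\<close> the profile has derivative \<open>- u / c\<close>, which is
 decreasing.\<close>

lemma cap_right_convex: "convex (grushin_transform \<alpha> ` cap_right)"
proof -
 define a where "a = \<alpha> + 1"
 have a: "0 < a" using alpha by (simp add: a_def)
 define \<Xi> where "\<Xi> = R powr a / a"
 define \<rho> where "\<rho> s = (a * s) powr (1 / a)" for s
 have \<rho>x: "\<rho> (x powr a / a) = x" if "0 < x" for x using that a by (simp add: \<rho>_def powr_powr)
 have \<rho>i: "\<rho> s powr a / a = s" if "0 < s" for s using that a by (simp add: \<rho>_def powr_powr)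
 have \<rho>p: "0 < \<rho> s" if "0 < s" for s using that a by (simp add: \<rho>_def)
 have \<rho>m: "\<rho> s \<le> \<rho> t" if "0 < s" "s \<le> t" for s t unfolding \<rho>_def using that a by (intro powr_mono2) auto
 have \<rho>R: "\<rho> s < R" if "0 < s" "s < \<Xi>" for s
 proof -
  have "a * s < R powr a" using that a by (simp add: \<Xi>_def pos_less_divide_eq mult.commute)
  then have "\<rho> s < (R powr a) powr (1 / a)" unfolding \<rho>_def using that a by (intro powr_less_mono2) auto
  then show ?thesis using R_pos a by (simp add: powr_powr)
 qed
 have \<rho>D: "(\<rho> has_real_derivative 1 / wt \<alpha> (\<rho> s)) (at s)" if "0 < s" for s
 proof -
  have "((\<lambda>s. (a * s) powr (1 / a)) has_real_derivative 1 / a * (a * s) powr (1 / a - 1) * a) (at s)"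
   by (rule DERIV_chain2[OF has_real_derivative_powr]) (use a that in \<open>auto intro!: derivative_eq_intros\<close>)
  moreover have "(a * s) powr (1 / a - 1) = 1 / wt \<alpha> (\<rho> s)"
  proof -
   have "wt \<alpha> (\<rho> s) = \<rho> s powr \<alpha>" using \<rho>p[OF that] by (simp add: grushin_weight_def)
   also have "\<dots> = (a * s) powr (1 - 1 / a)" unfolding \<rho>_def powr_powr using a by (simp add: a_def field_simps)
   finally show ?thesis using powr_minus_divide[of "a * s" "1 - 1 / a"] by simp
  qed
  ultimately show ?thesis unfolding \<rho>_def[abs_def] using a by simp
 qed
 have uc: "u x / c x \<le> u y / c y" if "0 < x" "x \<le> y" "y < R" for x y
 proof -
  have cp: "0 < c x" "0 < c y" using c_pos[of x] c_pos[of y] that by auto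
  have le: "u x \<le> u y" using that R_pos by (simp add: u_def divide_right_mono)
  have "u x * c y \<le> u y * c x"
  proof (cases "0 \<le> u x")
   case True
   then have "(u x)\<^sup>2 \<le> (u y)\<^sup>2" using le by (intro power_mono)
   then have "c y \<le> c x" by (simp add: c_def)
   then have "u x * c y \<le> u x * c x" using True by (rule mult_left_mono)
   then show ?thesis using mult_right_mono[OF le, of "c x"] cp by linarith
  next
   case neg: False
   show ?thesis
   proof (cases "0 \<le> u y")
    case True
    then have "0 \<le> u y * c x" "u x * c y \<le> 0" using neg cp by (auto simp: mult_le_0_iff)
    then show ?thesis by linarith
   next
    case False
    then have "(u y)\<^sup>2 \<le> (u x)\<^sup>2" using le by (simp flip: abs_le_square_iff)
    then have "c x \<le> c y" by (simp add: c_def)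
    then have "u x * c y \<le> u x * c x" using neg by (intro mult_left_mono_neg) auto
    then show ?thesis using mult_right_mono[OF le, of "c x"] cp by linarith
   qed
  qed
  then show ?thesis using cp by (simp add: divide_simps mult.commute)
 qed
 have cv: "convex_on {0<..<\<Xi>} (\<lambda>s. - f (\<rho> s))"
 proof (rule convex_on_realI)
  show "((\<lambda>s. - f (\<rho> s)) has_real_derivative u (\<rho> s) / c (\<rho> s)) (at s)" if "s \<in> {0<..<\<Xi>}" for s
  proof -
   have r: "0 < \<rho> s" "\<rho> s < R" using \<rho>p \<rho>R that by auto
   have "((\<lambda>s. - f (\<rho> s)) has_real_derivative - (f' (\<rho> s) * (1 / wt \<alpha> (\<rho> s)))) (at s)"
    by (intro DERIV_minus DERIV_chain2[OF f_DERIV[OF r] \<rho>D]) (use that in auto)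
   moreover have "- (f' (\<rho> s) * (1 / wt \<alpha> (\<rho> s))) = u (\<rho> s) / c (\<rho> s)"
    using wt_pos[of "\<rho> s" \<alpha>] r by (simp add: f'_def)
   ultimately show ?thesis by simp
  qed
  show "u (\<rho> s) / c (\<rho> s) \<le> u (\<rho> t) / c (\<rho> t)" if "s \<in> {0<..<\<Xi>}" "t \<in> {0<..<\<Xi>}" "s \<le> t" for s t
   using that \<rho>p \<rho>R \<rho>m by (intro uc) auto
 qed auto
 have im: "grushin_transform \<alpha> ` cap_right = {z. 0 < fst z \<and> fst z < \<Xi> \<and> \<bar>snd z\<bar> < f (\<rho> (fst z))}"
 proof (intro set_eqI iffI)
  fix z assume "z \<in> grushin_transform \<alpha> ` cap_right"
  then obtain w where w: "w \<in> cap_right" "z = grushin_transform \<alpha> w" by blast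
  then have x: "0 < fst w" "fst w < R" and z: "z = (fst w powr a / a, snd w)"
   by (auto simp: cap_right_def grushin_transform_def a_def case_prod_beta)
  have "fst w powr a < R powr a" using x a by (intro powr_less_mono2) auto
  then show "z \<in> {z. 0 < fst z \<and> fst z < \<Xi> \<and> \<bar>snd z\<bar> < f (\<rho> (fst z))}"
   using w(1) x a by (simp add: z \<rho>x \<Xi>_def divide_strict_right_mono cap_right_def)
 next
  fix z assume "z \<in> {z. 0 < fst z \<and> fst z < \<Xi> \<and> \<bar>snd z\<bar> < f (\<rho> (fst z))}"
  then have z: "0 < fst z" "fst z < \<Xi>" "\<bar>snd z\<bar> < f (\<rho> (fst z))" by auto
  then have "z = grushin_transform \<alpha> (\<rho> (fst z), snd z)"
   using \<rho>p[of "fst z"] \<rho>i[of "fst z"] by (simp add: grushin_transform_def a_def prod_eq_iff)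
  moreover have "(\<rho> (fst z), snd z) \<in> cap_right" using z \<rho>p \<rho>R by (simp add: cap_right_def)
  ultimately show "z \<in> grushin_transform \<alpha> ` cap_right" by blast
 qed
 show ?thesis unfolding im
 proof (rule convexI)
  fix z w :: plane and p q :: real
  assume zw: "z \<in> {z. 0 < fst z \<and> fst z < \<Xi> \<and> \<bar>snd z\<bar> < f (\<rho> (fst z))}" "w \<in> {z. 0 < fst z \<and> fst z < \<Xi> \<and> \<bar>snd z\<bar> < f (\<rho> (fst z))}"
   and pq: "0 \<le> p" "0 \<le> q" "p + q = 1"
  let ?m = "p *\<^sub>R fst z + q *\<^sub>R fst w"
  have m: "?m \<in> {0<..<\<Xi>}" by (rule convexD[OF convex_real_interval(8)]) (use zw pq in auto)
  have "- f (\<rho> ?m) \<le> p * - f (\<rho> (fst z)) + q * - f (\<rho> (fst w))"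
   using cv zw pq unfolding convex_on_def by auto
  moreover have "\<bar>p * snd z + q * snd w\<bar> \<le> p * \<bar>snd z\<bar> + q * \<bar>snd w\<bar>"
   using abs_triangle_ineq[of "p * snd z" "q * snd w"] pq by (simp add: abs_mult)
  moreover have "p * \<bar>snd z\<bar> + q * \<bar>snd w\<bar> < p * f (\<rho> (fst z)) + q * f (\<rho> (fst w))"
  proof (cases "p = 0")
   case False
   then show ?thesis using zw pq by (intro add_less_le_mono mult_strict_left_mono mult_left_mono) auto
  qed (use zw pq in auto)
  ultimately show "p *\<^sub>R z + q *\<^sub>R w \<in> {z. 0 < fst z \<and> fst z < \<Xi> \<and> \<bar>snd z\<bar> < f (\<rho> (fst z))}"
   using m by simp
 qed
qed

text \<open>In the transformed coordinates a dilation is linear, multiplying the first coordinate by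
  k powr (\<alpha> + 1) and the second by 1/k.\<close>

lemma dilation_convex:
 assumes "0 < k" shows "x_transformed_convex \<alpha> (dilation k cap_set)"
proof -
 have "dilation k cap_right = (\<lambda>z. (k * fst z, 1 / k * snd z)) ` cap_right"
 proof (intro set_eqI iffI)
  fix z assume "z \<in> dilation k cap_right"
  then have "(1 / k * fst z, k * snd z) \<in> cap_right" by (simp add: dilation_def)
  moreover have "z = (k * fst (1 / k * fst z, k * snd z), 1 / k * snd (1 / k * fst z, k * snd z))" using assms by simp
  ultimately show "z \<in> (\<lambda>z. (k * fst z, 1 / k * snd z)) ` cap_right" by blast
 qed (use assms in \<open>auto simp: dilation_def\<close>)
 moreover have "grushin_transform \<alpha> (k * fst z, 1 / k * snd z) = (\<lambda>z. (k powr (\<alpha> + 1) * fst z, 1 / k * snd z)) (grushin_transform \<alpha> z)" for z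
  using assms by (simp add: grushin_transform_def case_prod_beta abs_mult powr_mult sgn_mult)
 ultimately have "grushin_transform \<alpha> ` dilation k cap_right = (\<lambda>z. (k powr (\<alpha> + 1) * fst z, 1 / k * snd z)) ` (grushin_transform \<alpha> ` cap_right)"
  by (simp only: image_image)
 moreover have "linear (\<lambda>z. (k powr (\<alpha> + 1) * fst z, 1 / k * snd z) :: plane)"
  by (rule linearI) (auto simp: algebra_simps add_divide_distrib)
 ultimately have "convex (grushin_transform \<alpha> ` dilation k cap_right)"
  using convex_linear_image[OF _ cap_right_convex] by metis
 then show ?thesis unfolding x_transformed_convex_def dilation_parts[OF assms] cap_parts(1) using dilation_x_symmetric by blast
qed

text \<open>The Lipschitz bound on a compact part of the open interval comes from a bounded
  continuous derivative; it cannot reach the right end, where the slope is infinite.\<close>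

lemma dilation_profile:
 assumes k: "0 < k" and g: "g = (\<lambda>x. f (x / k) / k)"
 shows "equivalent_sets (dilation k cap_set) (profile_region (k * R) g)" "continuous_on {0..k * R} g" "locally_lipschitz_on {0<..<k * R} g"
proof -
 have xk: "0 \<le> x \<Longrightarrow> 0 \<le> x / k" "x \<le> k * R \<Longrightarrow> x / k \<le> R" "0 < x \<Longrightarrow> 0 < x / k" "x < k * R \<Longrightarrow> x / k < R" for x
  using k by (auto simp: pos_divide_le_eq pos_divide_less_eq mult.commute)
 show gc: "continuous_on {0..k * R} g" unfolding g
  by (intro continuous_intros continuous_on_compose2[OF f_cont]) (use k xk in auto)
 show "locally_lipschitz_on {0<..<k * R} g" unfolding locally_lipschitz_on_def
 proof (intro allI impI)
  fix K assume K: "compact K \<and> K \<subseteq> {0<..<k * R}"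
  show "\<exists>L. L-lipschitz_on K g"
  proof (cases "K = {}")
   case False
   obtain a b where ab: "a \<in> K" "b \<in> K" "\<And>x. x \<in> K \<Longrightarrow> a \<le> x \<and> x \<le> b"
    using compact_attains_inf[of K] compact_attains_sup[of K] K False by metis
   then have ab': "0 < a" "b < k * R" using K by auto
   have "(\<lambda>x. x / k) ` {a..b} \<subseteq> {0..<R}" by (rule image_subsetI) (use ab' xk in auto)
   then have "continuous_on {a..b} (\<lambda>x. f' (x / k) / (k * k))"
    by (intro continuous_intros continuous_on_compose2[OF f'_cont]) (use k in auto)
   then have "bounded ((\<lambda>x. f' (x / k) / (k * k)) ` {a..b})" by (intro compact_imp_bounded compact_continuous_image) auto
   then obtain L where "\<forall>x\<in>{a..b}. \<bar>f' (x / k) / (k * k)\<bar> \<le> L" by (auto simp: bounded_iff)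
   then have L: "\<And>x. x \<in> {a..b} \<Longrightarrow> \<bar>f' (x / k) / (k * k)\<bar> \<le> L" by blast
   have D: "(g has_real_derivative f' (x / k) / (k * k)) (at x)" if "x \<in> {a..b}" for x
   proof -
    have x: "0 < x / k" "x / k < R" using that ab' xk by auto
    have "((\<lambda>x. f (x / k)) has_real_derivative f' (x / k) * (1 / k)) (at x)"
     by (rule DERIV_chain2[where g = "\<lambda>x. x / k", OF f_DERIV[OF x]]) (use k in \<open>auto intro!: derivative_eq_intros\<close>)
    from DERIV_cdivide[OF this, of k] show ?thesis unfolding g by simp
   qed
   have "L-lipschitz_on {a..b} g"
   proof (rule lipschitz_onI)
    have "a \<in> {a..b}" using ab(3)[OF ab(1)] ab(3)[OF ab(2)] by simp
    then show "0 \<le> L" using L[of a] by linarith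
    show "dist (g x) (g y) \<le> L * dist x y" if "x \<in> {a..b}" "y \<in> {a..b}" for x y
     using field_differentiable_bound[of "{a..b}" g "\<lambda>x. f' (x / k) / (k * k)" L x y] D L that
     by (simp add: dist_norm has_field_derivative_at_within)
   qed
   then show ?thesis using ab by (meson atLeastAtMost_iff lipschitz_on_subset subsetI)
  qed (auto simp: lipschitz_on_def intro: exI[of _ 0])
 qed
 \<comment> \<open>The graphs of g and -g over the closed interval, a set with at most two points on
   each vertical line; the open dilated set and the closed region differ only inside it.\<close>
 define N where "N = {z. z \<in> {- (k * R)..k * R} \<times> UNIV \<and> \<bar>snd z\<bar> - g \<bar>fst z\<bar> = 0}"
 have "continuous_on ({- (k * R)..k * R} \<times> UNIV) (\<lambda>z. \<bar>snd z\<bar> - g \<bar>fst z\<bar>)"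
  by (intro continuous_intros continuous_on_compose2[OF gc]) auto
 then have "closed N" unfolding N_def by (intro continuous_closed_preimage_constant closed_Times) auto
 then have [measurable]: "N \<in> sets borel" by (rule borel_closed)
 have "AE x in lborel. AE y in lborel. (x, y) \<notin> N"
 proof (rule AE_I2)
  fix x :: real
  have "AE y in lborel. y \<noteq> g \<bar>x\<bar>" "AE y in lborel. y \<noteq> - g \<bar>x\<bar>" by (rule AE_lborel_singleton)+
  then show "AE y in lborel. (x, y) \<notin> N" by eventually_elim (auto simp: N_def abs_if split: if_splits)
 qed
 moreover have "{z \<in> space (lborel \<Otimes>\<^sub>M lborel). z \<notin> N} \<in> sets (lborel \<Otimes>\<^sub>M (lborel :: real measure))"
  unfolding lborel_prod by measurable
 ultimately have "AE z in lborel \<Otimes>\<^sub>M lborel. z \<notin> N" by (intro lborel_pair.AE_pair_measure)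
 then have "AE z in lborel. z \<notin> N" unfolding lborel_prod .
 then have "N \<in> null_sets lborel" by (subst AE_iff_null_sets) auto
 moreover have "(dilation k cap_set - profile_region (k * R) g) \<union> (profile_region (k * R) g - dilation k cap_set) \<subseteq> N"
 proof -
  have d: "(x, y) \<in> dilation k cap_set \<longleftrightarrow> \<bar>x\<bar> < k * R \<and> \<bar>y\<bar> < g \<bar>x\<bar>" for x y
   using dilation_section[OF k, of x] unfolding g by (auto simp: set_eq_iff abs_less_iff)
  have e: "g (k * R) = 0" using k f_end by (simp add: g)
  have "(x, y) \<in> N" if "\<bar>y\<bar> \<le> g \<bar>x\<bar>" "\<bar>x\<bar> \<le> k * R" "\<not> (\<bar>x\<bar> < k * R \<and> \<bar>y\<bar> < g \<bar>x\<bar>)" for x y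
  proof (cases "\<bar>x\<bar> = k * R")
   case True
   then show ?thesis using that e by (auto simp: N_def abs_le_iff)
  qed (use that in \<open>auto simp: N_def abs_le_iff\<close>)
  then show ?thesis by (auto simp: d profile_region_def)
 qed
 ultimately show "equivalent_sets (dilation k cap_set) (profile_region (k * R) g)"
  unfolding equivalent_sets_def using null_sets_completion_subset null_sets_completionI by blast
qed

end

section \<open>From the two halves back to the given set\<close>

lemma equivalent_sets_AE: "equivalent_sets E A \<longleftrightarrow> (AE z in lborel. z \<in> E \<longleftrightarrow> z \<in> A)"
proof
 assume "equivalent_sets E A"
 then have "AE z in lebesgue. z \<notin> (E - A) \<union> (A - E)" unfolding equivalent_sets_def by (rule AE_not_in)
 then have "AE z in lebesgue. z \<in> E \<longleftrightarrow> z \<in> A" by eventually_elim auto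
 then show "AE z in lborel. z \<in> E \<longleftrightarrow> z \<in> A" by (simp add: AE_completion_iff)
next
 assume "AE z in lborel. z \<in> E \<longleftrightarrow> z \<in> A"
 then obtain N where "{z. \<not> (z \<in> E \<longleftrightarrow> z \<in> A)} \<subseteq> N" "N \<in> null_sets lborel" by (auto simp: eventually_ae_filter)
 then have "(E - A) \<union> (A - E) \<subseteq> N" "N \<in> null_sets lborel" by auto
 then show "equivalent_sets E A" unfolding equivalent_sets_def using null_sets_completion_subset null_sets_completionI by blast
qed

lemma AE_reflect:
 assumes "AE z in lborel. P (z :: plane)"
 shows "AE z in lborel. P (- fst z, snd z)"
proof -
 have m: "(\<lambda>z :: plane. (-1 * fst z, 1 * snd z)) \<in> measurable lborel borel"
  using borel_scale_prod[of "-1" 1] measurable_lborel2 by blast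
 have e: "distr lborel borel (\<lambda>z. (-1 * fst z, 1 * snd z)) = (lborel :: plane measure)"
  by (rule lborel_scale_prod) simp
 have "AE z in distr lborel borel (\<lambda>z. (-1 * fst z, 1 * snd z)). P (z :: plane)"
  unfolding e by (rule assms)
 from AE_distrD[OF m this] show ?thesis by simp
qed

text \<open>Turns an admissible set of finite perimeter into two instances of
  \<open>half_set\<close>, the left one reflected. Finite area of the representative follows from
  the two halves, the axis being a null set.\<close>

lemma partition_half_sets:
 assumes alpha: "0 \<le> \<alpha>" and v: "0 < v" and E: "E \<in> admissible_x v" and P: "partition_perimeter_x \<alpha> E < \<infinity>"
  and A[measurable]: "A \<in> sets borel" and eq: "equivalent_sets E A"
 obtains CR CL SL where "half_set \<alpha> CR v (A \<inter> {z. fst z > 0}) (x_support (A \<inter> {z. fst z > 0}))"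
  "half_set \<alpha> CL v ({z. (- fst z, snd z) \<in> A} \<inter> {z. fst z > 0}) SL" "ereal (CR + CL) \<le> partition_perimeter_x \<alpha> E"
proof -
 have Es: "E \<in> sets lebesgue" and Ev: "emeasure lebesgue (right_part E) = ennreal v" "emeasure lebesgue (left_part E) = ennreal v"
  using E by (auto simp: admissible_x_def)
 have ae: "AE z in lebesgue. z \<in> E \<longleftrightarrow> z \<in> A" using eq by (simp add: equivalent_sets_AE AE_completion)
 have RL: "right_part E = E \<inter> {z. 0 < fst z}" "left_part E = E \<inter> {z. fst z < 0}" by (auto simp: right_part_def left_part_def)
 have H: "{z. 0 < fst z} \<in> sets (borel :: plane measure)" "{z. fst z < 0} \<in> sets (borel :: plane measure)"
  by measurable
 have v1: "emeasure lborel (A \<inter> {z. 0 < fst z}) = ennreal v"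
 proof -
  have "emeasure lebesgue (E \<inter> {z. 0 < fst z}) = emeasure lebesgue (A \<inter> {z. 0 < fst z})"
   by (rule emeasure_eq_AE) (use ae Es H A in \<open>auto elim!: eventually_mono\<close>)
  then show ?thesis using Ev(1) unfolding RL by simp
 qed
 have v2: "emeasure lborel (A \<inter> {z. fst z < 0}) = ennreal v"
 proof -
  have "emeasure lebesgue (E \<inter> {z. fst z < 0}) = emeasure lebesgue (A \<inter> {z. fst z < 0})"
   by (rule emeasure_eq_AE) (use ae Es H A in \<open>auto elim!: eventually_mono\<close>)
  then show ?thesis using Ev(2) unfolding RL by simp
 qed
 have refl: "{z. (- fst z, snd z) \<in> A} \<inter> {z. fst z > 0} = {z. (-1 * fst z, 1 * snd z) \<in> A \<inter> {z. fst z < 0}}" by auto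
 have v3: "emeasure lborel ({z. (- fst z, snd z) \<in> A} \<inter> {z. fst z > 0}) = ennreal v"
  unfolding refl by (subst emeasure_scale_prod) (use v2 in auto)
 have b3: "{z. (- fst z, snd z) \<in> A} \<inter> {z. fst z > 0} \<in> sets borel"
  using measurable_sets[OF borel_scale_prod, of "A \<inter> {z. fst z < 0}" "-1" 1] unfolding refl by (simp add: vimage_def)
 have "AE x in lborel. x \<noteq> (0::real)" by (rule AE_lborel_singleton)
 then have "AE z in lborel. fst (z :: plane) \<noteq> 0" by (rule AE_fst)
 then have "emeasure lborel A = emeasure lborel ((A \<inter> {z. 0 < fst z}) \<union> (A \<inter> {z. fst z < 0}))"
  by (intro emeasure_eq_AE) (auto elim!: eventually_mono)
 also have "\<dots> \<le> ennreal v + ennreal v"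
  using emeasure_subadditive[of "A \<inter> {z. 0 < fst z}" lborel "A \<inter> {z. fst z < 0}"] v1 v2 by simp
 also have "\<dots> < \<infinity>" by (simp add: ennreal_add_less_top)
 finally have fin: "emeasure lborel A < \<infinity>" .
 show ?thesis
 proof (rule partition_perimeter_halves[OF alpha Es A eq fin P])
  fix CR CL assume h: "half_le \<alpha> (A \<inter> {z. fst z > 0}) CR" "half_le \<alpha> ({z. (- fst z, snd z) \<in> A} \<inter> {z. fst z > 0}) CL"
   "ereal (CR + CL) \<le> partition_perimeter_x \<alpha> E"
  show ?thesis
  proof (rule that[OF _ _ h(3)])
   show "half_set \<alpha> CR v (A \<inter> {z. fst z > 0}) (x_support (A \<inter> {z. fst z > 0}))"
    by unfold_locales (use alpha h v v1 in auto)
   show "half_set \<alpha> CL v ({z. (- fst z, snd z) \<in> A} \<inter> {z. fst z > 0})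
     {x. emeasure lborel {y. (x, y) \<in> {z. (- fst z, snd z) \<in> A} \<inter> {z. fst z > 0}} \<noteq> 0}"
    by unfold_locales (use alpha h v v3 b3 in auto)
  qed
 qed
qed

context cap
begin

lemma half_value_le:
 assumes "half_set \<alpha> C v A S" shows "cap_value \<alpha> v R \<le> C"
 using half_set.cap_value_le[OF assms] cap_value_min(1)[OF alpha v_pos R_pos R_eq half_set.S_measure_pos[OF assms]] by linarith

lemma partition_perimeter_ge:
 assumes "E \<in> admissible_x v" "partition_perimeter_x \<alpha> E < \<infinity>"
 shows "ereal (2 * cap_value \<alpha> v R) \<le> partition_perimeter_x \<alpha> E"
proof -
 obtain A where A: "A \<in> sets borel" "equivalent_sets E A" using equivalent_borel[of E] assms(1) by (auto simp: admissible_x_def)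
 show ?thesis
 proof (rule partition_half_sets[OF alpha v_pos assms A])
  fix CR CL SL assume h: "half_set \<alpha> CR v (A \<inter> {z. fst z > 0}) (x_support (A \<inter> {z. fst z > 0}))"
   "half_set \<alpha> CL v ({z. (- fst z, snd z) \<in> A} \<inter> {z. fst z > 0}) SL" "ereal (CR + CL) \<le> partition_perimeter_x \<alpha> E"
  have "ereal (2 * cap_value \<alpha> v R) \<le> ereal (CR + CL)" using half_value_le[OF h(1)] half_value_le[OF h(2)] by simp
  then show ?thesis using h(3) by (rule order_trans)
 qed
qed

lemma cap_value_pos: "0 < r \<Longrightarrow> 0 < cap_value \<alpha> v r"
 unfolding cap_value_def using cap_const_pos[OF alpha] v_pos by (intro add_nonneg_pos mult_nonneg_nonneg divide_pos_pos) auto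

text \<open>The right half of the dilated set has sections over an interval of length k R, so its
  calibrated value contains a term that grows at least linearly in k. The other half contributes
  nonnegatively.\<close>

lemma dilation_unbounded: "\<exists>k\<ge>1. ereal p \<le> partition_perimeter_x \<alpha> (dilation k cap_set)"
proof -
 define q where "q = cap_const \<alpha> * wt \<alpha> R * R"
 have q: "0 < q" unfolding q_def using cap_const_pos[OF alpha] wt_pos[of R \<alpha>] R_pos by simp
 define k where "k = max 1 (p / q)"
 have k: "1 \<le> k" "0 < k" and "p / q \<le> k" by (auto simp: k_def)
 then have pk: "p \<le> k * q" using q by (simp add: divide_le_eq)
 let ?D = "dilation k cap_set"
 have "partition_perimeter_x \<alpha> ?D < \<infinity>"
  using partition_perimeter_dilation[OF alpha k(2) cap_set_borel cap_set_perimeter] by (rule order_le_less_trans) simp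
 then have "ereal (cap_value \<alpha> v (k * R)) \<le> partition_perimeter_x \<alpha> ?D"
 proof (rule partition_half_sets[OF alpha v_pos dilation_admissible[OF k(2)] _ dilation_borel[OF cap_set_borel] equivalent_refl])
  fix CR CL SL assume h: "half_set \<alpha> CR v (?D \<inter> {z. fst z > 0}) (x_support (?D \<inter> {z. fst z > 0}))"
   "half_set \<alpha> CL v ({z. (- fst z, snd z) \<in> ?D} \<inter> {z. fst z > 0}) SL" "ereal (CR + CL) \<le> partition_perimeter_x \<alpha> ?D"
  have "(x_support (?D \<inter> {z. fst z > 0})) = {0<..<k * R}"
  proof (intro set_eqI)
   fix x
   have "{y. (x, y) \<in> ?D \<inter> {z. fst z > 0}} = (if 0 < x then {y. (x, y) \<in> ?D} else {})" by auto
   moreover have "0 < f (\<bar>x\<bar> / k) / k" if "\<bar>x\<bar> < k * R"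
    using f_pos[of "\<bar>x\<bar> / k"] that k by (simp add: pos_divide_less_eq mult.commute)
   ultimately show "x \<in> (x_support (?D \<inter> {z. fst z > 0})) \<longleftrightarrow> x \<in> {0<..<k * R}"
    unfolding mem_Collect_eq dilation_section[OF k(2)] by (auto simp: not_le)
  qed
  then have "cap_value \<alpha> v (k * R) \<le> CR" using half_set.cap_value_le[OF h(1)] k R_pos by simp
  moreover have "0 \<le> CL" using half_value_le[OF h(2)] cap_value_pos[OF R_pos] by linarith
  ultimately have "ereal (cap_value \<alpha> v (k * R)) \<le> ereal (CR + CL)" by simp
  then show ?thesis using h(3) by (rule order_trans)
 qed
 moreover have "p \<le> cap_value \<alpha> v (k * R)"
 proof -
  have "R \<le> k * R" using k R_pos by simp
  then have "wt \<alpha> R \<le> wt \<alpha> (k * R)" using R_pos by (intro wt_mono[OF alpha]) auto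
  then have "cap_const \<alpha> * wt \<alpha> R * (k * R) \<le> cap_const \<alpha> * wt \<alpha> (k * R) * (k * R)"
   using cap_const_pos[OF alpha] k R_pos by (intro mult_right_mono mult_left_mono) auto
  moreover have "0 \<le> 3 * v / (2 * (k * R))" using v_pos k R_pos by simp
  ultimately show ?thesis using pk unfolding cap_value_def q_def by (simp add: mult_ac)
 qed
 ultimately show ?thesis using k(1) by (meson ereal_less_eq(3) order_trans)
qed

text \<open>Each half has at least the minimal value, so a total equal to twice the minimum makes
  the right half optimal. It is a vertical translate of the minimiser, and the symmetry of
  \<open>E\<close> transfers the shape, with the same translation, to the left half.\<close>

lemma equality_convex:
 assumes "0 < \<alpha>" and E: "E \<in> admissible_x v" "E \<in> x_symmetric_sets" and P: "partition_perimeter_x \<alpha> E \<le> ereal (2 * cap_value \<alpha> v R)"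
 shows "\<exists>F. equivalent_sets E F \<and> x_transformed_convex \<alpha> F"
proof -
 obtain A where A: "A \<in> sets borel" "equivalent_sets E A" using equivalent_borel[of E] E(1) by (auto simp: admissible_x_def)
 have fin: "partition_perimeter_x \<alpha> E < \<infinity>" using P by (rule order_le_less_trans) simp
 obtain CR CL SL where h: "half_set \<alpha> CR v (A \<inter> {z. fst z > 0}) (x_support (A \<inter> {z. fst z > 0}))"
   "half_set \<alpha> CL v ({z. (- fst z, snd z) \<in> A} \<inter> {z. fst z > 0}) SL" "ereal (CR + CL) \<le> partition_perimeter_x \<alpha> E"
  using partition_half_sets[OF alpha v_pos E(1) fin A] .
 have "ereal (CR + CL) \<le> ereal (2 * cap_value \<alpha> v R)" using h(3) P by (rule order_trans)
 then have "CR \<le> cap_value \<alpha> v R" using half_value_le[OF h(2)] by simp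
 then obtain \<sigma> where s: "AE z in lborel. z \<in> A \<inter> {z. fst z > 0} \<longleftrightarrow> 0 < fst z \<and> fst z < R \<and> \<bar>snd z - \<sigma>\<bar> < f (fst z)"
  using half_set.equality_set[OF h(1) cap_axioms \<open>0 < \<alpha>\<close>] by blast
 define F0 where "F0 = (\<lambda>z. (0, \<sigma>) + z) ` cap_right"
 have F0: "z \<in> F0 \<longleftrightarrow> 0 < fst z \<and> fst z < R \<and> \<bar>snd z - \<sigma>\<bar> < f (fst z)" for z
 proof
  assume "0 < fst z \<and> fst z < R \<and> \<bar>snd z - \<sigma>\<bar> < f (fst z)"
  then have "z - (0, \<sigma>) \<in> cap_right" by (simp add: cap_right_def)
  moreover have "z = (0, \<sigma>) + (z - (0, \<sigma>))" by simp
  ultimately show "z \<in> F0" unfolding F0_def by blast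
 qed (auto simp: F0_def cap_right_def)
 define F where "F = F0 \<union> {z. (- fst z, snd z) \<in> F0}"
 have "open F0" unfolding F0_def by (rule open_translation[OF cap_right_open])
 then have F0b: "F0 \<in> sets borel" by (rule borel_open)
 have "{z. (- fst z, snd z) \<in> F0} \<in> sets borel"
  using measurable_sets[OF borel_scale_prod F0b, of "-1" 1] by (simp add: vimage_def)
 then have Fb: "F \<in> sets borel" unfolding F_def using F0b by blast
 have sE: "z \<in> E \<longleftrightarrow> (- fst z, snd z) \<in> E" for z
  using E(2) unfolding x_symmetric_sets_def by (cases z) (auto, metis minus_minus)
 have EA: "AE z in lborel. z \<in> E \<longleftrightarrow> z \<in> A" using A(2) by (simp add: equivalent_sets_AE)
 have "AE x in lborel. x \<noteq> (0::real)" by (rule AE_lborel_singleton)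
 then have "AE z in lborel. fst (z :: plane) \<noteq> 0" by (rule AE_fst)
 then have "AE z in lborel. z \<in> E \<longleftrightarrow> z \<in> F"
  using EA s AE_reflect[OF EA] AE_reflect[OF s]
 proof eventually_elim
  fix z assume a: "fst z \<noteq> 0" "z \<in> E \<longleftrightarrow> z \<in> A" "z \<in> A \<inter> {z. fst z > 0} \<longleftrightarrow> 0 < fst z \<and> fst z < R \<and> \<bar>snd z - \<sigma>\<bar> < f (fst z)"
   "(- fst z, snd z) \<in> E \<longleftrightarrow> (- fst z, snd z) \<in> A"
   "(- fst z, snd z) \<in> A \<inter> {z. fst z > 0} \<longleftrightarrow> 0 < fst (- fst z, snd z) \<and> fst (- fst z, snd z) < R \<and> \<bar>snd (- fst z, snd z) - \<sigma>\<bar> < f (fst (- fst z, snd z))"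
  show "z \<in> E \<longleftrightarrow> z \<in> F"
  proof (cases "0 < fst z")
   case True
   then show ?thesis using a(2,3) by (auto simp: F_def F0)
  next
   case False
   then show ?thesis using a(1,4,5) sE[of z] by (auto simp: F_def F0)
  qed
 qed
 then have "equivalent_sets E F" by (simp add: equivalent_sets_AE)
 moreover have "x_transformed_convex \<alpha> F" unfolding x_transformed_convex_def
 proof
  show "F \<in> x_symmetric_sets" using Fb by (auto simp: x_symmetric_sets_def F_def)
  have "right_part F = F0" by (auto simp: right_part_def F_def F0)
  then have "grushin_transform \<alpha> ` right_part F = (\<lambda>z. (0, \<sigma>) + z) ` (grushin_transform \<alpha> ` cap_right)"
   by (simp add: F0_def image_image grushin_transform_def case_prod_beta)
  then show "convex (grushin_transform \<alpha> ` right_part F)" using convex_translation[OF cap_right_convex] by metis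
 qed
 ultimately show ?thesis by blast
qed

end

theorem theorem4p1:
  fixes \<alpha> v :: real and E :: "(real \<times> real) set"
  assumes "\<alpha> \<ge> 0" and "v > 0"
    and "E \<in> admissible_x v"
    and "partition_perimeter_x \<alpha> E < \<infinity>"
  shows "\<exists>E'. E' \<in> admissible_x v \<inter> x_symmetric_sets \<inter> y_schwarz_sets \<and>
      bounded E' \<and> x_transformed_convex \<alpha> E' \<and>
      partition_perimeter_x \<alpha> E' \<le> partition_perimeter_x \<alpha> E \<and>
      (\<alpha> > 0 \<longrightarrow> E \<in> x_symmetric_sets \<longrightarrow>
        ((\<exists>F. equivalent_sets E F \<and> x_transformed_convex \<alpha> F) \<longleftrightarrow>
         partition_perimeter_x \<alpha> E' = partition_perimeter_x \<alpha> E)) \<and>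
      (\<exists>r f. r > 0 \<and> continuous_on {0..r} f \<and> locally_lipschitz_on {0<..<r} f \<and>
        equivalent_sets E' (profile_region r f))"
proof -
 obtain R f where "cap \<alpha> v R f" using cap_exists[OF assms(1,2)] by blast
 then interpret cap \<alpha> v R f .
 have ge: "ereal (2 * cap_value \<alpha> v R) \<le> partition_perimeter_x \<alpha> E" by (rule partition_perimeter_ge[OF assms(3,4)])
 \<comment> \<open>All competitors are dilations of the minimiser; the requirements beyond the
   perimeter hold for every k > 0, so only the comparison of perimeters has to be arranged.\<close>
 have "\<exists>k\<ge>1. partition_perimeter_x \<alpha> (dilation k cap_set) \<le> partition_perimeter_x \<alpha> E \<and>
   (\<alpha> > 0 \<longrightarrow> E \<in> x_symmetric_sets \<longrightarrow>
    ((\<exists>F. equivalent_sets E F \<and> x_transformed_convex \<alpha> F) \<longleftrightarrow>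
     partition_perimeter_x \<alpha> (dilation k cap_set) = partition_perimeter_x \<alpha> E))"
 proof (cases "\<exists>F. equivalent_sets E F \<and> x_transformed_convex \<alpha> F")
  case True
  obtain p where p: "partition_perimeter_x \<alpha> E = ereal p"
   using assms(4) partition_perimeter_nonneg[of \<alpha> E] by (cases "partition_perimeter_x \<alpha> E") auto
  \<comment> \<open>Here the equivalence demands equality of perimeters, and the perimeter of
    \<open>E\<close> need not be the minimum: k is taken where the dilated set has exactly the
    perimeter of \<open>E\<close>.\<close>
  have "\<exists>k\<ge>1. partition_perimeter_x \<alpha> (dilation k cap_set) = ereal p"
   by (rule dilation_intermediate[OF alpha cap_set_borel cap_set_perimeter _ dilation_unbounded]) (use ge p in simp)
  then show ?thesis using True p by auto
 next
  case False
  have "dilation 1 cap_set = cap_set" by (simp add: dilation_def)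
  moreover have "partition_perimeter_x \<alpha> cap_set \<le> partition_perimeter_x \<alpha> E" using cap_set_perimeter ge by (rule order_trans)
  \<comment> \<open>Equality would give \<open>E\<close> the minimal perimeter, and then
    \<open>equality_convex\<close> would produce the convex set excluded in this case.\<close>
  moreover have "partition_perimeter_x \<alpha> cap_set \<noteq> partition_perimeter_x \<alpha> E" if "0 < \<alpha>" "E \<in> x_symmetric_sets"
   using equality_convex[OF that(1) assms(3) that(2)] cap_set_perimeter False by auto
  ultimately show ?thesis using False by (intro exI[of _ 1]) auto
 qed
 then obtain k where k: "1 \<le> k" and K: "partition_perimeter_x \<alpha> (dilation k cap_set) \<le> partition_perimeter_x \<alpha> E \<and>
   (\<alpha> > 0 \<longrightarrow> E \<in> x_symmetric_sets \<longrightarrow>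
    ((\<exists>F. equivalent_sets E F \<and> x_transformed_convex \<alpha> F) \<longleftrightarrow>
     partition_perimeter_x \<alpha> (dilation k cap_set) = partition_perimeter_x \<alpha> E))" by blast
 have k0: "0 < k" using k by simp
 have "0 < k * R" using k0 R_pos by simp
 then have "\<exists>r f. r > 0 \<and> continuous_on {0..r} f \<and> locally_lipschitz_on {0<..<r} f \<and> equivalent_sets (dilation k cap_set) (profile_region r f)"
  using dilation_profile[OF k0 refl] by blast
 then show ?thesis
  using K dilation_admissible[OF k0] dilation_x_symmetric dilation_y_schwarz[OF k0] dilation_bounded[OF k0] dilation_convex[OF k0] by blast
qed

end
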